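(* Let $\mathcal{R}$ and $\mathcal{B}$ be independent Poisson processes of intensity $1$ (on the space indicated in each case). (i) There does not exist a translation-invariant locally finite matching scheme of $\mathcal{R}$ to $\mathcal{B}$ in $\mathbb{R}$, nor in the strip $\mathbb{R}\times[0,1)$. (ii) There exists a translation-invariant locally finite matching scheme of $\mathcal{R}$ to $\mathcal{B}$ in $\mathbb{R}^d$ for all $d\geq 2$.
   Context: Let the space be $\mathbb{R}^d$ or the strip $\mathbb{R}\times[0,1)$. For a simple point process $\Pi$, its support is the random set $[\Pi]:=\{x:\Pi(\{x\})=1\}$. Points of $[\mathcal{R}]$ are called red points and points of $[\mathcal{B}]$ blue points. A matching scheme of $\mathcal{R}$ to $\mathcal{B}$ is a simple point process $\mathcal{M}$ in the product of the space with itself, defined jointly with $\mathcal{R},\mathcal{B}$ on some probability space (so $\mathcal{M}$ may use additional randomness), such that almost surely the graph with vertex set $[\mathcal{R}]\cup[\mathcal{B}]$ and edge set $[\mathcal{M}]$ is a perfect matching of $[\mathcal{R}]$ to $[\mathcal{B}]$, i.e. a bipartite graph with vertex classes $[\mathcal{R}],[\mathcal{B}]$ and all degrees equal to $1$; an edge is written $(r,b)\in[\mathcal{M}]$ with $r$ red and $b$ blue. It is translation-invariant if the law of $(\mathcal{R},\mathcal{B},\mathcal{M})$ is invariant under all translations of $\mathbb{R}^d$; on the strip, under all translations in the first coordinate direction. An edge $(r,b)\in[\mathcal{M}]$ crosses a set $S$ if the closed line segment from $r$ to $b$ intersects $S$. A matching scheme is locally finite if a.s. every bounded subset $S$ of the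 space is crossed by only finitely many edges. *)

theory Defs
  imports "HOL-Probability.Probability"
begin

section \<open>Point processes on a Borel set\<close>

text \<open>
  A point configuration on a Borel set \<open>S\<close> is a locally finite counting measure on the Borel
  subsets of \<open>S\<close>, i.e. a Borel measure that is finite and integer-valued on bounded sets.
  The \<open>\<sigma>\<close>-algebra on configurations is the one generated by the evaluation maps (the analogue of
  \<^const>\<open>subprob_algebra\<close> for counting measures).  Only the space and the measurable sets of
  \<open>config_algebra S\<close> are meaningful.
\<close>

definition point_configs :: "'a::metric_space set \<Rightarrow> 'a measure set" where
  "point_configs S = {\<mu>. sets \<mu> = sets (restrict_space borel S) \<and>
     (\<forall>A\<in>sets \<mu>. bounded A \<longrightarrow> (\<exists>n::nat. emeasure \<mu> A = of_nat n))}"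

definition config_algebra :: "'a::metric_space set \<Rightarrow> 'a measure measure" where
  "config_algebra S = (SUP A\<in>sets (restrict_space borel S).
     vimage_algebra (point_configs S) (\<lambda>\<mu>. emeasure \<mu> A) borel)"

definition point_process ::
    "'w measure \<Rightarrow> 'a::metric_space set \<Rightarrow> ('w \<Rightarrow> 'a measure) \<Rightarrow> bool" where
  "point_process P S X \<longleftrightarrow> prob_space P \<and> X \<in> P \<rightarrow>\<^sub>M config_algebra S"

definition simple_point_process ::
    "'w measure \<Rightarrow> 'a::metric_space set \<Rightarrow> ('w \<Rightarrow> 'a measure) \<Rightarrow> bool" where
  "simple_point_process P S X \<longleftrightarrow>
     point_process P S X \<and> (AE \<omega> in P. \<forall>x\<in>S. emeasure (X \<omega>) {x} \<le> 1)"

definition point_support :: "'a measure \<Rightarrow> 'a set" where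
  "point_support \<mu> = {x. emeasure \<mu> {x} = 1}"

text \<open>
  The counts of sets of finite Lebesgue measure are Poisson distributed, and the counts of finitely
  many disjoint such sets are independent.  The Poisson weights are written out because
  \<^const>\<open>poisson_pmf\<close> is only specified for positive rates, whereas \<open>A\<close> may be a null set
  (then \<open>m = 0\<close>, and the weights are those of the point mass at \<open>0\<close>).
\<close>

definition poisson_process ::
    "'w measure \<Rightarrow> 'a::euclidean_space set \<Rightarrow> real \<Rightarrow> ('w \<Rightarrow> 'a measure) \<Rightarrow> bool" where
  "poisson_process P S lam X \<longleftrightarrow> point_process P S X \<and>
     (\<forall>A\<in>sets (restrict_space borel S). emeasure lborel A < \<infinity> \<longrightarrow>
        (let m = lam * measure lborel A in
          \<forall>k::nat. measure P {\<omega>\<in>space P. emeasure (X \<omega>) A = of_nat k} =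
            m ^ k / fact k * exp (- m))) \<and>
     (\<forall>(n::nat) A. (\<forall>i<n. A i \<in> sets (restrict_space borel S) \<and> emeasure lborel (A i) < \<infinity>) \<longrightarrow>
        disjoint_family_on A {..<n} \<longrightarrow>
        prob_space.indep_vars P (\<lambda>_. borel) (\<lambda>i \<omega>. emeasure (X \<omega>) (A i)) {..<n})"

definition independent_poisson_processes ::
    "'w measure \<Rightarrow> 'a::euclidean_space set \<Rightarrow> ('w \<Rightarrow> 'a measure) \<Rightarrow> ('w \<Rightarrow> 'a measure) \<Rightarrow> bool"
  where
  "independent_poisson_processes P S R B \<longleftrightarrow>
     poisson_process P S 1 R \<and> poisson_process P S 1 B \<and>
     prob_space.indep_var P (config_algebra S) R (config_algebra S) B"


section \<open>Matching schemes\<close>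

definition perfect_matching :: "'a set \<Rightarrow> 'a set \<Rightarrow> ('a \<times> 'a) set \<Rightarrow> bool" where
  "perfect_matching V W E \<longleftrightarrow> V \<inter> W = {} \<and> E \<subseteq> V \<times> W \<and>
     (\<forall>v\<in>V \<union> W. card {e\<in>E. fst e = v \<or> snd e = v} = 1)"

definition matching_scheme ::
    "'w measure \<Rightarrow> 'a::euclidean_space set \<Rightarrow> ('w \<Rightarrow> 'a measure) \<Rightarrow> ('w \<Rightarrow> 'a measure) \<Rightarrow>
     ('w \<Rightarrow> ('a \<times> 'a) measure) \<Rightarrow> bool" where
  "matching_scheme P S R B M \<longleftrightarrow> simple_point_process P (S \<times> S) M \<and>
     (AE \<omega> in P. perfect_matching
        (point_support (R \<omega>)) (point_support (B \<omega>)) (point_support (M \<omega>)))"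

definition translate :: "'a::real_normed_vector set \<Rightarrow> 'a \<Rightarrow> 'a measure \<Rightarrow> 'a measure" where
  "translate S t \<mu> = distr \<mu> (restrict_space borel S) (\<lambda>x. x + t)"

text \<open>
  \<open>T\<close> is the set of admissible translation vectors; each is expected to map \<open>S\<close> onto itself.
  A translation acts diagonally on the edge process.
\<close>

definition translation_invariant ::
    "'w measure \<Rightarrow> 'a::euclidean_space set \<Rightarrow> 'a set \<Rightarrow> ('w \<Rightarrow> 'a measure) \<Rightarrow> ('w \<Rightarrow> 'a measure) \<Rightarrow>
     ('w \<Rightarrow> ('a \<times> 'a) measure) \<Rightarrow> bool" where
  "translation_invariant P S T R B M \<longleftrightarrow>
     (let K = config_algebra S \<Otimes>\<^sub>M config_algebra S \<Otimes>\<^sub>M config_algebra (S \<times> S) in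
      \<forall>t\<in>T. distr P K (\<lambda>\<omega>. (translate S t (R \<omega>), translate S t (B \<omega>),
                                translate (S \<times> S) (t, t) (M \<omega>)))
           = distr P K (\<lambda>\<omega>. (R \<omega>, B \<omega>, M \<omega>)))"

definition crosses :: "'a::real_vector \<times> 'a \<Rightarrow> 'a set \<Rightarrow> bool" where
  "crosses e C \<longleftrightarrow> closed_segment (fst e) (snd e) \<inter> C \<noteq> {}"

definition locally_finite_scheme ::
    "'w measure \<Rightarrow> 'a::euclidean_space set \<Rightarrow> ('w \<Rightarrow> ('a \<times> 'a) measure) \<Rightarrow> bool" where
  "locally_finite_scheme P S M \<longleftrightarrow>
     (AE \<omega> in P. \<forall>C\<subseteq>S. bounded C \<longrightarrow> finite {e\<in>point_support (M \<omega>). crosses e C})"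

definition strip :: "(real \<times> real) set" where
  "strip = UNIV \<times> {0..<1}"

text \<open>
  Sample space for existence statements.  HOL cannot quantify existentially over types, but this
  choice loses no generality: if \<open>R\<close>, \<open>B\<close>, \<open>M\<close> are defined on any probability space \<open>P\<close>, the law of
  \<open>\<lambda>\<omega>. (R \<omega>, B \<omega>, M \<omega>)\<close> under the completion of \<open>P\<close>, on the largest \<open>\<sigma>\<close>-algebra that makes this
  map measurable, gives a scheme on this sample space whose processes are the projections.
\<close>

type_synonym 'a canonical_sample = "'a measure \<times> 'a measure \<times> ('a \<times> 'a) measure"

end

theory Submission
  imports Defs
begin

text \<open>
  On the line or the strip, count the edges that cross a level. By stationarity, their number has
  the same law at all levels, so if it is finite, it is bounded in probability. But a red point of
  the slice between two levels whose partner is not in the slice has an edge that crosses one of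
  the levels; so the difference between the numbers of red and blue points of the slice is bounded
  in probability as the slice grows. This is false for independent Poisson variables: given one of
  them, the other would have to take one of boundedly many values, each of which is unlikely
  (\<open>poisson_weight_le\<close>, \<open>poisson_difference_concentration\<close>,
  \<open>no_locally_finite_scheme_slices\<close>).

  In dimension \<open>d\<close> at least two, match the points inside the boxes of a random stationary sequence of
  nested grids, level by level.  Boxes of level \<open>n\<close> have sides of order \<open>8 ^ n\<close>, so the numbers of red
  and blue points in a box differ by about \<open>8 ^ (n * d / 2)\<close>.  A cube of side \<open>4 ^ n\<close> near the lower
  corner of the box, its portal, contains \<open>4 ^ (n * d)\<close> points of either colour, which is much more.
  Let the points of the portal enter the game only at level \<open>n\<close>, match as many of the available
  points of the box as possible, and use the points of the portal last.  With large probability the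
  surplus that is passed on to level \<open>n + 1\<close> then consists of points of the portal
  (\<open>good_exports_own\<close>, \<open>good_at_prob\<close>).  So the edges of a late level join points of portals.  From
  one level to the next, the boxes grow either in one fixed direction or in all the others; since
  there are two kinds of directions, there always is one in which a box and the smaller boxes inside
  it have the same extent.  In that direction the portals are all within distance \<open>2 * 4 ^ n\<close> of one
  face of a box with side of order \<open>8 ^ n\<close>, and with them the edges (\<open>matching_of_good_boxes\<close>).  The
  origin is as close as that to a face of its box with probability of order \<open>2 ^ (- n)\<close>.  By
  Borel-Cantelli, only finitely many levels have edges near the origin, and every point is matched
  in the end.

  A later portal may cover an earlier one.  All lengths are powers of four, so that it then covers the
  whole box of the earlier one, which therefore has no points to match at its level
  (\<open>reserved_dichotomy\<close>).

  The rest is measure theory.  Poisson processes are built from independent uniform points in annuli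
  (\<open>poisson_process_annuli_points\<close>), and their law is unique (\<open>poisson_process_law_unique\<close>), hence
  invariant under translations, as is the law of the grids (\<open>shift_grid_law\<close>).  The edges are a
  measurable function of the two configurations and the grids (\<open>edge_config_measurable\<close>) that
  commutes with translations (\<open>edge_config_shift\<close>), so the matching scheme is invariant.
\<close>

section \<open>Point configurations\<close>

lemma space_config_algebra: "space (config_algebra S) = point_configs S"
proof -
  have "{} \<in> sets (restrict_space borel S)" by auto
  then show ?thesis
    by (auto simp add: config_algebra_def space_Sup_eq_UN)
qed

lemma measurable_emeasure_config[measurable]:
  "A \<in> sets (restrict_space borel S) \<Longrightarrow> (\<lambda>\<mu>. emeasure \<mu> A) \<in> borel_measurable (config_algebra S)"
  by (auto intro!: measurable_Sup1 measurable_vimage_algebra1 simp: config_algebra_def)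

lemma measurable_config_algebraI:
  assumes "\<And>x. x \<in> space N \<Longrightarrow> K x \<in> point_configs S"
    and "\<And>A. A \<in> sets (restrict_space borel S) \<Longrightarrow> (\<lambda>x. emeasure (K x) A) \<in> borel_measurable N"
  shows "K \<in> N \<rightarrow>\<^sub>M config_algebra S"
  using assms by (auto intro!: measurable_Sup2 measurable_vimage_algebra2 simp: config_algebra_def)

lemma sets_config: "\<mu> \<in> point_configs S \<Longrightarrow> sets \<mu> = sets (restrict_space borel S)"
  by (simp add: point_configs_def)

lemma space_config: "\<mu> \<in> point_configs S \<Longrightarrow> space \<mu> = S"
  using sets_eq_imp_space_eq[OF sets_config] by (simp add: space_restrict_space)

lemma singleton_in_sets_config:
  fixes \<mu> :: "'a::metric_space measure"
  shows "\<mu> \<in> point_configs S \<Longrightarrow> x \<in> S \<Longrightarrow> {x} \<in> sets \<mu>"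
  unfolding sets_config by (auto simp: sets_restrict_space image_iff intro!: bexI[of _ "{x}"])

lemma config_bounded_nat:
  "\<mu> \<in> point_configs S \<Longrightarrow> A \<in> sets \<mu> \<Longrightarrow> bounded A \<Longrightarrow> \<exists>n::nat. emeasure \<mu> A = of_nat n"
  by (auto simp: point_configs_def)

lemma ennreal_of_nat_less_1: "(of_nat n :: ennreal) < 1 \<Longrightarrow> n = 0"
  by (metis less_one of_nat_1 of_nat_less_iff)

text \<open>
  The mass of shrinking balls around a point decreases to the mass of the point; being integers,
  these masses are eventually constant.  So a point that is no atom has a neighbourhood of mass
  zero, and by the Lindelof property countably many of these cover a set without atoms.
\<close>

lemma config_no_atoms_null:
  fixes \<mu> :: "'a::{metric_space,second_countable_topology} measure"
  assumes \<mu>: "\<mu> \<in> point_configs S" and A: "A \<in> sets \<mu>"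
    and no: "\<And>x. x \<in> A \<Longrightarrow> emeasure \<mu> {x} = 0"
  shows "emeasure \<mu> A = 0"
proof -
  have AS: "A \<subseteq> S" using sets.sets_into_space[OF A] space_config[OF \<mu>] by simp
  have ball_sets: "ball x r \<inter> S \<in> sets \<mu>" for x r
    using sets_config[OF \<mu>] by (auto simp: sets_restrict_space)
  have "\<exists>r>0. emeasure \<mu> (ball x r \<inter> S) = 0" if "x \<in> A" for x
  proof -
    let ?D = "\<lambda>n::nat. ball x (1 / Suc n) \<inter> S"
    have xS: "x \<in> S" using that AS by auto
    have "(\<lambda>n. emeasure \<mu> (?D n)) \<longlonglongrightarrow> emeasure \<mu> (\<Inter>n. ?D n)"
    proof (rule Lim_emeasure_decseq)
      show "range ?D \<subseteq> sets \<mu>" using ball_sets by auto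
      show "decseq ?D"
        unfolding decseq_def
        by (intro allI impI Int_mono subset_ball frac_le order_refl) auto
      show "emeasure \<mu> (?D n) \<noteq> \<infinity>" for n
        using config_bounded_nat[OF \<mu> ball_sets, of x "1 / Suc n"]
        by (metis bounded_Int bounded_ball ennreal_of_nat_neq_top infinity_ennreal_def)
    qed
    moreover have "(\<Inter>n. ?D n) = {x}"
    proof -
      have "dist x y < inverse (Suc n)" if "y \<in> (\<Inter>n. ?D n)" for y n using that by (auto simp: inverse_eq_divide)
      then have "y = x" if "y \<in> (\<Inter>n. ?D n)" for y using that
        by (metis dist_nz dist_commute reals_Archimedean order.asym)
      then show ?thesis using xS by auto
    qed
    ultimately have "(\<lambda>n. emeasure \<mu> (?D n)) \<longlonglongrightarrow> 0" using no[OF that] by simp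
    then have "eventually (\<lambda>n. emeasure \<mu> (?D n) < 1) sequentially"
      by (rule order_tendstoD) simp
    then obtain n where "emeasure \<mu> (?D n) < 1" by (auto simp: eventually_sequentially)
    moreover obtain k :: nat where "emeasure \<mu> (?D n) = of_nat k"
      using config_bounded_nat[OF \<mu> ball_sets] by (metis bounded_Int bounded_ball)
    ultimately have "emeasure \<mu> (?D n) = 0" using ennreal_of_nat_less_1 by auto
    then show ?thesis by (intro exI[of _ "1 / Suc n"]) auto
  qed
  then obtain r where r: "\<And>x. x \<in> A \<Longrightarrow> r x > 0 \<and> emeasure \<mu> (ball x (r x) \<inter> S) = 0" by metis
  obtain F' where F': "F' \<subseteq> (\<lambda>x. ball x (r x)) ` A" "countable F'" "\<Union>F' = (\<Union>x\<in>A. ball x (r x))"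
    using Lindelof[of "(\<lambda>x. ball x (r x)) ` A"] by auto
  have "(\<Union>B\<in>F'. B \<inter> S) \<in> null_sets \<mu>"
    using F' r ball_sets by (intro null_sets_UN' ) (auto simp: null_sets_def)
  moreover have "A \<subseteq> (\<Union>B\<in>F'. B \<inter> S)"
  proof
    fix x assume x: "x \<in> A"
    then have "x \<in> \<Union>F'" unfolding F'(3) using r[OF x] by (intro UN_I[of x]) auto
    then show "x \<in> (\<Union>B\<in>F'. B \<inter> S)" using AS x by auto
  qed
  ultimately show ?thesis using null_sets_subset[OF _ A] by blast
qed

lemma config_finite_atoms:
  fixes \<mu> :: "'a::{metric_space,second_countable_topology} measure"
  assumes \<mu>: "\<mu> \<in> point_configs S" and A: "A \<in> sets \<mu>" and fin: "emeasure \<mu> A \<noteq> \<infinity>"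
  shows "finite {x\<in>A. emeasure \<mu> {x} \<noteq> 0}"
proof (rule ccontr)
  assume inf: "infinite {x\<in>A. emeasure \<mu> {x} \<noteq> 0}"
  obtain r where r: "emeasure \<mu> A = ennreal r" "r \<ge> 0" using fin by (cases "emeasure \<mu> A") auto
  obtain k :: nat where k: "r < real k" using reals_Archimedean2 by blast
  obtain F where F: "F \<subseteq> {x\<in>A. emeasure \<mu> {x} \<noteq> 0}" "finite F" "card F = k"
    using infinite_arbitrarily_large[OF inf] by blast
  have AS: "A \<subseteq> S" using sets.sets_into_space[OF A] space_config[OF \<mu>] by simp
  have sx: "{x} \<in> sets \<mu>" if "x \<in> F" for x
    using singleton_in_sets_config[OF \<mu>] AS that F(1) by blast
  have "of_nat k = (\<Sum>x\<in>F. 1::ennreal)" using F by simp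
  also have "\<dots> \<le> (\<Sum>x\<in>F. emeasure \<mu> {x})"
  proof (rule sum_mono)
    fix x assume x: "x \<in> F"
    then obtain n :: nat where n: "emeasure \<mu> {x} = of_nat n" using config_bounded_nat[OF \<mu> sx] by auto
    with x F(1) have "n \<noteq> 0" by auto
    then show "1 \<le> emeasure \<mu> {x}" unfolding n by (metis Suc_leI gr0I of_nat_1 of_nat_le_iff One_nat_def)
  qed
  also have "\<dots> = emeasure \<mu> F" using F sx by (intro emeasure_eq_sum_singleton[symmetric]) auto
  also have "\<dots> \<le> emeasure \<mu> A" using F A by (intro emeasure_mono) auto
  finally have "ennreal (real k) \<le> ennreal r" using r(1) by (simp add: ennreal_of_nat_eq_real_of_nat)
  then show False using k r by (simp)
qed

text \<open>
  The part of \<open>A\<close> outside the atoms has no mass.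
\<close>

lemma config_eq_sum_atoms:
  fixes \<mu> :: "'a::{metric_space,second_countable_topology} measure"
  assumes \<mu>: "\<mu> \<in> point_configs S" and A: "A \<in> sets \<mu>" and fin: "emeasure \<mu> A \<noteq> \<infinity> \<or> finite {x\<in>A. emeasure \<mu> {x} \<noteq> 0}"
  shows "emeasure \<mu> A = (\<Sum>x\<in>{x\<in>A. emeasure \<mu> {x} \<noteq> 0}. emeasure \<mu> {x})"
proof -
  let ?F = "{x\<in>A. emeasure \<mu> {x} \<noteq> 0}"
  have f: "finite ?F" using config_finite_atoms[OF \<mu> A] fin by auto
  have AS: "A \<subseteq> S" using sets.sets_into_space[OF A] space_config[OF \<mu>] by simp
  have sx: "{x} \<in> sets \<mu>" if "x \<in> A" for x
    using singleton_in_sets_config[OF \<mu>] AS that by blast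
  have F: "?F \<in> sets \<mu>" using sets.finite_UN[OF f, of "\<lambda>x. {x}"] sx by simp
  have "emeasure \<mu> A = emeasure \<mu> ?F + emeasure \<mu> (A - ?F)"
    using A F plus_emeasure[of ?F \<mu> "A - ?F"] by (simp add: Un_absorb1)
  also have "emeasure \<mu> (A - ?F) = 0"
    by (rule config_no_atoms_null[OF \<mu>]) (use A F in auto)
  also have "emeasure \<mu> ?F = (\<Sum>x\<in>?F. emeasure \<mu> {x})" using f sx by (intro emeasure_eq_sum_singleton) auto
  finally show ?thesis by simp
qed

definition simple_config :: "'a measure \<Rightarrow> bool" where
  "simple_config \<mu> \<longleftrightarrow> (\<forall>x. emeasure \<mu> {x} \<le> 1)"

lemma simple_config_support:
  assumes \<mu>: "\<mu> \<in> point_configs S" and s: "simple_config \<mu>"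
  shows "emeasure \<mu> {x} \<noteq> 0 \<longleftrightarrow> x \<in> point_support \<mu>"
proof (cases "x \<in> S")
  case True
  obtain n :: nat where n: "emeasure \<mu> {x} = of_nat n"
    using config_bounded_nat[OF \<mu> singleton_in_sets_config[OF \<mu> True]] by auto
  have "of_nat n \<le> (1::ennreal)" using s unfolding simple_config_def n[symmetric] by auto
  then have "n \<le> 1" by (metis of_nat_1 of_nat_le_iff)
  then show ?thesis using n by (cases n) (auto simp: point_support_def)
next
  case False
  then have "emeasure \<mu> {x} = 0"
    by (metis \<mu> emeasure_notin_sets insertI1 sets.sets_into_space space_config subsetD)
  then show ?thesis by (simp add: point_support_def)
qed

lemma simple_config_card:
  fixes \<mu> :: "'a::{metric_space,second_countable_topology} measure"
  assumes \<mu>: "\<mu> \<in> point_configs S" and s: "simple_config \<mu>" and A: "A \<in> sets \<mu>"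
    and "finite (A \<inter> point_support \<mu>)"
  shows "emeasure \<mu> A = of_nat (card (A \<inter> point_support \<mu>))"
proof -
  have eq: "{x\<in>A. emeasure \<mu> {x} \<noteq> 0} = A \<inter> point_support \<mu>"
    using simple_config_support[OF \<mu> s] by auto
  have "emeasure \<mu> A = (\<Sum>x\<in>A \<inter> point_support \<mu>. emeasure \<mu> {x})"
    using config_eq_sum_atoms[OF \<mu> A] assms(4) unfolding eq by simp
  also have "\<dots> = (\<Sum>x\<in>A \<inter> point_support \<mu>. 1)"
    by (intro sum.cong) (auto simp: point_support_def)
  finally show ?thesis by simp
qed

lemma simple_config_finite:
  fixes \<mu> :: "'a::{metric_space,second_countable_topology} measure"
  assumes \<mu>: "\<mu> \<in> point_configs S" and s: "simple_config \<mu>" and A: "A \<in> sets \<mu>" and "bounded A"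
  shows "finite (A \<inter> point_support \<mu>)"
proof -
  have eq: "{x\<in>A. emeasure \<mu> {x} \<noteq> 0} = A \<inter> point_support \<mu>"
    using simple_config_support[OF \<mu> s] by auto
  have "emeasure \<mu> A \<noteq> \<infinity>" using config_bounded_nat[OF \<mu> A \<open>bounded A\<close>] by auto
  then show ?thesis using config_finite_atoms[OF \<mu> A] eq by simp
qed

lemma point_support_subset: "\<mu> \<in> point_configs S \<Longrightarrow> point_support \<mu> \<subseteq> S"
  by (smt (verit) emeasure_notin_sets insert_subset mem_Collect_eq point_support_def
      sets.sets_into_space space_config subsetI zero_neq_one)

section \<open>Poisson processes\<close>

definition poisson_weight :: "real \<Rightarrow> nat \<Rightarrow> real" where
  "poisson_weight m k = m ^ k / fact k * exp (- m)"

lemma poisson_weight_nonneg: "0 \<le> m \<Longrightarrow> 0 \<le> poisson_weight m k"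
  by (simp add: poisson_weight_def)

lemma poisson_weight_sums: "poisson_weight m sums 1"
proof -
  have "(\<lambda>k. (m ^ k /\<^sub>R fact k) * exp (- m)) sums (exp m * exp (- m))"
    by (intro sums_mult2 exp_converges)
  then show ?thesis by (simp add: poisson_weight_def[abs_def] exp_minus field_simps)
qed

lemma poisson_process_prob_space: "poisson_process P S lam X \<Longrightarrow> prob_space P"
  by (simp add: poisson_process_def point_process_def)

lemma poisson_process_measurable: "poisson_process P S lam X \<Longrightarrow> X \<in> P \<rightarrow>\<^sub>M config_algebra S"
  by (simp add: poisson_process_def point_process_def)

lemma poisson_process_config: "poisson_process P S lam X \<Longrightarrow> \<omega> \<in> space P \<Longrightarrow> X \<omega> \<in> point_configs S"
  using measurable_space[OF poisson_process_measurable] by (auto simp: space_config_algebra)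

lemma poisson_process_emeasure_measurable:
  assumes "poisson_process P S lam X" "A \<in> sets (restrict_space borel S)"
  shows "(\<lambda>\<omega>. emeasure (X \<omega>) A) \<in> borel_measurable P"
  by (rule measurable_compose[OF poisson_process_measurable[OF assms(1)] measurable_emeasure_config[OF assms(2)]])

lemma poisson_process_weight:
  assumes "poisson_process P S lam X" "A \<in> sets (restrict_space borel S)" "emeasure lborel A < \<infinity>"
  shows "measure P {\<omega>\<in>space P. emeasure (X \<omega>) A = of_nat k} = poisson_weight (lam * measure lborel A) k"
  using assms by (auto simp: poisson_process_def Let_def poisson_weight_def)

lemma poisson_process_prob_sums:
  assumes P: "poisson_process P S lam X" and A: "A \<in> sets (restrict_space borel S)" "emeasure lborel A < \<infinity>"
  shows "(\<lambda>k. if Q k then poisson_weight (lam * measure lborel A) k else 0) sums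
     measure P {\<omega>\<in>space P. \<exists>k. emeasure (X \<omega>) A = of_nat k \<and> Q k}"
proof -
  interpret prob_space P using poisson_process_prob_space[OF P] .
  have [measurable]: "(\<lambda>\<omega>. emeasure (X \<omega>) A) \<in> borel_measurable P"
    by (rule poisson_process_emeasure_measurable[OF P A(1)])
  let ?E = "\<lambda>k. {\<omega>\<in>space P. emeasure (X \<omega>) A = of_nat k \<and> Q k}"
  have "(\<lambda>k. measure P (?E k)) sums measure P (\<Union>k. ?E k)"
    by (rule finite_measure_UNION) (auto simp: disjoint_family_on_def)
  moreover have "(\<Union>k. ?E k) = {\<omega>\<in>space P. \<exists>k. emeasure (X \<omega>) A = of_nat k \<and> Q k}" by auto
  moreover have "measure P (?E k) = (if Q k then poisson_weight (lam * measure lborel A) k else 0)" for k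
    using poisson_process_weight[OF P A, of k] by auto
  ultimately show ?thesis by simp
qed

lemma poisson_process_AE_nat:
  assumes P: "poisson_process P S lam X" and A: "A \<in> sets (restrict_space borel S)" "emeasure lborel A < \<infinity>"
  shows "AE \<omega> in P. \<exists>k::nat. emeasure (X \<omega>) A = of_nat k"
proof -
  interpret prob_space P using poisson_process_prob_space[OF P] .
  have [measurable]: "(\<lambda>\<omega>. emeasure (X \<omega>) A) \<in> borel_measurable P"
    by (rule poisson_process_emeasure_measurable[OF P A(1)])
  have "(\<lambda>k. poisson_weight (lam * measure lborel A) k) sums
     measure P {\<omega>\<in>space P. \<exists>k::nat. emeasure (X \<omega>) A = of_nat k}"
    using poisson_process_prob_sums[OF P A, of "\<lambda>_. True"] by simp
  then have "prob {\<omega>\<in>space P. \<exists>k::nat. emeasure (X \<omega>) A = of_nat k} = 1"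
    using poisson_weight_sums sums_unique2 by blast
  then show ?thesis by (subst (asm) prob_Collect_eq_1) auto
qed

subsection \<open>Simplicity\<close>

text \<open>
  The weights of zero and one add up to \<open>(1 + m) exp (- m)\<close>, which is at least \<open>1 - m\<^sup>2\<close>.
\<close>

lemma poisson_process_multiple_le:
  assumes P: "poisson_process P S 1 X" and A: "A \<in> sets (restrict_space borel S)" "emeasure lborel A < \<infinity>"
  shows "measure P {\<omega>\<in>space P. \<not> emeasure (X \<omega>) A \<le> 1} \<le> (measure lborel A)\<^sup>2"
proof -
  interpret prob_space P using poisson_process_prob_space[OF P] .
  have [measurable]: "(\<lambda>\<omega>. emeasure (X \<omega>) A) \<in> borel_measurable P"
    by (rule poisson_process_emeasure_measurable[OF P A(1)])
  define m where "m = measure lborel A"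
  have m: "m \<ge> 0" by (simp add: m_def)
  let ?E0 = "{\<omega>\<in>space P. emeasure (X \<omega>) A = of_nat 0}" and ?E1 = "{\<omega>\<in>space P. emeasure (X \<omega>) A = of_nat 1}"
  have "prob ?E0 + prob ?E1 = prob (?E0 \<union> ?E1)"
    by (rule finite_measure_Union[symmetric]) auto
  also have "\<dots> \<le> prob {\<omega>\<in>space P. emeasure (X \<omega>) A \<le> 1}" by (intro finite_measure_mono) auto
  also have "\<dots> = 1 - prob {\<omega>\<in>space P. \<not> emeasure (X \<omega>) A \<le> 1}" by (subst prob_neg) auto
  finally have "prob {\<omega>\<in>space P. \<not> emeasure (X \<omega>) A \<le> 1} \<le> 1 - (1 + m) * exp (- m)"
    using poisson_process_weight[OF P A, of 0] poisson_process_weight[OF P A, of 1]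
    by (simp add: poisson_weight_def m_def algebra_simps)
  also have "\<dots> \<le> 1 - (1 + m) * (1 - m)"
    using m exp_ge_add_one_self[of "-m"] by (intro diff_left_mono mult_left_mono) auto
  also have "\<dots> = m\<^sup>2" by (simp add: power2_eq_square algebra_simps)
  finally show ?thesis by (simp add: m_def)
qed

lemma emeasure_slab_le:
  fixes b :: "'a::euclidean_space"
  assumes b: "b \<in> Basis" and r: "r \<ge> 0" and st: "-r \<le> s" "s \<le> t" "t \<le> r"
  shows "emeasure lborel {x\<in>cbox (- r *\<^sub>R One) (r *\<^sub>R One). s \<le> x \<bullet> b \<and> x \<bullet> b < t}
     \<le> ennreal ((2 * r) ^ (DIM('a) - 1) * (t - s))"
proof -
  let ?l = "- r *\<^sub>R One + (s + r) *\<^sub>R b :: 'a" and ?h = "r *\<^sub>R One + (t - r) *\<^sub>R b :: 'a"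
  have in1: "(One::'a) \<bullet> i = 1" if "i \<in> Basis" for i using that by (simp add: inner_sum_left inner_Basis)
  have bi: "b \<bullet> i = (if i = b then 1 else 0)" if "i \<in> Basis" for i using that b by (auto simp: inner_Basis)
  have l: "?l \<bullet> i = (if i = b then s else - r)" and h: "?h \<bullet> i = (if i = b then t else r)" if "i \<in> Basis" for i
    using that by (simp_all add: inner_add_left inner_scaleR_left in1 bi del: scaleR_minus_left)
  have sub: "{x\<in>cbox (- r *\<^sub>R One) (r *\<^sub>R One). s \<le> x \<bullet> b \<and> x \<bullet> b < t} \<subseteq> cbox ?l ?h"
  proof (rule subsetI)
    fix x :: 'a assume x: "x \<in> {x \<in> cbox (- r *\<^sub>R One) (r *\<^sub>R One). s \<le> x \<bullet> b \<and> x \<bullet> b < t}"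
    show "x \<in> cbox ?l ?h" unfolding mem_box
    proof
      fix i :: 'a assume i: "i \<in> Basis"
      have "(- r *\<^sub>R One) \<bullet> i \<le> x \<bullet> i" "x \<bullet> i \<le> (r *\<^sub>R One) \<bullet> i"
        using x i by (auto simp: mem_box simp del: scaleR_minus_left)
      then have "- r \<le> x \<bullet> i" "x \<bullet> i \<le> r" using in1[OF i] by simp_all
      then show "?l \<bullet> i \<le> x \<bullet> i \<and> x \<bullet> i \<le> ?h \<bullet> i" using x l[OF i] h[OF i] by auto
    qed
  qed
  have "emeasure lborel {x\<in>cbox (- r *\<^sub>R One) (r *\<^sub>R One). s \<le> x \<bullet> b \<and> x \<bullet> b < t} \<le> emeasure lborel (cbox ?l ?h)"
    by (intro emeasure_mono sub) auto
  also have "\<dots> = ennreal (\<Prod>i\<in>Basis. (?h - ?l) \<bullet> i)"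
  proof (rule emeasure_lborel_cbox)
    fix i :: 'a assume i: "i \<in> Basis"
    show "?l \<bullet> i \<le> ?h \<bullet> i" unfolding l[OF i] h[OF i] using st by auto
  qed
  also have "(\<Prod>i\<in>Basis. (?h - ?l) \<bullet> i) = (\<Prod>i\<in>Basis. if i = b then t - s else 2 * r)"
    by (intro prod.cong refl) (simp only: inner_diff_left l h if_distrib[of "\<lambda>x. x - _"], simp)
  also have "\<dots> = (t - s) * (\<Prod>i\<in>Basis - {b}. if i = b then t - s else 2 * r)"
    using b by (subst prod.remove[of _ b]) auto
  also have "(\<Prod>i\<in>Basis - {b}. if i = b then t - s else 2 * r) = (\<Prod>i\<in>Basis - {b}. 2 * r)"
    by (intro prod.cong) auto
  finally show ?thesis using b by (simp add: mult.commute)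
qed

text \<open>
  Cut a large cube into \<open>N\<close> slabs of measure of order \<open>1 / N\<close>: a multiple point would give one of
  the slabs two points, which has probability of order \<open>N / N\<^sup>2\<close>.
\<close>

lemma poisson_process_simple:
  fixes X :: "'w \<Rightarrow> 'a::euclidean_space measure"
  assumes P: "poisson_process P S 1 X" and S: "S \<in> sets borel"
  shows "AE \<omega> in P. simple_config (X \<omega>)"
proof -
  interpret prob_space P using poisson_process_prob_space[OF P] .
  obtain b :: 'a where b: "b \<in> Basis" using nonempty_Basis by blast
  have "AE \<omega> in P. \<forall>x\<in>S \<inter> {x\<in>cbox (- real m *\<^sub>R One) (real m *\<^sub>R One). x \<bullet> b < m}. emeasure (X \<omega>) {x} \<le> 1" for m :: nat
  proof -
    define C where "C = (\<lambda>(N::nat) (i::nat). S \<inter> {x\<in>cbox (- real m *\<^sub>R One) (real m *\<^sub>R One).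
        - real m + 2 * m * i / N \<le> x \<bullet> b \<and> x \<bullet> b < - real m + 2 * m * (i + 1) / N})"
    define c where "c = (2 * real m) ^ DIM('a)"
    have Cs[measurable]: "C N i \<in> sets (restrict_space borel S)" for N i :: nat
    proof -
      have "{x\<in>cbox (- real m *\<^sub>R One) (real m *\<^sub>R One :: 'a).
        - real m + 2 * m * i / N \<le> x \<bullet> b \<and> x \<bullet> b < - real m + 2 * m * (i + 1) / N} \<in> sets borel"
        by measurable
      then show ?thesis unfolding C_def by (auto simp: sets_restrict_space)
    qed
    have Cem: "emeasure lborel (C N i) \<le> ennreal (c / N)" if "i < N" for N i :: nat
    proof -
      have "emeasure lborel (C N i) \<le> emeasure lborel {x\<in>cbox (- real m *\<^sub>R One) (real m *\<^sub>R One).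
        - real m + 2 * m * i / N \<le> x \<bullet> b \<and> x \<bullet> b < - real m + 2 * m * (i + 1) / N}"
        unfolding C_def by (intro emeasure_mono) auto
      also have "\<dots> \<le> ennreal ((2 * real m) ^ (DIM('a) - 1) * ((- real m + 2 * m * (i + 1) / N) - (- real m + 2 * m * i / N)))"
      proof -
        have "real m * (real i + 1) \<le> real m * real N" using that by (intro mult_left_mono) auto
        then have "- real m + 2 * m * (i + 1) / N \<le> real m" "- real m + 2 * m * i / N \<le> - real m + 2 * m * (i + 1) / N"
          "- real m \<le> - real m + 2 * m * i / N" using that by (simp_all add: field_simps)
        then show ?thesis by (intro emeasure_slab_le[OF b]) auto
      qed
      also have "(- real m + 2 * m * (i + 1) / N) - (- real m + 2 * m * i / N) = 2 * m / N"
        by (simp add: field_simps add_divide_distrib)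
      also have "(2 * real m) ^ (DIM('a) - 1) * (2 * m / N) = c / N"
        unfolding c_def using DIM_positive[where 'a='a]
        by (cases "DIM('a)") auto
      finally show ?thesis .
    qed
    have c0: "c \<ge> 0" by (simp add: c_def)
    have Cm: "measure lborel (C N i) \<le> c / N" if "i < N" for N i
      using Cem[OF that] c0 by (simp add: measure_def enn2real_leI)
    have Cf: "emeasure lborel (C N i) < \<infinity>" if "i < N" for N i
      using Cem[OF that] by (simp add: le_less_trans)
    have [measurable]: "(\<lambda>\<omega>. emeasure (X \<omega>) (C N i)) \<in> borel_measurable P" for N i
      by (rule poisson_process_emeasure_measurable[OF P Cs])
    let ?B = "\<lambda>N. \<Union>i<N. {\<omega>\<in>space P. \<not> emeasure (X \<omega>) (C N i) \<le> 1}"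
    have B: "prob (?B N) \<le> c\<^sup>2 / N" if "N > 0" for N
    proof -
      have "prob (?B N) \<le> (\<Sum>i<N. prob {\<omega>\<in>space P. \<not> emeasure (X \<omega>) (C N i) \<le> 1})"
        by (intro finite_measure_subadditive_finite) auto
      also have "\<dots> \<le> (\<Sum>i<N. (c / N)\<^sup>2)"
        by (intro sum_mono order.trans[OF poisson_process_multiple_le[OF P Cs]] power_mono Cm) (auto intro!: Cf[simplified])
      also have "\<dots> = c\<^sup>2 / N" using that by (simp add: power2_eq_square)
      finally show ?thesis .
    qed
    have "prob (\<Inter>N\<in>{1..}. ?B N) \<le> c\<^sup>2 / N" if "N > 0" for N :: nat
    proof -
      have "prob (\<Inter>N\<in>{1..}. ?B N) \<le> prob (?B N)" using that by (intro finite_measure_mono) auto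
      with B[OF that] show ?thesis by linarith
    qed
    then have "prob (\<Inter>N\<in>{1..}. ?B N) \<le> 0"
      by (intro LIMSEQ_le_const[OF lim_const_over_n[of "c\<^sup>2"]] exI[of _ 1]) auto
    then have "(\<Inter>N\<in>{1..}. ?B N) \<in> null_sets P"
      by (auto simp: null_sets_def emeasure_eq_measure measure_le_0_iff)
    then show ?thesis
    proof (rule AE_I', intro subsetI INT_I)
      fix \<omega> N assume "\<omega> \<in> {\<omega>\<in>space P. \<not> (\<forall>x\<in>S \<inter> {x\<in>cbox (- real m *\<^sub>R One) (real m *\<^sub>R One). x \<bullet> b < m}.
          emeasure (X \<omega>) {x} \<le> 1)}" and "N \<in> {1::nat..}"
      then obtain x where \<omega>: "\<omega> \<in> space P" and N: "1 \<le> N" and xS: "x \<in> S"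
        and xc: "x \<in> cbox (- real m *\<^sub>R One) (real m *\<^sub>R One)"
        and xm: "x \<bullet> b < real m" and n: "\<not> emeasure (X \<omega>) {x} \<le> 1" by blast
      have cfg: "X \<omega> \<in> point_configs S" by (rule poisson_process_config[OF P \<omega>])
      have One: "(One::'a) \<bullet> b = 1" using b by (simp add: inner_sum_left inner_Basis)
      have xl: "- real m \<le> x \<bullet> b" using xc b One by (auto simp: mem_box)
      have m0: "0 < real m" using xl xm by linarith
      define i where "i = nat \<lfloor>(x \<bullet> b + m) * N / (2 * m)\<rfloor>"
      have i: "real i \<le> (x \<bullet> b + m) * N / (2 * m)" "(x \<bullet> b + m) * N / (2 * m) < real i + 1"
        using xl m0 N unfolding i_def by (auto simp: of_nat_nat)
      have "(x \<bullet> b + m) * N / (2 * m) < N" using xm m0 N by (simp add: field_simps)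
      then have iN: "i < N" using i(1) by linarith
      have "x \<in> C N i" using xS xc i m0 N by (auto simp: C_def field_simps)
      then have "emeasure (X \<omega>) {x} \<le> emeasure (X \<omega>) (C N i)"
        using Cs sets_config[OF cfg] by (intro emeasure_mono) auto
      then show "\<omega> \<in> (\<Union>i<N. {\<omega> \<in> space P. \<not> emeasure (X \<omega>) (C N i) \<le> 1})"
        using n \<omega> iN by (auto intro: order_trans)
    qed
  qed
  then have "AE \<omega> in P. \<forall>m::nat. \<forall>x\<in>S \<inter> {x\<in>cbox (- real m *\<^sub>R One) (real m *\<^sub>R One). x \<bullet> b < m}. emeasure (X \<omega>) {x} \<le> 1"
    by (simp add: AE_all_countable)
  moreover have "AE \<omega> in P. \<omega> \<in> space P" by simp
  ultimately show ?thesis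
  proof eventually_elim
    fix \<omega> assume *: "\<forall>m::nat. \<forall>x\<in>S \<inter> {x\<in>cbox (- real m *\<^sub>R One) (real m *\<^sub>R One). x \<bullet> b < m}. emeasure (X \<omega>) {x} \<le> 1"
      and \<omega>: "\<omega> \<in> space P"
    have cfg: "X \<omega> \<in> point_configs S" by (rule poisson_process_config[OF P \<omega>])
    show "simple_config (X \<omega>)" unfolding simple_config_def
    proof
      fix x show "emeasure (X \<omega>) {x} \<le> 1"
      proof (cases "x \<in> S")
        case True
        obtain m :: nat where m: "norm x < m" using reals_Archimedean2 by blast
        have "\<bar>x \<bullet> i\<bar> \<le> norm x" if "i \<in> Basis" for i using Basis_le_norm[OF that] .
        then have "x \<in> cbox (- real m *\<^sub>R One) (real m *\<^sub>R One)" "x \<bullet> b < m"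
          using m b by (force simp: mem_box inner_sum_left inner_Basis)+
        then show ?thesis using * True by blast
      next
        case False
        then have "{x} \<notin> sets (X \<omega>)" using sets.sets_into_space space_config[OF cfg] by blast
        then show ?thesis by (simp add: emeasure_notin_sets)
      qed
    qed
  qed
qed

lemma poisson_process_indep:
  fixes A :: "nat \<Rightarrow> 'a::euclidean_space set"
  assumes P: "poisson_process P S lam X"
    and "\<And>i. i < n \<Longrightarrow> A i \<in> sets (restrict_space borel S)" "\<And>i. i < n \<Longrightarrow> emeasure lborel (A i) < \<infinity>"
    and "disjoint_family_on A {..<n}"
  shows "prob_space.indep_vars P (\<lambda>_. borel) (\<lambda>i \<omega>. emeasure (X \<omega>) (A i)) {..<n}"
  using P[unfolded poisson_process_def, THEN conjunct2, THEN conjunct2, rule_format, of n A] assms(2-4)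
  by simp

subsection \<open>The law of a Poisson process\<close>

text \<open>
  An intersection-stable generator of the \<open>\<sigma>\<close>-algebra of configurations.  There is at least one
  count, so that all index sets in the product measures below are nonempty.
\<close>

definition count_events :: "'a::euclidean_space set \<Rightarrow> 'a measure set set" where
  "count_events S = {{\<mu>\<in>point_configs S. \<forall>i<Suc n. emeasure \<mu> (A i) \<in> B i} | n A B.
     \<forall>i<Suc n::nat. A i \<in> sets (restrict_space borel S) \<and> bounded (A i) \<and> B i \<in> sets borel}"

lemma count_eventsI:
  fixes A :: "nat \<Rightarrow> 'a::euclidean_space set"
  assumes "\<And>i. i < Suc n \<Longrightarrow> A i \<in> sets (restrict_space borel S)" "\<And>i. i < Suc n \<Longrightarrow> bounded (A i)"
    "\<And>i. i < Suc n \<Longrightarrow> B i \<in> sets borel"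
  shows "{\<mu>\<in>point_configs S. \<forall>i<Suc n. emeasure \<mu> (A i) \<in> B i} \<in> count_events S"
  unfolding count_events_def using assms by blast

lemma count_events_subset: "count_events S \<subseteq> Pow (point_configs S)"
  unfolding count_events_def by (intro subsetI PowI, elim CollectE exE conjE) simp

lemma Int_stable_count_events: "Int_stable (count_events S)"
proof (rule Int_stableI)
  fix a b assume "a \<in> count_events S" "b \<in> count_events S"
  then obtain n A B n' A' B' where
    a: "a = {\<mu>\<in>point_configs S. \<forall>i<Suc n. emeasure \<mu> (A i) \<in> B i}"
      "\<forall>i<Suc n::nat. A i \<in> sets (restrict_space borel S) \<and> bounded (A i) \<and> B i \<in> sets borel" and
    b: "b = {\<mu>\<in>point_configs S. \<forall>i<Suc n'. emeasure \<mu> (A' i) \<in> B' i}"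
      "\<forall>i<Suc n'::nat. A' i \<in> sets (restrict_space borel S) \<and> bounded (A' i) \<and> B' i \<in> sets borel"
    unfolding count_events_def by blast
  let ?A = "\<lambda>i. if i < Suc n then A i else A' (i - Suc n)"
  let ?B = "\<lambda>i. if i < Suc n then B i else B' (i - Suc n)"
  have "a \<inter> b = {\<mu>\<in>point_configs S. \<forall>i<Suc (n + Suc n'). emeasure \<mu> (?A i) \<in> ?B i}" (is "_ = ?R")
  proof (intro equalityI subsetI)
    fix \<mu> assume "\<mu> \<in> a \<inter> b" then show "\<mu> \<in> ?R" unfolding a(1) b(1) by auto
  next
    fix \<mu> assume *: "\<mu> \<in> ?R"
    have "emeasure \<mu> (A i) \<in> B i" if "i < Suc n" for i
    proof -
      have "i < Suc (n + Suc n')" using that by simp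
      then have "emeasure \<mu> (?A i) \<in> ?B i" using * by blast
      then show ?thesis using that by simp
    qed
    moreover have "emeasure \<mu> (A' i) \<in> B' i" if "i < Suc n'" for i
    proof -
      have "i + Suc n < Suc (n + Suc n')" using that by simp
      then have "emeasure \<mu> (?A (i + Suc n)) \<in> ?B (i + Suc n)" using * by blast
      then show ?thesis by simp
    qed
    ultimately show "\<mu> \<in> a \<inter> b" using * unfolding a(1) b(1) by auto
  qed
  also have "\<dots> \<in> count_events S"
    by (rule count_eventsI) (use a(2) b(2) in auto)
  finally show "a \<inter> b \<in> count_events S" .
qed

lemma restrict_space_Int:
  assumes "A \<in> sets (restrict_space M S)" "B \<in> sets M"
  shows "A \<inter> B \<in> sets (restrict_space M S)"
proof -
  obtain A' where "A = S \<inter> A'" "A' \<in> sets M" using assms(1) unfolding sets_restrict_space by blast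
  then have "A \<inter> B = S \<inter> (A' \<inter> B)" "A' \<inter> B \<in> sets M" using assms(2) by auto
  then show ?thesis unfolding sets_restrict_space by blast
qed

lemma sets_config_algebra:
  fixes S :: "'a::euclidean_space set"
  shows "sets (config_algebra S) = sigma_sets (point_configs S) (count_events S)"
proof -
  note G = count_events_subset[of S]
  have "(\<lambda>x. x) \<in> sigma (point_configs S) (count_events S) \<rightarrow>\<^sub>M config_algebra S"
  proof (rule measurable_config_algebraI)
    fix A assume A: "A \<in> sets (restrict_space borel S)"
    have bd: "(\<lambda>\<mu>. emeasure \<mu> (A \<inter> ball 0 (real k))) \<in> borel_measurable (sigma (point_configs S) (count_events S))" for k
    proof (rule measurableI)
      fix B :: "ennreal set" assume B: "B \<in> sets borel"
      have "A \<inter> ball 0 (real k) \<in> sets (restrict_space borel S)"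
        using A by (rule restrict_space_Int) simp
      then have "{\<mu>\<in>point_configs S. \<forall>i<Suc 0. emeasure \<mu> (A \<inter> ball 0 (real k)) \<in> B} \<in> count_events S"
        using B by (intro count_eventsI) (auto intro: bounded_Int)
      moreover have "(\<lambda>\<mu>. emeasure \<mu> (A \<inter> ball 0 (real k))) -` B \<inter> space (sigma (point_configs S) (count_events S))
         = {\<mu>\<in>point_configs S. \<forall>i<Suc 0. emeasure \<mu> (A \<inter> ball 0 (real k)) \<in> B}"
        using G by auto
      ultimately show "(\<lambda>\<mu>. emeasure \<mu> (A \<inter> ball 0 (real k))) -` B \<inter> space (sigma (point_configs S) (count_events S))
        \<in> sets (sigma (point_configs S) (count_events S))"
        using G by auto
    qed auto
    have "emeasure \<mu> A = (SUP k. emeasure \<mu> (A \<inter> ball 0 (real k)))"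
      if \<mu>: "\<mu> \<in> space (sigma (point_configs S) (count_events S))" for \<mu>
    proof -
      have \<mu>: "\<mu> \<in> point_configs S" using \<mu> G by simp
      have "(SUP k. emeasure \<mu> (A \<inter> ball 0 (real k))) = emeasure \<mu> (\<Union>k. A \<inter> ball 0 (real k))"
        by (rule SUP_emeasure_incseq)
          (use restrict_space_Int[OF A] sets_config[OF \<mu>] in \<open>auto simp: incseq_def\<close>)
      also have "(\<Union>k. A \<inter> ball 0 (real k)) = A" by (auto intro: reals_Archimedean2)
      finally show ?thesis ..
    qed
    then have "(\<lambda>\<mu>. emeasure \<mu> A) \<in> borel_measurable (sigma (point_configs S) (count_events S)) \<longleftrightarrow>
      (\<lambda>\<mu>. SUP k. emeasure \<mu> (A \<inter> ball 0 (real k))) \<in> borel_measurable (sigma (point_configs S) (count_events S))"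
      by (rule measurable_cong)
    then show "(\<lambda>\<mu>. emeasure \<mu> A) \<in> borel_measurable (sigma (point_configs S) (count_events S))"
      using bd by simp
  qed (use G in auto)
  then have "sets (config_algebra S) \<subseteq> sigma_sets (point_configs S) (count_events S)"
  proof (intro subsetI)
    fix E assume id: "(\<lambda>x. x) \<in> sigma (point_configs S) (count_events S) \<rightarrow>\<^sub>M config_algebra S"
      and E: "E \<in> sets (config_algebra S)"
    have "(\<lambda>x. x) -` E \<inter> space (sigma (point_configs S) (count_events S)) = E"
      using sets.sets_into_space[OF E] G by (auto simp: space_config_algebra)
    then show "E \<in> sigma_sets (point_configs S) (count_events S)"
      using measurable_sets[OF id E] G by simp
  qed
  moreover have "sigma_sets (point_configs S) (count_events S) \<subseteq> sets (config_algebra S)"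
  proof -
    have "count_events S \<subseteq> sets (config_algebra S)"
    proof
      fix a assume "a \<in> count_events S"
      then obtain n A B where a: "a = {\<mu>\<in>space (config_algebra S). \<forall>i<Suc n. emeasure \<mu> (A i) \<in> B i}"
        "\<forall>i<Suc n::nat. A i \<in> sets (restrict_space borel S) \<and> bounded (A i) \<and> B i \<in> sets borel"
        unfolding count_events_def space_config_algebra by blast
      have "{\<mu>\<in>space (config_algebra S). emeasure \<mu> (A i) \<in> B i} \<in> sets (config_algebra S)" if "i < Suc n" for i
        using a(2) that measurable_emeasure_config[of "A i" S] by auto
      then have "{\<mu>\<in>space (config_algebra S). \<forall>i\<in>{..<Suc n}. emeasure \<mu> (A i) \<in> B i} \<in> sets (config_algebra S)"
        by (intro sets.sets_Collect_finite_All) auto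
      then show "a \<in> sets (config_algebra S)" unfolding a(1) Ball_def lessThan_iff .
    qed
    then show ?thesis
      using sets.sigma_sets_subset[of "count_events S" "config_algebra S"] by (simp add: space_config_algebra)
  qed
  ultimately show ?thesis by blast
qed

lemma poisson_count_distr:
  fixes X :: "'w \<Rightarrow> 'a::euclidean_space measure" and X' :: "'v \<Rightarrow> 'a measure"
  assumes P: "poisson_process P S lam X" and P': "poisson_process P' S lam X'"
    and A: "A \<in> sets (restrict_space borel S)" "emeasure lborel A < \<infinity>"
  shows "distr P borel (\<lambda>\<omega>. emeasure (X \<omega>) A) = distr P' borel (\<lambda>\<omega>. emeasure (X' \<omega>) A)"
proof -
  have *: "emeasure (distr Q borel (\<lambda>\<omega>. emeasure (Y \<omega>) A)) B =
      ennreal (\<Sum>k. if of_nat k \<in> B then poisson_weight (lam * measure lborel A) k else 0)"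
    if Q: "poisson_process Q S lam Y" and B: "B \<in> sets borel" for Q :: "'u measure" and Y B
  proof -
    interpret prob_space Q using poisson_process_prob_space[OF Q] .
    have [measurable]: "(\<lambda>\<omega>. emeasure (Y \<omega>) A) \<in> borel_measurable Q"
      by (rule poisson_process_emeasure_measurable[OF Q A(1)])
    note B[measurable]
    have "emeasure (distr Q borel (\<lambda>\<omega>. emeasure (Y \<omega>) A)) B = emeasure Q {\<omega>\<in>space Q. emeasure (Y \<omega>) A \<in> B}"
      by (subst emeasure_distr) (auto intro!: arg_cong[where f="emeasure Q"])
    also have "\<dots> = emeasure Q {\<omega>\<in>space Q. \<exists>k::nat. emeasure (Y \<omega>) A = of_nat k \<and> of_nat k \<in> B}"
      using poisson_process_AE_nat[OF Q A] by (intro emeasure_eq_AE) auto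
    also have "\<dots> = ennreal (measure Q {\<omega>\<in>space Q. \<exists>k::nat. emeasure (Y \<omega>) A = of_nat k \<and> of_nat k \<in> B})"
      by (simp add: emeasure_eq_measure)
    also have "measure Q {\<omega>\<in>space Q. \<exists>k::nat. emeasure (Y \<omega>) A = of_nat k \<and> of_nat k \<in> B} =
       (\<Sum>k. if of_nat k \<in> B then poisson_weight (lam * measure lborel A) k else 0)"
      by (rule sums_unique[OF poisson_process_prob_sums[OF Q A]])
    finally show ?thesis .
  qed
  show ?thesis
    by (rule measure_eqI) (simp_all add: *[OF P] *[OF P'])
qed

text \<open>
  The law is determined: the counts of arbitrary bounded sets are sums of the counts of the atoms of
  the algebra that they generate, and those are independent with known distributions.
\<close>

lemma poisson_process_law_unique:
  fixes X :: "'w \<Rightarrow> 'a::euclidean_space measure" and X' :: "'v \<Rightarrow> 'a measure"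
  assumes P: "poisson_process P S lam X" and P': "poisson_process P' S lam X'"
  shows "distr P (config_algebra S) X = distr P' (config_algebra S) X'"
proof (rule measure_eqI_generator_eq[OF Int_stable_count_events, of S "point_configs S"])
  interpret P: prob_space P using poisson_process_prob_space[OF P] .
  interpret P': prob_space P' using poisson_process_prob_space[OF P'] .
  show "count_events S \<subseteq> Pow (point_configs S)" by (rule count_events_subset)
  show "sets (distr P (config_algebra S) X) = sigma_sets (point_configs S) (count_events S)"
    "sets (distr P' (config_algebra S) X') = sigma_sets (point_configs S) (count_events S)"
    by (simp_all add: sets_config_algebra)
  define U where "U = {\<mu>\<in>point_configs S. \<forall>i<Suc 0. emeasure \<mu> {} \<in> (UNIV::ennreal set)}"
  have U: "U \<in> count_events S" unfolding U_def by (intro count_eventsI) auto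
  show "range (\<lambda>_::nat. U) \<subseteq> count_events S" using U by auto
  show "(\<Union>i::nat. U) = point_configs S" by (auto simp: U_def)
  show "emeasure (distr P (config_algebra S) X) U \<noteq> \<infinity>" for i :: nat
    by (metis P.prob_space_distr ennreal_one_neq_top infinity_ennreal_def poisson_process_measurable[OF P] prob_space.emeasure_le_1 top.extremum_uniqueI)
  fix E assume "E \<in> count_events S"
  then obtain n A B where E: "E = {\<mu>\<in>point_configs S. \<forall>i<Suc n. emeasure \<mu> (A i) \<in> B i}" and
    AB: "\<And>i. i < Suc n \<Longrightarrow> A i \<in> sets (restrict_space borel S)" "\<And>i. i < Suc n \<Longrightarrow> bounded (A i)"
      "\<And>i. i < Suc n \<Longrightarrow> B i \<in> sets borel"
    unfolding count_events_def by blast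
  \<comment> \<open>the points that lie in exactly those of the sets that \<open>I\<close> names\<close>
  define C where "C = (\<lambda>I. (\<Inter>i\<in>I. A i) - (\<Union>i\<in>{..<Suc n} - I. A i))"
  define N where "N = card (Pow {..<Suc n} - {{}})"
  obtain e where e: "bij_betw e {..<N} (Pow {..<Suc n} - {{}})"
    unfolding N_def using ex_bij_betw_nat_finite[of "Pow {..<Suc n} - {{}}"] by (auto simp: atLeast0LessThan)
  have eI: "e j \<subseteq> {..<Suc n}" "e j \<noteq> {}" if "j < N" for j using e that by (auto simp: bij_betw_def)
  have "{0} \<in> Pow {..<Suc n} - {{}}" by auto
  then have "Pow {..<Suc n} - {{}} \<noteq> {}" by blast
  then have N0: "N \<noteq> 0" unfolding N_def by (subst card_0_eq) auto
  have C1: "C (e j) \<in> sets (restrict_space borel S)" if "j < N" for j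
    unfolding C_def using eI[OF that] AB(1)
    by (intro sets.Diff sets.finite_INT sets.finite_UN) (auto intro: finite_subset)
  have C2: "bounded (C (e j))" if j: "j < N" for j
  proof -
    obtain i where "i \<in> e j" using eI[OF j] by auto
    then have "C (e j) \<subseteq> A i" "i < Suc n" using eI[OF j] by (auto simp: C_def)
    then show ?thesis using AB(2) bounded_subset by blast
  qed
  have C3: "emeasure lborel (C (e j)) < \<infinity>" if "j < N" for j
    using emeasure_bounded_finite[OF C2[OF that]] by simp
  have disjC: "C I \<inter> C J = {}" if "I \<subseteq> {..<Suc n}" "J \<subseteq> {..<Suc n}" "I \<noteq> J" for I J
    using that unfolding C_def by auto
  have disj: "disjoint_family_on (\<lambda>j. C (e j)) {..<N}"
    unfolding disjoint_family_on_def
  proof (intro ballI impI)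
    fix j k assume "j \<in> {..<N}" "k \<in> {..<N}" "j \<noteq> k"
    then show "C (e j) \<inter> C (e k) = {}"
      using eI by (intro disjC) (auto dest: inj_onD[OF bij_betw_imp_inj_on[OF e]])
  qed
  have Adec: "A i = (\<Union>j\<in>{j. j < N \<and> i \<in> e j}. C (e j))" if i: "i < Suc n" for i
  proof (intro equalityI subsetI)
    fix x assume x: "x \<in> A i"
    define I where "I = {i. i < Suc n \<and> x \<in> A i}"
    have "I \<in> Pow {..<Suc n} - {{}}" using x i by (auto simp: I_def)
    then have "I \<in> e ` {..<N}" using bij_betw_imp_surj_on[OF e] by simp
    then obtain j where j: "j < N" "e j = I" by auto
    have "x \<in> C (e j)" unfolding j(2) C_def by (auto simp: I_def)
    then show "x \<in> (\<Union>j\<in>{j. j < N \<and> i \<in> e j}. C (e j))" using j x i by (auto simp: I_def)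
  qed (auto simp: C_def)
  define Z where "Z = {v\<in>space (PiM {..<N} (\<lambda>_. borel)). \<forall>i\<in>{..<Suc n}. (\<Sum>j\<in>{j. j < N \<and> i \<in> e j}. v j) \<in> B i}"
  have Z[measurable]: "Z \<in> sets (PiM {..<N} (\<lambda>_. borel :: ennreal measure))"
    unfolding Z_def
  proof (rule sets.sets_Collect_finite_All)
    fix i assume i: "i \<in> {..<Suc n}"
    have "(\<lambda>v. \<Sum>j\<in>{j. j < N \<and> i \<in> e j}. v j) \<in> borel_measurable (PiM {..<N} (\<lambda>_. borel :: ennreal measure))"
      by (intro borel_measurable_sum measurable_component_singleton) auto
    then show "{v\<in>space (PiM {..<N} (\<lambda>_. borel)). (\<Sum>j\<in>{j. j < N \<and> i \<in> e j}. v j) \<in> B i} \<in> sets (PiM {..<N} (\<lambda>_. borel))"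
      using AB(3) i by auto
  qed auto
  have main: "emeasure (distr Q (config_algebra S) Y) E =
      emeasure (PiM {..<N} (\<lambda>j. distr Q borel (\<lambda>\<omega>. emeasure (Y \<omega>) (C (e j))))) Z"
    if Q: "poisson_process Q S lam Y" for Q :: "'u measure" and Y
  proof -
    interpret prob_space Q using poisson_process_prob_space[OF Q] .
    have meas: "(\<lambda>\<omega>. emeasure (Y \<omega>) (C (e j))) \<in> borel_measurable Q" if "j < N" for j
      by (rule poisson_process_emeasure_measurable[OF Q C1[OF that]])
    have vm: "(\<lambda>\<omega>. \<lambda>j\<in>{..<N}. emeasure (Y \<omega>) (C (e j))) \<in> Q \<rightarrow>\<^sub>M PiM {..<N} (\<lambda>_. borel)"
      using meas by (intro measurable_restrict) auto
    have ind: "indep_vars (\<lambda>_. borel) (\<lambda>j \<omega>. emeasure (Y \<omega>) (C (e j))) {..<N}"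
      using C1 C3 disj by (intro poisson_process_indep[OF Q])
    have eq: "emeasure \<mu> (A i) = (\<Sum>j\<in>{j. j < N \<and> i \<in> e j}. emeasure \<mu> (C (e j)))"
      if "\<mu> \<in> point_configs S" "i < Suc n" for \<mu> i
      unfolding Adec[OF that(2)]
      by (rule sum_emeasure[symmetric]) (use C1 sets_config[OF that(1)] disj in \<open>auto simp: disjoint_family_on_def\<close>)
    have Eset: "E \<in> sets (config_algebra S)"
      unfolding sets_config_algebra by (rule sigma_sets.Basic) (unfold E, intro count_eventsI AB)
    have "emeasure (distr Q (config_algebra S) Y) E = emeasure Q (Y -` E \<inter> space Q)"
      by (rule emeasure_distr[OF poisson_process_measurable[OF Q] Eset])
    also have "Y -` E \<inter> space Q = (\<lambda>\<omega>. \<lambda>j\<in>{..<N}. emeasure (Y \<omega>) (C (e j))) -` Z \<inter> space Q"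
      using poisson_process_config[OF Q] unfolding E Z_def
      by (auto simp: eq space_PiM)
    also have "emeasure Q \<dots> = emeasure (distr Q (PiM {..<N} (\<lambda>_. borel)) (\<lambda>\<omega>. \<lambda>j\<in>{..<N}. emeasure (Y \<omega>) (C (e j)))) Z"
      by (rule emeasure_distr[OF vm Z, symmetric])
    also have "distr Q (PiM {..<N} (\<lambda>_. borel)) (\<lambda>\<omega>. \<lambda>j\<in>{..<N}. emeasure (Y \<omega>) (C (e j))) =
       PiM {..<N} (\<lambda>j. distr Q borel (\<lambda>\<omega>. emeasure (Y \<omega>) (C (e j))))"
      using N0 meas by (intro indep_vars_iff_distr_eq_PiM'[THEN iffD1, OF _ _ ind]) auto
    finally show ?thesis .
  qed
  have "PiM {..<N} (\<lambda>j. distr P borel (\<lambda>\<omega>. emeasure (X \<omega>) (C (e j)))) =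
      PiM {..<N} (\<lambda>j. distr P' borel (\<lambda>\<omega>. emeasure (X' \<omega>) (C (e j))))"
    by (intro PiM_cong refl poisson_count_distr[OF P P'] C1 C3) auto
  then show "emeasure (distr P (config_algebra S) X) E = emeasure (distr P' (config_algebra S) X') E"
    unfolding main[OF P] main[OF P'] by simp
qed

text \<open>
  Being a Poisson process is a property of the law.
\<close>

lemma poisson_process_transfer:
  fixes X :: "'w \<Rightarrow> 'a::euclidean_space measure" and X' :: "'v \<Rightarrow> 'a measure"
  assumes P: "poisson_process P S lam X" and "prob_space P'" and X': "X' \<in> P' \<rightarrow>\<^sub>M config_algebra S"
    and eq: "distr P' (config_algebra S) X' = distr P (config_algebra S) X"
  shows "poisson_process P' S lam X'"
  unfolding poisson_process_def Let_def
proof (intro conjI ballI impI allI)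
  interpret P': prob_space P' by fact
  interpret P: prob_space P using poisson_process_prob_space[OF P] .
  note X = poisson_process_measurable[OF P]
  show "point_process P' S X'" using assms(2,3) by (simp add: point_process_def)
  have comp: "distr P' N (\<lambda>\<omega>. f (X' \<omega>)) = distr P N (\<lambda>\<omega>. f (X \<omega>))"
    if "f \<in> config_algebra S \<rightarrow>\<^sub>M N" for f and N :: "'n measure"
  proof -
    have "distr P' N (\<lambda>\<omega>. f (X' \<omega>)) = distr (distr P' (config_algebra S) X') N f"
      by (subst distr_distr[OF that X']) (simp add: o_def)
    also have "\<dots> = distr P N (\<lambda>\<omega>. f (X \<omega>))"
      unfolding eq by (subst distr_distr[OF that X]) (simp add: o_def)
    finally show ?thesis .
  qed
  { fix A k assume A: "A \<in> sets (restrict_space borel S)" "emeasure lborel A < \<infinity>"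
    note m = measurable_emeasure_config[OF A(1)]
    have "measure P' {\<omega>\<in>space P'. emeasure (X' \<omega>) A = of_nat k} =
        measure (distr P' borel (\<lambda>\<omega>. emeasure (X' \<omega>) A)) {of_nat k}"
      by (subst measure_distr) (auto intro!: measurable_compose[OF X' m] arg_cong[where f="measure P'"])
    also have "\<dots> = measure (distr P borel (\<lambda>\<omega>. emeasure (X \<omega>) A)) {of_nat k}"
      unfolding comp[OF m] ..
    also have "\<dots> = measure P {\<omega>\<in>space P. emeasure (X \<omega>) A = of_nat k}"
      by (subst measure_distr) (auto intro!: measurable_compose[OF X m] arg_cong[where f="measure P"])
    also have "\<dots> = (lam * measure lborel A) ^ k / fact k * exp (- (lam * measure lborel A))"
      using poisson_process_weight[OF P A] by (simp add: poisson_weight_def)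
    finally show "measure P' {\<omega>\<in>space P'. emeasure (X' \<omega>) A = of_nat k} =
       (lam * measure lborel A) ^ k / fact k * exp (- (lam * measure lborel A))" . }
  fix n :: nat and A
  assume A: "\<forall>i<n. A i \<in> sets (restrict_space borel S) \<and> emeasure lborel (A i) < \<infinity>"
    and disj: "disjoint_family_on A {..<n}"
  have ind: "P.indep_vars (\<lambda>_. borel) (\<lambda>i \<omega>. emeasure (X \<omega>) (A i)) {..<n}"
    using A disj by (intro poisson_process_indep[OF P]) auto
  show "P'.indep_vars (\<lambda>_. borel) (\<lambda>i \<omega>. emeasure (X' \<omega>) (A i)) {..<n}"
  proof (cases "n = 0")
    case True then show ?thesis by (simp add: P'.indep_vars_def P'.indep_sets_def)
  next
    case False
    have m: "(\<lambda>\<mu>. emeasure \<mu> (A i)) \<in> borel_measurable (config_algebra S)" if "i < n" for i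
      using measurable_emeasure_config A that by auto
    have v: "(\<lambda>\<mu>. \<lambda>i\<in>{..<n}. emeasure \<mu> (A i)) \<in> config_algebra S \<rightarrow>\<^sub>M PiM {..<n} (\<lambda>_. borel)"
      using m by (intro measurable_restrict) auto
    show ?thesis
    proof (subst P'.indep_vars_iff_distr_eq_PiM')
      show "distr P' (PiM {..<n} (\<lambda>_. borel)) (\<lambda>\<omega>. \<lambda>i\<in>{..<n}. emeasure (X' \<omega>) (A i)) =
         PiM {..<n} (\<lambda>i. distr P' borel (\<lambda>\<omega>. emeasure (X' \<omega>) (A i)))"
        unfolding comp[OF v]
        using False
        by (subst P.indep_vars_iff_distr_eq_PiM'[THEN iffD1, OF _ _ ind])
          (auto intro!: PiM_cong comp[OF m, symmetric] measurable_compose[OF X m])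
    qed (use False in \<open>auto intro!: measurable_compose[OF X' m]\<close>)
  qed
qed

subsection \<open>Translations\<close>

lemma borel_measurable_shift: "(\<lambda>x::'a::real_normed_vector. x + t) \<in> borel_measurable borel"
  by (intro borel_measurable_continuous_onI continuous_intros)

lemma measurable_shift_restrict:
  fixes t :: "'a::real_normed_vector"
  assumes "\<And>x. x + t \<in> S \<longleftrightarrow> x \<in> S"
  shows "(\<lambda>x. x + t) \<in> restrict_space borel S \<rightarrow>\<^sub>M restrict_space borel S"
  using assms by (intro measurable_restrict_space2 measurable_restrict_space1 borel_measurable_shift)
    (auto simp: space_restrict_space)

lemma sets_shift:
  fixes t :: "'a::real_normed_vector"
  assumes S: "\<And>x. x + t \<in> S \<longleftrightarrow> x \<in> S" and A: "A \<in> sets (restrict_space borel S)"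
  shows "{x. x + t \<in> A} \<in> sets (restrict_space borel S)"
proof -
  have "A \<subseteq> S" using sets.sets_into_space[OF A] by (simp add: space_restrict_space)
  then have "(\<lambda>x. x + t) -` A \<inter> space (restrict_space borel S) = {x. x + t \<in> A}"
    using S by (auto simp: space_restrict_space)
  then show ?thesis using measurable_sets[OF measurable_shift_restrict[OF S] A] by simp
qed

lemma translate_config:
  fixes t :: "'a::real_normed_vector"
  assumes S: "\<And>x. x + t \<in> S \<longleftrightarrow> x \<in> S" and \<mu>: "\<mu> \<in> point_configs S"
  shows "translate S t \<mu> \<in> point_configs S"
    and "A \<in> sets (restrict_space borel S) \<Longrightarrow> emeasure (translate S t \<mu>) A = emeasure \<mu> {x. x + t \<in> A}"
proof -
  note s = sets_config[OF \<mu>] and sp = space_config[OF \<mu>]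
  have m: "(\<lambda>x. x + t) \<in> \<mu> \<rightarrow>\<^sub>M restrict_space borel S"
    by (subst measurable_cong_sets[OF s refl]) (rule measurable_shift_restrict[OF S])
  show em: "emeasure (translate S t \<mu>) A = emeasure \<mu> {x. x + t \<in> A}"
    if A: "A \<in> sets (restrict_space borel S)" for A
  proof -
    have "A \<subseteq> S" using sets.sets_into_space[OF A] by (simp add: space_restrict_space)
    then have "(\<lambda>x. x + t) -` A \<inter> space \<mu> = {x. x + t \<in> A}" using S by (auto simp: sp)
    then show ?thesis unfolding translate_def using emeasure_distr[OF m A] by simp
  qed
  show "translate S t \<mu> \<in> point_configs S"
    unfolding point_configs_def
  proof (intro CollectI conjI ballI impI)
    show "sets (translate S t \<mu>) = sets (restrict_space borel S)" by (simp add: translate_def)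
    fix A :: "'a set" assume A: "A \<in> sets (translate S t \<mu>)" "bounded A"
    have A': "A \<in> sets (restrict_space borel S)" using A by (simp add: translate_def)
    have "{x. x + t \<in> A} = (\<lambda>x. x - t) ` A" by (force simp: image_iff)
    then have "bounded {x. x + t \<in> A}" using bounded_translation_minus[OF A(2), of t] by simp
    moreover have "{x. x + t \<in> A} \<in> sets \<mu>"
      unfolding s using S A' by (rule sets_shift)
    ultimately show "\<exists>n::nat. emeasure (translate S t \<mu>) A = of_nat n"
      using em[OF A'] config_bounded_nat[OF \<mu>] by simp
  qed
qed

lemma translate_measurable:
  fixes t :: "'a::real_normed_vector"
  assumes S: "\<And>x. x + t \<in> S \<longleftrightarrow> x \<in> S"
  shows "translate S t \<in> config_algebra S \<rightarrow>\<^sub>M config_algebra S"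
proof (rule measurable_config_algebraI)
  fix A :: "'a set" assume A: "A \<in> sets (restrict_space borel S)"
  have "(\<lambda>\<mu>. emeasure \<mu> {x. x + t \<in> A}) \<in> borel_measurable (config_algebra S)"
    by (rule measurable_emeasure_config[OF sets_shift[OF S A]])
  then show "(\<lambda>\<mu>. emeasure (translate S t \<mu>) A) \<in> borel_measurable (config_algebra S)"
    by (rule measurable_cong[THEN iffD1, rotated]) (simp add: translate_config(2)[OF S] A space_config_algebra)
qed (simp add: space_config_algebra translate_config(1)[OF S])

lemma (in prob_space) indep_vars_cong_space:
  assumes "\<And>i \<omega>. i \<in> I \<Longrightarrow> \<omega> \<in> space M \<Longrightarrow> X i \<omega> = Y i \<omega>"
  shows "indep_vars M' X I \<longleftrightarrow> indep_vars M' Y I"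
proof -
  have "X i -` A \<inter> space M = Y i -` A \<inter> space M" if "i \<in> I" for i A
    using assms[OF that] by auto
  then have "indep_sets (\<lambda>i. {X i -` A \<inter> space M |A. A \<in> sets (M' i)}) I \<longleftrightarrow>
      indep_sets (\<lambda>i. {Y i -` A \<inter> space M |A. A \<in> sets (M' i)}) I"
    by (intro indep_sets_cong refl) auto
  moreover have "random_variable (M' i) (X i) \<longleftrightarrow> random_variable (M' i) (Y i)" if "i \<in> I" for i
    by (rule measurable_cong) (rule assms[OF that])
  ultimately show ?thesis unfolding indep_vars_def2 by auto
qed

lemma poisson_process_translate:
  fixes X :: "'w \<Rightarrow> 'a::euclidean_space measure"
  assumes P: "poisson_process P UNIV lam X"
  shows "poisson_process P UNIV lam (\<lambda>\<omega>. translate UNIV t (X \<omega>))"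
  unfolding poisson_process_def Let_def
proof (intro conjI ballI impI allI)
  interpret P: prob_space P using poisson_process_prob_space[OF P] .
  show "point_process P UNIV (\<lambda>\<omega>. translate UNIV t (X \<omega>))"
    using measurable_compose[OF poisson_process_measurable[OF P] translate_measurable[of t UNIV]]
    by (simp add: point_process_def P.prob_space_axioms)
  have em: "emeasure (translate UNIV t (X \<omega>)) A = emeasure (X \<omega>) {x. x + t \<in> A}"
    if "\<omega> \<in> space P" "A \<in> sets (restrict_space borel UNIV)" for A \<omega>
    using that by (intro translate_config(2) poisson_process_config[OF P]) simp_all
  have pre: "{x. x + t \<in> A} \<in> sets (restrict_space borel UNIV)"
    if "A \<in> sets (restrict_space borel UNIV)" for A :: "'a set"
    using that by (intro sets_shift) auto
  have leb: "emeasure lborel {x. x + t \<in> A} = emeasure lborel A"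
    if "A \<in> sets (restrict_space borel UNIV)" for A :: "'a set"
  proof -
    have "emeasure lborel A = emeasure (distr lborel borel ((+) t)) A" by (simp add: lborel_distr_plus)
    also have "\<dots> = emeasure lborel {x. x + t \<in> A}"
      using that by (subst emeasure_distr) (auto simp: sets_restrict_UNIV vimage_def add.commute)
    finally show ?thesis ..
  qed
  { fix A :: "'a set" and k assume A: "A \<in> sets (restrict_space borel UNIV)" "emeasure lborel A < \<infinity>"
    have "{\<omega>\<in>space P. emeasure (translate UNIV t (X \<omega>)) A = of_nat k} = {\<omega>\<in>space P. emeasure (X \<omega>) {x. x + t \<in> A} = of_nat k}"
      using em[OF _ A(1)] by auto
    then show "measure P {\<omega>\<in>space P. emeasure (translate UNIV t (X \<omega>)) A = of_nat k} =
        (lam * measure lborel A) ^ k / fact k * exp (- (lam * measure lborel A))"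
      using poisson_process_weight[OF P pre[OF A(1)], of k] A leb[OF A(1)]
      by (simp add: poisson_weight_def measure_def) }
  fix n :: nat and A :: "nat \<Rightarrow> 'a set"
  assume A: "\<forall>i<n. A i \<in> sets (restrict_space borel UNIV) \<and> emeasure lborel (A i) < \<infinity>"
    and disj: "disjoint_family_on A {..<n}"
  have "P.indep_vars (\<lambda>_. borel) (\<lambda>i \<omega>. emeasure (X \<omega>) ((\<lambda>i. {x. x + t \<in> A i}) i)) {..<n}"
    using A disj pre leb by (intro poisson_process_indep[OF P]) (auto simp: disjoint_family_on_def)
  then show "P.indep_vars (\<lambda>_. borel) (\<lambda>i \<omega>. emeasure (translate UNIV t (X \<omega>)) (A i)) {..<n}"
  proof (rule P.indep_vars_cong_space[THEN iffD1, rotated])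
    fix i \<omega> assume "i \<in> {..<n}" "\<omega> \<in> space P"
    then show "emeasure (X \<omega>) {x. x + t \<in> A i} = emeasure (translate UNIV t (X \<omega>)) (A i)"
      using A em by auto
  qed
qed

section \<open>No locally finite matching scheme in one dimension\<close>

subsection \<open>Poisson probabilities are uniformly small\<close>

lemma poisson_weight_Suc: "poisson_weight m (Suc k) * real (Suc k) = poisson_weight m k * m"
  by (simp add: poisson_weight_def field_simps del: of_nat_Suc)

lemma sum_poisson_weight_le_1:
  assumes "0 \<le> m" "finite F" shows "sum (poisson_weight m) F \<le> 1"
  using sum_le_suminf[of "poisson_weight m" F] poisson_weight_sums[of m] assms
  by (simp add: poisson_weight_nonneg sums_iff)

text \<open>
  Within distance \<open>L\<close> of \<open>k\<close>, on the side of the mode, the weights are at least about as large as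
  the weight of \<open>k\<close> once \<open>m\<close> is large compared to \<open>L\<^sup>2\<close>; and they sum to at most one.
\<close>

lemma poisson_weight_le:
  assumes m: "2 * (real L)\<^sup>2 \<le> m" "0 < m" "real L \<le> m"
  shows "poisson_weight m k \<le> 2 / (real L + 1)"
proof -
  \<comment> \<open>\<open>f\<close> walks from \<open>k\<close> towards the mode, and a step loses at most the factor \<open>c\<close>\<close>
  have key: "poisson_weight m k \<le> 2 / (real L + 1)"
    if g: "\<And>i. i < L \<Longrightarrow> poisson_weight m (f i) * c \<le> poisson_weight m (f (Suc i))" "f 0 = k" "inj_on f {..L}"
      and c: "c = 1 - L / M" "m \<le> M" for f c M
  proof -
    have M: "0 < M" "real L \<le> M" "2 * (real L)\<^sup>2 \<le> M" using m c by auto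
    have c0: "0 \<le> c" "c \<le> 1" using M unfolding c by auto
    have "1 + real L * (- (L / M)) \<le> (1 + (- (L / M))) ^ L"
      using M by (intro Bernoulli_inequality) auto
    moreover have "real L * (L / M) \<le> 1 / 2" using M by (simp add: field_simps power2_eq_square)
    ultimately have cL: "1 / 2 \<le> c ^ L" unfolding c by simp
    have ind: "poisson_weight m k * c ^ i \<le> poisson_weight m (f i)" if "i \<le> L" for i
      using that
    proof (induction i)
      case (Suc i)
      have "poisson_weight m k * c ^ Suc i = (poisson_weight m k * c ^ i) * c" by simp
      also have "\<dots> \<le> poisson_weight m (f i) * c" using Suc c0 by (intro mult_right_mono) auto
      also have "\<dots> \<le> poisson_weight m (f (Suc i))" using Suc by (intro g) auto
      finally show ?case .
    qed (simp add: g)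
    have "real (L + 1) * (poisson_weight m k * (1 / 2)) = (\<Sum>i\<le>L. poisson_weight m k * (1 / 2))" by simp
    also have "\<dots> \<le> (\<Sum>i\<le>L. poisson_weight m (f i))"
    proof (rule sum_mono)
      fix i assume i: "i \<in> {..L}"
      have "1 / 2 \<le> c ^ i" using cL power_decreasing[of i L c] c0 i by auto
      then have "poisson_weight m k * (1 / 2) \<le> poisson_weight m k * c ^ i"
        using m by (intro mult_left_mono poisson_weight_nonneg) auto
      then show "poisson_weight m k * (1 / 2) \<le> poisson_weight m (f i)" using ind[of i] i by auto
    qed
    also have "\<dots> = sum (poisson_weight m) (f ` {..L})" using g(3) by (simp add: sum.reindex)
    also have "\<dots> \<le> 1" using m by (intro sum_poisson_weight_le_1) auto
    finally show ?thesis by (simp add: field_simps)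
  qed
  show ?thesis
  proof (cases "real k < m")
    case True
    show ?thesis
    proof (rule key[of "\<lambda>i. k + i" "1 - L / (m + L)" "m + L"])
      fix i assume i: "i < L"
      have "1 - L / (m + L) = m / (m + L)" using m by (simp add: field_simps)
      then have "poisson_weight m (k + i) * (1 - L / (m + L)) = poisson_weight m (Suc (k + i)) * real (Suc (k + i)) / (m + L)"
        using poisson_weight_Suc[of m "k + i"] by simp
      also have "\<dots> \<le> poisson_weight m (Suc (k + i)) * (m + L) / (m + L)"
        using True i m by (intro divide_right_mono mult_left_mono poisson_weight_nonneg) auto
      also have "\<dots> = poisson_weight m (k + Suc i)" using m by simp
      finally show "poisson_weight m (k + i) * (1 - L / (m + L)) \<le> poisson_weight m (k + Suc i)" .
    qed auto
  next
    case False
    show ?thesis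
    proof (rule key[of "\<lambda>i. k - i" "1 - L / m" m])
      have "real L \<le> real k" using False m by linarith
      then have Lk: "L \<le> k" by simp
      then show "inj_on (\<lambda>i. k - i) {..L}" by (auto simp: inj_on_def)
      fix i assume i: "i < L"
      have "poisson_weight m (k - i) * (1 - L / m) = poisson_weight m (k - i) * (m - L) / m"
        using m by (simp add: field_simps)
      also have "\<dots> \<le> poisson_weight m (k - i) * real (k - i) / m"
        using False i m Lk by (intro divide_right_mono mult_left_mono poisson_weight_nonneg) (auto simp: of_nat_diff)
      also have "\<dots> = poisson_weight m (k - Suc i)"
        using poisson_weight_Suc[of m "k - Suc i"] i Lk m by (simp add: Suc_diff_Suc)
      finally show "poisson_weight m (k - i) * (1 - L / m) \<le> poisson_weight m (k - Suc i)" .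
    qed auto
  qed
qed

text \<open>
  Given the number of blue points, the number of red points has to be one of \<open>2 K + 1\<close> values.
\<close>

lemma poisson_difference_concentration:
  assumes RB: "independent_poisson_processes P S R B" and A: "A \<in> sets (restrict_space borel S)" "emeasure lborel A < \<infinity>"
    and s: "\<And>k. poisson_weight (measure lborel A) k \<le> s"
  shows "measure P {\<omega>\<in>space P. emeasure (R \<omega>) A \<le> emeasure (B \<omega>) A + of_nat K \<and> emeasure (B \<omega>) A \<le> emeasure (R \<omega>) A + of_nat K}
     \<le> (2 * K + 1) * s"
proof -
  have R: "poisson_process P S 1 R" and B: "poisson_process P S 1 B"
    and ind: "prob_space.indep_var P (config_algebra S) R (config_algebra S) B"
    using RB by (auto simp: independent_poisson_processes_def)
  interpret prob_space P using poisson_process_prob_space[OF R] .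
  have [measurable]: "(\<lambda>\<omega>. emeasure (R \<omega>) A) \<in> borel_measurable P" "(\<lambda>\<omega>. emeasure (B \<omega>) A) \<in> borel_measurable P"
    using poisson_process_emeasure_measurable A R B by blast+
  define p where "p = poisson_weight (measure lborel A)"
  have p0: "p k \<ge> 0" for k by (simp add: p_def poisson_weight_nonneg)
  have joint: "prob {\<omega>\<in>space P. emeasure (R \<omega>) A = of_nat k \<and> emeasure (B \<omega>) A = of_nat j} = p k * p j" for k j :: nat
  proof -
    have "indep_var borel ((\<lambda>\<mu>. emeasure \<mu> A) \<circ> R) borel ((\<lambda>\<mu>. emeasure \<mu> A) \<circ> B)"
      by (rule indep_var_compose[OF ind]) (rule measurable_emeasure_config[OF A(1)])+
    from indep_varD[OF this, of "{of_nat k}" "{of_nat j}"]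
    have "prob ((\<lambda>x. (emeasure (R x) A, emeasure (B x) A)) -` ({of_nat k} \<times> {of_nat j}) \<inter> space P) =
      prob ((\<lambda>x. emeasure (R x) A) -` {of_nat k} \<inter> space P) * prob ((\<lambda>x. emeasure (B x) A) -` {of_nat j} \<inter> space P)"
      by (simp add: o_def)
    moreover have "(\<lambda>x. emeasure (Y x) A) -` {of_nat k} \<inter> space P = {\<omega>\<in>space P. emeasure (Y \<omega>) A = of_nat k}" for Y and k :: nat
      by auto
    moreover have "(\<lambda>x. (emeasure (R x) A, emeasure (B x) A)) -` ({of_nat k} \<times> {of_nat j}) \<inter> space P =
      {\<omega>\<in>space P. emeasure (R \<omega>) A = of_nat k \<and> emeasure (B \<omega>) A = of_nat j}" by auto
    ultimately show ?thesis
      using poisson_process_weight[OF R A, of k] poisson_process_weight[OF B A, of j] by (simp add: p_def)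
  qed
  let ?D = "\<lambda>\<omega>. emeasure (R \<omega>) A \<le> emeasure (B \<omega>) A + of_nat K \<and> emeasure (B \<omega>) A \<le> emeasure (R \<omega>) A + of_nat K"
  let ?F = "\<lambda>j::nat. {\<omega>\<in>space P. emeasure (B \<omega>) A = of_nat j \<and> ?D \<omega> \<and> (\<exists>k::nat. emeasure (R \<omega>) A = of_nat k)}"
  have F: "prob (?F j) \<le> (2 * K + 1) * s * p j" for j
  proof -
    have "prob (?F j) \<le> prob (\<Union>k\<in>{j-K..j+K}. {\<omega>\<in>space P. emeasure (R \<omega>) A = of_nat k \<and> emeasure (B \<omega>) A = of_nat j})"
    proof (intro finite_measure_mono subsetI)
      fix \<omega> assume \<omega>: "\<omega> \<in> ?F j"
      then obtain k :: nat where k: "emeasure (R \<omega>) A = of_nat k" by auto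
      then have "(of_nat k :: ennreal) \<le> of_nat (j + K)" "(of_nat j :: ennreal) \<le> of_nat (k + K)" using \<omega> by auto
      then have "k \<le> j + K" "j \<le> k + K" by (simp_all only: of_nat_le_iff)
      then show "\<omega> \<in> (\<Union>k\<in>{j-K..j+K}. {\<omega>\<in>space P. emeasure (R \<omega>) A = of_nat k \<and> emeasure (B \<omega>) A = of_nat j})"
        using \<omega> k by auto
    qed auto
    also have "\<dots> \<le> (\<Sum>k\<in>{j-K..j+K}. prob {\<omega>\<in>space P. emeasure (R \<omega>) A = of_nat k \<and> emeasure (B \<omega>) A = of_nat j})"
      by (intro finite_measure_subadditive_finite) auto
    also have "\<dots> \<le> (\<Sum>k\<in>{j-K..j+K}. s * p j)"
      unfolding joint using s p0 by (intro sum_mono mult_right_mono) (auto simp: p_def)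
    also have "\<dots> = real (card {j-K..j+K}) * (s * p j)" by simp
    also have "\<dots> \<le> (2 * K + 1) * (s * p j)"
      using order_trans[OF p0[of 0]] s[of 0] p0[of j] by (intro mult_right_mono mult_nonneg_nonneg) (auto simp: p_def)
    finally show ?thesis by (simp add: mult.assoc)
  qed
  have "prob {\<omega>\<in>space P. ?D \<omega>} = prob (\<Union>j. ?F j)"
    using poisson_process_AE_nat[OF R A] poisson_process_AE_nat[OF B A]
    by (intro measure_eq_AE) auto
  also have "\<dots> = (\<Sum>j. prob (?F j))"
    by (intro sums_unique finite_measure_UNION) (auto simp: disjoint_family_on_def)
  also have "\<dots> \<le> (\<Sum>j. (2 * K + 1) * s * p j)"
  proof (intro suminf_le F)
    show "summable (\<lambda>j. prob (?F j))"
      by (rule sums_summable, rule finite_measure_UNION) (auto simp: disjoint_family_on_def)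
    show "summable (\<lambda>j. (2 * K + 1) * s * p j)"
      unfolding p_def using poisson_weight_sums by (intro summable_mult) (auto simp: sums_iff)
  qed
  also have "\<dots> = (2 * K + 1) * s"
    unfolding p_def using sums_unique[OF sums_mult[OF poisson_weight_sums, of "(2 * K + 1) * s"]] by simp
  finally show ?thesis by (simp add: add.commute)
qed

subsection \<open>Comparing the colour imbalance of a slice with the edges that leave it\<close>

text \<open>
  Read \<open>f\<close> and \<open>g\<close> as the two ends of an edge: a vertex in \<open>I\<close> has its partner in \<open>I\<close>, or its edge
  leaves \<open>I\<close>.
\<close>

lemma card_le_leaving_edges:
  assumes f: "inj_on f E" "V = f ` E" and g: "inj_on g E" "g ` E \<subseteq> W"
    and fin: "finite (W \<inter> I)" "finite (E \<inter> A)" "finite (E \<inter> A')"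
    and leave: "\<And>e. e \<in> E \<Longrightarrow> f e \<in> I \<Longrightarrow> g e \<notin> I \<Longrightarrow> e \<in> A \<union> A'"
  shows "card (V \<inter> I) \<le> card (W \<inter> I) + (card (E \<inter> A) + card (E \<inter> A'))"
proof -
  let ?G = "{e\<in>E. g e \<in> I}"
  have "g ` ?G \<subseteq> W \<inter> I" using g by auto
  then have G: "finite ?G" "card ?G \<le> card (W \<inter> I)"
    using g(1) fin(1) by (auto intro!: inj_on_finite[of g _ "W \<inter> I"] card_inj_on_le[of g] elim: inj_on_subset)
  have "V \<inter> I \<subseteq> f ` (?G \<union> (E \<inter> A \<union> E \<inter> A'))" using f leave by blast
  then have "card (V \<inter> I) \<le> card (f ` (?G \<union> (E \<inter> A \<union> E \<inter> A')))" using G fin by (intro card_mono) auto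
  also have "\<dots> \<le> card (?G \<union> (E \<inter> A \<union> E \<inter> A'))" using G fin by (intro card_image_le) auto
  also have "\<dots> \<le> card ?G + (card (E \<inter> A) + card (E \<inter> A'))"
    by (intro order_trans[OF card_Un_le] add_left_mono card_Un_le)
  finally show ?thesis using G by linarith
qed

lemma perfect_matching_inj:
  assumes "perfect_matching V W E"
  shows "inj_on fst E" "inj_on snd E" "V = fst ` E" "W = snd ` E"
proof -
  have EVW: "E \<subseteq> V \<times> W" and one: "\<And>v. v \<in> V \<union> W \<Longrightarrow> card {e\<in>E. fst e = v \<or> snd e = v} = 1"
    and disj: "V \<inter> W = {}" using assms by (auto simp: perfect_matching_def)
  have uniq: "e = e'" if e: "e \<in> E" "e' \<in> E" and v: "v \<in> V \<union> W"
    and ev: "fst e = v \<or> snd e = v" "fst e' = v \<or> snd e' = v" for e e' v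
  proof -
    obtain d where "{e\<in>E. fst e = v \<or> snd e = v} = {d}" using one[OF v] by (auto simp: card_1_singleton_iff)
    then have "e = d" "e' = d" using e ev by blast+
    then show ?thesis by simp
  qed
  show "inj_on fst E"
  proof (rule inj_onI)
    fix e e' assume "e \<in> E" "e' \<in> E" "fst e = fst e'"
    then show "e = e'" using EVW by (intro uniq[of e e' "fst e"]) auto
  qed
  show "inj_on snd E"
  proof (rule inj_onI)
    fix e e' assume "e \<in> E" "e' \<in> E" "snd e = snd e'"
    then show "e = e'" using EVW by (intro uniq[of e e' "snd e"]) auto
  qed
  have ex: "\<exists>e\<in>E. fst e = v \<or> snd e = v" if "v \<in> V \<union> W" for v
    using one[OF that] by (metis (mono_tags, lifting) Collect_empty_eq card.empty zero_neq_one)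
  show "V = fst ` E"
  proof
    show "V \<subseteq> fst ` E"
    proof
      fix v assume v: "v \<in> V"
      then obtain e where e: "e \<in> E" "fst e = v \<or> snd e = v" using ex by blast
      have "snd e \<noteq> v" using v disj subsetD[OF EVW e(1)] by (auto simp: mem_Times_iff)
      then show "v \<in> fst ` E" using e by auto
    qed
  qed (use EVW in auto)
  show "W = snd ` E"
  proof
    show "W \<subseteq> snd ` E"
    proof
      fix v assume v: "v \<in> W"
      then obtain e where e: "e \<in> E" "fst e = v \<or> snd e = v" using ex by blast
      have "fst e \<noteq> v" using v disj subsetD[OF EVW e(1)] by (auto simp: mem_Times_iff)
      then show "v \<in> snd ` E" using e by auto
    qed
  qed (use EVW in auto)
qed

lemma closed_segment_crosses_level:
  fixes e :: "'a::euclidean_space"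
  assumes "(x \<bullet> e < t) \<noteq> (y \<bullet> e < t)"
  obtains z where "z \<in> closed_segment x y" "z \<bullet> e = t"
proof -
  define d where "d = y \<bullet> e - x \<bullet> e"
  define a where "a = (t - x \<bullet> e) / d"
  have "d \<noteq> 0" using assms by (auto simp: d_def)
  have a: "0 \<le> a" "a \<le> 1" using assms by (auto simp: a_def d_def divide_simps)
  have "a * d = t - x \<bullet> e" using \<open>d \<noteq> 0\<close> by (simp add: a_def)
  then have "((1 - a) *\<^sub>R x + a *\<^sub>R y) \<bullet> e = t"
    by (simp add: inner_add_left d_def algebra_simps)
  moreover have "(1 - a) *\<^sub>R x + a *\<^sub>R y \<in> closed_segment x y" using a by (auto simp: in_segment)
  ultimately show ?thesis using that by blast
qed

text \<open>
  The number of edges that cross a level of the coordinate \<open>e\<close> is finite and has the same law at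
  every level, so it is bounded in probability.  The colour imbalance of a slice between two levels
  is at most the number of edges that cross one of the two, but it is not bounded in probability
  as the slice grows.
\<close>

lemma no_locally_finite_scheme_slices:
  fixes S :: "'a::euclidean_space set" and P :: "'w measure"
  assumes RB: "independent_poisson_processes P S R B" and match: "matching_scheme P S R B M"
    and inv: "translation_invariant P S T R B M" and lf: "locally_finite_scheme P S M"
    and S: "S \<in> sets borel" "convex S"
    and slice: "\<And>n::nat. emeasure lborel (S \<inter> {x. 0 \<le> x \<bullet> e \<and> x \<bullet> e < real n}) = ennreal (real n)"
    and bdd: "\<And>n::nat. bounded (S \<inter> {x. 0 \<le> x \<bullet> e \<and> x \<bullet> e < real n})"
    and T: "\<And>n::nat. real n *\<^sub>R e \<in> T" and shift: "\<And>(n::nat) x. x + real n *\<^sub>R e \<in> S \<longleftrightarrow> x \<in> S"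
    and e: "e \<in> Basis"
  shows False
proof -
  have R: "poisson_process P S 1 R" and B: "poisson_process P S 1 B"
    using RB by (auto simp: independent_poisson_processes_def)
  interpret prob_space P using poisson_process_prob_space[OF R] .
  have Mm: "M \<in> P \<rightarrow>\<^sub>M config_algebra (S \<times> S)" and Ms: "AE \<omega> in P. \<forall>x\<in>S \<times> S. emeasure (M \<omega>) {x} \<le> 1"
    and pm: "AE \<omega> in P. perfect_matching (point_support (R \<omega>)) (point_support (B \<omega>)) (point_support (M \<omega>))"
    using match by (auto simp: matching_scheme_def simple_point_process_def point_process_def)
  have Mc: "M \<omega> \<in> point_configs (S \<times> S)" if "\<omega> \<in> space P" for \<omega>
    using measurable_space[OF Mm that] by (simp add: space_config_algebra)
  \<comment> \<open>the pairs that are separated by the level \<open>t\<close>\<close>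
  define Cut where "Cut = (\<lambda>t. (S \<times> S) \<inter> {p. (fst p \<bullet> e < t) \<noteq> (snd p \<bullet> e < t)})"
  have Cut[measurable]: "Cut t \<in> sets (restrict_space borel (S \<times> S))" for t
  proof -
    have "(\<lambda>p::'a\<times>'a. fst p \<bullet> e) \<in> borel_measurable borel" "(\<lambda>p::'a\<times>'a. snd p \<bullet> e) \<in> borel_measurable borel"
      by (intro borel_measurable_continuous_onI continuous_intros)+
    then have "{p::'a\<times>'a. (fst p \<bullet> e < t) \<noteq> (snd p \<bullet> e < t)} \<in> sets borel" by measurable
    then show ?thesis unfolding Cut_def sets_restrict_space by blast
  qed
  have [measurable]: "(\<lambda>\<omega>. emeasure (M \<omega>) (Cut t)) \<in> borel_measurable P" for t
    by (rule measurable_compose[OF Mm measurable_emeasure_config[OF Cut]])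
  define I where "I = (\<lambda>n::nat. S \<inter> {x. 0 \<le> x \<bullet> e \<and> x \<bullet> e < real n})"
  have I: "I n \<in> sets (restrict_space borel S)" for n
  proof -
    have "{x::'a. 0 \<le> x \<bullet> e \<and> x \<bullet> e < real n} \<in> sets borel" by measurable
    then show ?thesis unfolding I_def sets_restrict_space by blast
  qed
  have If: "emeasure lborel (I n) < \<infinity>" and Im: "measure lborel (I n) = n" for n
    using slice[of n] by (simp_all add: I_def measure_def)
  have Mcard: "finite (point_support (M \<omega>) \<inter> Cut (real n)) \<and>
      emeasure (M \<omega>) (Cut (real n)) = of_nat (card (point_support (M \<omega>) \<inter> Cut (real n)))"
    if \<omega>: "\<omega> \<in> space P" and s: "\<forall>x\<in>S \<times> S. emeasure (M \<omega>) {x} \<le> 1"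
      and l: "\<forall>C\<subseteq>S. bounded C \<longrightarrow> finite {e\<in>point_support (M \<omega>). crosses e C}" for \<omega> n
  proof -
    let ?C = "S \<inter> {x. x \<bullet> e = real n}"
    have "?C \<subseteq> I (Suc n)" by (auto simp: I_def)
    then have "bounded ?C" using bdd[of "Suc n"] bounded_subset unfolding I_def by blast
    then have "finite {e\<in>point_support (M \<omega>). crosses e ?C}" using l by auto
    moreover have "point_support (M \<omega>) \<inter> Cut (real n) \<subseteq> {e\<in>point_support (M \<omega>). crosses e ?C}"
    proof
      fix p assume p: "p \<in> point_support (M \<omega>) \<inter> Cut (real n)"
      then have xy: "fst p \<in> S" "snd p \<in> S" "(fst p \<bullet> e < n) \<noteq> (snd p \<bullet> e < n)" by (auto simp: Cut_def)
      then obtain z where z: "z \<in> closed_segment (fst p) (snd p)" "z \<bullet> e = real n"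
        using closed_segment_crosses_level by blast
      have "z \<in> S" using z(1) xy S(2) closed_segment_subset by blast
      then show "p \<in> {e\<in>point_support (M \<omega>). crosses e ?C}" using z p by (auto simp: crosses_def)
    qed
    ultimately have f: "finite (point_support (M \<omega>) \<inter> Cut (real n))" using finite_subset by blast
    have "emeasure (M \<omega>) {x} \<le> 1" for x
    proof (cases "x \<in> S \<times> S")
      case False
      then have "{x} \<notin> sets (M \<omega>)" using sets.sets_into_space space_config[OF Mc[OF \<omega>]] by blast
      then show ?thesis by (simp add: emeasure_notin_sets)
    qed (use s in auto)
    then have "simple_config (M \<omega>)" by (simp add: simple_config_def)
    then have "emeasure (M \<omega>) (Cut (real n)) = of_nat (card (Cut (real n) \<inter> point_support (M \<omega>)))"
      using f Cut sets_config[OF Mc[OF \<omega>]]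
      by (intro simple_config_card[OF Mc[OF \<omega>]]) (auto simp: Int_commute)
    then show ?thesis using f by (simp add: Int_commute)
  qed
  have good: "AE \<omega> in P. emeasure (R \<omega>) (I n) \<le> emeasure (B \<omega>) (I n) + (emeasure (M \<omega>) (Cut 0) + emeasure (M \<omega>) (Cut n)) \<and>
       emeasure (B \<omega>) (I n) \<le> emeasure (R \<omega>) (I n) + (emeasure (M \<omega>) (Cut 0) + emeasure (M \<omega>) (Cut n)) \<and>
       emeasure (M \<omega>) (Cut 0) \<noteq> \<infinity>" for n :: nat
    using poisson_process_simple[OF R S(1)] poisson_process_simple[OF B S(1)] Ms pm lf[unfolded locally_finite_scheme_def] AE_space
  proof eventually_elim
    case (elim \<omega>)
    note Rc = poisson_process_config[OF R elim(6)] and Bc = poisson_process_config[OF B elim(6)]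
    note M0 = Mcard[OF elim(6,3,5), of 0, simplified] and Mn = Mcard[OF elim(6,3,5), of n]
    let ?V = "point_support (R \<omega>)" and ?W = "point_support (B \<omega>)" and ?E = "point_support (M \<omega>)"
    note pmE = perfect_matching_inj[OF elim(4)]
    have bI: "bounded (I n)" using bdd by (simp add: I_def)
    have fV: "finite (?V \<inter> I n)" using simple_config_finite[OF Rc elim(1) _ bI] I sets_config[OF Rc] by (simp add: Int_commute)
    have fW: "finite (?W \<inter> I n)" using simple_config_finite[OF Bc elim(2) _ bI] I sets_config[OF Bc] by (simp add: Int_commute)
    have eV: "emeasure (R \<omega>) (I n) = of_nat (card (?V \<inter> I n))"
      using simple_config_card[OF Rc elim(1)] I sets_config[OF Rc] fV by (simp add: Int_commute)
    have eW: "emeasure (B \<omega>) (I n) = of_nat (card (?W \<inter> I n))"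
      using simple_config_card[OF Bc elim(2)] I sets_config[OF Bc] fW by (simp add: Int_commute)
    have VS: "?V \<subseteq> S" "?W \<subseteq> S" using point_support_subset[OF Rc] point_support_subset[OF Bc] by auto
    have "fst e \<in> S" "snd e \<in> S" if "e \<in> ?E" for e using that pmE(3,4) VS by blast+
    then have leave: "d \<in> Cut 0 \<union> Cut (real n)" if "d \<in> ?E" "(fst d \<in> I n) \<noteq> (snd d \<in> I n)" for d
      using that by (cases d) (fastforce simp: I_def Cut_def)
    have "card (?V \<inter> I n) \<le> card (?W \<inter> I n) + (card (?E \<inter> Cut 0) + card (?E \<inter> Cut (real n)))"
      using pmE fW M0 Mn leave by (intro card_le_leaving_edges[where f=fst and g=snd]) auto
    moreover have "card (?W \<inter> I n) \<le> card (?V \<inter> I n) + (card (?E \<inter> Cut 0) + card (?E \<inter> Cut (real n)))"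
      using pmE fV M0 Mn leave by (intro card_le_leaving_edges[where f=snd and g=fst]) auto
    ultimately show ?case
      unfolding eV eW M0[THEN conjunct2] Mn[THEN conjunct2] of_nat_add[symmetric] by (simp only: of_nat_le_iff) simp
  qed
  have law: "prob {\<omega>\<in>space P. emeasure (M \<omega>) (Cut (real n)) \<le> of_nat K} = prob {\<omega>\<in>space P. emeasure (M \<omega>) (Cut 0) \<le> of_nat K}" for n K :: nat
  proof -
    let ?K = "config_algebra S \<Otimes>\<^sub>M config_algebra S \<Otimes>\<^sub>M config_algebra (S \<times> S)"
    let ?t = "real n *\<^sub>R e"
    have shift2: "p + (?t, ?t) \<in> S \<times> S \<longleftrightarrow> p \<in> S \<times> S" for p using shift by (cases p) auto
    note Rm = poisson_process_measurable[OF R] and Bm = poisson_process_measurable[OF B]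
    note tm = translate_measurable[of ?t S, OF shift] translate_measurable[of "(?t, ?t)" "S \<times> S", OF shift2]
    have m1: "(\<lambda>\<omega>. (translate S ?t (R \<omega>), translate S ?t (B \<omega>), translate (S \<times> S) (?t, ?t) (M \<omega>))) \<in> P \<rightarrow>\<^sub>M ?K"
      by (intro measurable_Pair measurable_compose[OF Rm] measurable_compose[OF Bm] measurable_compose[OF Mm] tm)
    have m2: "(\<lambda>\<omega>. (R \<omega>, B \<omega>, M \<omega>)) \<in> P \<rightarrow>\<^sub>M ?K" by (intro measurable_Pair Rm Bm Mm)
    let ?G = "{x\<in>space ?K. emeasure (snd (snd x)) (Cut (real n)) \<le> of_nat K}"
    have "(\<lambda>x. emeasure (snd (snd x)) (Cut (real n))) \<in> borel_measurable ?K"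
      by (rule measurable_compose[OF _ measurable_emeasure_config[OF Cut]]) measurable
    then have G: "?G \<in> sets ?K" by measurable
    have cutn: "{x. x + (?t, ?t) \<in> Cut (real n)} = Cut 0"
      using shift2 e by (auto simp: Cut_def inner_add_left)
    have "measure (distr P ?K (\<lambda>\<omega>. (translate S ?t (R \<omega>), translate S ?t (B \<omega>), translate (S \<times> S) (?t, ?t) (M \<omega>)))) ?G
       = measure (distr P ?K (\<lambda>\<omega>. (R \<omega>, B \<omega>, M \<omega>))) ?G"
      using inv T[of n] by (simp add: translation_invariant_def Let_def)
    also have "measure (distr P ?K (\<lambda>\<omega>. (R \<omega>, B \<omega>, M \<omega>))) ?G = prob {\<omega>\<in>space P. emeasure (M \<omega>) (Cut (real n)) \<le> of_nat K}"
      using measurable_space[OF m2] by (subst measure_distr[OF m2 G]) (auto intro!: arg_cong[where f=prob])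
    also have "measure (distr P ?K (\<lambda>\<omega>. (translate S ?t (R \<omega>), translate S ?t (B \<omega>), translate (S \<times> S) (?t, ?t) (M \<omega>)))) ?G
       = prob {\<omega>\<in>space P. emeasure (M \<omega>) (Cut 0) \<le> of_nat K}"
      using measurable_space[OF m1] translate_config(2)[OF shift2 Mc Cut, of _ "real n"] cutn
      by (subst measure_distr[OF m1 G]) (auto intro!: arg_cong[where f=prob])
    finally show ?thesis by simp
  qed
  have "(\<lambda>K. prob {\<omega>\<in>space P. emeasure (M \<omega>) (Cut 0) \<le> of_nat K}) \<longlonglongrightarrow> prob (\<Union>K. {\<omega>\<in>space P. emeasure (M \<omega>) (Cut 0) \<le> of_nat K})"
    by (rule finite_Lim_measure_incseq) (auto simp: incseq_def elim!: order_trans)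
  also have "prob (\<Union>K. {\<omega>\<in>space P. emeasure (M \<omega>) (Cut 0) \<le> of_nat K}) = 1"
  proof (subst prob_eq_1)
    show "AE \<omega> in P. \<omega> \<in> (\<Union>K. {\<omega>\<in>space P. emeasure (M \<omega>) (Cut 0) \<le> of_nat K})"
      using good[of 0] AE_space
    proof eventually_elim
      case (elim \<omega>)
      then obtain r where "emeasure (M \<omega>) (Cut 0) = ennreal r" "0 \<le> r" by (cases "emeasure (M \<omega>) (Cut 0)") auto
      moreover obtain K :: nat where "r \<le> K" using real_arch_simple by blast
      ultimately have "emeasure (M \<omega>) (Cut 0) \<le> of_nat K" by (simp add: ennreal_of_nat_eq_real_of_nat)
      then show ?case using elim by auto
    qed
  qed auto
  finally have "eventually (\<lambda>K. prob {\<omega>\<in>space P. emeasure (M \<omega>) (Cut 0) \<le> of_nat K} > 3/4) sequentially"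
    by (rule order_tendstoD) simp
  then obtain K :: nat where K: "prob {\<omega>\<in>space P. emeasure (M \<omega>) (Cut 0) \<le> of_nat K} > 3/4"
    by (auto simp: eventually_sequentially)
  \<comment> \<open>then \<open>(4 K + 1) * 2 / (L + 1)\<close> is at most \<open>1 / 4\<close>, and \<open>n\<close> is large enough for the bound on the weights\<close>
  define L where "L = 8 * (4 * K + 1)"
  define n where "n = 2 * L\<^sup>2"
  have L0: "L > 0" by (simp add: L_def)
  have "L \<le> L\<^sup>2" by (simp add: power2_eq_square)
  then have "real L \<le> real n" "2 * (real L)\<^sup>2 \<le> real n" "0 < real n" using L0 unfolding n_def of_nat_le_iff by auto
  then have w: "poisson_weight (measure lborel (I n)) k \<le> 2 / (real L + 1)" for k
    unfolding Im by (intro poisson_weight_le)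
  let ?D = "\<lambda>\<omega>. emeasure (R \<omega>) (I n) \<le> emeasure (B \<omega>) (I n) + of_nat (2 * K) \<and> emeasure (B \<omega>) (I n) \<le> emeasure (R \<omega>) (I n) + of_nat (2 * K)"
  have [measurable]: "(\<lambda>\<omega>. emeasure (R \<omega>) (I n)) \<in> borel_measurable P" "(\<lambda>\<omega>. emeasure (B \<omega>) (I n)) \<in> borel_measurable P"
    using poisson_process_emeasure_measurable I R B by blast+
  have "prob {\<omega>\<in>space P. ?D \<omega>} \<le> (2 * (2 * K) + 1) * (2 / (real L + 1))"
    using poisson_difference_concentration[OF RB I If w, of "2 * K"] by (simp add: add.commute)
  also have "(2 * (2 * K) + 1) * (2 / (real L + 1)) \<le> 1/4"
    by (simp add: L_def field_simps)
  finally have up: "prob {\<omega>\<in>space P. ?D \<omega>} \<le> 1/4" .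
  let ?X = "\<lambda>t. {\<omega>\<in>space P. emeasure (M \<omega>) (Cut t) \<le> of_nat K}"
  have "prob (?X 0 \<inter> ?X n) \<le> prob {\<omega>\<in>space P. ?D \<omega>}"
  proof (rule finite_measure_mono_AE)
    show "AE \<omega> in P. \<omega> \<in> ?X 0 \<inter> ?X n \<longrightarrow> \<omega> \<in> {\<omega>\<in>space P. ?D \<omega>}"
      using good[of n]
    proof eventually_elim
      case (elim \<omega>)
      show ?case
      proof
        assume \<omega>: "\<omega> \<in> ?X 0 \<inter> ?X n"
        then have "emeasure (M \<omega>) (Cut 0) + emeasure (M \<omega>) (Cut n) \<le> of_nat K + of_nat K" by (intro add_mono) auto
        then have le: "emeasure (M \<omega>) (Cut 0) + emeasure (M \<omega>) (Cut n) \<le> of_nat (2 * K)"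
          by (simp only: mult_2 of_nat_add)
        show "\<omega> \<in> {\<omega>\<in>space P. ?D \<omega>}"
          using elim \<omega> order_trans[OF _ add_left_mono[OF le]] by blast
      qed
    qed
  qed auto
  moreover have "prob (?X 0) + prob (?X n) \<le> 1 + prob (?X 0 \<inter> ?X n)"
  proof -
    have "prob (?X 0 \<union> ?X n) = prob (?X 0) + prob (?X n) - prob (?X 0 \<inter> ?X n)"
      by (rule measure_Un3) (auto simp: fmeasurable_def emeasure_eq_measure)
    then show ?thesis using prob_le_1[of "?X 0 \<union> ?X n"] by linarith
  qed
  ultimately show False using K law[of n K] up by linarith
qed

lemma no_locally_finite_scheme_line:
  "\<nexists>(P :: 'w measure) (R :: 'w \<Rightarrow> real measure) B M.
    independent_poisson_processes P UNIV R B \<and> matching_scheme P UNIV R B M \<and>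
    translation_invariant P UNIV UNIV R B M \<and> locally_finite_scheme P UNIV M"
proof safe
  fix P :: "'w measure" and R :: "'w \<Rightarrow> real measure" and B M
  assume *: "independent_poisson_processes P UNIV R B" "matching_scheme P UNIV R B M"
    "translation_invariant P UNIV UNIV R B M" "locally_finite_scheme P UNIV M"
  have eq: "UNIV \<inter> {x::real. 0 \<le> x \<bullet> 1 \<and> x \<bullet> 1 < real n} = {0..<real n}" for n by auto
  show False
    by (rule no_locally_finite_scheme_slices[OF *, of 1], unfold eq) auto
qed

lemma no_locally_finite_scheme_strip:
  "\<nexists>(P :: 'w measure) R B M.
    independent_poisson_processes P strip R B \<and> matching_scheme P strip R B M \<and>
    translation_invariant P strip (UNIV \<times> {0}) R B M \<and> locally_finite_scheme P strip M"
proof safe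
  fix P :: "'w measure" and R B M
  assume *: "independent_poisson_processes P strip R B" "matching_scheme P strip R B M"
    "translation_invariant P strip (UNIV \<times> {0}) R B M" "locally_finite_scheme P strip M"
  have eq: "strip \<inter> {x. 0 \<le> x \<bullet> (1, 0) \<and> x \<bullet> (1, 0) < real n} = {0..<real n} \<times> {0..<1}" for n
    by (auto simp: strip_def)
  show False
  proof (rule no_locally_finite_scheme_slices[OF *, of "(1, 0)"])
    show "strip \<in> sets borel" by (simp add: strip_def borel_Times)
    show "convex strip" by (simp add: strip_def convex_Times)
    fix n :: nat
    have "emeasure (lborel :: (real \<times> real) measure) ({0..<real n} \<times> {0..<1}) = emeasure (lborel \<Otimes>\<^sub>M lborel) ({0..<real n} \<times> {0..<1::real})"
      by (simp add: lborel_prod)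
    also have "\<dots> = ennreal (real n)"
      by (subst lborel.emeasure_pair_measure_Times) auto
    finally show "emeasure lborel (strip \<inter> {x. 0 \<le> x \<bullet> (1, 0) \<and> x \<bullet> (1, 0) < real n}) = ennreal (real n)"
      unfolding eq .
    show "bounded (strip \<inter> {x. 0 \<le> x \<bullet> (1, 0) \<and> x \<bullet> (1, 0) < real n})"
      unfolding eq by (intro bounded_Times) auto
    show "(1, 0) \<in> (Basis :: (real \<times> real) set)" by (simp add: Basis_prod_def)
  qed (auto simp: strip_def)
qed

section \<open>Existence of Poisson processes\<close>

subsection \<open>Joint Poisson counts are independent\<close>

text \<open>
  At the rate zero the weights are those of the point mass at zero.
\<close>

lemma poisson_weight_pmf:
  assumes "0 \<le> m"
  obtains q :: "nat pmf" where "pmf q = poisson_weight m"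
proof (cases "m = 0")
  case True
  have "pmf (return_pmf 0) = poisson_weight m"
    by (auto simp: fun_eq_iff poisson_weight_def True power_0_left pmf_return split: split_indicator)
  then show ?thesis using that by blast
next
  case False
  then have "pmf (poisson_pmf m) = poisson_weight m"
    using assms by (auto simp: fun_eq_iff poisson_weight_def pmf_poisson)
  then show ?thesis using that by blast
qed

definition nat_of_ennreal :: "ennreal \<Rightarrow> nat" where
  "nat_of_ennreal x = nat \<lfloor>enn2real x\<rfloor>"

lemma nat_of_ennreal_of_nat [simp]: "nat_of_ennreal (of_nat k) = k"
  by (simp add: nat_of_ennreal_def enn2real_of_nat)

lemma measurable_nat_of_ennreal [measurable]: "nat_of_ennreal \<in> borel \<rightarrow>\<^sub>M count_space UNIV"
  unfolding nat_of_ennreal_def[abs_def] by measurable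

text \<open>
  The values are natural numbers, so the joint law is determined by the probabilities of single
  vectors of values, and these are products.
\<close>

lemma (in prob_space) indep_vars_joint_poisson:
  fixes X :: "nat \<Rightarrow> 'a \<Rightarrow> ennreal"
  assumes X: "\<And>a. a < n \<Longrightarrow> random_variable borel (X a)"
    and fin: "\<And>a. a < n \<Longrightarrow> AE \<omega> in M. \<exists>k::nat. X a \<omega> = of_nat k"
    and m: "\<And>a. a < n \<Longrightarrow> 0 \<le> m a"
    and joint: "\<And>k. prob {\<omega>\<in>space M. \<forall>a<n. X a \<omega> = of_nat (k a)} = (\<Prod>a<n. poisson_weight (m a) (k a))"
  shows "indep_vars (\<lambda>_. borel) X {..<n}"
proof (cases "n = 0")
  case True then show ?thesis by (simp add: indep_vars_def indep_sets_def)
next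
  case False
  define Y where "Y = (\<lambda>a \<omega>. nat_of_ennreal (X a \<omega>))"
  have Y: "random_variable (count_space UNIV) (Y a)" if "a < n" for a
    unfolding Y_def using X[OF that] by measurable
  have XY: "AE \<omega> in M. \<forall>a\<in>{..<n}. X a \<omega> = of_nat (Y a \<omega>)"
  proof (rule AE_finite_allI)
    fix a assume "a \<in> {..<n}"
    then show "AE \<omega> in M. X a \<omega> = of_nat (Y a \<omega>)" using fin[of a] by (auto simp: Y_def elim: eventually_mono)
  qed simp
  have "\<exists>q. \<forall>a<n. pmf (q a) = poisson_weight (m a)"
    using poisson_weight_pmf[OF m] by (intro choice) metis
  then obtain q where q: "\<And>a. a < n \<Longrightarrow> pmf (q a) = poisson_weight (m a)" by blast
  have vm: "(\<lambda>\<omega>. \<lambda>a\<in>{..<n}. Y a \<omega>) \<in> M \<rightarrow>\<^sub>M PiM {..<n} (\<lambda>_. count_space UNIV)"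
    using Y by (intro measurable_restrict) auto
  have cnt: "PiM {..<n} (\<lambda>_. count_space (UNIV::nat set)) = count_space (PiE {..<n} (\<lambda>_. UNIV))"
    by (intro count_space_PiM_finite) auto
  interpret q: product_prob_space "\<lambda>a. measure_pmf (q a)" "{..<n}"
    by (intro product_prob_spaceI measure_pmf.prob_space_axioms)
  have law: "distr M (PiM {..<n} (\<lambda>_. count_space UNIV)) (\<lambda>\<omega>. \<lambda>a\<in>{..<n}. Y a \<omega>) = PiM {..<n} (\<lambda>a. measure_pmf (q a))"
  proof (rule measure_eqI_countable[where A="PiE {..<n} (\<lambda>_. UNIV)"])
    show "sets (distr M (PiM {..<n} (\<lambda>_. count_space UNIV)) (\<lambda>\<omega>. \<lambda>a\<in>{..<n}. Y a \<omega>)) = Pow (PiE {..<n} (\<lambda>_. UNIV))"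
      by (simp add: cnt)
    have "sets (PiM {..<n} (\<lambda>a. measure_pmf (q a))) = sets (PiM {..<n} (\<lambda>_. count_space (UNIV::nat set)))"
      by (intro sets_PiM_cong) auto
    then show "sets (PiM {..<n} (\<lambda>a. measure_pmf (q a))) = Pow (PiE {..<n} (\<lambda>_. UNIV))"
      by (simp add: cnt)
    show "countable (PiE {..<n} (\<lambda>_. UNIV :: nat set))" by (intro countable_PiE) auto
    fix k :: "nat \<Rightarrow> nat" assume k: "k \<in> PiE {..<n} (\<lambda>_. UNIV)"
    have ks: "{k} \<in> sets (PiM {..<n} (\<lambda>_. count_space (UNIV::nat set)))" using k by (simp add: cnt)
    have "emeasure (distr M (PiM {..<n} (\<lambda>_. count_space UNIV)) (\<lambda>\<omega>. \<lambda>a\<in>{..<n}. Y a \<omega>)) {k} =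
      emeasure M ((\<lambda>\<omega>. \<lambda>a\<in>{..<n}. Y a \<omega>) -` {k} \<inter> space M)"
      by (rule emeasure_distr[OF vm ks])
    also have "(\<lambda>\<omega>. \<lambda>a\<in>{..<n}. Y a \<omega>) -` {k} \<inter> space M = {\<omega>\<in>space M. \<forall>a\<in>{..<n}. Y a \<omega> = k a}"
      using k by (auto simp: fun_eq_iff PiE_def extensional_def restrict_def)
    also have "emeasure M \<dots> = emeasure M {\<omega>\<in>space M. \<forall>a\<in>{..<n}. X a \<omega> = of_nat (k a)}"
    proof (rule emeasure_eq_AE)
      show "AE \<omega> in M. \<omega> \<in> {\<omega>\<in>space M. \<forall>a\<in>{..<n}. Y a \<omega> = k a} \<longleftrightarrow> \<omega> \<in> {\<omega>\<in>space M. \<forall>a\<in>{..<n}. X a \<omega> = of_nat (k a)}"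
        using XY by eventually_elim auto
      show "{\<omega>\<in>space M. \<forall>a\<in>{..<n}. Y a \<omega> = k a} \<in> events"
        using Y by (intro sets.sets_Collect_finite_All) auto
      show "{\<omega>\<in>space M. \<forall>a\<in>{..<n}. X a \<omega> = of_nat (k a)} \<in> events"
        using X by (intro sets.sets_Collect_finite_All) auto
    qed
    also have "\<dots> = ennreal (\<Prod>a<n. poisson_weight (m a) (k a))"
      using joint[of k] by (simp add: emeasure_eq_measure Ball_def)
    also have "\<dots> = (\<Prod>a<n. emeasure (measure_pmf (q a)) {k a})"
      using m by (subst prod_ennreal[symmetric]) (auto simp: poisson_weight_nonneg emeasure_pmf_single q intro!: prod.cong)
    also have "\<dots> = emeasure (PiM {..<n} (\<lambda>a. measure_pmf (q a))) (PiE {..<n} (\<lambda>a. {k a}))"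
      by (intro q.emeasure_PiM[symmetric]) auto
    also have "PiE {..<n} (\<lambda>a. {k a}) = {k}"
    proof (intro equalityI subsetI)
      fix x assume "x \<in> PiE {..<n} (\<lambda>a. {k a})"
      then have "x = k" using k by (intro PiE_ext[of x "{..<n}" "\<lambda>a. {k a}"]) (auto simp: PiE_iff)
      then show "x \<in> {k}" by simp
    qed (use k in \<open>auto simp: PiE_iff\<close>)
    finally show "emeasure (distr M (PiM {..<n} (\<lambda>_. count_space UNIV)) (\<lambda>\<omega>. \<lambda>a\<in>{..<n}. Y a \<omega>)) {k} =
      emeasure (PiM {..<n} (\<lambda>a. measure_pmf (q a))) {k}" .
  qed
  have marg: "distr M (count_space UNIV) (Y a) = measure_pmf (q a)" if a: "a < n" for a
  proof -
    have "distr M (count_space UNIV) (Y a) = distr M (count_space UNIV) (\<lambda>\<omega>. (\<lambda>a\<in>{..<n}. Y a \<omega>) a)"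
      using a by (intro distr_cong) auto
    also have "\<dots> = distr (PiM {..<n} (\<lambda>a. measure_pmf (q a))) (count_space UNIV) (\<lambda>f. f a)"
      unfolding law[symmetric] using a vm by (subst distr_distr) (auto simp: o_def)
    also have "\<dots> = distr (PiM {..<n} (\<lambda>a. measure_pmf (q a))) (measure_pmf (q a)) (\<lambda>f. f a)"
      by (intro distr_cong) auto
    also have "\<dots> = measure_pmf (q a)"
      using a by (intro distr_PiM_component measure_pmf.prob_space_axioms) auto
    finally show ?thesis .
  qed
  have ind: "indep_vars (\<lambda>_. count_space UNIV) Y {..<n}"
    using False Y by (subst indep_vars_iff_distr_eq_PiM') (auto simp: law marg intro!: PiM_cong)
  have ind2: "indep_vars (\<lambda>_. borel) (\<lambda>a \<omega>. of_nat (Y a \<omega>) :: ennreal) {..<n}"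
    by (rule indep_vars_compose2[OF ind]) auto
  have Y2: "random_variable borel (\<lambda>\<omega>. of_nat (Y a \<omega>) :: ennreal)" if "a < n" for a
    using Y[OF that] by measurable
  have "distr M (PiM {..<n} (\<lambda>_. borel)) (\<lambda>\<omega>. \<lambda>a\<in>{..<n}. X a \<omega>) =
      distr M (PiM {..<n} (\<lambda>_. borel)) (\<lambda>\<omega>. \<lambda>a\<in>{..<n}. of_nat (Y a \<omega>))"
  proof (rule distr_cong_AE[OF refl refl])
    show "AE \<omega> in M. (\<lambda>a\<in>{..<n}. X a \<omega>) = (\<lambda>a\<in>{..<n}. of_nat (Y a \<omega>))"
      using XY by eventually_elim (auto simp: fun_eq_iff)
  qed (use X Y2 in \<open>auto intro!: measurable_restrict\<close>)
  also have "\<dots> = PiM {..<n} (\<lambda>a. distr M borel (\<lambda>\<omega>. of_nat (Y a \<omega>)))"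
    using False Y2 by (intro indep_vars_iff_distr_eq_PiM'[THEN iffD1, OF _ _ ind2]) auto
  also have "\<dots> = PiM {..<n} (\<lambda>a. distr M borel (X a))"
  proof (intro PiM_cong refl distr_cong_AE)
    fix a assume a: "a \<in> {..<n}"
    show "AE \<omega> in M. of_nat (Y a \<omega>) = X a \<omega>" using XY by eventually_elim (use a in auto)
  qed (use X Y2 in auto)
  finally show ?thesis
    using False X by (subst indep_vars_iff_distr_eq_PiM') auto
qed

subsection \<open>Counting independent points: the multinomial formula and Poissonisation\<close>

definition hits :: "(nat \<Rightarrow> 'b) \<Rightarrow> nat \<Rightarrow> 'b set \<Rightarrow> nat" where
  "hits u m A = card {i. i < m \<and> u i \<in> A}"

lemma hits_Suc: "hits (u(m := y)) (Suc m) A = hits u m A + (if y \<in> A then 1 else 0)"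
proof -
  have "{i. i < Suc m \<and> (u(m := y)) i \<in> A} = {i. i < m \<and> u i \<in> A} \<union> (if y \<in> A then {m} else {})"
    by auto
  then show ?thesis by (auto simp: hits_def)
qed

lemma hits_measurable [measurable]:
  assumes [measurable]: "A \<in> sets \<nu>" and "{..<m} \<subseteq> J"
  shows "(\<lambda>u. hits u m A) \<in> PiM J (\<lambda>_. \<nu>) \<rightarrow>\<^sub>M count_space UNIV"
proof -
  have eq: "hits u m A = (\<Sum>i<m. if u i \<in> A then 1 else 0)" for u
    by (simp add: hits_def sum.If_cases Collect_conj_eq lessThan_def)
  have "(\<lambda>u. u i) \<in> PiM J (\<lambda>_. \<nu>) \<rightarrow>\<^sub>M \<nu>" if "i < m" for i
    using assms(2) that by (intro measurable_component_singleton) auto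
  then show ?thesis unfolding eq by measurable
qed

text \<open>
  Induction on the number of points, conditioning on the cell that contains the last one.
\<close>

lemma multinomial_hits:
  fixes E :: "nat \<Rightarrow> 'b set"
  assumes \<nu>: "prob_space \<nu>" and E: "\<And>a. a < n \<Longrightarrow> E a \<in> sets \<nu>" and disj: "disjoint_family_on E {..<n}"
    and cover: "(\<Union>a<n. E a) = space \<nu>"
  shows "emeasure (PiM {..<m} (\<lambda>_. \<nu>)) {u\<in>space (PiM {..<m} (\<lambda>_. \<nu>)). \<forall>a<n. hits u m (E a) = k a} =
    ennreal (if (\<Sum>a<n. k a) = m then fact m * (\<Prod>a<n. measure \<nu> (E a) ^ k a / fact (k a)) else 0)"
proof (induction m arbitrary: k)
  interpret prob_space \<nu> by fact
  case 0
  interpret p: product_prob_space "\<lambda>_. \<nu>" "{}" by (intro product_prob_spaceI \<nu>)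
  show ?case
  proof (cases "\<forall>a<n. k a = 0")
    case True
    then have "{u\<in>space (PiM {..<0} (\<lambda>_. \<nu>)). \<forall>a<n. hits u 0 (E a) = k a} = {\<lambda>_. undefined}"
      by (auto simp: hits_def space_PiM)
    moreover have "emeasure (PiM {} (\<lambda>_. \<nu>)) {\<lambda>_. undefined} = 1"
      by (simp add: emeasure_PiM_empty)
    ultimately show ?thesis using True by simp
  next
    case False
    then have eq: "{u\<in>space (PiM {..<0} (\<lambda>_. \<nu>)). \<forall>a<n. hits u 0 (E a) = k a} = {}"
      by (auto simp: hits_def)
    have "(\<Sum>a<n. k a) \<noteq> 0" using False by auto
    then show ?thesis unfolding eq by simp
  qed
next
  interpret prob_space \<nu> by fact
  case (Suc m)
  define p where "p = (\<lambda>a. measure \<nu> (E a))"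
  define h where "h = (\<lambda>k. \<Prod>a<n. p a ^ k a / fact (k a))"
  interpret P: product_prob_space "\<lambda>_. \<nu>" "{..<m}" by (intro product_prob_spaceI \<nu>)
  let ?M = "\<lambda>m. PiM {..<m} (\<lambda>_. \<nu>)"
  let ?V = "\<lambda>m k. {u\<in>space (?M m). \<forall>a<n. hits u m (E a) = k a}"
  have V: "?V m' k' \<in> sets (?M m')" for m' k'
  proof -
    have "{u\<in>space (?M m'). \<forall>a\<in>{..<n}. hits u m' (E a) = k' a} \<in> sets (?M m')"
    proof (rule sets.sets_Collect_finite_All)
      fix a assume "a \<in> {..<n}"
      then have [measurable]: "(\<lambda>u. hits u m' (E a)) \<in> ?M m' \<rightarrow>\<^sub>M count_space UNIV"
        using E by (intro hits_measurable) auto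
      show "{u\<in>space (?M m'). hits u m' (E a) = k' a} \<in> sets (?M m')" by measurable
    qed auto
    then show ?thesis unfolding Ball_def lessThan_iff .
  qed
  let ?k = "\<lambda>a. k(a := k a - 1)"
  have point: "indicator (?V (Suc m) k) (u(m := y)) =
      (\<Sum>a\<in>{a. a < n \<and> 0 < k a}. indicator (E a) y * indicator (?V m (?k a)) u :: ennreal)"
    if u: "u \<in> space (?M m)" and y: "y \<in> space \<nu>" for u y
  proof -
    obtain b where b: "b < n" "y \<in> E b" using y cover by auto
    have yE: "y \<in> E a \<longleftrightarrow> a = b" if "a < n" for a
      using disj that b by (auto simp: disjoint_family_on_def)
    have um: "u(m := y) \<in> space (?M (Suc m))"
      using u y by (auto simp: space_PiM PiE_iff extensional_def less_Suc_eq)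
    have "u(m := y) \<in> ?V (Suc m) k \<longleftrightarrow> (0 < k b \<and> u \<in> ?V m (?k b))"
    proof -
      have "u(m := y) \<in> ?V (Suc m) k \<longleftrightarrow> (\<forall>a<n. hits u m (E a) + (if a = b then 1 else 0) = k a)"
        using um yE by (auto simp: hits_Suc)
      also have "\<dots> \<longleftrightarrow> (0 < k b \<and> (\<forall>a<n. hits u m (E a) = ?k b a))"
        using b(1) by (auto split: if_splits)
      finally show ?thesis using u by simp
    qed
    moreover have "(\<Sum>a\<in>{a. a < n \<and> 0 < k a}. indicator (E a) y * indicator (?V m (?k a)) u :: ennreal) =
      (\<Sum>a\<in>{a. a < n \<and> 0 < k a}. if a = b then indicator (?V m (?k b)) u else 0)"
      using yE by (intro sum.cong) (auto simp: indicator_def)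
    moreover have "\<dots> = (if b \<in> {a. a < n \<and> 0 < k a} then indicator (?V m (?k b)) u else 0)"
      by (rule sum.delta) simp
    ultimately show ?thesis using b(1) by (auto simp: indicator_def)
  qed
  have ins: "{..<Suc m} = insert m {..<m}" by auto
  have "emeasure (?M (Suc m)) (?V (Suc m) k) = (\<integral>\<^sup>+ u. indicator (?V (Suc m) k) u \<partial>?M (Suc m))"
    using V by (simp only: nn_integral_indicator)
  also have "\<dots> = (\<integral>\<^sup>+ u. \<integral>\<^sup>+ y. indicator (?V (Suc m) k) (u(m := y)) \<partial>\<nu> \<partial>?M m)"
  proof -
    have im: "(indicator (?V (Suc m) k) :: _ \<Rightarrow> ennreal) \<in> borel_measurable (PiM (insert m {..<m}) (\<lambda>_. \<nu>))"
      using V[of "Suc m" k] unfolding ins by (rule borel_measurable_indicator)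
    show ?thesis unfolding ins by (rule P.product_nn_integral_insert[OF finite_lessThan _ im[unfolded ins]]) simp
  qed
  also have "\<dots> = (\<integral>\<^sup>+ u. \<integral>\<^sup>+ y. (\<Sum>a\<in>{a. a < n \<and> 0 < k a}. indicator (E a) y * indicator (?V m (?k a)) u) \<partial>\<nu> \<partial>?M m)"
    by (intro nn_integral_cong point) auto
  also have "\<dots> = (\<integral>\<^sup>+ u. (\<Sum>a\<in>{a. a < n \<and> 0 < k a}. emeasure \<nu> (E a) * indicator (?V m (?k a)) u) \<partial>?M m)"
    using E by (intro nn_integral_cong) (subst nn_integral_sum, auto simp: nn_integral_multc)
  also have "\<dots> = (\<Sum>a\<in>{a. a < n \<and> 0 < k a}. emeasure \<nu> (E a) * emeasure (?M m) (?V m (?k a)))"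
    by (subst nn_integral_sum)
      (intro borel_measurable_times_ennreal borel_measurable_const borel_measurable_indicator V,
       intro sum.cong refl nn_integral_cmult_indicator V)
  also have "\<dots> = (\<Sum>a\<in>{a. a < n \<and> 0 < k a}. ennreal (if (\<Sum>a<n. k a) = Suc m then fact m * h k * k a else 0))"
  proof (rule sum.cong[OF refl])
    fix a assume a: "a \<in> {a. a < n \<and> 0 < k a}"
    have s: "(\<Sum>b<n. ?k a b) + 1 = (\<Sum>b<n. k b)"
      using a by (subst (1 2) sum.remove[of _ a]) auto
    have "p a * h (?k a) = p a * (p a ^ (k a - 1) / fact (k a - 1)) * (\<Prod>b\<in>{..<n} - {a}. p b ^ k b / fact (k b))"
      unfolding h_def using a by (subst prod.remove[of _ a]) auto
    also have "p a * (p a ^ (k a - 1) / fact (k a - 1)) = (p a ^ k a / fact (k a)) * k a"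
      using a by (cases "k a") (auto simp: field_simps simp del: of_nat_Suc)
    also have "\<dots> * (\<Prod>b\<in>{..<n} - {a}. p b ^ k b / fact (k b)) = h k * k a"
      unfolding h_def using a by (subst (2) prod.remove[of _ a]) auto
    finally have hk: "p a * h (?k a) = h k * k a" .
    define T where "T = (\<Sum>b<n. ?k a b)"
    have V1: "emeasure (?M m) (?V m (?k a)) = ennreal (if T = m then fact m * h (?k a) else 0)"
      using Suc.IH[of "?k a"] unfolding h_def p_def T_def by simp
    have "emeasure \<nu> (E a) * emeasure (?M m) (?V m (?k a)) = ennreal (p a * (if T = m then fact m * h (?k a) else 0))"
      unfolding V1
      by (subst ennreal_mult) (auto simp: p_def emeasure_eq_measure h_def intro!: mult_nonneg_nonneg prod_nonneg)
    moreover have "p a * (if T = m then fact m * h (?k a) else 0) = (if (\<Sum>a<n. k a) = Suc m then fact m * h k * k a else 0)"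
    proof (cases "T = m")
      case True
      have "p a * (fact m * h (?k a)) = fact m * h k * k a"
        unfolding mult.left_commute[of "p a"] hk by (rule mult.assoc[symmetric])
      then show ?thesis using True s[folded T_def] by simp
    qed (use s[folded T_def] in simp)
    ultimately show "emeasure \<nu> (E a) * emeasure (?M m) (?V m (?k a)) = ennreal (if (\<Sum>a<n. k a) = Suc m then fact m * h k * k a else 0)"
      by (rule trans[OF _ arg_cong[where f=ennreal]])
  qed
  also have "\<dots> = ennreal (\<Sum>a\<in>{a. a < n \<and> 0 < k a}. if (\<Sum>a<n. k a) = Suc m then fact m * h k * k a else 0)"
    by (intro sum_ennreal) (auto simp: h_def p_def intro!: mult_nonneg_nonneg prod_nonneg)
  also have "(\<Sum>a\<in>{a. a < n \<and> 0 < k a}. if (\<Sum>a<n. k a) = Suc m then fact m * h k * k a else 0) =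
     (if (\<Sum>a<n. k a) = Suc m then fact (Suc m) * h k else 0)"
  proof (cases "(\<Sum>a<n. k a) = Suc m")
    case True
    have "(\<Sum>a\<in>{a. a < n \<and> 0 < k a}. fact m * h k * k a) = fact m * h k * (\<Sum>a\<in>{a. a < n \<and> 0 < k a}. real (k a))"
      by (simp add: sum_distrib_left)
    also have "(\<Sum>a\<in>{a. a < n \<and> 0 < k a}. real (k a)) = (\<Sum>a<n. real (k a))"
      by (rule sum.mono_neutral_left) auto
    also have "\<dots> = Suc m" using True by (simp only: of_nat_sum[symmetric])
    finally show ?thesis using True by simp
  qed simp
  finally show ?case unfolding h_def p_def .
qed

lemma restrict_lessThan_PiM:
  assumes "prob_space \<nu>"
  shows "distr (PiM UNIV (\<lambda>_::nat. \<nu>)) (PiM {..<m} (\<lambda>_. \<nu>)) (\<lambda>x. restrict x {..<m}) = PiM {..<m} (\<lambda>_. \<nu>)"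
proof -
  interpret product_prob_space "\<lambda>_::nat. \<nu>" UNIV by (intro product_prob_spaceI assms)
  show ?thesis by (rule distr_PiM_restrict_finite) auto
qed

text \<open>
  The hits of all cells add up to the number of points; so only one number of points contributes,
  and its Poisson weight turns the multinomial probability into a product.
\<close>

lemma poisson_hits:
  fixes E :: "nat \<Rightarrow> 'b set"
  assumes \<nu>: "prob_space \<nu>" and c: "0 < c"
    and E: "\<And>a. a < n \<Longrightarrow> E a \<in> sets \<nu>" and disj: "disjoint_family_on E {..<n}"
    and cover: "(\<Union>a<n. E a) = space \<nu>"
  shows "emeasure (measure_pmf (poisson_pmf c) \<Otimes>\<^sub>M PiM UNIV (\<lambda>_::nat. \<nu>))
      {q\<in>space (measure_pmf (poisson_pmf c) \<Otimes>\<^sub>M PiM UNIV (\<lambda>_::nat. \<nu>)). \<forall>a<n. hits (snd q) (fst q) (E a) = k a} =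
    ennreal (\<Prod>a<n. poisson_weight (c * measure \<nu> (E a)) (k a))"
proof -
  interpret prob_space \<nu> by fact
  interpret U: prob_space "PiM UNIV (\<lambda>_::nat. \<nu>)" by (intro prob_space_PiM \<nu>)
  define m where "m = (\<Sum>a<n. k a)"
  define p where "p = (\<lambda>a. measure \<nu> (E a))"
  have sp: "(\<Sum>a<n. p a) = 1"
  proof -
    have "(\<Sum>a<n. p a) = prob (\<Union>a<n. E a)"
      unfolding p_def using E disj by (intro finite_measure_finite_Union[symmetric]) auto
    then show ?thesis by (simp add: cover prob_space)
  qed
  have tot: "(\<Sum>a<n. hits u N (E a)) = N" if "\<And>i. i < N \<Longrightarrow> u i \<in> space \<nu>" for u N
  proof -
    have "(\<Sum>a<n. hits u N (E a)) = card (\<Union>a<n. {i. i < N \<and> u i \<in> E a})"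
      unfolding hits_def using disj by (intro card_UN_disjoint[symmetric]) (auto simp: disjoint_family_on_def)
    also have "(\<Union>a<n. {i. i < N \<and> u i \<in> E a}) = {..<N}" using that cover by blast
    finally show ?thesis by simp
  qed
  let ?W = "{u\<in>space (PiM UNIV (\<lambda>_::nat. \<nu>)). \<forall>a<n. hits u m (E a) = k a}"
  let ?W' = "{u\<in>space (PiM {..<m} (\<lambda>_. \<nu>)). \<forall>a<n. hits u m (E a) = k a}"
  have set_meas: "{u\<in>space (PiM J (\<lambda>_. \<nu>)). \<forall>a<n. hits u m (E a) = k a} \<in> sets (PiM J (\<lambda>_. \<nu>))"
    if J: "{..<m} \<subseteq> J" for J
  proof -
    have "{u\<in>space (PiM J (\<lambda>_. \<nu>)). \<forall>a\<in>{..<n}. hits u m (E a) = k a} \<in> sets (PiM J (\<lambda>_. \<nu>))"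
    proof (rule sets.sets_Collect_finite_All)
      fix a assume "a \<in> {..<n}"
      then have [measurable]: "(\<lambda>u. hits u m (E a)) \<in> PiM J (\<lambda>_. \<nu>) \<rightarrow>\<^sub>M count_space UNIV"
        using E J by (intro hits_measurable) auto
      show "{u\<in>space (PiM J (\<lambda>_. \<nu>)). hits u m (E a) = k a} \<in> sets (PiM J (\<lambda>_. \<nu>))" by measurable
    qed auto
    then show ?thesis unfolding Ball_def lessThan_iff .
  qed
  have W: "?W \<in> sets (PiM UNIV (\<lambda>_::nat. \<nu>))" and W': "?W' \<in> sets (PiM {..<m} (\<lambda>_. \<nu>))"
    by (intro set_meas; simp)+
  have eq: "{q\<in>space (measure_pmf (poisson_pmf c) \<Otimes>\<^sub>M PiM UNIV (\<lambda>_::nat. \<nu>)). \<forall>a<n. hits (snd q) (fst q) (E a) = k a} = {m} \<times> ?W"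
  proof -
    have N: "N = m" if "u \<in> space (PiM UNIV (\<lambda>_::nat. \<nu>))" "\<forall>a<n. hits u N (E a) = k a" for N u
      using tot[of N u] that unfolding m_def by (auto simp: space_PiM PiE_iff)
    show ?thesis
    proof (rule set_eqI)
      fix q :: "nat \<times> (nat \<Rightarrow> 'b)"
      obtain N u where q: "q = (N, u)" by (cases q)
      show "q \<in> {q\<in>space (measure_pmf (poisson_pmf c) \<Otimes>\<^sub>M PiM UNIV (\<lambda>_::nat. \<nu>)). \<forall>a<n. hits (snd q) (fst q) (E a) = k a} \<longleftrightarrow> q \<in> {m} \<times> ?W"
        unfolding q mem_Collect_eq space_pair_measure mem_Times_iff fst_conv snd_conv using N[of u N] by auto
    qed
  qed
  have "emeasure (measure_pmf (poisson_pmf c) \<Otimes>\<^sub>M PiM UNIV (\<lambda>_::nat. \<nu>))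
      {q\<in>space (measure_pmf (poisson_pmf c) \<Otimes>\<^sub>M PiM UNIV (\<lambda>_::nat. \<nu>)). \<forall>a<n. hits (snd q) (fst q) (E a) = k a}
    = emeasure (measure_pmf (poisson_pmf c)) {m} * emeasure (PiM UNIV (\<lambda>_::nat. \<nu>)) ?W"
    unfolding eq by (rule U.emeasure_pair_measure_Times[OF _ W]) simp
  also have "emeasure (measure_pmf (poisson_pmf c)) {m} = ennreal (poisson_weight c m)"
    using c by (simp add: emeasure_pmf_single poisson_weight_def)
  also have "emeasure (PiM UNIV (\<lambda>_::nat. \<nu>)) ?W = emeasure (distr (PiM UNIV (\<lambda>_::nat. \<nu>)) (PiM {..<m} (\<lambda>_. \<nu>)) (\<lambda>x. restrict x {..<m})) ?W'"
  proof (subst emeasure_distr[OF _ W'])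
    have "hits (restrict u {..<m}) m A = hits u m A" for u :: "nat \<Rightarrow> 'b" and A
      unfolding hits_def by (intro arg_cong[where f=card]) auto
    then show "emeasure (PiM UNIV (\<lambda>_::nat. \<nu>)) ?W = emeasure (PiM UNIV (\<lambda>_::nat. \<nu>)) ((\<lambda>x. restrict x {..<m}) -` ?W' \<inter> space (PiM UNIV (\<lambda>_::nat. \<nu>)))"
      by (intro arg_cong[where f="emeasure _"]) (auto simp: space_PiM)
    show "(\<lambda>x. restrict x {..<m}) \<in> PiM UNIV (\<lambda>_::nat. \<nu>) \<rightarrow>\<^sub>M PiM {..<m} (\<lambda>_. \<nu>)"
      by (rule measurable_restrict_subset) auto
  qed
  also have "\<dots> = ennreal (fact m * (\<Prod>a<n. p a ^ k a / fact (k a)))"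
    unfolding restrict_lessThan_PiM[OF \<nu>] using multinomial_hits[OF \<nu> E disj cover, where m=m and k=k]
    by (simp add: m_def p_def)
  also have "ennreal (poisson_weight c m) * \<dots> = ennreal (poisson_weight c m * (fact m * (\<Prod>a<n. p a ^ k a / fact (k a))))"
    using c by (intro ennreal_mult[symmetric] poisson_weight_nonneg) (auto simp: p_def intro!: prod_nonneg mult_nonneg_nonneg)
  also have "poisson_weight c m * (fact m * (\<Prod>a<n. p a ^ k a / fact (k a))) =
      (c ^ m * (\<Prod>a<n. p a ^ k a / fact (k a))) * exp (- c)"
    by (simp add: poisson_weight_def)
  also have "c ^ m * (\<Prod>a<n. p a ^ k a / fact (k a)) = (\<Prod>a<n. (c * p a) ^ k a / fact (k a))"
    by (simp add: m_def power_sum prod.distrib[symmetric] power_mult_distrib)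
  also have "exp (- c) = (\<Prod>a<n. exp (- (c * p a)))"
    by (simp add: exp_sum[symmetric] sum_negf sum_distrib_left[symmetric] sp)
  also have "(\<Prod>a<n. (c * p a) ^ k a / fact (k a)) * (\<Prod>a<n. exp (- (c * p a))) =
      (\<Prod>a<n. poisson_weight (c * measure \<nu> (E a)) (k a))"
    unfolding poisson_weight_def p_def by (rule prod.distrib[symmetric])
  finally show ?thesis .
qed

lemma hits_measurable_pair:
  assumes A: "A \<in> sets \<nu>"
  shows "(\<lambda>q. hits (snd q) (fst q) A) \<in> measure_pmf p \<Otimes>\<^sub>M PiM UNIV (\<lambda>_::nat. \<nu>) \<rightarrow>\<^sub>M count_space UNIV"
proof (rule measurable_compose_countable[where f="\<lambda>m q. hits (snd q) m A" and g=fst])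
  fix m
  show "(\<lambda>q. hits (snd q) m A) \<in> measure_pmf p \<Otimes>\<^sub>M PiM UNIV (\<lambda>_::nat. \<nu>) \<rightarrow>\<^sub>M count_space UNIV"
    by (rule measurable_compose[OF measurable_snd hits_measurable[OF A]]) simp
  show "fst \<in> measure_pmf p \<Otimes>\<^sub>M PiM UNIV (\<lambda>_::nat. \<nu>) \<rightarrow>\<^sub>M count_space UNIV"
    by (rule measurable_compose[OF measurable_fst]) simp
qed

lemma sets_joint_counts:
  fixes n :: nat
  assumes "\<And>a. a < n \<Longrightarrow> f a \<in> M \<rightarrow>\<^sub>M count_space (UNIV :: 'b::countable set)"
  shows "{q\<in>space M. \<forall>a<n. f a q = k a} \<in> sets M"
proof -
  have "{q\<in>space M. \<forall>a\<in>{..<n}. f a q = k a} \<in> sets M"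
  proof (rule sets.sets_Collect_finite_All)
    fix a assume "a \<in> {..<n}"
    then have "f a -` {k a} \<inter> space M \<in> sets M" using assms by (intro measurable_sets) auto
    moreover have "f a -` {k a} \<inter> space M = {q\<in>space M. f a q = k a}" by auto
    ultimately show "{q\<in>space M. f a q = k a} \<in> sets M" by simp
  qed simp
  then show ?thesis unfolding Ball_def lessThan_iff .
qed

text \<open>
  Add the complement of the cells as one more cell and sum over its number of hits.
\<close>

lemma poisson_hits_disjoint:
  fixes E :: "nat \<Rightarrow> 'b set"
  assumes \<nu>: "prob_space \<nu>" and c: "0 < c"
    and E: "\<And>a. a < n \<Longrightarrow> E a \<in> sets \<nu>" and disj: "disjoint_family_on E {..<n}"
  shows "emeasure (measure_pmf (poisson_pmf c) \<Otimes>\<^sub>M PiM UNIV (\<lambda>_::nat. \<nu>))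
      {q\<in>space (measure_pmf (poisson_pmf c) \<Otimes>\<^sub>M PiM UNIV (\<lambda>_::nat. \<nu>)). \<forall>a<n. hits (snd q) (fst q) (E a) = k a} =
    ennreal (\<Prod>a<n. poisson_weight (c * measure \<nu> (E a)) (k a))"
proof -
  let ?Q = "measure_pmf (poisson_pmf c) \<Otimes>\<^sub>M PiM UNIV (\<lambda>_::nat. \<nu>)"
  define F where "F = (\<lambda>a. if a < n then E a else space \<nu> - (\<Union>a<n. E a))"
  have F: "F a \<in> sets \<nu>" for a using E by (auto simp: F_def)
  have Fd: "disjoint_family_on F {..<Suc n}"
    using disj by (auto simp: disjoint_family_on_def F_def less_Suc_eq)
  have Fc: "(\<Union>a<Suc n. F a) = space \<nu>"
  proof -
    have FU: "(\<Union>a<n. F a) = (\<Union>a<n. E a)" by (intro SUP_cong refl) (simp add: F_def)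
    have Fn: "F n = space \<nu> - (\<Union>a<n. E a)" by (simp add: F_def)
    have sub: "(\<Union>a<n. E a) \<subseteq> space \<nu>" using sets.sets_into_space[OF E] by blast
    show ?thesis unfolding lessThan_Suc UN_insert Fn FU using sub by blast
  qed
  let ?A = "\<lambda>l. {q\<in>space ?Q. \<forall>a<Suc n. hits (snd q) (fst q) (F a) = (k(n := l)) a}"
  have A: "?A l \<in> sets ?Q" for l
    by (intro sets_joint_counts hits_measurable_pair F)
  have "{q\<in>space ?Q. \<forall>a<n. hits (snd q) (fst q) (E a) = k a} = (\<Union>l. ?A l)"
    by (auto simp: F_def less_Suc_eq)
  also have "emeasure ?Q \<dots> = (\<Sum>l. emeasure ?Q (?A l))"
  proof (rule suminf_emeasure[symmetric])
    show "disjoint_family ?A" unfolding disjoint_family_on_def by (auto simp: less_Suc_eq)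
    show "range ?A \<subseteq> sets ?Q" using A by (rule image_subsetI)
  qed
  also have "\<dots> = (\<Sum>l. ennreal ((\<Prod>a<n. poisson_weight (c * measure \<nu> (E a)) (k a)) * poisson_weight (c * measure \<nu> (F n)) l))"
  proof (rule suminf_cong)
    fix l
    have "emeasure ?Q (?A l) = ennreal (\<Prod>a<Suc n. poisson_weight (c * measure \<nu> (F a)) ((k(n := l)) a))"
      by (rule poisson_hits[OF \<nu> c F Fd Fc])
    also have "(\<Prod>a<Suc n. poisson_weight (c * measure \<nu> (F a)) ((k(n := l)) a)) =
      (\<Prod>a<n. poisson_weight (c * measure \<nu> (E a)) (k a)) * poisson_weight (c * measure \<nu> (F n)) l"
      unfolding prod.lessThan_Suc by (intro arg_cong2[where f="(*)"] prod.cong) (auto simp: F_def)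
    finally show "emeasure ?Q (?A l) = ennreal ((\<Prod>a<n. poisson_weight (c * measure \<nu> (E a)) (k a)) * poisson_weight (c * measure \<nu> (F n)) l)" .
  qed
  also have "\<dots> = ennreal ((\<Prod>a<n. poisson_weight (c * measure \<nu> (E a)) (k a)) * 1)"
    using c by (intro suminf_ennreal_eq sums_mult poisson_weight_sums)
      (auto intro!: mult_nonneg_nonneg prod_nonneg poisson_weight_nonneg)
  finally show ?thesis by simp
qed

subsection \<open>Superposition\<close>

lemma poisson_weight_convolution:
  "(\<Sum>l\<le>k. poisson_weight m l * poisson_weight m' (k - l)) = poisson_weight (m + m') k"
proof -
  have "(\<Sum>l\<le>k. poisson_weight m l * poisson_weight m' (k - l)) =
      (\<Sum>l\<le>k. of_nat (k choose l) * m ^ l * m' ^ (k - l) * (exp (- (m + m')) / fact k))"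
    by (intro sum.cong refl) (simp add: poisson_weight_def binomial_fact exp_add[symmetric] exp_diff exp_minus field_simps)
  also have "\<dots> = (m + m') ^ k * (exp (- (m + m')) / fact k)"
    by (subst binomial_ring) (simp only: sum_distrib_right)
  finally show ?thesis by (simp add: poisson_weight_def)
qed

lemma PiM_sum_poisson:
  fixes Q :: "nat \<Rightarrow> 'q measure" and x :: "nat \<Rightarrow> nat \<Rightarrow> 'q \<Rightarrow> nat"
  assumes Q: "\<And>j. prob_space (Q j)" and x: "\<And>j a. a < n \<Longrightarrow> x j a \<in> Q j \<rightarrow>\<^sub>M count_space UNIV"
    and \<mu>: "\<And>j a. a < n \<Longrightarrow> 0 \<le> \<mu> j a"
    and joint: "\<And>j k. emeasure (Q j) {q\<in>space (Q j). \<forall>a<n. x j a q = k a} = ennreal (\<Prod>a<n. poisson_weight (\<mu> j a) (k a))"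
  shows "emeasure (PiM {..<J} Q) {u\<in>space (PiM {..<J} Q). \<forall>a<n. (\<Sum>j<J. x j a (u j)) = k a} =
    ennreal (\<Prod>a<n. poisson_weight (\<Sum>j<J. \<mu> j a) (k a))"
proof (induction J arbitrary: k)
  case 0
  show ?case
  proof (cases "\<forall>a<n. k a = 0")
    case True
    then have eq: "{u\<in>space (PiM {..<0} Q). \<forall>a<n. (\<Sum>j<0. x j a (u j)) = k a} = {\<lambda>_. undefined}"
      by (auto simp: space_PiM)
    have "emeasure (PiM {} Q) {\<lambda>_. undefined} = 1" by (simp add: emeasure_PiM_empty)
    moreover have "(\<Prod>a<n. poisson_weight (\<Sum>j<0. \<mu> j a) (k a)) = 1"
      using True by (intro prod.neutral) (auto simp: poisson_weight_def)
    ultimately show ?thesis unfolding eq by simp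
  next
    case False
    then have eq: "{u\<in>space (PiM {..<0} Q). \<forall>a<n. (\<Sum>j<0. x j a (u j)) = k a} = {}" by auto
    have zero: "(\<Prod>a<n. poisson_weight (\<Sum>j<0. \<mu> j a) (k a)) = 0"
      using False by (intro prod_zero) (auto simp: poisson_weight_def)
    show ?thesis unfolding eq zero by simp
  qed
next
  case (Suc J)
  interpret P: product_prob_space Q "{..<J}" by (intro product_prob_spaceI Q)
  have xm: "(\<lambda>u. \<Sum>j<J'. x j a (u j)) \<in> PiM {..<J'} Q \<rightarrow>\<^sub>M count_space UNIV" if "a < n" for a J'
  proof (rule measurable_sum_nat)
    fix j assume j: "j \<in> {..<J'}"
    show "(\<lambda>u. x j a (u j)) \<in> PiM {..<J'} Q \<rightarrow>\<^sub>M count_space UNIV"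
      by (rule measurable_compose[OF measurable_component_singleton[OF j] x[OF that]])
  qed
  let ?S = "\<lambda>J k. {u\<in>space (PiM {..<J} Q). \<forall>a<n. (\<Sum>j<J. x j a (u j)) = k a}"
  have S: "?S J' k' \<in> sets (PiM {..<J'} Q)" for J' k' by (intro sets_joint_counts xm)
  let ?L = "PiE {..<n} (\<lambda>a. {..k a})"
  let ?Y = "\<lambda>l. {q\<in>space (Q J). \<forall>a<n. x J a q = k a - l a}"
  have Y: "?Y l \<in> sets (Q J)" for l by (intro sets_joint_counts x)
  have finL: "finite ?L" by (intro finite_PiE) auto
  have point: "indicator (?S (Suc J) k) (u(J := y)) = (\<Sum>l\<in>?L. indicator (?S J l) u * indicator (?Y l) y :: ennreal)"
    if u: "u \<in> space (PiM {..<J} Q)" and y: "y \<in> space (Q J)" for u y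
  proof -
    define s where "s = (\<lambda>a\<in>{..<n}. \<Sum>j<J. x j a (u j))"
    have mem: "u(J := y) \<in> space (PiM {..<Suc J} Q)"
      using u y by (auto simp: space_PiM PiE_iff extensional_def less_Suc_eq)
    have "(\<Sum>j<J. x j a ((u(J := y)) j)) = (\<Sum>j<J. x j a (u j))" for a by (intro sum.cong) auto
    then have L: "u(J := y) \<in> ?S (Suc J) k \<longleftrightarrow> (\<forall>a<n. s a + x J a y = k a)"
      using mem by (auto simp: s_def)
    have eqs: "l = s" if "l \<in> ?L" "u \<in> ?S J l" for l
    proof (rule PiE_ext[of l "{..<n}" "\<lambda>_. UNIV" s])
      show "s \<in> PiE {..<n} (\<lambda>_. UNIV)" by (auto simp: s_def)
    qed (use that in \<open>auto simp: s_def\<close>)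
    have "(\<Sum>l\<in>?L. indicator (?S J l) u * indicator (?Y l) y :: ennreal) =
        (\<Sum>l\<in>?L. if l = s then indicator (?S J s) u * indicator (?Y s) y else 0)"
      by (rule sum.cong[OF refl]) (use eqs in \<open>auto simp: indicator_def\<close>)
    also have "\<dots> = (if s \<in> ?L then indicator (?S J s) u * indicator (?Y s) y else 0)"
      using finL by (subst sum.delta) auto
    also have "\<dots> = (if \<forall>a<n. s a + x J a y = k a then 1 else 0)"
    proof -
      have "u \<in> ?S J s" using u by (auto simp: s_def)
      moreover have "(s \<in> ?L \<and> y \<in> ?Y s) \<longleftrightarrow> (\<forall>a<n. s a + x J a y = k a)"
      proof
        assume *: "\<forall>a<n. s a + x J a y = k a"
        then have "s a \<le> k a" "x J a y = k a - s a" if "a < n" for a using that by (metis le_add1, metis diff_add_inverse)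
        then show "s \<in> ?L \<and> y \<in> ?Y s" using y by (auto simp: PiE_iff s_def)
      qed (auto simp: PiE_iff)
      ultimately show ?thesis by (auto simp: indicator_def)
    qed
    finally show ?thesis unfolding indicator_def L by simp
  qed
  have ins: "{..<Suc J} = insert J {..<J}" by auto
  have "emeasure (PiM {..<Suc J} Q) (?S (Suc J) k) = (\<integral>\<^sup>+ u. indicator (?S (Suc J) k) u \<partial>PiM {..<Suc J} Q)"
    by (rule nn_integral_indicator[OF S, symmetric])
  also have "\<dots> = (\<integral>\<^sup>+ u. \<integral>\<^sup>+ y. indicator (?S (Suc J) k) (u(J := y)) \<partial>Q J \<partial>PiM {..<J} Q)"
  proof -
    have im: "(indicator (?S (Suc J) k) :: _ \<Rightarrow> ennreal) \<in> borel_measurable (PiM {..<Suc J} Q)"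
      by (rule borel_measurable_indicator[OF S])
    show ?thesis unfolding ins by (rule P.product_nn_integral_insert[OF finite_lessThan _ im[unfolded ins]]) simp
  qed
  also have "\<dots> = (\<integral>\<^sup>+ u. \<integral>\<^sup>+ y. (\<Sum>l\<in>?L. indicator (?S J l) u * indicator (?Y l) y) \<partial>Q J \<partial>PiM {..<J} Q)"
    by (intro nn_integral_cong point) auto
  also have "\<dots> = (\<integral>\<^sup>+ u. (\<Sum>l\<in>?L. indicator (?S J l) u * emeasure (Q J) (?Y l)) \<partial>PiM {..<J} Q)"
    by (intro nn_integral_cong, subst nn_integral_sum)
      (intro borel_measurable_times_ennreal borel_measurable_const borel_measurable_indicator Y,
       intro sum.cong refl nn_integral_cmult_indicator Y)
  also have "\<dots> = (\<Sum>l\<in>?L. emeasure (PiM {..<J} Q) (?S J l) * emeasure (Q J) (?Y l))"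
    by (subst nn_integral_sum)
      (intro borel_measurable_times_ennreal borel_measurable_const borel_measurable_indicator S,
       simp only: mult.commute[of "indicator _ _"] mult.commute[of "emeasure (PiM _ _) _"],
       intro sum.cong refl nn_integral_cmult_indicator S)
  also have "\<dots> = (\<Sum>l\<in>?L. ennreal (\<Prod>a<n. poisson_weight (\<Sum>j<J. \<mu> j a) (l a) * poisson_weight (\<mu> J a) (k a - l a)))"
    unfolding Suc.IH joint prod.distrib using \<mu>
    by (intro sum.cong refl ennreal_mult[symmetric] prod_nonneg poisson_weight_nonneg sum_nonneg) auto
  also have "\<dots> = ennreal (\<Sum>l\<in>?L. \<Prod>a<n. poisson_weight (\<Sum>j<J. \<mu> j a) (l a) * poisson_weight (\<mu> J a) (k a - l a))"
    using \<mu> by (intro sum_ennreal prod_nonneg mult_nonneg_nonneg poisson_weight_nonneg sum_nonneg) auto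
  also have "(\<Sum>l\<in>?L. \<Prod>a<n. poisson_weight (\<Sum>j<J. \<mu> j a) (l a) * poisson_weight (\<mu> J a) (k a - l a)) =
      (\<Prod>a<n. \<Sum>l\<le>k a. poisson_weight (\<Sum>j<J. \<mu> j a) l * poisson_weight (\<mu> J a) (k a - l))"
    by (subst prod_sum_PiE) auto
  finally show ?case by (simp add: poisson_weight_convolution)
qed

subsection \<open>The Poisson process on a Euclidean space\<close>

text \<open>
  Put independent finite Poisson processes on annuli: the number of points is Poisson distributed,
  and the points are independent and uniform.  A sample provides infinitely many uniform points in
  every annulus, of which only the first ones are used.
\<close>

definition annulus :: "nat \<Rightarrow> 'a::euclidean_space set" where
  "annulus j = ball 0 (real (Suc j)) - ball 0 (real j)"

definition annulus_law :: "nat \<Rightarrow> (nat \<times> (nat \<Rightarrow> 'a::euclidean_space)) measure" where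
  "annulus_law j = measure_pmf (poisson_pmf (measure lborel (annulus j :: 'a set))) \<Otimes>\<^sub>M
     PiM UNIV (\<lambda>_. uniform_measure lborel (annulus j))"

definition annuli_points :: "(nat \<Rightarrow> nat \<times> (nat \<Rightarrow> 'a::euclidean_space)) \<Rightarrow> 'a measure" where
  "annuli_points \<omega> = distr (count_space {(j, i). i < fst (\<omega> j) \<and> snd (\<omega> j) i \<in> annulus j}) borel
     (\<lambda>(j, i). snd (\<omega> j) i)"

lemma annulus_borel [measurable]: "annulus j \<in> sets borel"
  by (simp add: annulus_def)

lemma annulus_finite: "emeasure lborel (annulus j) < \<infinity>"
  using emeasure_bounded_finite[of "annulus j"] bounded_subset[OF bounded_ball, of "annulus j" 0 "real (Suc j)"]
  by (auto simp: annulus_def)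

lemma annulus_pos: "0 < measure lborel (annulus j :: 'a::euclidean_space set)"
proof -
  have sub: "ball 0 (real j) \<subseteq> (ball 0 (real (Suc j)) :: 'a set)" by (rule subset_ball) simp
  have "measure lborel (annulus j :: 'a set) = measure lborel (ball 0 (real (Suc j)) :: 'a set) - measure lborel (ball 0 (real j) :: 'a set)"
    unfolding annulus_def using sub
    using emeasure_bounded_finite[OF bounded_ball[of "0::'a" "real (Suc j)"]]
    by (intro measure_Diff) (simp_all add: less_top del: of_nat_Suc)
  also have "\<dots> = unit_ball_vol DIM('a) * (real (Suc j) ^ DIM('a) - real j ^ DIM('a))"
    by (simp add: content_ball algebra_simps del: of_nat_Suc)
  also have "\<dots> > 0"
    by (intro mult_pos_pos) (auto intro!: power_strict_mono)
  finally show ?thesis .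
qed

lemma disjoint_annuli: "disjoint_family annulus"
proof -
  have "annulus i \<inter> annulus j = ({} :: 'a::euclidean_space set)" if "i < j" for i j
  proof -
    have "real (Suc i) \<le> real j" using that by simp
    then show ?thesis by (auto simp: annulus_def)
  qed
  then show ?thesis unfolding disjoint_family_on_def by (metis Int_commute linorder_neqE_nat)
qed

lemma UN_annuli: "(\<Union>j<J. annulus j) = ball 0 (real J)"
proof (induction J)
  case (Suc J)
  have "ball 0 (real J) \<subseteq> (ball 0 (real (Suc J)) :: 'a set)" by (rule subset_ball) simp
  then show ?case unfolding lessThan_Suc UN_insert Suc by (auto simp: annulus_def simp del: of_nat_Suc)
qed simp

text \<open>
  Counting indices rather than points gives points that are hit repeatedly their multiplicity.
\<close>

lemma annuli_points_emeasure:
  fixes A :: "'a::euclidean_space set"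
  assumes A: "A \<in> sets borel"
  shows "emeasure (annuli_points \<omega>) A = (\<Sum>j. of_nat (hits (snd (\<omega> j)) (fst (\<omega> j)) (A \<inter> annulus j)))"
proof -
  let ?N = "count_space {(j, i). i < fst (\<omega> j) \<and> snd (\<omega> j) i \<in> annulus j}"
  let ?B = "\<lambda>j. {(j', i). j' = j \<and> i < fst (\<omega> j) \<and> snd (\<omega> j) i \<in> A \<inter> annulus j}"
  have "emeasure (annuli_points \<omega>) A = emeasure ?N ((\<lambda>(j, i). snd (\<omega> j) i) -` A \<inter> space ?N)"
    unfolding annuli_points_def using A by (intro emeasure_distr) auto
  also have "(\<lambda>(j, i). snd (\<omega> j) i) -` A \<inter> space ?N = (\<Union>j. ?B j)" by auto
  also have "emeasure ?N \<dots> = (\<Sum>j. emeasure ?N (?B j))"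
    by (rule suminf_emeasure[symmetric]) (auto simp: disjoint_family_on_def)
  also have "\<dots> = (\<Sum>j. of_nat (hits (snd (\<omega> j)) (fst (\<omega> j)) (A \<inter> annulus j)))"
  proof (rule suminf_cong)
    fix j
    show "emeasure ?N (?B j) = of_nat (hits (snd (\<omega> j)) (fst (\<omega> j)) (A \<inter> annulus j))"
  proof -
    have eq: "?B j = Pair j ` {i. i < fst (\<omega> j) \<and> snd (\<omega> j) i \<in> A \<inter> annulus j}" by auto
    have "card (?B j) = hits (snd (\<omega> j)) (fst (\<omega> j)) (A \<inter> annulus j)"
      unfolding eq hits_def by (rule card_image) (simp add: inj_on_def)
    moreover have "finite (?B j)" unfolding eq by simp
    ultimately show ?thesis by (subst emeasure_count_space_finite) auto
  qed
  qed
  finally show ?thesis .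
qed

lemma annuli_points_config: "annuli_points \<omega> \<in> point_configs (UNIV :: 'a::euclidean_space set)"
  unfolding point_configs_def
proof (intro CollectI conjI ballI impI)
  show "sets (annuli_points \<omega>) = sets (restrict_space borel (UNIV :: 'a set))" by (simp add: annuli_points_def)
  fix A :: "'a set" assume "A \<in> sets (annuli_points \<omega>)" and b: "bounded A"
  then have A: "A \<in> sets borel" by (simp add: annuli_points_def)
  obtain r where r: "A \<subseteq> ball 0 r" using b bounded_subset_ballD by blast
  obtain J :: nat where J: "r \<le> J" using real_arch_simple by blast
  have "A \<inter> annulus j = {}" if "J \<le> j" for j
  proof -
    have "r \<le> real j" using J that by simp
    then show ?thesis using r by (auto simp: annulus_def)
  qed
  then have "hits (snd (\<omega> j)) (fst (\<omega> j)) (A \<inter> annulus j) = 0" if "j \<notin> {..<J}" for j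
    using that by (simp add: hits_def)
  then have "emeasure (annuli_points \<omega>) A = (\<Sum>j<J. of_nat (hits (snd (\<omega> j)) (fst (\<omega> j)) (A \<inter> annulus j)))"
    unfolding annuli_points_emeasure[OF A] by (intro suminf_finite) auto
  then show "\<exists>n::nat. emeasure (annuli_points \<omega>) A = of_nat n"
    unfolding of_nat_sum[symmetric] by blast
qed

text \<open>
  Within finitely many annuli the counts have the right joint law by superposition.  Letting the
  number of annuli grow gives it for all sets of finite measure, and the joint law contains both the
  distribution of single counts and independence.
\<close>

lemma poisson_process_annuli_points:
  "poisson_process (PiM UNIV annulus_law) (UNIV :: 'a::euclidean_space set) 1 annuli_points"
proof -
  let ?P = "PiM UNIV (annulus_law :: nat \<Rightarrow> (nat \<times> (nat \<Rightarrow> 'a)) measure)"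
  let ?\<nu> = "\<lambda>j. uniform_measure lborel (annulus j :: 'a set)"
  have \<nu>: "prob_space (?\<nu> j)" for j
  proof (rule prob_space_uniform_measure)
    show "emeasure lborel (annulus j :: 'a set) \<noteq> 0"
      using annulus_pos[of j, where 'a='a] by (auto simp: measure_def)
    show "emeasure lborel (annulus j :: 'a set) \<noteq> \<infinity>" using annulus_finite[of j, where 'a='a] by auto
  qed
  have Q: "prob_space (annulus_law j :: (nat \<times> (nat \<Rightarrow> 'a)) measure)" for j
    unfolding annulus_law_def by (intro prob_space_pair measure_pmf.prob_space_axioms prob_space_PiM \<nu>)
  interpret P: prob_space ?P by (intro prob_space_PiM Q)
  interpret PP: product_prob_space "annulus_law :: nat \<Rightarrow> (nat \<times> (nat \<Rightarrow> 'a)) measure" UNIV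
    by (intro product_prob_spaceI Q)
  let ?x = "\<lambda>A j (q :: nat \<times> (nat \<Rightarrow> 'a)). hits (snd q) (fst q) (A \<inter> annulus j)"
  have x: "?x A j \<in> annulus_law j \<rightarrow>\<^sub>M count_space UNIV" if "A \<in> sets borel" for A :: "'a set" and j
    unfolding annulus_law_def using that by (intro hits_measurable_pair) auto
  have xJ: "(\<lambda>\<omega>. ?x A j (\<omega> j)) \<in> PiM J annulus_law \<rightarrow>\<^sub>M count_space UNIV"
    if "A \<in> sets borel" "j \<in> J" for A :: "'a set" and j J
    by (rule measurable_compose[OF measurable_component_singleton[of j J annulus_law] x[OF that(1)]]) (rule that)
  have xP: "(\<lambda>\<omega>. ?x A j (\<omega> j)) \<in> ?P \<rightarrow>\<^sub>M count_space UNIV" if "A \<in> sets borel" for A :: "'a set" and j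
    using xJ[OF that, of j UNIV] by simp
  have Xm: "(\<lambda>\<omega>. emeasure (annuli_points \<omega>) A) \<in> borel_measurable ?P" if A: "A \<in> sets borel" for A :: "'a set"
  proof -
    have "(\<lambda>\<omega>. of_nat (?x A j (\<omega> j)) :: ennreal) \<in> borel_measurable ?P" for j
      by (rule measurable_compose[OF xP[OF A]]) simp
    then show ?thesis unfolding annuli_points_emeasure[OF A] by (rule borel_measurable_suminf_order)
  qed
  have pp: "point_process ?P (UNIV :: 'a set) annuli_points"
    unfolding point_process_def
    by (intro conjI P.prob_space_axioms measurable_config_algebraI annuli_points_config Xm) simp
  have joint: "P.prob {\<omega>\<in>space ?P. \<forall>a<n. emeasure (annuli_points \<omega>) (A a) = of_nat (k a)} =
      (\<Prod>a<n. poisson_weight (measure lborel (A a)) (k a))"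
    if A: "\<And>a. a < n \<Longrightarrow> A a \<in> sets borel" and Af: "\<And>a. a < n \<Longrightarrow> emeasure lborel (A a) < \<infinity>"
      and disj: "disjoint_family_on A {..<n}" for n :: nat and A :: "nat \<Rightarrow> 'a set" and k
  proof -
    let ?S = "\<lambda>J. {\<omega>\<in>space ?P. \<forall>a<n. (\<Sum>j<J. ?x (A a) j (\<omega> j)) = k a}"
    let ?E = "{\<omega>\<in>space ?P. \<forall>a<n. emeasure (annuli_points \<omega>) (A a) = of_nat (k a)}"
    have law_j: "emeasure (annulus_law j) {q\<in>space (annulus_law j). \<forall>a<n. ?x (A a) j q = l a} =
       ennreal (\<Prod>a<n. poisson_weight (measure lborel (A a \<inter> annulus j)) (l a))" for j l
    proof -
      have "emeasure (annulus_law j) {q\<in>space (annulus_law j). \<forall>a<n. ?x (A a) j q = l a} =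
        ennreal (\<Prod>a<n. poisson_weight (measure lborel (annulus j :: 'a set) * measure (?\<nu> j) (A a \<inter> annulus j)) (l a))"
        unfolding annulus_law_def
        by (rule poisson_hits_disjoint[OF \<nu> annulus_pos, of n "\<lambda>a. A a \<inter> annulus j"])
          (use A disj in \<open>auto simp: disjoint_family_on_def\<close>)
      also have "(\<Prod>a<n. poisson_weight (measure lborel (annulus j :: 'a set) * measure (?\<nu> j) (A a \<inter> annulus j)) (l a)) =
          (\<Prod>a<n. poisson_weight (measure lborel (A a \<inter> annulus j)) (l a))"
      proof (intro prod.cong refl)
        fix a assume a: "a \<in> {..<n}"
        have "measure (?\<nu> j) (A a \<inter> annulus j) = measure lborel (A a \<inter> annulus j) / measure lborel (annulus j :: 'a set)"
          using A a annulus_pos[of j, where 'a='a] annulus_finite[of j, where 'a='a]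
          by (subst measure_uniform_measure) (auto simp: Int_ac measure_def)
        then show "poisson_weight (measure lborel (annulus j :: 'a set) * measure (?\<nu> j) (A a \<inter> annulus j)) (l a) =
            poisson_weight (measure lborel (A a \<inter> annulus j)) (l a)"
          using annulus_pos[of j, where 'a='a] by simp
      qed
      finally show ?thesis .
    qed
    have Sm: "?S J \<in> sets ?P" for J
      using A by (intro sets_joint_counts measurable_sum_nat xP) auto
    have em_S: "P.prob (?S J) = (\<Prod>a<n. poisson_weight (\<Sum>j<J. measure lborel (A a \<inter> annulus j)) (k a))" for J
    proof -
      let ?S' = "{\<omega>\<in>space (PiM {..<J} annulus_law). \<forall>a<n. (\<Sum>j<J. ?x (A a) j (\<omega> j)) = k a}"
      have S'm: "?S' \<in> sets (PiM {..<J} annulus_law)"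
        using A by (intro sets_joint_counts measurable_sum_nat xJ) auto
      have rm: "(\<lambda>\<omega>. restrict \<omega> {..<J}) \<in> ?P \<rightarrow>\<^sub>M PiM {..<J} annulus_law"
        by (rule measurable_restrict_subset) simp
      have sum_eq: "(\<Sum>j<J. ?x (A a) j (restrict \<omega> {..<J} j)) = (\<Sum>j<J. ?x (A a) j (\<omega> j))" for a and \<omega> :: "nat \<Rightarrow> nat \<times> (nat \<Rightarrow> 'a)"
        by (intro sum.cong) auto
      have "?S J = (\<lambda>\<omega>. restrict \<omega> {..<J}) -` ?S' \<inter> space ?P"
        unfolding vimage_def mem_Collect_eq sum_eq using measurable_space[OF rm] by blast
      then have "emeasure ?P (?S J) = emeasure (distr ?P (PiM {..<J} annulus_law) (\<lambda>\<omega>. restrict \<omega> {..<J})) ?S'"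
        using emeasure_distr[OF rm S'm] by simp
      also have "distr ?P (PiM {..<J} annulus_law) (\<lambda>\<omega>. restrict \<omega> {..<J}) = PiM {..<J} annulus_law"
        by (rule PP.distr_PiM_restrict_finite) auto
      also have "emeasure (PiM {..<J} annulus_law) ?S' = ennreal (\<Prod>a<n. poisson_weight (\<Sum>j<J. measure lborel (A a \<inter> annulus j)) (k a))"
        by (rule PiM_sum_poisson[OF Q, where x="\<lambda>j a. ?x (A a) j" and \<mu>="\<lambda>j a. measure lborel (A a \<inter> annulus j)"])
          (auto simp: law_j intro!: x A)
      finally show ?thesis
        by (simp add: P.emeasure_eq_measure prod_nonneg poisson_weight_nonneg sum_nonneg)
    qed
    have "(\<lambda>J. P.prob (?S J)) \<longlonglongrightarrow> P.prob ?E"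
    proof -
      have Em: "?E \<in> sets ?P"
      proof -
        have "{\<omega>\<in>space ?P. \<forall>a\<in>{..<n}. emeasure (annuli_points \<omega>) (A a) = of_nat (k a)} \<in> sets ?P"
          using Xm[OF A] by (intro sets.sets_Collect_finite_All) auto
        then show ?thesis unfolding Ball_def lessThan_iff .
      qed
      have "(\<lambda>J. \<integral>\<omega>. indicator (?S J) \<omega> \<partial>?P) \<longlonglongrightarrow> (\<integral>\<omega>. (indicator ?E \<omega> :: real) \<partial>?P)"
      proof (rule integral_dominated_convergence[where w="\<lambda>_. 1"])
        show "AE \<omega> in ?P. (\<lambda>J. indicator (?S J) \<omega> :: real) \<longlonglongrightarrow> indicator ?E \<omega>"
        proof (rule AE_I2)
          fix \<omega> assume \<omega>: "\<omega> \<in> space ?P"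
          have each: "\<forall>\<^sub>F J in sequentially. ((\<Sum>j<J. ?x (A a) j (\<omega> j)) = k a \<longleftrightarrow> emeasure (annuli_points \<omega>) (A a) = of_nat (k a))"
            if a: "a < n" for a
          proof -
            define s where "s = (\<lambda>J. \<Sum>j<J. ?x (A a) j (\<omega> j))"
            have s: "(\<Sum>j<J. ?x (A a) j (\<omega> j)) = s J" for J by (simp add: s_def)
            have "incseq s" unfolding s_def by (intro incseq_SucI) simp
            have "(\<lambda>J. of_nat (s J) :: ennreal) \<longlonglongrightarrow> emeasure (annuli_points \<omega>) (A a)"
              unfolding s_def annuli_points_emeasure[OF A[OF a]] of_nat_sum by (rule summable_LIMSEQ) simp
            moreover have "incseq (\<lambda>J. of_nat (s J) :: ennreal)"
              using \<open>incseq s\<close> by (auto simp: incseq_def)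
            ultimately have le: "of_nat (s J) \<le> emeasure (annuli_points \<omega>) (A a)"
              and lim: "(\<lambda>J. of_nat (s J) :: ennreal) \<longlonglongrightarrow> emeasure (annuli_points \<omega>) (A a)" for J
              by (auto intro: incseq_le)
            show ?thesis
            proof (cases "\<exists>J. s J > k a")
              case True
              then obtain J where J: "s J > k a" by blast
              then have "(of_nat (k a) :: ennreal) < of_nat (s J)" by simp
              then have "emeasure (annuli_points \<omega>) (A a) \<noteq> of_nat (k a)" using le[of J] by auto
              moreover have "s J' \<noteq> k a" if "J \<le> J'" for J' using J incseqD[OF \<open>incseq s\<close> that] by linarith
              ultimately show ?thesis unfolding s eventually_sequentially by auto
            next
              case False
              then have b: "s J \<le> k a" for J by (meson not_le)
              have "finite (range s)" by (rule finite_subset[of _ "{..k a}"]) (use b in auto)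
              then obtain J where J: "s J = Max (range s)" by (metis Max_in empty_is_image empty_not_UNIV rangeE)
              have const: "s J' = s J" if "J \<le> J'" for J'
                using incseqD[OF \<open>incseq s\<close> that] J Max_ge[OF \<open>finite (range s)\<close>, of "s J'"] by auto
              have "(\<lambda>J. of_nat (s J) :: ennreal) \<longlonglongrightarrow> of_nat (s J)"
                by (rule tendsto_eventually) (auto simp: eventually_sequentially intro!: exI[of _ J] const)
              then have "emeasure (annuli_points \<omega>) (A a) = of_nat (s J)" using lim LIMSEQ_unique by blast
              then have lim_eq: "emeasure (annuli_points \<omega>) (A a) = of_nat (s J)" .
              show ?thesis unfolding s eventually_sequentially
              proof (intro exI allI impI)
                fix J' assume "J \<le> J'"
                then show "s J' = k a \<longleftrightarrow> emeasure (annuli_points \<omega>) (A a) = of_nat (k a)"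
                  unfolding const[OF \<open>J \<le> J'\<close>] lim_eq by simp
              qed
            qed
          qed
          have "\<forall>\<^sub>F J in sequentially. \<forall>a\<in>{..<n}. ((\<Sum>j<J. ?x (A a) j (\<omega> j)) = k a \<longleftrightarrow> emeasure (annuli_points \<omega>) (A a) = of_nat (k a))"
            using each by (intro eventually_ball_finite) auto
          then have "\<forall>\<^sub>F J in sequentially. (indicator (?S J) \<omega> :: real) = indicator ?E \<omega>"
            by eventually_elim (auto simp: indicator_def)
          then show "(\<lambda>J. indicator (?S J) \<omega> :: real) \<longlonglongrightarrow> indicator ?E \<omega>" by (rule tendsto_eventually)
        qed
        show "(indicator ?E :: _ \<Rightarrow> real) \<in> borel_measurable ?P" by (rule borel_measurable_indicator[OF Em])
        show "(indicator (?S J) :: _ \<Rightarrow> real) \<in> borel_measurable ?P" for J by (rule borel_measurable_indicator[OF Sm])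
        have "norm (indicator B \<omega> :: real) \<le> 1" for B :: "(nat \<Rightarrow> nat \<times> (nat \<Rightarrow> 'a)) set" and \<omega>
          by (simp add: indicator_def)
        then show "AE \<omega> in ?P. norm (indicator (?S J) \<omega> :: real) \<le> 1" for J by (rule AE_I2)
        show "integrable ?P (\<lambda>_. 1 :: real)" by simp
      qed
      moreover have "(\<integral>\<omega>. (indicator B \<omega> :: real) \<partial>?P) = P.prob B" if "B \<in> sets ?P" for B
        using that by (simp add: Int_absorb2 sets.sets_into_space)
      ultimately show ?thesis using Sm Em by (simp only:)
    qed
    moreover have "(\<lambda>J. P.prob (?S J)) \<longlonglongrightarrow> (\<Prod>a<n. poisson_weight (measure lborel (A a)) (k a))"
      unfolding em_S
    proof (rule tendsto_prod)
      fix a assume "a \<in> {..<n}"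
      then have a: "A a \<in> sets borel" "emeasure lborel (A a) < \<infinity>" using A Af by auto
      have "(\<Sum>j<J. measure lborel (A a \<inter> annulus j)) = measure lborel (A a \<inter> ball 0 (real J))" for J
      proof -
        have "(\<Sum>j<J. measure lborel (A a \<inter> annulus j)) = measure lborel (\<Union>j<J. A a \<inter> annulus j)"
        proof (rule measure_finite_Union[symmetric])
          show "disjoint_family_on (\<lambda>j. A a \<inter> annulus j) {..<J}"
            using disjoint_annuli[where 'a='a] by (auto simp: disjoint_family_on_def)
          show "emeasure lborel (A a \<inter> annulus j) \<noteq> \<infinity>" for j
            using a emeasure_mono[of "A a \<inter> annulus j" "A a" lborel] by (auto simp: top_unique)
        qed (use a in auto)
        also have "(\<Union>j<J. A a \<inter> annulus j) = A a \<inter> ball 0 (real J)" unfolding UN_annuli[symmetric] by blast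
        finally show ?thesis .
      qed
      moreover have "(\<lambda>J. measure lborel (A a \<inter> ball 0 (real J))) \<longlonglongrightarrow> measure lborel (\<Union>J. A a \<inter> ball 0 (real J))"
      proof (rule Lim_measure_incseq)
        show "emeasure lborel (\<Union>J. A a \<inter> ball 0 (real J)) \<noteq> \<infinity>"
          using a emeasure_mono[of "\<Union>J. A a \<inter> ball 0 (real J)" "A a" lborel] by (auto simp: top_unique)
      qed (use a in \<open>auto simp: incseq_def\<close>)
      moreover have "(\<Union>J. A a \<inter> ball 0 (real J)) = A a" by (auto intro: reals_Archimedean2)
      ultimately have "(\<lambda>J. \<Sum>j<J. measure lborel (A a \<inter> annulus j)) \<longlonglongrightarrow> measure lborel (A a)" by simp
      then show "(\<lambda>J. poisson_weight (\<Sum>j<J. measure lborel (A a \<inter> annulus j)) (k a)) \<longlonglongrightarrow> poisson_weight (measure lborel (A a)) (k a)"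
        unfolding poisson_weight_def by (intro tendsto_intros) auto
    qed
    ultimately show ?thesis by (rule LIMSEQ_unique)
  qed
  have single: "P.prob {\<omega>\<in>space ?P. emeasure (annuli_points \<omega>) A = of_nat k} = poisson_weight (measure lborel A) k"
    if "A \<in> sets borel" "emeasure lborel A < \<infinity>" for A :: "'a set" and k
    using joint[of 1 "\<lambda>_. A" "\<lambda>_. k"] that by (simp add: disjoint_family_on_def)
  have AEnat: "AE \<omega> in ?P. \<exists>k::nat. emeasure (annuli_points \<omega>) A = of_nat k"
    if A: "A \<in> sets borel" "emeasure lborel A < \<infinity>" for A :: "'a set"
  proof -
    note [measurable] = Xm[OF A(1)]
    have "(\<lambda>k. P.prob {\<omega>\<in>space ?P. emeasure (annuli_points \<omega>) A = of_nat k}) sums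
      P.prob (\<Union>k. {\<omega>\<in>space ?P. emeasure (annuli_points \<omega>) A = of_nat k})"
      by (rule P.finite_measure_UNION) (auto simp: disjoint_family_on_def)
    then have "P.prob (\<Union>k. {\<omega>\<in>space ?P. emeasure (annuli_points \<omega>) A = of_nat k}) = 1"
      unfolding single[OF A] using poisson_weight_sums sums_unique2 by blast
    then have "AE \<omega> in ?P. \<omega> \<in> (\<Union>k::nat. {\<omega>\<in>space ?P. emeasure (annuli_points \<omega>) A = of_nat k})"
      by (subst (asm) P.prob_eq_1) auto
    then show ?thesis by eventually_elim auto
  qed
  show ?thesis
    unfolding poisson_process_def Let_def
  proof (intro conjI ballI allI impI pp)
    fix A :: "'a set" and k assume "A \<in> sets (restrict_space borel UNIV)" "emeasure lborel A < \<infinity>"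
    then show "P.prob {\<omega>\<in>space ?P. emeasure (annuli_points \<omega>) A = of_nat k} =
        (1 * measure lborel A) ^ k / fact k * exp (- (1 * measure lborel A))"
      using single[of A k] by (simp add: poisson_weight_def)
  next
    fix n :: nat and A :: "nat \<Rightarrow> 'a set"
    assume A: "\<forall>i<n. A i \<in> sets (restrict_space borel UNIV) \<and> emeasure lborel (A i) < \<infinity>"
      and disj: "disjoint_family_on A {..<n}"
    show "P.indep_vars (\<lambda>_. borel) (\<lambda>i \<omega>. emeasure (annuli_points \<omega>) (A i)) {..<n}"
      by (rule P.indep_vars_joint_poisson[where m="\<lambda>i. measure lborel (A i)"])
        (use A disj in \<open>auto intro!: Xm AEnat joint\<close>)
  qed
qed

section \<open>A random nested sequence of grids\<close>

subsection \<open>Positions modulo a period\<close>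

definition wrap :: "real \<Rightarrow> real \<Rightarrow> real" where
  "wrap L x = x - L * of_int \<lfloor>x / L\<rfloor>"

lemma wrap_bounds:
  assumes "0 < L" shows "0 \<le> wrap L x" "wrap L x < L"
proof -
  have "of_int \<lfloor>x / L\<rfloor> \<le> x / L" "x / L < of_int \<lfloor>x / L\<rfloor> + 1" by linarith+
  then have "L * of_int \<lfloor>x / L\<rfloor> \<le> L * (x / L)" "L * (x / L) < L * (of_int \<lfloor>x / L\<rfloor> + 1)"
    using assms by (intro mult_left_mono, simp_all only: less_imp_le) (rule mult_strict_left_mono)
  then show "0 \<le> wrap L x" "wrap L x < L"
    using assms by (simp_all add: wrap_def algebra_simps)
qed

lemma wrap_add_period:
  assumes "0 < L" shows "wrap L (x + L * of_int k) = wrap L x"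
proof -
  have "\<lfloor>(x + L * of_int k) / L\<rfloor> = \<lfloor>x / L\<rfloor> + k"
    using assms by (simp add: add_divide_distrib)
  then show ?thesis by (simp add: wrap_def algebra_simps)
qed

lemma wrap_eqI:
  assumes "0 \<le> y" "y < L" "x = y + L * of_int k" shows "wrap L x = y"
proof -
  have "wrap L x = wrap L y" unfolding assms(3) using assms by (intro wrap_add_period) auto
  also have "\<lfloor>y / L\<rfloor> = 0" using assms by (simp add: floor_eq_iff)
  then have "wrap L y = y" by (simp add: wrap_def)
  finally show ?thesis .
qed

lemma wrap_eq_diff: "\<exists>k::int. wrap L x = x - L * of_int k"
  by (auto simp: wrap_def)

lemma wrap_wrap_add:
  assumes "0 < L" shows "wrap L (wrap L x + t) = wrap L (x + t)"
proof -
  have "wrap L x + t = (x + t) + L * of_int (- \<lfloor>x / L\<rfloor>)" by (simp add: wrap_def)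
  then show ?thesis using wrap_add_period[OF assms] by metis
qed

lemma wrap_wrap_multiple:
  assumes "0 < L" shows "wrap L (wrap (L * of_nat n) x) = wrap L x"
proof -
  have "wrap (L * of_nat n) x = x + L * of_int (- (int n * \<lfloor>x / (L * of_nat n)\<rfloor>))"
    by (simp add: wrap_def)
  then show ?thesis using wrap_add_period[OF assms] by metis
qed

lemma borel_measurable_wrap [measurable]: "wrap L \<in> borel_measurable borel"
  unfolding wrap_def[abs_def] by measurable

abbreviation uniform_upto :: "real \<Rightarrow> real measure" where
  "uniform_upto L \<equiv> uniform_measure lborel {0..<L}"

lemma prob_space_uniform_upto: "0 < L \<Longrightarrow> prob_space (uniform_upto L)"
  by (intro prob_space_uniform_measure) auto

lemma emeasure_lborel_shift:
  fixes A :: "real set"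
  assumes "A \<in> sets borel"
  shows "emeasure lborel {x. x + t \<in> A} = emeasure lborel A"
proof -
  have "emeasure lborel A = emeasure (distr lborel borel ((+) t)) A" by (simp add: lborel_distr_plus)
  also have "\<dots> = emeasure lborel {x. x + t \<in> A}"
    using assms by (subst emeasure_distr) (auto simp: vimage_def add.commute)
  finally show ?thesis ..
qed

text \<open>
  A uniform point on a circle stays uniform under rotation.
\<close>

lemma wrap_uniform:
  assumes L: "0 < L"
  shows "distr (uniform_upto L) borel (\<lambda>x. wrap L (x + t)) = uniform_upto L"
proof (rule measure_eqI)
  define s where "s = wrap L t"
  have s: "0 \<le> s" "s < L" using wrap_bounds[OF L] by (auto simp: s_def)
  have ws: "wrap L (x + t) = (if x + s < L then x + s else x + s - L)" if "0 \<le> x" "x < L" for x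
  proof -
    obtain k :: int where k: "s = t - L * of_int k" using wrap_eq_diff[of L t] by (auto simp: s_def)
    show ?thesis
    proof (cases "x + s < L")
      case True
      then show ?thesis using that s k by (simp, intro wrap_eqI[where k=k]) auto
    next
      case False
      then show ?thesis using that s k by (simp, intro wrap_eqI[where k="k + 1"]) (auto simp: algebra_simps)
    qed
  qed
  fix A assume "A \<in> sets (distr (uniform_upto L) borel (\<lambda>x. wrap L (x + t)))"
  then have A[measurable]: "A \<in> sets borel" by simp
  have "emeasure (distr (uniform_upto L) borel (\<lambda>x. wrap L (x + t))) A = emeasure (uniform_upto L) {x. wrap L (x + t) \<in> A}"
    by (subst emeasure_distr) (auto simp: vimage_def)
  also have "\<dots> = emeasure lborel ({0..<L} \<inter> {x. wrap L (x + t) \<in> A}) / emeasure lborel {0..<L}"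
    by (subst emeasure_uniform_measure) auto
  also have "{0..<L} \<inter> {x. wrap L (x + t) \<in> A} = {x. x + s \<in> A \<inter> {s..<L}} \<union> {x. x + (s - L) \<in> A \<inter> {0..<s}}"
  proof (intro set_eqI iffI)
    fix x assume "x \<in> {0..<L} \<inter> {x. wrap L (x + t) \<in> A}"
    then show "x \<in> {x. x + s \<in> A \<inter> {s..<L}} \<union> {x. x + (s - L) \<in> A \<inter> {0..<s}}"
      using ws[of x] by (auto simp: algebra_simps split: if_splits)
  next
    fix x assume "x \<in> {x. x + s \<in> A \<inter> {s..<L}} \<union> {x. x + (s - L) \<in> A \<inter> {0..<s}}"
    then show "x \<in> {0..<L} \<inter> {x. wrap L (x + t) \<in> A}"
    proof
      assume x: "x \<in> {x. x + s \<in> A \<inter> {s..<L}}"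
      then have "0 \<le> x" "x < L" using s by auto
      then show ?thesis using ws[of x] x by auto
    next
      assume x: "x \<in> {x. x + (s - L) \<in> A \<inter> {0..<s}}"
      then have "0 \<le> x" "x < L" "\<not> x + s < L" using s by auto
      then have "wrap L (x + t) = x + (s - L)" using ws[of x] by simp
      then show ?thesis using \<open>0 \<le> x\<close> \<open>x < L\<close> x by auto
    qed
  qed
  also have "emeasure lborel \<dots> = emeasure lborel {x. x + s \<in> A \<inter> {s..<L}} + emeasure lborel {x. x + (s - L) \<in> A \<inter> {0..<s}}"
    by (rule plus_emeasure[symmetric]) (auto simp: Int_def)
  also have "\<dots> = emeasure lborel (A \<inter> {s..<L}) + emeasure lborel (A \<inter> {0..<s})"
    by (subst (1 2) emeasure_lborel_shift) auto
  also have "\<dots> = emeasure lborel (A \<inter> {s..<L} \<union> A \<inter> {0..<s})"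
    by (rule plus_emeasure) auto
  also have "A \<inter> {s..<L} \<union> A \<inter> {0..<s} = {0..<L} \<inter> A" using s by auto
  also have "emeasure lborel ({0..<L} \<inter> A) / emeasure lborel {0..<L} = emeasure (uniform_upto L) A"
    by (subst emeasure_uniform_measure) auto
  finally show "emeasure (distr (uniform_upto L) borel (\<lambda>x. wrap L (x + t))) A = emeasure (uniform_upto L) A" .
qed simp

subsection \<open>Nested offsets\<close>

text \<open>
  Grids of successive indices differ by a factor of \<open>64\<close>, the square of \<open>8\<close>.  Since every direction
  is coarsened at every other level only, the boxes of level \<open>n\<close> will have sides of order \<open>8 ^ n\<close>.
\<close>

definition period :: "nat \<Rightarrow> real" where
  "period k = 16 * 64 ^ k"

lemma period_pos [simp]: "0 < period k"
  by (simp add: period_def)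

lemma period_Suc: "period (Suc k) = period k * 64"
  by (simp add: period_def)

lemma period_add: "period (k + j) = period k * of_nat (64 ^ j)"
  by (simp add: period_def power_add)

text \<open>
  A random grid of index \<open>0\<close> has a uniform offset.  A grid of the next index keeps every 64th point
  of it; the digit says which of the 64 classes is kept.  The offset of the grid of index \<open>k\<close> is the
  sum of the first digits.
\<close>

definition digit_law :: "nat \<Rightarrow> real measure" where
  "digit_law i = (case i of 0 \<Rightarrow> uniform_upto 16
     | Suc j \<Rightarrow> distr (measure_pmf (pmf_of_set {..<64::nat})) borel (\<lambda>b. period j * real b))"

definition offset :: "(nat \<Rightarrow> real) \<Rightarrow> nat \<Rightarrow> real" where
  "offset \<beta> k = (\<Sum>i<Suc k. \<beta> i)"

definition offset_law :: "(nat \<Rightarrow> real) measure" where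
  "offset_law = distr (PiM UNIV digit_law) (PiM UNIV (\<lambda>_. borel)) offset"

lemma prob_space_digit_law: "prob_space (digit_law i)"
proof (cases i)
  case 0 then show ?thesis by (simp add: digit_law_def prob_space_uniform_upto)
next
  case (Suc j)
  then show ?thesis by (auto simp: digit_law_def intro!: prob_space.prob_space_distr measure_pmf.prob_space_axioms)
qed

lemma sets_digit_law [measurable_cong]: "sets (digit_law i) = sets borel"
  by (cases i) (auto simp: digit_law_def)

lemma digit_component:
  "(\<lambda>\<beta>. \<beta> i) \<in> borel_measurable (PiM UNIV digit_law)" "distr (PiM UNIV digit_law) borel (\<lambda>\<beta>. \<beta> i) = digit_law i"
proof -
  show "(\<lambda>\<beta>. \<beta> i) \<in> borel_measurable (PiM UNIV digit_law)"
    using measurable_component_singleton[of i UNIV digit_law] measurable_cong_sets[OF refl sets_digit_law] by simp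
  have "distr (PiM UNIV digit_law) borel (\<lambda>\<beta>. \<beta> i) = distr (PiM UNIV digit_law) (digit_law i) (\<lambda>\<beta>. \<beta> i)"
    by (intro distr_cong) (auto simp: sets_digit_law)
  also have "\<dots> = digit_law i" by (intro distr_PiM_component prob_space_digit_law) auto
  finally show "distr (PiM UNIV digit_law) borel (\<lambda>\<beta>. \<beta> i) = digit_law i" .
qed

lemma offset_measurable: "offset \<in> PiM UNIV digit_law \<rightarrow>\<^sub>M PiM UNIV (\<lambda>_. borel)"
proof (rule measurable_PiM_single')
  fix k
  show "(\<lambda>\<beta>. offset \<beta> k) \<in> borel_measurable (PiM UNIV digit_law)"
    unfolding offset_def by (intro borel_measurable_sum digit_component)
qed (auto simp: space_PiM)

lemma prob_space_offset_law: "prob_space offset_law"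
  unfolding offset_law_def
  by (intro prob_space.prob_space_distr prob_space_PiM prob_space_digit_law offset_measurable)

lemma digits_indep:
  "prob_space.indep_vars (PiM UNIV digit_law) (\<lambda>_. borel) (\<lambda>i \<beta>. \<beta> i) UNIV"
proof -
  interpret prob_space "PiM UNIV digit_law" by (intro prob_space_PiM prob_space_digit_law)
  note m = digit_component(1) and comp = digit_component(2)
  have "distr (PiM UNIV digit_law) (PiM UNIV (\<lambda>_. borel)) (\<lambda>\<beta>. \<lambda>i\<in>UNIV. \<beta> i) = distr (PiM UNIV digit_law) (PiM UNIV digit_law) (\<lambda>\<beta>. \<beta>)"
    by (intro distr_cong sets_PiM_cong) (auto simp: sets_digit_law)
  also have "\<dots> = PiM UNIV digit_law" by (rule distr_id)
  finally show ?thesis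
    by (subst indep_vars_iff_distr_eq_PiM) (auto simp: m comp)
qed

text \<open>
  Translating the interval of length \<open>period k\<close> by the 64 values of the next digit tiles the interval
  of length \<open>period (Suc k)\<close>.
\<close>

lemma offset_digit_law:
  "distr (PiM UNIV digit_law) borel (\<lambda>\<beta>. offset \<beta> k) = uniform_upto (period k)"
proof (induction k)
  interpret prob_space "PiM UNIV digit_law" by (intro prob_space_PiM prob_space_digit_law)
  note m = digit_component(1) and comp = digit_component(2)
  {
    case 0
    have "digit_law 0 = uniform_upto 16" by (simp add: digit_law_def)
    then show ?case using comp[of 0] by (simp add: offset_def period_def)
  next
    case (Suc k)
    define L where "L = period k"
    have L: "0 < L" by (simp add: L_def)
    let ?Y = "\<lambda>\<beta>. offset \<beta> k" and ?X = "\<lambda>\<beta>::nat \<Rightarrow> real. \<beta> (Suc k)"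
    have "indep_vars (\<lambda>_. borel) (\<lambda>i \<beta>. \<beta> i) (insert (Suc k) {..<Suc k})"
      by (rule indep_vars_subset[OF digits_indep]) simp
    then have "indep_var borel ?X borel (\<lambda>\<beta>. \<Sum>i<Suc k. \<beta> i)"
      by (intro indep_vars_sum) auto
    then have ind: "indep_var borel ?X borel ?Y" by (simp add: offset_def)
    then have joint: "distr (PiM UNIV digit_law) (borel \<Otimes>\<^sub>M borel) (\<lambda>\<beta>. (?X \<beta>, ?Y \<beta>)) = digit_law (Suc k) \<Otimes>\<^sub>M uniform_upto L"
      using indep_var_distribution_eq[of borel ?X borel ?Y] comp[of "Suc k"] Suc.IH by (simp add: L_def)
    have Ym: "?Y \<in> borel_measurable (PiM UNIV digit_law)" unfolding offset_def by (intro borel_measurable_sum m)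
    interpret U: prob_space "uniform_upto L" by (rule prob_space_uniform_upto[OF L])
    show ?case
    proof (rule measure_eqI)
      fix A assume "A \<in> sets (distr (PiM UNIV digit_law) borel (\<lambda>\<beta>. offset \<beta> (Suc k)))"
      then have A[measurable]: "A \<in> sets borel" by simp
      let ?S = "{p::real \<times> real. fst p + snd p \<in> A}"
      have S: "?S \<in> sets (borel \<Otimes>\<^sub>M borel)"
      proof -
        have "(\<lambda>p::real\<times>real. fst p + snd p) \<in> borel_measurable (borel \<Otimes>\<^sub>M borel)" by measurable
        from measurable_sets[OF this A] show ?thesis by (simp add: vimage_def space_pair_measure)
      qed
      have S': "?S \<in> sets (digit_law (Suc k) \<Otimes>\<^sub>M uniform_upto L)"
        using S by (simp add: sets_pair_measure_cong[OF sets_digit_law refl] cong: sets_pair_measure_cong)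
      have pm: "(\<lambda>\<beta>. (?X \<beta>, ?Y \<beta>)) \<in> PiM UNIV digit_law \<rightarrow>\<^sub>M borel \<Otimes>\<^sub>M borel"
        by (intro measurable_Pair m Ym)
      have "emeasure (distr (PiM UNIV digit_law) borel (\<lambda>\<beta>. offset \<beta> (Suc k))) A =
          emeasure (PiM UNIV digit_law) ((\<lambda>\<beta>. offset \<beta> (Suc k)) -` A \<inter> space (PiM UNIV digit_law))"
        by (rule emeasure_distr[OF _ A]) (unfold offset_def, intro borel_measurable_sum m)
      also have "(\<lambda>\<beta>. offset \<beta> (Suc k)) -` A \<inter> space (PiM UNIV digit_law) = (\<lambda>\<beta>. (?X \<beta>, ?Y \<beta>)) -` ?S \<inter> space (PiM UNIV digit_law)"
        by (auto simp: offset_def add.commute)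
      also have "emeasure (PiM UNIV digit_law) \<dots> = emeasure (digit_law (Suc k) \<Otimes>\<^sub>M uniform_upto L) ?S"
        unfolding joint[symmetric] by (rule emeasure_distr[OF pm S, symmetric])
      also have "\<dots> = (\<integral>\<^sup>+ x. emeasure (uniform_upto L) (Pair x -` ?S) \<partial>digit_law (Suc k))"
        by (rule U.emeasure_pair_measure_alt[OF S'])
      also have "\<dots> = (\<integral>\<^sup>+ b. emeasure (uniform_upto L) (Pair (L * real b) -` ?S) \<partial>measure_pmf (pmf_of_set {..<64::nat}))"
      proof -
        have "(\<lambda>x. emeasure (uniform_upto L) (Pair x -` ?S)) \<in> borel_measurable (digit_law (Suc k))"
          by (rule U.measurable_emeasure_Pair[OF S'])
        then have "(\<lambda>x. emeasure (uniform_upto L) (Pair x -` ?S)) \<in> borel_measurable borel"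
          using measurable_cong_sets[OF sets_digit_law refl] by blast
        then show ?thesis by (simp add: digit_law_def nn_integral_distr L_def)
      qed
      also have "\<dots> = (\<Sum>b<64. emeasure (uniform_upto L) (Pair (L * real b) -` ?S)) / 64"
        by (subst nn_integral_pmf_of_set) (auto simp: lessThan_empty_iff)
      also have "\<dots> = (\<Sum>b<64. emeasure lborel (A \<inter> {L * real b..<L * real b + L}) / ennreal L) / 64"
      proof (intro arg_cong[where f="\<lambda>x. x / 64"] sum.cong refl)
        fix b :: nat
        have "Pair (L * real b) -` ?S \<in> sets borel"
        proof -
          have "(\<lambda>x. L * real b + x) \<in> borel_measurable borel" by measurable
          from measurable_sets[OF this A] show ?thesis by (simp add: vimage_def)
        qed
        then have "emeasure (uniform_upto L) (Pair (L * real b) -` ?S) = emeasure lborel ({0..<L} \<inter> Pair (L * real b) -` ?S) / emeasure lborel {0..<L}"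
          by (intro emeasure_uniform_measure) auto
        also have "{0..<L} \<inter> Pair (L * real b) -` ?S = {x. x + L * real b \<in> A \<inter> {L * real b..<L * real b + L}}"
          by (auto simp: add.commute)
        also have "emeasure lborel \<dots> = emeasure lborel (A \<inter> {L * real b..<L * real b + L})"
          by (rule emeasure_lborel_shift) simp
        finally show "emeasure (uniform_upto L) (Pair (L * real b) -` ?S) = emeasure lborel (A \<inter> {L * real b..<L * real b + L}) / ennreal L"
          using L by simp
      qed
      also have "\<dots> = (\<Sum>b<64. emeasure lborel (A \<inter> {L * real b..<L * real b + L})) / ennreal L / 64"
        by (simp only: divide_ennreal_def sum_distrib_right)
      also have "(\<Sum>b<n. emeasure lborel (A \<inter> {L * real b..<L * real b + L})) = emeasure lborel (A \<inter> {0..<L * real n})" for n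
      proof (induction n)
        case (Suc n)
        have "emeasure lborel (A \<inter> {0..<L * real n}) + emeasure lborel (A \<inter> {L * real n..<L * real n + L}) =
            emeasure lborel (A \<inter> {0..<L * real n} \<union> A \<inter> {L * real n..<L * real n + L})"
          by (rule plus_emeasure) auto
        also have "A \<inter> {0..<L * real n} \<union> A \<inter> {L * real n..<L * real n + L} = A \<inter> {0..<L * real (Suc n)}"
        proof -
          have "0 \<le> L * real n" "L * real n \<le> L * real n + L" using L by auto
          then have "{0..<L * real n} \<union> {L * real n..<L * real n + L} = {0..<L * real n + L}" by (rule ivl_disj_un_two(3))
          then show ?thesis by (simp add: Int_Un_distrib[symmetric] algebra_simps)
        qed
        finally show ?case using Suc by simp
      qed simp
      also have "emeasure lborel (A \<inter> {0..<L * real 64}) / ennreal L / 64 = emeasure lborel ({0..<period (Suc k)} \<inter> A) / emeasure lborel {0..<period (Suc k)}"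
      proof -
        have e: "emeasure lborel {0..<period (Suc k)} = ennreal L * 64"
          using L by (simp add: period_Suc L_def[symmetric] ennreal_mult)
        have "x / ennreal L / 64 = x / (ennreal L * 64)" for x :: ennreal
          unfolding divide_ennreal_def using L
          by (subst ennreal_inverse_mult) (auto simp: mult.assoc)
        then show ?thesis unfolding e by (simp add: period_Suc L_def[symmetric] Int_commute)
      qed
      also have "\<dots> = emeasure (uniform_upto (period (Suc k))) A"
        by (rule emeasure_uniform_measure[symmetric]) auto
      finally show "emeasure (distr (PiM UNIV digit_law) borel (\<lambda>\<beta>. offset \<beta> (Suc k))) A = emeasure (uniform_upto (period (Suc k))) A" .
    qed simp
  }
qed

lemma offset_law_component:
  "distr offset_law borel (\<lambda>u. u k) = uniform_upto (period k)"
proof -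
  have "distr offset_law borel (\<lambda>u. u k) = distr (PiM UNIV digit_law) borel (\<lambda>\<beta>. offset \<beta> k)"
    unfolding offset_law_def by (subst distr_distr[OF _ offset_measurable]) (auto simp: o_def)
  then show ?thesis by (simp add: offset_digit_law)
qed

lemma offset_law_component_measurable [measurable]: "(\<lambda>u. u k) \<in> borel_measurable offset_law"
  by (simp add: offset_law_def)

lemma sets_offset_law [measurable_cong]: "sets offset_law = sets (PiM UNIV (\<lambda>_. borel))"
  by (simp add: offset_law_def)

lemma space_offset_law [simp]: "space offset_law = UNIV"
  by (simp add: offset_law_def space_PiM)

text \<open>
  The points of a later grid belong to all earlier grids, and the offsets are reduced.
\<close>

definition nested_offsets :: "(nat \<Rightarrow> real) \<Rightarrow> bool" where
  "nested_offsets u \<longleftrightarrow> (\<forall>k j. u k = wrap (period k) (u (k + j)))"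

lemma AE_digits:
  "AE \<beta> in PiM UNIV digit_law. 0 \<le> \<beta> 0 \<and> \<beta> 0 < 16 \<and> (\<forall>j. \<exists>b::nat. b < 64 \<and> \<beta> (Suc j) = period j * real b)"
proof -
  have "AE x in digit_law 0. 0 \<le> x \<and> x < 16"
  proof -
    have 0: "digit_law 0 = uniform_upto 16" by (simp add: digit_law_def)
    show ?thesis unfolding 0 by (rule AE_uniform_measureI) auto
  qed
  then have 0: "AE \<beta> in PiM UNIV digit_law. 0 \<le> \<beta> 0 \<and> \<beta> 0 < 16"
    by (intro AE_PiM_component prob_space_digit_law) auto
  have "AE x in digit_law (Suc j). \<exists>b::nat. b < 64 \<and> x = period j * real b" for j
    unfolding digit_law_def nat.case
    by (subst AE_distr_iff) (auto simp: AE_measure_pmf_iff lessThan_empty_iff intro!: pred_intros_countable)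
  then have "AE \<beta> in PiM UNIV digit_law. \<exists>b::nat. b < 64 \<and> \<beta> (Suc j) = period j * real b" for j
    by (intro AE_PiM_component prob_space_digit_law) auto
  with 0 show ?thesis by (simp add: AE_all_countable)
qed

lemma offset_nested:
  assumes "0 \<le> \<beta> 0" "\<beta> 0 < 16" "\<And>j. \<exists>b::nat. b < 64 \<and> \<beta> (Suc j) = period j * real b"
  shows "nested_offsets (offset \<beta>)"
proof -
  obtain b :: "nat \<Rightarrow> nat" where b: "\<And>j. b j < 64 \<and> \<beta> (Suc j) = period j * real (b j)"
    using assms(3) by metis
  have step: "offset \<beta> (Suc k) = offset \<beta> k + period k * real (b k)" for k
    using b[of k] by (simp add: offset_def)
  have bounds: "0 \<le> offset \<beta> k \<and> offset \<beta> k < period k" for k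
  proof (induction k)
    case 0 then show ?case using assms by (simp add: offset_def period_def)
  next
    case (Suc k)
    have "real (b k) + 1 \<le> 64" using b[of k] by linarith
    then have "period k * (real (b k) + 1) \<le> period k * 64" using less_imp_le[OF period_pos] by (intro mult_left_mono)
    moreover have "0 \<le> period k * real (b k)" using less_imp_le[OF period_pos] by (intro mult_nonneg_nonneg) auto
    ultimately show ?case using Suc unfolding step period_Suc distrib_left mult_1_right by linarith
  qed
  have diff: "\<exists>m::int. offset \<beta> (k + j) = offset \<beta> k + period k * of_int m" for k j
  proof (induction j)
    case 0 show ?case by (rule exI[of _ 0]) simp
  next
    case (Suc j)
    then obtain m :: int where "offset \<beta> (k + j) = offset \<beta> k + period k * of_int m" by blast
    then have "offset \<beta> (k + Suc j) = offset \<beta> k + period k * of_int (m + int (64 ^ j * b (k + j)))"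
      using step[of "k + j"] unfolding add_Suc_right period_add[of k j]
      by (simp add: algebra_simps)
    then show ?case by blast
  qed
  show ?thesis unfolding nested_offsets_def
  proof (intro allI)
    fix k j
    obtain m :: int where "offset \<beta> (k + j) = offset \<beta> k + period k * of_int m" using diff by blast
    then show "offset \<beta> k = wrap (period k) (offset \<beta> (k + j))"
      using bounds[of k] by (intro wrap_eqI[symmetric]) auto
  qed
qed

lemma measurable_nested_offsets [measurable]: "Measurable.pred (PiM UNIV (\<lambda>_. borel)) nested_offsets"
  unfolding nested_offsets_def[abs_def]
proof (intro pred_intros_countable)
  fix k j :: nat
  have c: "(\<lambda>u. u i) \<in> borel_measurable (PiM UNIV (\<lambda>_::nat. borel :: real measure))" for i
    by (rule measurable_component_singleton) simp
  have "{u\<in>space (PiM UNIV (\<lambda>_::nat. borel :: real measure)). u k = wrap (period k) (u (k + j))} \<in> sets (PiM UNIV (\<lambda>_. borel))"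
    by (rule borel_measurable_eq[OF c measurable_compose[OF c borel_measurable_wrap]])
  then show "Measurable.pred (PiM UNIV (\<lambda>_. borel)) (\<lambda>u. u k = wrap (period k) (u (k + j)))"
    by (simp add: pred_def)
qed

lemma AE_nested_offsets: "AE u in offset_law. nested_offsets u"
  unfolding offset_law_def
proof (subst AE_distr_iff[OF offset_measurable])
  show "{u\<in>space (PiM UNIV (\<lambda>_. borel)). nested_offsets u} \<in> sets (PiM UNIV (\<lambda>_::nat. borel))"
    using measurable_nested_offsets by (simp add: pred_def)
  show "AE \<beta> in PiM UNIV digit_law. nested_offsets (offset \<beta>)"
    using AE_digits by eventually_elim (intro offset_nested, auto)
qed

definition shift_offsets :: "real \<Rightarrow> (nat \<Rightarrow> real) \<Rightarrow> nat \<Rightarrow> real" where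
  "shift_offsets t u k = wrap (period k) (u k + t)"

lemma shift_offsets_measurable [measurable]:
  "shift_offsets t \<in> PiM UNIV (\<lambda>_. borel) \<rightarrow>\<^sub>M PiM UNIV (\<lambda>_. borel)"
  by (rule measurable_PiM_single') (auto simp: shift_offsets_def space_PiM)

text \<open>
  The offsets of the first grids are functions of a later offset, which is uniform; and a uniform
  offset stays uniform when it is translated modulo its period.
\<close>

lemma shift_offsets_law: "distr offset_law offset_law (shift_offsets t) = offset_law"
proof (rule measure_eqI_PiM_infinite[where I="UNIV :: nat set" and M="\<lambda>_. borel"])
  show "sets (distr offset_law offset_law (shift_offsets t)) = sets (PiM UNIV (\<lambda>_. borel))"
    by (simp add: sets_offset_law)
  show "sets offset_law = sets (PiM UNIV (\<lambda>_. borel))" by (rule sets_offset_law)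
  interpret prob_space offset_law by (rule prob_space_offset_law)
  have sm: "shift_offsets t \<in> offset_law \<rightarrow>\<^sub>M offset_law" by measurable
  show "finite_measure (distr offset_law offset_law (shift_offsets t))"
    by (intro prob_space.finite_measure prob_space_distr sm)
  fix A :: "nat \<Rightarrow> real set" and J :: "nat set"
  assume J: "finite J" "J \<subseteq> UNIV" and A: "\<And>i. i \<in> J \<Longrightarrow> A i \<in> sets borel"
  obtain n where n: "\<And>k. k \<in> J \<Longrightarrow> k \<le> n" using finite_nat_set_iff_bounded_le[of J] J by auto
  define G where "G = {v. \<forall>k\<in>J. wrap (period k) v \<in> A k}"
  have G[measurable]: "G \<in> sets borel"
  proof -
    have "{v\<in>space borel. \<forall>k\<in>J. wrap (period k) v \<in> A k} \<in> sets borel"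
      using A J by (intro sets.sets_Collect_finite_All) auto
    then show ?thesis by (simp add: G_def)
  qed
  let ?C = "prod_emb UNIV (\<lambda>_. borel) J (PiE J A)"
  have C: "?C = {u. \<forall>k\<in>J. u k \<in> A k}" by (auto simp: prod_emb_def PiE_iff)
  have Cs: "?C \<in> sets offset_law" unfolding sets_offset_law using J A by (intro sets_PiM_I) auto
  have law_n: "emeasure offset_law {u. wrap (period n) (u n + s) \<in> G} = emeasure (uniform_upto (period n)) G" for s
  proof -
    have "emeasure (uniform_upto (period n)) G = emeasure (distr (uniform_upto (period n)) borel (\<lambda>x. wrap (period n) (x + s))) G"
      by (simp add: wrap_uniform)
    also have "\<dots> = emeasure (distr offset_law borel (\<lambda>u. wrap (period n) (u n + s))) G"
      unfolding offset_law_component[symmetric] by (subst distr_distr) (auto simp: o_def)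
    also have "\<dots> = emeasure offset_law {u. wrap (period n) (u n + s) \<in> G}"
      by (subst emeasure_distr) (auto simp: vimage_def)
    finally show ?thesis ..
  qed
  have wn: "wrap (period k) (wrap (period n) x) = wrap (period k) x" if "k \<le> n" for k x
    using wrap_wrap_multiple[of "period k" "64 ^ (n - k)" x] period_add[of k "n - k"] that by simp
  have "emeasure (distr offset_law offset_law (shift_offsets t)) ?C = emeasure offset_law (shift_offsets t -` ?C \<inter> space offset_law)"
    by (rule emeasure_distr[OF sm Cs])
  also have "\<dots> = emeasure offset_law {u. wrap (period n) (u n + t) \<in> G}"
  proof (rule emeasure_eq_AE)
    show "AE u in offset_law. u \<in> shift_offsets t -` ?C \<inter> space offset_law \<longleftrightarrow> u \<in> {u. wrap (period n) (u n + t) \<in> G}"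
      using AE_nested_offsets
    proof eventually_elim
      case (elim u)
      have "wrap (period k) (wrap (period n) (u n + t)) = wrap (period k) (u k + t)" if "k \<in> J" for k
      proof -
        have "u k = wrap (period k) (u n)" using elim n[OF that] le_add_diff_inverse[of k n] unfolding nested_offsets_def by metis
        then show ?thesis using wn[OF n[OF that]] wrap_wrap_add[of "period k" "u n" t] by simp
      qed
      then show ?case unfolding C by (auto simp: G_def shift_offsets_def)
    qed
    show "shift_offsets t -` ?C \<inter> space offset_law \<in> sets offset_law" by (rule measurable_sets[OF sm Cs])
    have "(\<lambda>u. wrap (period n) (u n + t)) -` G \<inter> space offset_law \<in> sets offset_law"
      by (rule measurable_sets[OF _ G]) measurable
    then show "{u. wrap (period n) (u n + t) \<in> G} \<in> sets offset_law" by (simp add: vimage_def)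
  qed
  also have "\<dots> = emeasure offset_law {u. wrap (period n) (u n + 0) \<in> G}" unfolding law_n ..
  also have "\<dots> = emeasure offset_law ?C"
  proof (rule emeasure_eq_AE)
    show "AE u in offset_law. u \<in> {u. wrap (period n) (u n + 0) \<in> G} \<longleftrightarrow> u \<in> ?C"
      using AE_nested_offsets
    proof eventually_elim
      case (elim u)
      have "wrap (period k) (wrap (period n) (u n)) = u k" if "k \<in> J" for k
        using elim n[OF that] le_add_diff_inverse[of k n] wn[OF n[OF that]] unfolding nested_offsets_def by metis
      then show ?case unfolding C by (auto simp: G_def)
    qed
    have "(\<lambda>u. wrap (period n) (u n + 0)) -` G \<inter> space offset_law \<in> sets offset_law"
      by (rule measurable_sets[OF _ G]) measurable
    then show "{u. wrap (period n) (u n + 0) \<in> G} \<in> sets offset_law" by (simp add: vimage_def)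
  qed (rule Cs)
  finally show "emeasure (distr offset_law offset_law (shift_offsets t)) ?C = emeasure offset_law ?C" .
qed

subsection \<open>Grids in Euclidean space\<close>

definition grid_law :: "('d::finite \<Rightarrow> nat \<Rightarrow> real) measure" where
  "grid_law = PiM UNIV (\<lambda>_. offset_law)"

definition shift_grid :: "(real ^ 'd) \<Rightarrow> ('d \<Rightarrow> nat \<Rightarrow> real) \<Rightarrow> 'd \<Rightarrow> nat \<Rightarrow> real" where
  "shift_grid t u = (\<lambda>i. shift_offsets (t $ i) (u i))"

lemma prob_space_grid_law: "prob_space grid_law"
  unfolding grid_law_def by (intro prob_space_PiM prob_space_offset_law)

lemma space_grid_law [simp]: "space grid_law = UNIV"
  by (simp add: grid_law_def space_PiM)

lemma grid_offset_measurable [measurable]: "(\<lambda>u. u i k) \<in> borel_measurable grid_law"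
proof -
  have "(\<lambda>u. u i) \<in> grid_law \<rightarrow>\<^sub>M offset_law" unfolding grid_law_def by (rule measurable_component_singleton) simp
  then show ?thesis by measurable
qed

lemma shift_grid_measurable: "shift_grid t \<in> grid_law \<rightarrow>\<^sub>M grid_law"
  unfolding grid_law_def
proof (rule measurable_PiM_single')
  fix i
  have "shift_offsets (t $ i) \<in> offset_law \<rightarrow>\<^sub>M offset_law" by measurable
  from measurable_compose[OF measurable_component_singleton[of i UNIV "\<lambda>_. offset_law"] this]
  show "(\<lambda>u. shift_grid t u i) \<in> PiM UNIV (\<lambda>_. offset_law) \<rightarrow>\<^sub>M offset_law" by (simp add: shift_grid_def)
qed (auto simp: space_PiM)

lemma shift_grid_law: "distr grid_law grid_law (shift_grid t) = (grid_law :: ('d::finite \<Rightarrow> nat \<Rightarrow> real) measure)"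
proof -
  interpret product_prob_space "\<lambda>_::'d. offset_law" UNIV by (intro product_prob_spaceI prob_space_offset_law)
  have "distr grid_law grid_law (shift_grid t) = PiM UNIV (\<lambda>_::'d. offset_law)"
  proof (rule PiM_eqI)
    show "sets (distr grid_law grid_law (shift_grid t)) = sets (PiM UNIV (\<lambda>_::'d. offset_law))" by (simp add: grid_law_def)
    fix A :: "'d \<Rightarrow> (nat \<Rightarrow> real) set" assume A: "\<And>i. i \<in> UNIV \<Longrightarrow> A i \<in> sets offset_law"
    have sm: "shift_offsets s \<in> offset_law \<rightarrow>\<^sub>M offset_law" for s by measurable
    have B: "shift_offsets s -` A i \<in> sets offset_law" for s i
      using measurable_sets[OF sm A[of i]] by simp
    have "emeasure (distr grid_law grid_law (shift_grid t)) (PiE UNIV A) = emeasure grid_law (shift_grid t -` PiE UNIV A \<inter> space grid_law)"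
      using A by (intro emeasure_distr shift_grid_measurable) (auto simp: grid_law_def intro!: sets_PiM_I_finite)
    also have "shift_grid t -` PiE UNIV A \<inter> space grid_law = PiE UNIV (\<lambda>i. shift_offsets (t $ i) -` A i)"
      by (auto simp: shift_grid_def PiE_iff)
    also have "emeasure grid_law \<dots> = (\<Prod>i\<in>UNIV. emeasure offset_law (shift_offsets (t $ i) -` A i))"
      unfolding grid_law_def using B by (intro emeasure_PiM) auto
    also have "\<dots> = (\<Prod>i\<in>UNIV. emeasure offset_law (A i))"
    proof (intro prod.cong refl)
      fix i
      have "emeasure offset_law (A i) = emeasure (distr offset_law offset_law (shift_offsets (t $ i))) (A i)"
        by (simp add: shift_offsets_law)
      also have "\<dots> = emeasure offset_law (shift_offsets (t $ i) -` A i)"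
        using emeasure_distr[OF sm A[of i]] by simp
      finally show "emeasure offset_law (shift_offsets (t $ i) -` A i) = emeasure offset_law (A i)" ..
    qed
    finally show "emeasure (distr grid_law grid_law (shift_grid t)) (PiE UNIV A) = (\<Prod>i\<in>UNIV. emeasure offset_law (A i))" .
  qed simp
  then show ?thesis by (simp add: grid_law_def)
qed

lemma grid_law_component: "distr grid_law borel (\<lambda>u. u i k) = uniform_upto (period k)"
proof -
  have c: "(\<lambda>u. u i) \<in> grid_law \<rightarrow>\<^sub>M offset_law" unfolding grid_law_def by (rule measurable_component_singleton) simp
  have "distr grid_law borel (\<lambda>u. u i k) = distr (distr grid_law offset_law (\<lambda>u. u i)) borel (\<lambda>v. v k)"
    by (subst distr_distr[OF _ c]) (auto simp: o_def)
  also have "distr grid_law offset_law (\<lambda>u. u i) = offset_law"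
    unfolding grid_law_def by (intro distr_PiM_component prob_space_offset_law) simp
  finally show ?thesis by (simp add: offset_law_component)
qed

lemma AE_nested_grid: "AE u in (grid_law :: ('d::finite \<Rightarrow> nat \<Rightarrow> real) measure). \<forall>i. nested_offsets (u i)"
proof -
  have "AE u in grid_law. nested_offsets (u i)" for i :: 'd
    unfolding grid_law_def by (intro AE_PiM_component prob_space_offset_law AE_nested_offsets) simp
  then have "AE u in grid_law. \<forall>i\<in>(UNIV :: 'd set). nested_offsets (u i)" by (intro AE_finite_allI) auto
  then show ?thesis by simp
qed

section \<open>Matching level by level\<close>

text \<open>
  At every level the space is partitioned into boxes, and a point enters the game at the one level
  that owns it.  In every box the points of both colours that are still available are ranked, and
  points of equal rank are matched; the surplus stays available at the next level.  The points that
  the level owns come last in the ranking, so that the surplus consists of such points if there are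
  enough of them.
\<close>

locale levels =
  fixes same :: "nat \<Rightarrow> 'a \<Rightarrow> 'a \<Rightarrow> bool" and own :: "nat \<Rightarrow> 'a \<Rightarrow> bool" and prec :: "nat \<Rightarrow> 'a \<Rightarrow> 'a \<Rightarrow> bool"
  assumes same_refl: "same n x x" and same_sym: "same n x y \<Longrightarrow> same n y x"
    and same_trans: "same n x y \<Longrightarrow> same n y z \<Longrightarrow> same n x z"
    and same_Suc: "same n x y \<Longrightarrow> same (Suc n) x y"
    and own_unique: "own n x \<Longrightarrow> own m x \<Longrightarrow> n = m"
    and prec_irrefl: "\<not> prec n x x" and prec_trans: "prec n x y \<Longrightarrow> prec n y z \<Longrightarrow> prec n x z"
    and prec_total: "x \<noteq> y \<Longrightarrow> prec n x y \<or> prec n y x"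
    and prec_own: "\<not> own n x \<Longrightarrow> own n y \<Longrightarrow> prec n x y"
begin

lemma same_mono: "same n x y \<Longrightarrow> n \<le> m \<Longrightarrow> same m x y"
  by (induction m) (auto simp: le_Suc_eq intro: same_Suc)

text \<open>
  The points of \<open>V\<close> that are available at a level when they are matched with those of \<open>W\<close>.  A point
  stays available if its rank exceeds the ranks of the other colour.
\<close>

primrec pool :: "nat \<Rightarrow> 'a set \<Rightarrow> 'a set \<Rightarrow> 'a set" where
  "pool 0 = (\<lambda>V W. {x\<in>V. own 0 x})"
| "pool (Suc n) = (\<lambda>V W. {x\<in>V. own (Suc n) x} \<union>
     {x\<in>pool n V W. card {y\<in>pool n W V. same n x y} \<le> card {y\<in>pool n V W. same n x y \<and> prec n y x}})"

definition rank :: "nat \<Rightarrow> 'a set \<Rightarrow> 'a set \<Rightarrow> 'a \<Rightarrow> nat" where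
  "rank n V W x = card {y\<in>pool n V W. same n x y \<and> prec n y x}"

lemma pool_Suc:
  "x \<in> pool (Suc n) V W \<longleftrightarrow> x \<in> V \<and> own (Suc n) x \<or> x \<in> pool n V W \<and> card {y\<in>pool n W V. same n x y} \<le> rank n V W x"
  by (auto simp: rank_def)

declare pool.simps(2) [simp del]

definition matched_at :: "nat \<Rightarrow> 'a set \<Rightarrow> 'a set \<Rightarrow> 'a \<Rightarrow> 'a \<Rightarrow> bool" where
  "matched_at n V W x y \<longleftrightarrow> x \<in> pool n V W \<and> y \<in> pool n W V \<and> same n x y \<and> rank n V W x = rank n W V y"

definition edges :: "'a set \<Rightarrow> 'a set \<Rightarrow> ('a \<times> 'a) set" where
  "edges V W = {(x, y). \<exists>n. matched_at n V W x y}"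

definition entered :: "nat \<Rightarrow> 'a set \<Rightarrow> 'a \<Rightarrow> 'a set" where
  "entered n V x = {y\<in>V. same n x y \<and> (\<exists>k\<le>n. own k y)}"

definition finite_boxes :: "'a set \<Rightarrow> bool" where
  "finite_boxes V \<longleftrightarrow> (\<forall>n x. finite {y\<in>V. same n x y})"

lemma finite_box: "finite_boxes V \<Longrightarrow> A \<subseteq> {y\<in>V. same n x y} \<Longrightarrow> finite A"
  unfolding finite_boxes_def using finite_subset by blast

lemma pool_subset: "pool n V W \<subseteq> V"
  by (induction n) (auto simp: pool_Suc)

lemma pool_own: "x \<in> pool n V W \<Longrightarrow> \<exists>k\<le>n. own k x"
proof (induction n)
  case (Suc n)
  then show ?case
  proof (cases "own (Suc n) x")
    case False
    then have "x \<in> pool n V W" using Suc.prems by (simp add: pool_Suc)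
    then show ?thesis using Suc.IH le_SucI by blast
  qed auto
qed auto

lemma own_pool: "own n x \<Longrightarrow> x \<in> V \<Longrightarrow> x \<in> pool n V W"
  by (cases n) (auto simp: pool_Suc)

lemma pool_Suc_iff:
  assumes "x \<in> pool n V W"
  shows "x \<in> pool (Suc n) V W \<longleftrightarrow> card {y\<in>pool n W V. same n x y} \<le> rank n V W x"
proof -
  obtain k where "k \<le> n" "own k x" using pool_own[OF assms] by blast
  then have "\<not> own (Suc n) x" using own_unique[of k x "Suc n"] by auto
  then show ?thesis using assms by (simp add: pool_Suc)
qed

text \<open>
  A point enters the pools only at the level that owns it, so it does not return after it has left.
\<close>

lemma pool_left:
  assumes "x \<in> pool n V W" "x \<notin> pool (Suc n) V W" "n < m"
  shows "x \<notin> pool m V W"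
  using \<open>n < m\<close>
proof (induction m)
  case (Suc m)
  obtain k where k: "k \<le> n" "own k x" using pool_own[OF assms(1)] by blast
  then have "\<not> own (Suc m) x" using own_unique[of k x "Suc m"] Suc.prems by auto
  then show ?case using Suc assms(2) by (cases "n = m") (auto simp: pool_Suc)
qed simp

lemma leave_level:
  assumes k: "x \<in> pool k V W" and m: "x \<notin> pool m V W" "k \<le> m"
  obtains j where "k \<le> j" "j < m" "x \<in> pool j V W" "x \<notin> pool (Suc j) V W"
proof -
  have "\<exists>j\<ge>k. j < m \<and> x \<in> pool j V W \<and> x \<notin> pool (Suc j) V W"
    using m
  proof (induction m)
    case 0
    then show ?case using k by simp
  next
    case (Suc m)
    have "k \<noteq> Suc m" using k Suc.prems(1) by auto
    then have km: "k \<le> m" using Suc.prems(2) by simp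
    show ?case
    proof (cases "x \<in> pool m V W")
      case True
      then show ?thesis using Suc.prems(1) km lessI by blast
    next
      case False
      then show ?thesis using Suc.IH km less_SucI by blast
    qed
  qed
  then show ?thesis using that by blast
qed

lemma pool_same_box:
  "same n x y \<Longrightarrow> {z\<in>pool n V W. same n x z} = {z\<in>pool n V W. same n y z}"
  using same_trans[of n x y] same_trans[of n y x] same_sym[of n x y] by auto

lemma rank_less_rank:
  assumes V: "finite_boxes V" and "x \<in> pool n V W" "y \<in> pool n V W" "same n x y" "prec n x y"
  shows "rank n V W x < rank n V W y"
  unfolding rank_def
proof (rule psubset_card_mono)
  show "finite {z\<in>pool n V W. same n y z \<and> prec n z y}"
    using pool_subset by (intro finite_box[OF V, of _ n y]) blast
  have "x \<in> {z\<in>pool n V W. same n y z \<and> prec n z y}" using assms same_sym[of n x y] by auto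
  moreover have "x \<notin> {z\<in>pool n V W. same n x z \<and> prec n z x}" using prec_irrefl by auto
  moreover have "{z\<in>pool n V W. same n x z \<and> prec n z x} \<subseteq> {z\<in>pool n V W. same n y z \<and> prec n z y}"
    using same_trans[OF same_sym[OF assms(4)]] prec_trans[OF _ assms(5)] by auto
  ultimately show "{z\<in>pool n V W. same n x z \<and> prec n z x} \<subset> {z\<in>pool n V W. same n y z \<and> prec n z y}" by blast
qed

lemma rank_inj:
  assumes V: "finite_boxes V" and "x \<in> pool n V W" "y \<in> pool n V W" "same n x y" "rank n V W x = rank n V W y"
  shows "x = y"
  using assms rank_less_rank[OF V, of x n W y] rank_less_rank[OF V, of y n W x] prec_total[of x y n] same_sym[of n x y]
  by auto

lemma rank_less:
  assumes V: "finite_boxes V" and x: "x \<in> pool n V W"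
  shows "rank n V W x < card {y\<in>pool n V W. same n x y}"
  unfolding rank_def
proof (rule psubset_card_mono)
  show "finite {y\<in>pool n V W. same n x y}"
    using pool_subset by (intro finite_box[OF V, of _ n x]) blast
  have "x \<in> {y\<in>pool n V W. same n x y}" using x same_refl by auto
  moreover have "x \<notin> {y\<in>pool n V W. same n x y \<and> prec n y x}" using prec_irrefl by auto
  moreover have "{y\<in>pool n V W. same n x y \<and> prec n y x} \<subseteq> {y\<in>pool n V W. same n x y}" by auto
  ultimately show "{y\<in>pool n V W. same n x y \<and> prec n y x} \<subset> {y\<in>pool n V W. same n x y}" by blast
qed

lemma rank_surj:
  assumes V: "finite_boxes V" and k: "k < card {y\<in>pool n V W. same n x y}"
  obtains y where "y \<in> pool n V W" "same n x y" "rank n V W y = k"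
proof -
  let ?P = "{y\<in>pool n V W. same n x y}"
  have inj: "inj_on (rank n V W) ?P"
  proof (rule inj_onI)
    fix y z assume yz: "y \<in> ?P" "z \<in> ?P" "rank n V W y = rank n V W z"
    then have "same n y z" using same_trans[OF same_sym[of n x y]] by simp
    then show "y = z" using rank_inj[OF V, of y n W z] yz by simp
  qed
  have "rank n V W ` ?P \<subseteq> {..<card ?P}"
  proof
    fix k assume "k \<in> rank n V W ` ?P"
    then obtain y where y: "y \<in> ?P" "k = rank n V W y" by blast
    then show "k \<in> {..<card ?P}" using rank_less[OF V, of y n W] pool_same_box[of n x y V W] by simp
  qed
  then have "rank n V W ` ?P = {..<card ?P}"
    by (rule card_subset_eq[OF finite_lessThan]) (simp add: card_image[OF inj])
  then have "k \<in> rank n V W ` ?P" using k by simp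
  then show ?thesis using that by blast
qed

lemma matched_at_sym: "matched_at n V W x y \<Longrightarrow> matched_at n W V y x"
  by (auto simp: matched_at_def intro: same_sym)

lemma matched_leaves:
  assumes W: "finite_boxes W" and m: "matched_at n V W x y"
  shows "x \<in> pool n V W" "x \<notin> pool (Suc n) V W"
proof -
  show x: "x \<in> pool n V W" using m by (simp add: matched_at_def)
  have "rank n V W x < card {z\<in>pool n W V. same n y z}"
    using m rank_less[OF W, of y n V] by (simp add: matched_at_def)
  also have "{z\<in>pool n W V. same n y z} = {z\<in>pool n W V. same n x z}"
    using m pool_same_box[of n x y W V] by (simp add: matched_at_def)
  finally show "x \<notin> pool (Suc n) V W" using pool_Suc_iff[OF x] by simp
qed

lemma leaves_matched:
  assumes W: "finite_boxes W" and x: "x \<in> pool n V W" "x \<notin> pool (Suc n) V W"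
  obtains y where "matched_at n V W x y"
proof -
  have "rank n V W x < card {y\<in>pool n W V. same n x y}" using x pool_Suc_iff by auto
  then obtain y where "y \<in> pool n W V" "same n x y" "rank n W V y = rank n V W x"
    by (rule rank_surj[OF W])
  then have "matched_at n V W x y" using x by (simp add: matched_at_def)
  then show ?thesis by (rule that)
qed

lemma matched_unique:
  assumes V: "finite_boxes V" and W: "finite_boxes W"
    and m: "matched_at n V W x y" "matched_at n' V W x y'"
  shows "n = n'" "y = y'"
proof -
  show n: "n = n'"
    using matched_leaves[OF W m(1)] matched_leaves[OF W m(2)] pool_left
    by (metis linorder_neqE_nat)
  have "same n y y'" using m n same_trans[OF same_sym[of n x y], of y'] unfolding matched_at_def by simp
  then show "y = y'" using m n unfolding matched_at_def by (intro rank_inj[OF W, of y n V y']) auto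
qed

lemma entered_eq: "entered n V x = {y\<in>pool n V W. same n x y} \<union> (entered n V x - pool n V W)"
proof -
  have "{y\<in>pool n V W. same n x y} \<subseteq> entered n V x"
    using pool_subset[of n V W] pool_own[of _ n V W] by (auto simp: entered_def)
  moreover have "entered n V x \<inter> pool n V W \<subseteq> {y\<in>pool n V W. same n x y}" by (auto simp: entered_def)
  ultimately show ?thesis by blast
qed

lemma finite_entered: "finite_boxes V \<Longrightarrow> finite (entered n V x)"
  by (rule finite_box[of V _ n x]) (auto simp: entered_def)

text \<open>The points of a box that have left are matched with each other.\<close>

lemma card_left_le:
  assumes V: "finite_boxes V" and W: "finite_boxes W"
  shows "card (entered n V x - pool n V W) \<le> card (entered n W x - pool n W V)"
proof -
  have "\<exists>y. y \<in> entered n W x - pool n W V \<and> (\<exists>m. matched_at m V W z y)"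
    if z: "z \<in> entered n V x - pool n V W" for z
  proof -
    obtain k where k: "k \<le> n" "own k z" "z \<in> V" "same n x z" using z by (auto simp: entered_def)
    have "z \<in> pool k V W" using own_pool k by blast
    then obtain j where j: "j < n" "z \<in> pool j V W" "z \<notin> pool (Suc j) V W"
      using leave_level[of z k V W n] k(1) z by blast
    then obtain y where y: "matched_at j V W z y" using leaves_matched[OF W] by blast
    note y' = matched_leaves[OF V matched_at_sym[OF y]]
    have "y \<notin> pool n W V" using pool_left[OF y'] j(1) by blast
    moreover have "y \<in> W" using y' pool_subset by blast
    moreover have "\<exists>k\<le>n. own k y" using pool_own[OF y'(1)] j(1) by (meson less_imp_le order_trans)
    moreover have "same n x y"
      using same_trans[OF k(4), of y] y j(1) same_mono[of j z y n] by (simp add: matched_at_def)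
    ultimately show ?thesis using y by (auto simp: entered_def)
  qed
  then obtain f where f: "\<And>z. z \<in> entered n V x - pool n V W \<Longrightarrow>
      f z \<in> entered n W x - pool n W V \<and> (\<exists>m. matched_at m V W z (f z))" by metis
  have "inj_on f (entered n V x - pool n V W)"
  proof (rule inj_onI)
    fix z z' assume z: "z \<in> entered n V x - pool n V W" "z' \<in> entered n V x - pool n V W" "f z = f z'"
    obtain m m' where "matched_at m V W z (f z)" "matched_at m' V W z' (f z)" using f z by metis
    then show "z = z'" using matched_unique(2)[OF W V] matched_at_sym by blast
  qed
  then show ?thesis
    by (rule card_inj_on_le) (use f finite_entered[OF W] in auto)
qed

text \<open>
  Those who have left a box are matched with each other inside the box; so the surplus of one colour
  among the available points is its surplus among all points that have entered.
\<close>

lemma balance: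
  assumes V: "finite_boxes V" and W: "finite_boxes W"
  shows "card (entered n V x) + card {y\<in>pool n W V. same n x y} = card (entered n W x) + card {y\<in>pool n V W. same n x y}"
proof -
  have split: "card (entered n V x) = card {y\<in>pool n V W. same n x y} + card (entered n V x - pool n V W)"
    if V: "finite_boxes V" for V W
  proof -
    have "finite {y\<in>pool n V W. same n x y}" using pool_subset by (intro finite_box[OF V, of _ n x]) blast
    moreover have "{y\<in>pool n V W. same n x y} \<inter> (entered n V x - pool n V W) = {}" by blast
    ultimately have "card ({y\<in>pool n V W. same n x y} \<union> (entered n V x - pool n V W)) =
        card {y\<in>pool n V W. same n x y} + card (entered n V x - pool n V W)"
      using finite_entered[OF V] by (intro card_Un_disjoint) auto
    then show ?thesis using entered_eq[of n V x W] by simp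
  qed
  show ?thesis
    using split[OF V, of W] split[OF W, of V] card_left_le[OF V W, of n x] card_left_le[OF W V, of n x] by linarith
qed

text \<open>
  If this holds, then only points that the level owns can stay available, by \<open>balance\<close> and the ranking.
\<close>

definition good :: "nat \<Rightarrow> 'a set \<Rightarrow> 'a set \<Rightarrow> 'a \<Rightarrow> bool" where
  "good n V W x \<longleftrightarrow> card (entered n V x) \<le> card (entered n W x) + card {y\<in>V. same n x y \<and> own n y}"

text \<open>
  The points that the level owns rank last.  If another point stayed available, then all of them
  would too, and the surplus would exceed their number.
\<close>

lemma good_exports_own:
  assumes V: "finite_boxes V" and W: "finite_boxes W" and g: "good n V W x"
    and x: "x \<in> pool n V W" "x \<in> pool (Suc n) V W"
  shows "own n x"
proof (rule ccontr)
  assume no: "\<not> own n x"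
  let ?O = "{y\<in>V. same n x y \<and> own n y}" and ?B = "{y\<in>pool n V W. same n x y \<and> prec n y x}"
  have fin: "finite {y\<in>pool n V W. same n x y}" using pool_subset by (intro finite_box[OF V, of _ n x]) blast
  have finO: "finite ?O" by (intro finite_box[OF V, of _ n x]) blast
  have finB: "finite ?B" by (rule finite_subset[OF _ fin]) blast
  have disj: "?B \<inter> ?O = {}"
  proof -
    have False if "prec n y x" "own n y" for y
      using prec_trans[OF prec_own[OF no that(2)] that(1)] prec_irrefl by blast
    then show ?thesis by blast
  qed
  have "card ?B + card ?O + 1 = card (insert x (?B \<union> ?O))"
  proof -
    have "x \<notin> ?B \<union> ?O" using no prec_irrefl by blast
    then show ?thesis using finO finB card_Un_disjoint[OF finB finO disj] by simp
  qed
  also have "\<dots> \<le> card {y\<in>pool n V W. same n x y}"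
  proof (rule card_mono[OF fin])
    show "insert x (?B \<union> ?O) \<subseteq> {y\<in>pool n V W. same n x y}"
      using x(1) own_pool[of n _ V W] same_refl by auto
  qed
  finally have "rank n V W x + card ?O + 1 \<le> card {y\<in>pool n V W. same n x y}" by (simp add: rank_def)
  moreover have "card {y\<in>pool n W V. same n x y} \<le> rank n V W x" using x pool_Suc_iff by blast
  moreover have "card (entered n V x) \<le> card (entered n W x) + card ?O" using g by (simp add: good_def)
  ultimately show False using balance[OF V W, of n x] by linarith
qed

text \<open>
  It suffices that every point leaves the pools: it leaves when it is matched.
\<close>

lemma edges_perfect:
  assumes V: "finite_boxes V" and W: "finite_boxes W" and disj: "V \<inter> W = {}"
    and leave: "\<And>x. x \<in> V \<Longrightarrow> \<exists>k m. own k x \<and> k \<le> m \<and> x \<notin> pool m V W"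
      "\<And>x. x \<in> W \<Longrightarrow> \<exists>k m. own k x \<and> k \<le> m \<and> x \<notin> pool m W V"
  shows "perfect_matching V W (edges V W)"
proof -
  have ex: "\<exists>n y. matched_at n V W x y" if W: "finite_boxes W" and x: "x \<in> V" and km: "own k x" "k \<le> m" "x \<notin> pool m V W"
    for V W x k m
  proof -
    have "x \<in> pool k V W" using own_pool km x by blast
    then obtain j where "x \<in> pool j V W" "x \<notin> pool (Suc j) V W" using leave_level km(2,3) by blast
    then show ?thesis using leaves_matched[OF W] by metis
  qed
  have sub: "edges V W \<subseteq> V \<times> W" using pool_subset[of _ V W] pool_subset[of _ W V] by (auto simp: edges_def matched_at_def dest!: subsetD)
  have "card {e\<in>edges V W. fst e = v \<or> snd e = v} = 1" if v: "v \<in> V \<union> W" for v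
  proof (cases "v \<in> V")
    case True
    then obtain n y where y: "matched_at n V W v y" using leave(1) ex[OF W] by blast
    have "{e\<in>edges V W. fst e = v \<or> snd e = v} = {(v, y)}"
    proof (intro equalityI subsetI)
      fix e assume e: "e \<in> {e\<in>edges V W. fst e = v \<or> snd e = v}"
      then have "snd e \<in> W" using subsetD[OF sub, of e] by (simp add: mem_Times_iff)
      then have "snd e \<noteq> v" using True disj by blast
      then have "fst e = v" using e by blast
      then obtain n' where "matched_at n' V W v (snd e)" using e by (auto simp: edges_def)
      then show "e \<in> {(v, y)}" using matched_unique(2)[OF V W y] \<open>fst e = v\<close> by (cases e) auto
    qed (use y in \<open>auto simp: edges_def\<close>)
    then show ?thesis by simp
  next
    case False
    then have vW: "v \<in> W" using v by blast
    then obtain n y where y: "matched_at n W V v y" using leave(2) ex[OF V] by blast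
    have "{e\<in>edges V W. fst e = v \<or> snd e = v} = {(y, v)}"
    proof (intro equalityI subsetI)
      fix e assume e: "e \<in> {e\<in>edges V W. fst e = v \<or> snd e = v}"
      then have "fst e \<in> V" using subsetD[OF sub, of e] by (simp add: mem_Times_iff)
      then have "fst e \<noteq> v" using vW disj by blast
      then have "snd e = v" using e by blast
      then obtain n' where "matched_at n' V W (fst e) v" using e by (auto simp: edges_def)
      then have "matched_at n' W V v (fst e)" by (rule matched_at_sym)
      then show "e \<in> {(y, v)}" using matched_unique(2)[OF W V y] \<open>snd e = v\<close> by (cases e) auto
    qed (use matched_at_sym[OF y] in \<open>auto simp: edges_def\<close>)
    then show ?thesis by simp
  qed
  then show ?thesis using sub disj unfolding perfect_matching_def by blast
qed

end

section \<open>Boxes and portals\<close>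

text \<open>
  The boxes of level \<open>n\<close> have sides of order \<open>8 ^ n\<close>; from one level to the next either the side in
  the direction \<open>a\<close> grows or the sides in all other directions do.  So there always is a direction in
  which a box and the boxes that it consists of have the same lower end.
\<close>

definition lev :: "'d \<Rightarrow> nat \<Rightarrow> 'd \<Rightarrow> nat" where
  "lev a n i = (if i = a then n div 2 else Suc n div 2)"

definition side :: "'d \<Rightarrow> nat \<Rightarrow> 'd \<Rightarrow> real" where
  "side a n i = period (lev a n i)"

definition cell :: "'d \<Rightarrow> ('d \<Rightarrow> nat \<Rightarrow> real) \<Rightarrow> nat \<Rightarrow> real ^ 'd \<Rightarrow> 'd \<Rightarrow> int" where
  "cell a u n x i = \<lfloor>(x $ i - u i (lev a n i)) / side a n i\<rfloor>"

definition pos :: "'d \<Rightarrow> ('d \<Rightarrow> nat \<Rightarrow> real) \<Rightarrow> nat \<Rightarrow> real ^ 'd \<Rightarrow> 'd \<Rightarrow> real" where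
  "pos a u n x i = wrap (side a n i) (x $ i - u i (lev a n i))"

definition same_box :: "'d \<Rightarrow> ('d \<Rightarrow> nat \<Rightarrow> real) \<Rightarrow> nat \<Rightarrow> real ^ 'd \<Rightarrow> real ^ 'd \<Rightarrow> bool" where
  "same_box a u n x y \<longleftrightarrow> (\<forall>i. cell a u n x i = cell a u n y i)"

text \<open>
  A cube of side \<open>4 ^ n\<close> in every box of level \<open>n\<close>.  Its volume is large compared to the square root of
  the volume of the box, while its side is small compared to the sides of the box.
\<close>

definition portal :: "'d \<Rightarrow> ('d \<Rightarrow> nat \<Rightarrow> real) \<Rightarrow> nat \<Rightarrow> real ^ 'd \<Rightarrow> bool" where
  "portal a u n x \<longleftrightarrow> (\<forall>i. 4 ^ n \<le> pos a u n x i \<and> pos a u n x i < 2 * 4 ^ n)"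

definition reserved :: "'d \<Rightarrow> ('d \<Rightarrow> nat \<Rightarrow> real) \<Rightarrow> nat \<Rightarrow> real ^ 'd \<Rightarrow> bool" where
  "reserved a u n x \<longleftrightarrow> (\<exists>m>n. portal a u m x)"

text \<open>
  A point waits for the last level in whose portals it lies; points outside all portals enter at
  level \<open>0\<close>.  So \<open>reserved\<close> points have not entered yet.
\<close>

definition own_level :: "'d \<Rightarrow> ('d \<Rightarrow> nat \<Rightarrow> real) \<Rightarrow> nat \<Rightarrow> real ^ 'd \<Rightarrow> bool" where
  "own_level a u n x \<longleftrightarrow> (n = 0 \<or> portal a u n x) \<and> \<not> reserved a u n x"

definition coord_index :: "'d::finite \<Rightarrow> nat" where
  "coord_index = (SOME f. inj f)"

text \<open>
  A total order that is invariant under translations, so that the ranking is, too.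
\<close>

definition lex_less :: "real ^ 'd \<Rightarrow> real ^ 'd \<Rightarrow> bool" where
  "lex_less x y \<longleftrightarrow> (\<exists>i. x $ i < y $ i \<and> (\<forall>j. coord_index j < coord_index i \<longrightarrow> x $ j = y $ j))"

definition precedes :: "'d \<Rightarrow> ('d \<Rightarrow> nat \<Rightarrow> real) \<Rightarrow> nat \<Rightarrow> real ^ 'd \<Rightarrow> real ^ 'd \<Rightarrow> bool" where
  "precedes a u n x y \<longleftrightarrow> \<not> own_level a u n x \<and> own_level a u n y \<or>
     (own_level a u n x \<longleftrightarrow> own_level a u n y) \<and> lex_less x y"

lemma inj_coord_index: "inj (coord_index :: 'd::finite \<Rightarrow> nat)"
proof -
  obtain f :: "'d \<Rightarrow> nat" and n where "f ` UNIV = {i. i < n} \<and> inj f"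
    using finite_imp_inj_to_nat_seg[of "UNIV :: 'd set"] by auto
  then have "\<exists>f :: 'd \<Rightarrow> nat. inj f" by (intro exI[of _ f]) simp
  then show ?thesis unfolding coord_index_def by (rule someI_ex)
qed

lemma lex_less_irrefl: "\<not> lex_less x x"
  by (simp add: lex_less_def)

lemma lex_less_trans:
  assumes "lex_less x y" "lex_less y z" shows "lex_less x z"
proof -
  obtain i where i: "x $ i < y $ i" "\<And>j. coord_index j < coord_index i \<Longrightarrow> x $ j = y $ j"
    using assms(1) by (auto simp: lex_less_def)
  obtain k where k: "y $ k < z $ k" "\<And>j. coord_index j < coord_index k \<Longrightarrow> y $ j = z $ j"
    using assms(2) by (auto simp: lex_less_def)
  consider "coord_index i < coord_index k" | "coord_index k < coord_index i" | "i = k"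
    using inj_coord_index by (metis injD linorder_neqE_nat)
  then show ?thesis
  proof cases
    case 1
    then show ?thesis unfolding lex_less_def using i k by (intro exI[of _ i]) (metis order.strict_trans)
  next
    case 2
    then show ?thesis unfolding lex_less_def using i k by (intro exI[of _ k]) (metis order.strict_trans)
  next
    case 3
    then have "x $ i < z $ i" "\<forall>j. coord_index j < coord_index i \<longrightarrow> x $ j = z $ j" using i k by auto
    then show ?thesis unfolding lex_less_def by blast
  qed
qed

lemma lex_less_total:
  fixes x y :: "real ^ 'd"
  assumes "x \<noteq> y" shows "lex_less x y \<or> lex_less y x"
proof -
  have "\<exists>i. x $ i \<noteq> y $ i" using assms vec_eq_iff[of x y] by blast
  then obtain i0 where "x $ i0 \<noteq> y $ i0" ..
  then obtain i where i: "x $ i \<noteq> y $ i" "\<And>j. x $ j \<noteq> y $ j \<Longrightarrow> coord_index i \<le> coord_index j"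
    using ex_has_least_nat[of "\<lambda>i. x $ i \<noteq> y $ i" i0 coord_index] by blast
  then have "\<forall>j. coord_index j < coord_index i \<longrightarrow> x $ j = y $ j" by (meson not_le)
  then show ?thesis using i(1) unfolding lex_less_def by (metis linorder_neqE_linordered_idom)
qed

lemma side_pos [simp]: "0 < side a n i"
  by (simp add: side_def)

lemma side_bounds: "2 * 8 ^ n \<le> side a n i" "side a n i \<le> 128 * 8 ^ n"
proof -
  have 1: "2 * (8::real) ^ n \<le> 16 * 64 ^ (n div 2)" and 2: "16 * (64::real) ^ (Suc n div 2) \<le> 128 * 8 ^ n"
    and mono: "(64::real) ^ (n div 2) \<le> 64 ^ (Suc n div 2)"
  proof -
    have sq: "(64::real) ^ k = 8 ^ (2 * k)" for k by (simp add: power_mult)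
    have "(8::real) ^ n \<le> 8 ^ Suc (2 * (n div 2))" by (rule power_increasing) auto
    then show "2 * (8::real) ^ n \<le> 16 * 64 ^ (n div 2)" by (simp add: sq)
    have "(8::real) ^ (2 * (Suc n div 2)) \<le> 8 ^ Suc n" by (rule power_increasing) auto
    then show "16 * (64::real) ^ (Suc n div 2) \<le> 128 * 8 ^ n" by (simp add: sq)
    show "(64::real) ^ (n div 2) \<le> 64 ^ (Suc n div 2)" by (rule power_increasing) auto
  qed
  have "side a n i = 16 * 64 ^ (n div 2) \<or> side a n i = 16 * 64 ^ (Suc n div 2)"
    unfolding side_def period_def lev_def by auto
  then show "2 * 8 ^ n \<le> side a n i" "side a n i \<le> 128 * 8 ^ n"
    using 1 2 mono by linarith+
qed

lemma pos_bounds: "0 \<le> pos a u n x i" "pos a u n x i < side a n i"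
  by (simp_all add: pos_def wrap_bounds)

lemma cell_pos: "x $ i = u i (lev a n i) + side a n i * of_int (cell a u n x i) + pos a u n x i"
  by (simp add: pos_def wrap_def cell_def)

lemma cell_eqI:
  assumes "x $ i = u i (lev a n i) + side a n i * of_int k + p" "0 \<le> p" "p < side a n i"
  shows "cell a u n x i = k" "pos a u n x i = p"
proof -
  have "(x $ i - u i (lev a n i)) / side a n i = of_int k + p / side a n i"
    using less_imp_neq[OF side_pos[of a n i]] by (simp add: assms(1) add_divide_distrib)
  moreover have "0 \<le> p / side a n i" "p / side a n i < 1" using assms side_pos[of a n i] by auto
  ultimately show k: "cell a u n x i = k" unfolding cell_def by (simp add: floor_eq_iff)
  show "pos a u n x i = p" using cell_pos[of x i u a n] assms(1) unfolding k by simp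
qed

lemma same_box_diff: "same_box a u n x y \<Longrightarrow> x $ i - y $ i = pos a u n x i - pos a u n y i"
  using cell_pos[of x i u a n] cell_pos[of y i u a n] by (simp add: same_box_def)

lemma same_box_equiv: "same_box a u n x x" "same_box a u n x y \<Longrightarrow> same_box a u n y x"
  "same_box a u n x y \<Longrightarrow> same_box a u n y z \<Longrightarrow> same_box a u n x z"
  by (simp_all add: same_box_def)

lemma same_box_dist: "same_box a u n x y \<Longrightarrow> \<bar>x $ i - y $ i\<bar> < side a n i"
  using same_box_diff[of a u n x y i] pos_bounds[of a u n x i] pos_bounds[of a u n y i] by linarith

lemma bounded_box_of: "bounded {y. same_box a u n x (y :: real ^ 'd)}"
proof (rule bounded_subset[OF bounded_cball])
  show "{y. same_box a u n x y} \<subseteq> cball x (\<Sum>i\<in>UNIV. side a n i)"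
  proof
    fix y assume "y \<in> {y. same_box a u n x y}"
    then have "\<bar>(x - y) $ i\<bar> \<le> side a n i" for i using same_box_dist[of a u n x y i] by simp
    then have "(\<Sum>i\<in>UNIV. \<bar>(x - y) $ i\<bar>) \<le> (\<Sum>i\<in>UNIV. side a n i)" by (intro sum_mono)
    then show "y \<in> cball x (\<Sum>i\<in>UNIV. side a n i)"
      using norm_le_l1_cart[of "x - y"] by (simp add: dist_norm)
  qed
qed

lemma offset_diff:
  assumes "nested_offsets v" "k \<le> k'"
  obtains c :: int where "v k = v k' + period k * of_int c"
proof -
  have "v k = wrap (period k) (v k')" using assms le_add_diff_inverse[of k k'] unfolding nested_offsets_def by metis
  then obtain c :: int where "v k = v k' - period k * of_int c" using wrap_eq_diff[of "period k" "v k'"] by auto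
  then have "v k = v k' + period k * of_int (- c)" by simp
  then show ?thesis by (rule that)
qed

text \<open>
  Both the coarser period and the difference of the offsets are multiples of the finer period, so the
  coarser floor is a function of the finer one.
\<close>

lemma floor_coarser:
  assumes v: "nested_offsets v" and k: "k \<le> k'"
    and eq: "\<lfloor>(x - v k) / period k\<rfloor> = \<lfloor>(y - v k) / period k\<rfloor>"
  shows "\<lfloor>(x - v k') / period k'\<rfloor> = \<lfloor>(y - v k') / period k'\<rfloor>"
proof -
  obtain c :: int where c: "v k = v k' + period k * of_int c" by (rule offset_diff[OF v k])
  have p: "period k' = period k * of_int (64 ^ (k' - k))" using period_add[of k "k' - k"] k by simp
  have "\<lfloor>(z - v k') / period k'\<rfloor> = (\<lfloor>(z - v k) / period k\<rfloor> + c) div 64 ^ (k' - k)" for z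
  proof -
    have "(z - v k) / period k + of_int c = (z - v k + period k * of_int c) / period k"
      using less_imp_neq[OF period_pos[of k]] by (simp add: add_divide_distrib)
    also have "z - v k + period k * of_int c = z - v k'" by (simp add: c)
    finally have "(z - v k') / period k' = ((z - v k) / period k + of_int c) / of_int (64 ^ (k' - k))"
      unfolding p by (simp only: divide_divide_eq_left)
    moreover have "\<lfloor>((z - v k) / period k + of_int c) / of_int (64 ^ (k' - k))\<rfloor> = \<lfloor>(z - v k) / period k + of_int c\<rfloor> div 64 ^ (k' - k)"
      by (rule floor_divide_real_eq_div) simp
    ultimately show ?thesis by simp
  qed
  then show ?thesis by (simp only: eq)
qed

lemma lev_mono: "n \<le> m \<Longrightarrow> lev a n i \<le> lev a m i"
  by (simp add: lev_def div_le_mono)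

lemma same_box_Suc:
  assumes "\<forall>i. nested_offsets (u i)" "same_box a u n x y"
  shows "same_box a u (Suc n) x y"
  unfolding same_box_def
proof
  fix i
  have "lev a n i \<le> lev a (Suc n) i" by (rule lev_mono) simp
  moreover have "nested_offsets (u i)" using assms(1) by blast
  moreover have "cell a u n x i = cell a u n y i" using assms(2) by (simp add: same_box_def)
  ultimately show "cell a u (Suc n) x i = cell a u (Suc n) y i"
    unfolding cell_def side_def by (metis floor_coarser)
qed

lemma same_box_mono:
  assumes "\<forall>i. nested_offsets (u i)" "same_box a u n x y" "n \<le> m"
  shows "same_box a u m x y"
  using assms(3,2) by (induction rule: dec_induct) (auto intro: same_box_Suc[OF assms(1)])

text \<open>
  All lengths are powers of four.  Hence a side divides the width of a later portal, or it exceeds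
  it so much that the later portal stays clear of the portals of this level.
\<close>

lemma portal_covers_box:
  assumes u: "\<forall>i. nested_offsets (u i)" and nm: "n < m"
    and y: "portal a u n y" "portal a u m y" and same: "same_box a u n y z"
  shows "portal a u m z"
  unfolding portal_def
proof
  fix i
  define k where "k = lev a n i"
  define L where "L = side a n i"
  define w where "w = (4::real) ^ m"
  have Lk: "L = 4 ^ (2 + 3 * k)" by (simp add: L_def side_def period_def k_def power_add power_mult)
  have L: "0 < L" by (simp add: L_def)
  have lev_le: "lev a n i \<le> lev a m i" using nm by (simp add: lev_def div_le_mono)
  obtain c :: int where c: "u i (lev a n i) = u i (lev a m i) + L * of_int c"
    using offset_diff[of "u i", OF _ lev_le] u unfolding L_def side_def by blast
  have period_m: "side a m i = L * of_int (64 ^ (lev a m i - lev a n i))"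
    using period_add[of "lev a n i" "lev a m i - lev a n i"] lev_le by (simp add: L_def side_def)
  define q where "q = c + cell a u n y i - 64 ^ (lev a m i - lev a n i) * cell a u m y i"
  have posm: "pos a u m x i = L * of_int q + pos a u n x i" if "same_box a u n y x" for x
  proof -
    have "cell a u n x i = cell a u n y i" "cell a u m x i = cell a u m y i"
      using that same_box_mono[OF u that, of m] nm by (auto simp: same_box_def)
    then show ?thesis
      using cell_pos[of x i u a n] cell_pos[of x i u a m] c period_m
      by (simp add: q_def L_def[symmetric] algebra_simps)
  qed
  have py: "w \<le> L * of_int q + pos a u n y i" "L * of_int q + pos a u n y i < 2 * w"
  proof -
    have "4 ^ m \<le> pos a u m y i" "pos a u m y i < 2 * 4 ^ m" using y(2) unfolding portal_def by blast+
    then show "w \<le> L * of_int q + pos a u n y i" "L * of_int q + pos a u n y i < 2 * w"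
      using posm[OF same_box_equiv(1)] by (simp_all add: w_def)
  qed
  have py': "4 ^ n \<le> pos a u n y i" "pos a u n y i < 2 * 4 ^ n" "0 \<le> pos a u n y i" "pos a u n y i < L"
    using y(1) pos_bounds[of a u n y i] unfolding portal_def L_def by blast+
  have pz: "0 \<le> pos a u n z i" "pos a u n z i < L" using pos_bounds[of a u n z i] by (auto simp: L_def)
  have "w \<le> L * of_int q + pos a u n z i \<and> L * of_int q + pos a u n z i < 2 * w"
  proof (cases "2 + 3 * k \<le> m")
    case True
    define d :: int where "d = 4 ^ (m - (2 + 3 * k))"
    have wd: "w = L * of_int d" unfolding w_def Lk d_def of_int_power of_int_numeral power_add[symmetric] using True by (simp only: le_add_diff_inverse)
    have "L * of_int d < L * (of_int q + 1)" using py py' wd by (simp add: distrib_left)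
    then have "of_int d < (of_int q + 1 :: real)" using L by simp
    then have dq: "d \<le> q" by linarith
    have "L * of_int q < 2 * w" using py py' by linarith
    then have "L * of_int q < L * (2 * of_int d)" unfolding wd by (simp only: mult.left_commute)
    then have "of_int q < (2 * of_int d :: real)" by (rule mult_less_cancel_left_pos[OF L, THEN iffD1])
    then have q2: "q + 1 \<le> 2 * d" by linarith
    have "L * of_int d \<le> L * of_int q" using dq L by simp
    moreover have "L * of_int (q + 1) \<le> L * of_int (2 * d)" using q2 L by (intro mult_left_mono) (simp_all only: of_int_le_iff less_imp_le)
    then have "L * of_int q + L \<le> 2 * w" unfolding wd by (simp add: distrib_left)
    ultimately show ?thesis using pz wd by linarith
  next
    case False
    then have "(4::real) ^ Suc m \<le> 4 ^ (2 + 3 * k)" by (intro power_increasing) auto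
    then have wL: "4 * w \<le> L" by (simp add: w_def Lk)
    have "L * of_int q < L * 1" using py py' wL L by linarith
    then have "q < 1" using L by simp
    moreover have "- 1 < q"
    proof -
      have "0 < w" by (simp add: w_def)
      then have "L * (- 1) < L * of_int q" using py py' by linarith
      then have "- 1 < (of_int q :: real)" by (rule mult_less_cancel_left_pos[OF L, THEN iffD1])
      then show ?thesis by linarith
    qed
    ultimately have "q = 0" by simp
    then have wy: "w \<le> pos a u n y i" using py by simp
    have "(4::real) ^ Suc n \<le> 4 ^ m" using nm by (intro power_increasing) auto
    moreover have "(0::real) < 4 ^ n" by simp
    ultimately have "2 * (4::real) ^ n \<le> w" unfolding w_def power_Suc by linarith
    with wy show ?thesis using py' by linarith
  qed
  then show "4 ^ m \<le> pos a u m z i \<and> pos a u m z i < 2 * 4 ^ m"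
    using posm[OF same] by (simp add: w_def)
qed

text \<open>A later portal that meets the portal of a box covers the box.\<close>

lemma reserved_dichotomy:
  assumes u: "\<forall>i. nested_offsets (u i)"
  shows "(\<forall>z. same_box a u n y z \<longrightarrow> reserved a u n z) \<or> (\<forall>z. same_box a u n y z \<and> portal a u n z \<longrightarrow> \<not> reserved a u n z)"
proof (rule disjCI)
  assume "\<not> (\<forall>z. same_box a u n y z \<and> portal a u n z \<longrightarrow> \<not> reserved a u n z)"
  then obtain x m where x: "same_box a u n y x" "portal a u n x" "n < m" "portal a u m x"
    by (auto simp: reserved_def)
  have "portal a u m z" if "same_box a u n y z" for z
    using portal_covers_box[OF u x(3,2,4), of z] same_box_equiv(3)[OF same_box_equiv(2)[OF x(1)] that] by blast
  then show "\<forall>z. same_box a u n y z \<longrightarrow> reserved a u n z" using x(3) by (auto simp: reserved_def)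
qed

lemma levels_boxes:
  fixes u :: "'d::finite \<Rightarrow> nat \<Rightarrow> real"
  assumes "\<forall>i. nested_offsets (u i)"
  shows "levels (same_box a u) (own_level a u) (precedes a u)"
proof
  show "own_level a u n x \<Longrightarrow> own_level a u m x \<Longrightarrow> n = m" for n m x
  proof (rule ccontr)
    assume nm: "own_level a u n x" "own_level a u m x" "n \<noteq> m"
    have False if "own_level a u n x" "own_level a u m x" "n < m" for n m
      using that by (auto simp: own_level_def reserved_def)
    then show False using nm by (metis linorder_neqE_nat)
  qed
  show "\<not> precedes a u n x x" for n x by (simp add: precedes_def lex_less_irrefl)
  show "precedes a u n x y \<Longrightarrow> precedes a u n y z \<Longrightarrow> precedes a u n x z" for n x y z
    unfolding precedes_def using lex_less_trans by blast
  show "x \<noteq> y \<Longrightarrow> precedes a u n x y \<or> precedes a u n y x" for n x y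
    unfolding precedes_def using lex_less_total by blast
  show "\<not> own_level a u n x \<Longrightarrow> own_level a u n y \<Longrightarrow> precedes a u n x y" for n x y
    by (simp add: precedes_def)
qed (use same_box_equiv same_box_Suc[OF assms] in blast)+

section \<open>Well placed origins\<close>

text \<open>
  Then the ball of radius \<open>n\<close> around the origin lies in the box of the origin, and beyond its portal
  in every direction.
\<close>

definition well_placed :: "'d::finite \<Rightarrow> ('d \<Rightarrow> nat \<Rightarrow> real) \<Rightarrow> nat \<Rightarrow> bool" where
  "well_placed a u n \<longleftrightarrow> (\<forall>i. 2 * 4 ^ n + real n \<le> pos a u n 0 i \<and> pos a u n 0 i + real n < side a n i)"

lemma well_placed_near:
  fixes x :: "real ^ 'd"
  assumes "well_placed a u n" "norm x \<le> n"
  shows "same_box a u n 0 x" "2 * 4 ^ n \<le> pos a u n x i" "\<not> portal a u n x"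
proof -
  have x: "\<bar>x $ i\<bar> \<le> n" for i using component_le_norm_cart[of x i] assms(2) by linarith
  have c: "cell a u n x i = cell a u n 0 i \<and> pos a u n x i = pos a u n 0 i + x $ i" for i
  proof -
    have "2 * 4 ^ n + real n \<le> pos a u n 0 i" "pos a u n 0 i + real n < side a n i" using assms(1) by (auto simp: well_placed_def)
    moreover have "(0::real) \<le> 2 * 4 ^ n" by simp
    ultimately have "0 \<le> pos a u n 0 i + x $ i" "pos a u n 0 i + x $ i < side a n i"
      using x[of i] by linarith+
    moreover have "x $ i = u i (lev a n i) + side a n i * of_int (cell a u n 0 i) + (pos a u n 0 i + x $ i)"
      using cell_pos[of 0 i u a n] by simp
    ultimately show ?thesis using cell_eqI by blast
  qed
  then show "same_box a u n 0 x" by (simp add: same_box_def)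
  have ge: "2 * 4 ^ n \<le> pos a u n x i" for i
  proof -
    have "2 * 4 ^ n + real n \<le> pos a u n 0 i" using assms(1) by (auto simp: well_placed_def)
    then show ?thesis using c[of i] x[of i] by linarith
  qed
  then show "2 * 4 ^ n \<le> pos a u n x i" .
  show "\<not> portal a u n x" unfolding portal_def using ge[of i] by (meson not_le)
qed

text \<open>
  In every coordinate, a point of the segment lies between its ends, so it is in the same box and no
  further from the lower face.
\<close>

lemma segment_in_box:
  fixes r b p :: "real ^ 'd"
  assumes s: "same_box a u n r b" and p: "p \<in> closed_segment r b"
  shows "same_box a u n r p" "pos a u n p i \<le> max (pos a u n r i) (pos a u n b i)"
proof -
  obtain t where t: "0 \<le> t" "t \<le> 1" "p = (1 - t) *\<^sub>R r + t *\<^sub>R b" using p by (auto simp: in_segment)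
  have c: "cell a u n p i = cell a u n r i \<and> pos a u n p i = (1 - t) * pos a u n r i + t * pos a u n b i" for i
  proof -
    have cb: "cell a u n b i = cell a u n r i" using s by (simp add: same_box_def)
    have "p $ i = (1 - t) * r $ i + t * b $ i" by (simp add: t(3))
    also have "\<dots> = u i (lev a n i) + side a n i * of_int (cell a u n r i) + ((1 - t) * pos a u n r i + t * pos a u n b i)"
      using cell_pos[of r i u a n] cell_pos[of b i u a n] unfolding cb by (simp add: algebra_simps)
    finally have "p $ i = u i (lev a n i) + side a n i * of_int (cell a u n r i) + ((1 - t) * pos a u n r i + t * pos a u n b i)" .
    moreover have "0 \<le> (1 - t) * pos a u n r i + t * pos a u n b i" using t pos_bounds by (intro add_nonneg_nonneg mult_nonneg_nonneg) auto
    moreover have "(1 - t) * pos a u n r i + t * pos a u n b i < side a n i"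
      using t pos_bounds(2)[of a u n r i] pos_bounds(2)[of a u n b i] by (intro convex_bound_lt) auto
    ultimately show ?thesis using cell_eqI by blast
  qed
  then show "same_box a u n r p" by (simp add: same_box_def)
  have "(1 - t) * pos a u n r i + t * pos a u n b i \<le> max (pos a u n r i) (pos a u n b i)"
    using t by (intro convex_bound_le) auto
  then show "pos a u n p i \<le> max (pos a u n r i) (pos a u n b i)" using c by simp
qed

text \<open>
  This is where the dimension enters: the direction \<open>a\<close> and the other directions take turns.
\<close>

lemma common_direction:
  fixes a :: "'d::finite"
  assumes "2 \<le> CARD('d)"
  obtains c where "lev a (Suc k) c = lev a k c"
proof (cases "even k")
  case True
  then have "lev a (Suc k) a = lev a k a" by (auto simp: lev_def elim!: evenE)
  then show ?thesis by (rule that)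
next
  case False
  have "\<not> (UNIV :: 'd set) \<subseteq> {a}" using assms card_mono[of "{a}" "UNIV :: 'd set"] by auto
  then obtain c where "c \<noteq> a" by blast
  then have "lev a (Suc k) c = lev a k c" using False by (auto simp: lev_def elim!: oddE)
  then show ?thesis by (rule that)
qed

text \<open>
  Consider an edge of a late level in the box of the origin.  If the boxes below that box are good,
  then both its ends lie in portals, so that the edge stays in a slab along a face of the box; and
  the origin, if it is well placed, is far from that slab.
\<close>

lemma matching_of_good_boxes:
  fixes V W :: "(real ^ 'd) set" and u :: "'d::finite \<Rightarrow> nat \<Rightarrow> real"
  assumes u: "\<forall>i. nested_offsets (u i)"
    and d: "2 \<le> CARD('d)"
    and V: "\<And>C. bounded C \<Longrightarrow> finite (V \<inter> C)" and W: "\<And>C. bounded C \<Longrightarrow> finite (W \<inter> C)" and disj: "V \<inter> W = {}"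
    and ev: "\<forall>\<^sub>F n in sequentially. well_placed a u n"
      "\<forall>\<^sub>F n in sequentially. \<forall>y. same_box a u (Suc n) 0 y \<longrightarrow> levels.good (same_box a u) (own_level a u) n V W y \<and> levels.good (same_box a u) (own_level a u) n W V y"
  shows "perfect_matching V W (levels.edges (same_box a u) (own_level a u) (precedes a u) V W)" and "bounded C \<Longrightarrow> finite {e\<in>levels.edges (same_box a u) (own_level a u) (precedes a u) V W. crosses e C}"
proof -
  interpret levels "same_box a u" "own_level a u" "precedes a u" by (rule levels_boxes[OF u])
  have "\<forall>\<^sub>F n in sequentially. well_placed a u n \<and> (\<forall>y. same_box a u (Suc n) 0 y \<longrightarrow> good n V W y \<and> good n W V y)"
    using ev by eventually_elim auto
  then obtain n0 where n0: "\<And>n. n0 \<le> n \<Longrightarrow> well_placed a u n"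
    "\<And>n y. n0 \<le> n \<Longrightarrow> same_box a u (Suc n) 0 y \<Longrightarrow> good n V W y \<and> good n W V y"
    unfolding eventually_sequentially by blast
  have fin: "finite_boxes X" if "\<And>C. bounded C \<Longrightarrow> finite (X \<inter> C)" for X
    unfolding finite_boxes_def
  proof (intro allI)
    fix n x
    have "{y\<in>X. same_box a u n x y} = X \<inter> {y. same_box a u n x y}" by blast
    then show "finite {y\<in>X. same_box a u n x y}" using that[OF bounded_box_of, of a u n x] by simp
  qed
  note fV = fin[OF V] and fW = fin[OF W]
  have leave: "\<exists>k m. own_level a u k x \<and> k \<le> m \<and> x \<notin> pool m X Y"
    if fX: "finite_boxes X" and fY: "finite_boxes Y" and g: "\<And>n y. n0 \<le> n \<Longrightarrow> same_box a u (Suc n) 0 y \<Longrightarrow> good n X Y y"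
    for X Y :: "(real ^ 'd) set" and x
  proof -
    obtain n1 :: nat where n1: "norm x \<le> n1" using real_arch_simple by blast
    \<comment> \<open>the level that owns \<open>x\<close>\<close>
    define N where "N = Max {n. n = 0 \<or> portal a u n x}"
    have np: "\<not> portal a u n x" if "n0 \<le> n" "n1 \<le> n" for n
    proof -
      have "norm x \<le> real n" using n1 that by linarith
      then show ?thesis by (rule well_placed_near(3)[OF n0(1)[OF that(1)]])
    qed
    have "{n. n = 0 \<or> portal a u n x} \<subseteq> {..max n0 n1}"
    proof
      fix n assume "n \<in> {n. n = 0 \<or> portal a u n x}"
      then have "n = 0 \<or> \<not> n0 \<le> n \<or> \<not> n1 \<le> n" using np[of n] by blast
      then show "n \<in> {..max n0 n1}" unfolding atMost_iff by linarith
    qed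
    then have finN: "finite {n. n = 0 \<or> portal a u n x}" using finite_subset by blast
    have "N \<in> {n. n = 0 \<or> portal a u n x}" unfolding N_def by (rule Max_in[OF finN]) auto
    moreover have "\<not> portal a u m x" if "N < m" for m
      using Max_ge[OF finN, of m] that by (auto simp: N_def)
    ultimately have N: "own_level a u N x" by (auto simp: own_level_def reserved_def)
    define n where "n = Suc (max N (max n0 n1))"
    have n: "n0 \<le> n" "n1 \<le> n" "N \<le> n" "n \<noteq> 0" by (auto simp: n_def)
    have "x \<notin> pool (Suc n) X Y"
    proof
      assume x: "x \<in> pool (Suc n) X Y"
      have no: "\<not> own_level a u (Suc n) x" "\<not> own_level a u n x" using np[of n] np[of "Suc n"] n by (auto simp: own_level_def)
      then have xn: "x \<in> pool n X Y" using x by (auto simp: pool_Suc)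
      have nx: "norm x \<le> real (Suc n)" using n1 n(2) by linarith
      have "same_box a u (Suc n) 0 x" by (rule well_placed_near(1)[OF n0(1) nx]) (use n in simp)
      then have "good n X Y x" using g n(1) by blast
      then show False using good_exports_own[OF fX fY _ xn x] no by blast
    qed
    then show ?thesis using N n(3) by (intro exI[of _ N] exI[of _ "Suc n"]) auto
  qed
  show "perfect_matching V W (edges V W)"
    by (rule edges_perfect[OF fV fW disj]) (use leave[OF fV fW] leave[OF fW fV] n0(2) in blast)+
  show "finite {e\<in>edges V W. crosses e C}" if C: "bounded C"
  proof -
    obtain r where r: "\<And>x. x \<in> C \<Longrightarrow> norm x \<le> r" using C bounded_iff by blast
    obtain n1 :: nat where n1: "r \<le> n1" using real_arch_simple by blast
    define n where "n = Suc (max n0 n1)"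
    have n: "n0 \<le> n" "1 \<le> n" "\<And>m p. n \<le> m \<Longrightarrow> p \<in> C \<Longrightarrow> norm p \<le> real m"
    proof -
      fix m p assume "n \<le> m" "p \<in> C"
      then have "norm p \<le> r" "n1 \<le> m" using r by (auto simp: n_def)
      then show "norm p \<le> real m" using n1 by linarith
    qed (auto simp: n_def)
    have slab: "pos a u (Suc k) x c < 2 * 4 ^ Suc k"
      if x: "x \<in> pool (Suc k) X Y" and fX: "finite_boxes X" and fY: "finite_boxes Y" and g: "good k X Y x"
        and k: "1 \<le> k" and c: "lev a (Suc k) c = lev a k c" for X Y x k c
    proof (cases "own_level a u (Suc k) x")
      case True
      then show ?thesis by (auto simp: own_level_def portal_def)
    next
      case False
      then have xk: "x \<in> pool k X Y" using x by (auto simp: pool_Suc)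
      have "own_level a u k x" by (rule good_exports_own[OF fX fY g xk x])
      then have "pos a u k x c < 2 * 4 ^ k" using k by (auto simp: own_level_def portal_def)
      moreover have "pos a u (Suc k) x c = pos a u k x c" using c by (simp add: pos_def side_def)
      moreover have "(0::real) < 4 ^ k" by simp
      ultimately show ?thesis unfolding power_Suc by linarith
    qed
    \<comment> \<open>an edge that meets \<open>C\<close> is of a level at most \<open>n\<close>\<close>
    have level: "m \<le> n" if mt: "matched_at m V W r b" and p: "p \<in> C" "p \<in> closed_segment r b" for m r b p
    proof (rule ccontr)
      assume "\<not> m \<le> n"
      then obtain k where k: "m = Suc k" "n \<le> k" by (cases m) auto
      obtain c where c: "lev a (Suc k) c = lev a k c" by (rule common_direction[OF d])
      have rb: "r \<in> pool (Suc k) V W" "b \<in> pool (Suc k) W V" "same_box a u (Suc k) r b"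
        using mt k by (auto simp: matched_at_def)
      note seg = segment_in_box[OF rb(3) p(2)]
      have "norm p \<le> real (Suc k)" using n(3)[of "Suc k" p] k p by simp
      note near = well_placed_near[OF n0(1) this]
      have 0: "same_box a u (Suc k) 0 p" "2 * 4 ^ Suc k \<le> pos a u (Suc k) p c"
        using near n k by auto
      have r0: "same_box a u (Suc k) 0 r" using same_trans[OF 0(1) same_sym[of "Suc k" r p]] seg(1) by simp
      have b0: "same_box a u (Suc k) 0 b" by (rule same_trans[OF r0 rb(3)])
      have "n0 \<le> k" "1 \<le> k" using n k by auto
      then have "pos a u (Suc k) r c < 2 * 4 ^ Suc k" "pos a u (Suc k) b c < 2 * 4 ^ Suc k"
        using slab[OF rb(1) fV fW] slab[OF rb(2) fW fV] n0(2)[of k] r0 b0 c by blast+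
      then show False using seg(2)[of c] 0(2) by linarith
    qed
    let ?Q = "{y. same_box a u n 0 y}"
    have "{e\<in>edges V W. crosses e C} \<subseteq> (V \<inter> ?Q) \<times> (W \<inter> ?Q)"
    proof
      fix e assume e: "e \<in> {e\<in>edges V W. crosses e C}"
      obtain r b where rb: "e = (r, b)" by (cases e)
      obtain m where m: "matched_at m V W r b" using e rb by (auto simp: edges_def)
      obtain p where p: "p \<in> C" "p \<in> closed_segment r b" using e rb by (auto simp: crosses_def)
      have mn: "m \<le> n" by (rule level[OF m p])
      have "same_box a u m r b" using m by (simp add: matched_at_def)
      then have sm: "same_box a u n r b" "same_box a u n r p"
        using segment_in_box(1)[of a u m r b p] p(2) same_box_mono[OF u _ mn] by blast+
      have "same_box a u n 0 p" by (rule well_placed_near(1)[OF n0(1)[OF n(1)] n(3)[OF order_refl p(1)]])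
      then have "same_box a u n 0 r" "same_box a u n 0 b" using sm by (auto simp: same_box_def)
      moreover have "r \<in> V" "b \<in> W" using m pool_subset by (auto simp: matched_at_def)
      ultimately show "e \<in> (V \<inter> ?Q) \<times> (W \<inter> ?Q)" using rb by simp
    qed
    moreover have "finite ((V \<inter> ?Q) \<times> (W \<inter> ?Q))" by (intro finite_cartesian_product V W bounded_box_of)
    ultimately show ?thesis by (rule finite_subset)
  qed
qed

section \<open>Integrals against random configurations\<close>

lemma config_kernel:
  assumes "k \<in> K \<rightarrow>\<^sub>M config_algebra UNIV" "x \<in> space K"
  shows "k x \<in> point_configs UNIV" "sets (k x) = sets borel" "space (k x) = UNIV"
proof -
  show k: "k x \<in> point_configs UNIV" using measurable_space[OF assms] by (simp add: space_config_algebra)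
  show "sets (k x) = sets borel" "space (k x) = UNIV" using sets_config[OF k] space_config[OF k] by simp_all
qed

text \<open>
  Configurations need not be finite.  Restricted to a ball and scaled down they are random
  subprobabilities, for which measurability is known; then let the ball grow.
\<close>

lemma nn_integral_config_measurable:
  fixes k :: "'x \<Rightarrow> 'a::euclidean_space measure"
  assumes k: "k \<in> K \<rightarrow>\<^sub>M config_algebra UNIV" and g: "(\<lambda>(x, y). g x y) \<in> borel_measurable (K \<Otimes>\<^sub>M borel)"
  shows "(\<lambda>x. \<integral>\<^sup>+y. g x y \<partial>k x) \<in> borel_measurable K"
proof -
  define D where "D n = ball (0::'a) (real n)" for n
  define c where "c n x = 1 + emeasure (k x) (D n)" for n x
  define L where "L n x = scale_measure (inverse (c n x)) (density (k x) (indicator (D n)))" for n x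
  have D: "D n \<in> sets borel" "bounded (D n)" for n by (simp_all add: D_def)
  note kc = config_kernel[OF k]
  have em: "(\<lambda>x. emeasure (k x) A) \<in> borel_measurable K" if "A \<in> sets borel" for A
    using measurable_compose[OF k measurable_emeasure_config[of A UNIV]] that by simp
  have c: "c n \<in> borel_measurable K" for n
    unfolding c_def using em[OF D(1)[of n]] by measurable
  have cfin: "c n x \<noteq> 0" "c n x \<noteq> \<top>" if x: "x \<in> space K" for n x
  proof -
    obtain m :: nat where "emeasure (k x) (D n) = of_nat m"
      using config_bounded_nat[OF kc(1)[OF x] _ D(2)] D(1) kc(2)[OF x] by metis
    then have "c n x = of_nat (Suc m)" by (simp add: c_def)
    then show "c n x \<noteq> 0" "c n x \<noteq> \<top>" by (simp_all only: of_nat_eq_0_iff ennreal_of_nat_neq_top) simp_all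
  qed
  have L_int: "(\<integral>\<^sup>+y. f y \<partial>L n x) = inverse (c n x) * (\<integral>\<^sup>+y. f y * indicator (D n) y \<partial>k x)"
    if x: "x \<in> space K" and f: "f \<in> borel_measurable borel" for f n x
  proof -
    have f': "f \<in> borel_measurable (k x)" using f kc(2)[OF x] by (simp cong: measurable_cong_sets)
    have D': "indicator (D n) \<in> borel_measurable (k x)" using D(1) kc(2)[OF x] by simp
    have "(\<integral>\<^sup>+y. f y \<partial>L n x) = inverse (c n x) * (\<integral>\<^sup>+y. f y \<partial>density (k x) (indicator (D n)))"
      unfolding L_def by (rule nn_integral_scale_measure) (use f' in simp)
    also have "(\<integral>\<^sup>+y. f y \<partial>density (k x) (indicator (D n))) = (\<integral>\<^sup>+y. indicator (D n) y * f y \<partial>k x)"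
      by (rule nn_integral_density[OF D' f'])
    finally show ?thesis by (simp only: mult.commute[of "indicator _ _"])
  qed
  have L_em: "emeasure (L n x) A = inverse (c n x) * emeasure (k x) (A \<inter> D n)"
    if x: "x \<in> space K" and A: "A \<in> sets borel" for A n x
  proof -
    have sA: "A \<in> sets (L n x)" using A kc(2)[OF x] by (simp add: L_def)
    have "emeasure (L n x) A = (\<integral>\<^sup>+y. indicator A y \<partial>L n x)" by (rule nn_integral_indicator[OF sA, symmetric])
    also have "\<dots> = inverse (c n x) * (\<integral>\<^sup>+y. indicator A y * indicator (D n) y \<partial>k x)" using A by (intro L_int[OF x]) simp
    also have "(\<lambda>y. indicator A y * indicator (D n) y :: ennreal) = indicator (A \<inter> D n)" by (simp add: fun_eq_iff indicator_inter_arith)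
    also have "(\<integral>\<^sup>+y. indicator (A \<inter> D n) y \<partial>k x) = emeasure (k x) (A \<inter> D n)"
      using A D(1)[of n] kc(2)[OF x] by (intro nn_integral_indicator) auto
    finally show ?thesis .
  qed
  have L: "L n \<in> K \<rightarrow>\<^sub>M subprob_algebra borel" for n
  proof (rule measurable_subprob_algebra)
    fix x assume x: "x \<in> space K"
    show "sets (L n x) = sets borel" using kc(2)[OF x] by (simp add: L_def)
    have sp: "space (L n x) = UNIV" using kc(3)[OF x] by (simp add: L_def space_scale_measure)
    show "subprob_space (L n x)"
    proof
      have "emeasure (L n x) UNIV = inverse (c n x) * emeasure (k x) (D n)" using L_em[OF x, of UNIV n] by simp
      also have "\<dots> \<le> inverse (c n x) * c n x" by (intro mult_left_mono) (simp_all add: c_def)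
      also have "\<dots> = 1" using ennreal_divide_self[of "c n x"] cfin[OF x] by (simp add: divide_ennreal_def mult.commute top.not_eq_extremum)
      finally show "emeasure (L n x) (space (L n x)) \<le> 1" by (simp add: sp)
      show "space (L n x) \<noteq> {}" by (simp add: sp)
    qed
  next
    fix A :: "'a set" assume A: "A \<in> sets borel"
    have "(\<lambda>x. emeasure (k x) (A \<inter> D n)) \<in> borel_measurable K" using A D(1) by (intro em) auto
    then have "(\<lambda>x. inverse (c n x) * emeasure (k x) (A \<inter> D n)) \<in> borel_measurable K" using c[of n] by measurable
    then show "(\<lambda>x. emeasure (L n x) A) \<in> borel_measurable K"
      by (subst measurable_cong[OF L_em[OF _ A]]) assumption+
  qed
  have gx: "g x \<in> borel_measurable borel" if "x \<in> space K" for x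
    using measurable_Pair2[OF g that] by simp
  have "(\<lambda>x. SUP n. c n x * (\<integral>\<^sup>+y. g x y \<partial>L n x)) \<in> borel_measurable K"
    using c nn_integral_measurable_subprob_algebra2[OF g L] by measurable
  moreover have "(\<integral>\<^sup>+y. g x y \<partial>k x) = (SUP n. c n x * (\<integral>\<^sup>+y. g x y \<partial>L n x))" if x: "x \<in> space K" for x
  proof -
    have 1: "c n x * (\<integral>\<^sup>+y. g x y \<partial>L n x) = (\<integral>\<^sup>+y. g x y * indicator (D n) y \<partial>k x)" for n
    proof -
      have "c n x * inverse (c n x) = 1" using ennreal_divide_self[of "c n x"] cfin[OF x] by (simp add: divide_ennreal_def top.not_eq_extremum)
      then show ?thesis unfolding L_int[OF x gx[OF x]] mult.assoc[symmetric] by simp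
    qed
    have "(\<integral>\<^sup>+y. (SUP n. g x y * indicator (D n) y) \<partial>k x) = (SUP n. \<integral>\<^sup>+y. g x y * indicator (D n) y \<partial>k x)"
    proof (rule nn_integral_monotone_convergence_SUP)
      show "incseq (\<lambda>n y. g x y * indicator (D n) y)"
        by (intro incseq_SucI le_funI mult_left_mono) (auto simp: indicator_def D_def)
      show "(\<lambda>y. g x y * indicator (D n) y) \<in> borel_measurable (k x)" for n
        using gx[OF x] D(1)[of n] kc(2)[OF x] by (simp cong: measurable_cong_sets)
    qed
    moreover have "(SUP n. g x y * indicator (D n) y) = g x y" for y
    proof (rule antisym)
      show "(SUP n. g x y * indicator (D n) y) \<le> g x y" by (intro SUP_least) (simp add: indicator_def)
      obtain n :: nat where "norm y < n" using reals_Archimedean2 by blast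
      then have "g x y = g x y * indicator (D n) y" by (simp add: D_def)
      also have "\<dots> \<le> (SUP n. g x y * indicator (D n) y)" by (rule SUP_upper) simp
      finally show "g x y \<le> (SUP n. g x y * indicator (D n) y)" .
    qed
    ultimately show ?thesis using 1 by simp
  qed
  ultimately show ?thesis by (subst measurable_cong) assumption+
qed

lemma emeasure_config_measurable:
  fixes k :: "'x \<Rightarrow> 'a::euclidean_space measure"
  assumes k: "k \<in> K \<rightarrow>\<^sub>M config_algebra UNIV" and P: "Measurable.pred (K \<Otimes>\<^sub>M borel) (\<lambda>(x, y). P x y)"
  shows "(\<lambda>x. emeasure (k x) {y. P x y}) \<in> borel_measurable K"
    and "x \<in> space K \<Longrightarrow> {y. P x y} \<in> sets borel"
proof -
  show s: "{y. P x y} \<in> sets borel" if "x \<in> space K" for x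
    using measurable_Pair2[OF P that] by (simp add: pred_def)
  have m: "(\<lambda>(x, y). indicator {y. P x y} y :: ennreal) \<in> borel_measurable (K \<Otimes>\<^sub>M borel)"
  proof -
    have "(\<lambda>p. indicator {p\<in>space (K \<Otimes>\<^sub>M borel). case p of (x, y) \<Rightarrow> P x y} p :: ennreal) \<in> borel_measurable (K \<Otimes>\<^sub>M borel)"
      using P by (intro borel_measurable_indicator) (simp add: pred_def)
    then show ?thesis by (rule measurable_cong[THEN iffD1, rotated]) (auto simp: indicator_def)
  qed
  show "(\<lambda>x. emeasure (k x) {y. P x y}) \<in> borel_measurable K"
  proof (rule measurable_cong[THEN iffD2, OF _ nn_integral_config_measurable[OF k m]])
    fix x assume x: "x \<in> space K"
    show "emeasure (k x) {y. P x y} = (\<integral>\<^sup>+y. indicator {y. P x y} y \<partial>k x)"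
      using s[OF x] config_kernel(2)[OF k x] by (intro nn_integral_indicator[symmetric]) simp
  qed
qed

text \<open>
  Inside a bounded set the integral is a finite sum over atoms of integral mass.
\<close>

lemma config_integral_nat:
  fixes f :: "'a::euclidean_space \<Rightarrow> ennreal"
  assumes \<mu>: "\<mu> \<in> point_configs UNIV" and D: "D \<in> sets borel" "bounded D"
    and f: "f \<in> borel_measurable borel" "\<And>x. \<exists>n::nat. f x = of_nat n"
  shows "\<exists>n::nat. (\<integral>\<^sup>+x. f x * indicator D x \<partial>\<mu>) = of_nat n"
proof -
  have s: "sets \<mu> = sets borel" using sets_config[OF \<mu>] by simp
  obtain m :: nat where m: "emeasure \<mu> D = of_nat m" using config_bounded_nat[OF \<mu> _ D(2)] D(1) s by auto
  define F where "F = {x\<in>D. emeasure \<mu> {x} \<noteq> 0}"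
  have finF: "finite F" unfolding F_def using config_finite_atoms[OF \<mu>, of D] D(1) s m by auto
  have sD: "D - F \<in> sets \<mu>" "{x} \<in> sets \<mu>" for x using s D(1) finite_imp_closed[OF finF] by auto
  have "emeasure \<mu> (D - F) = 0" by (rule config_no_atoms_null[OF \<mu> sD(1)]) (auto simp: F_def)
  then have ae: "AE x in \<mu>. x \<notin> D - F" using sD(1) by (intro AE_not_in) auto
  have "(\<integral>\<^sup>+x. f x * indicator D x \<partial>\<mu>) = (\<integral>\<^sup>+x. (\<Sum>z\<in>F. f z * indicator {z} x) \<partial>\<mu>)"
  proof (rule nn_integral_cong_AE, use ae in eventually_elim)
    fix x assume x: "x \<notin> D - F"
    show "f x * indicator D x = (\<Sum>z\<in>F. f z * indicator {z} x)"
    proof (cases "x \<in> F")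
      case True
      then have "(\<Sum>z\<in>F. f z * indicator {z} x) = (\<Sum>z\<in>{x}. f z * indicator {z} x)"
        by (intro sum.mono_neutral_right finF) (auto simp: indicator_def)
      then show ?thesis using True by (simp add: F_def)
    next
      case False
      then have "(\<Sum>z\<in>F. f z * indicator {z} x) = 0" by (intro sum.neutral) (auto simp: indicator_def)
      moreover have "x \<notin> D" using x False by blast
      ultimately show ?thesis by simp
    qed
  qed
  also have "\<dots> = (\<Sum>z\<in>F. f z * emeasure \<mu> {z})"
    using sD(2) by (subst nn_integral_sum) (auto simp: nn_integral_cmult_indicator)
  finally have eq: "(\<integral>\<^sup>+x. f x * indicator D x \<partial>\<mu>) = (\<Sum>z\<in>F. f z * emeasure \<mu> {z})" .
  have "\<exists>n::nat. f z * emeasure \<mu> {z} = of_nat n" for z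
  proof -
    obtain i :: nat where i: "f z = of_nat i" using f(2) by blast
    obtain j :: nat where j: "emeasure \<mu> {z} = of_nat j" using config_bounded_nat[OF \<mu> sD(2)] by auto
    show ?thesis unfolding i j by (intro exI[of _ "i * j"]) simp
  qed
  then obtain h :: "'a \<Rightarrow> nat" where "\<And>z. f z * emeasure \<mu> {z} = of_nat (h z)" by metis
  then have "(\<Sum>z\<in>F. f z * emeasure \<mu> {z}) = of_nat (\<Sum>z\<in>F. h z)" by simp
  then show ?thesis using eq by metis
qed

lemma config_sigma_finite:
  fixes \<mu> :: "'a::euclidean_space measure"
  assumes \<mu>: "\<mu> \<in> point_configs UNIV"
  shows "sigma_finite_measure \<mu>"
proof
  have s: "sets \<mu> = sets borel" using sets_config[OF \<mu>] by simp
  have "ball (0::'a) (real n) \<in> sets \<mu> \<and> emeasure \<mu> (ball 0 (real n)) \<noteq> \<infinity>" for n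
  proof -
    obtain m :: nat where "emeasure \<mu> (ball 0 (real n)) = of_nat m"
      using config_bounded_nat[OF \<mu>, of "ball 0 (real n)"] s by auto
    then show ?thesis using s by simp
  qed
  moreover have "(\<Union>n. ball (0::'a) (real n)) = UNIV" using reals_Archimedean2 by auto
  ultimately show "\<exists>A. countable A \<and> A \<subseteq> sets \<mu> \<and> \<Union>A = space \<mu> \<and> (\<forall>a\<in>A. emeasure \<mu> a \<noteq> \<infinity>)"
    using space_config[OF \<mu>] by (intro exI[of _ "range (\<lambda>n. ball (0::'a) (real n))"]) auto
qed

section \<open>The edges as a function of the points and the boxes\<close>

lemma borel_measurable_vec_component:
  assumes "f \<in> K \<rightarrow>\<^sub>M (borel :: (real ^ 'd) measure)"
  shows "(\<lambda>w. f w $ i) \<in> borel_measurable K"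
proof -
  have "(\<lambda>x :: real ^ 'd. x $ i) \<in> borel_measurable borel" by (intro borel_measurable_continuous_onI continuous_intros)
  then show ?thesis by (rule measurable_compose[OF assms])
qed

lemma grid_offset_measurable':
  assumes "u \<in> K \<rightarrow>\<^sub>M grid_law" shows "(\<lambda>w. u w i k) \<in> borel_measurable K"
  using measurable_compose[OF assms grid_offset_measurable] .

context
  fixes K :: "'x measure" and a :: "'d::finite" and u :: "'x \<Rightarrow> 'd \<Rightarrow> nat \<Rightarrow> real" and x y :: "'x \<Rightarrow> real ^ 'd"
  assumes u: "u \<in> K \<rightarrow>\<^sub>M grid_law" and x: "x \<in> borel_measurable K"
begin

lemma pos_measurable: "(\<lambda>w. pos a (u w) n (x w) i) \<in> borel_measurable K"
  unfolding pos_def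
  by (intro measurable_compose[OF _ borel_measurable_wrap] borel_measurable_diff grid_offset_measurable'[OF u]
      borel_measurable_vec_component x)

lemma portal_measurable: "Measurable.pred K (\<lambda>w. portal a (u w) n (x w))"
  unfolding portal_def using pos_measurable by measurable

lemma reserved_measurable: "Measurable.pred K (\<lambda>w. reserved a (u w) n (x w))"
  unfolding reserved_def using portal_measurable by measurable

lemma own_level_measurable: "Measurable.pred K (\<lambda>w. own_level a (u w) n (x w))"
  unfolding own_level_def using portal_measurable reserved_measurable by measurable

end

lemma same_box_iff: "same_box a u n x y \<longleftrightarrow> (\<forall>i. x $ i - y $ i = pos a u n x i - pos a u n y i)"
proof -
  have "cell a u n x i = cell a u n y i \<longleftrightarrow> x $ i - y $ i = pos a u n x i - pos a u n y i" for i
  proof -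
    have "x $ i - y $ i = pos a u n x i - pos a u n y i \<longleftrightarrow> side a n i * of_int (cell a u n x i) = side a n i * of_int (cell a u n y i)"
      using cell_pos[of x i u a n] cell_pos[of y i u a n] by linarith
    then show ?thesis using less_imp_neq[OF side_pos[of a n i]] by simp
  qed
  then show ?thesis by (simp add: same_box_def)
qed

lemma same_box_measurable:
  assumes "u \<in> K \<rightarrow>\<^sub>M grid_law" "x \<in> borel_measurable K" "y \<in> borel_measurable K"
  shows "Measurable.pred K (\<lambda>w. same_box a (u w) n (x w) (y w))"
  unfolding same_box_iff
  using pos_measurable[OF assms(1,2)] pos_measurable[OF assms(1,3)]
    borel_measurable_vec_component[OF assms(2)] borel_measurable_vec_component[OF assms(3)] by measurable

lemma precedes_measurable:
  assumes "u \<in> K \<rightarrow>\<^sub>M grid_law" "x \<in> borel_measurable K" "y \<in> borel_measurable K"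
  shows "Measurable.pred K (\<lambda>w. precedes a (u w) n (x w) (y w))"
proof -
  have [measurable]: "(\<lambda>w. x w $ i) \<in> borel_measurable K" "(\<lambda>w. y w $ i) \<in> borel_measurable K" for i
    using assms by (auto intro: borel_measurable_vec_component)
  have [measurable]: "Measurable.pred K (\<lambda>w. lex_less (x w) (y w))" unfolding lex_less_def by measurable
  note [measurable] = own_level_measurable[OF assms(1,2)] own_level_measurable[OF assms(1,3)]
  show ?thesis unfolding precedes_def by measurable
qed

text \<open>
  The pools and the matching of the previous sections, with cardinalities replaced by masses.  In this
  form they are defined for all configurations and measurable by construction; for simple
  configurations they agree.
\<close>

primrec avail :: "'d::finite \<Rightarrow> nat \<Rightarrow> ('d \<Rightarrow> nat \<Rightarrow> real) \<Rightarrow> (real ^ 'd) measure \<Rightarrow> (real ^ 'd) measure \<Rightarrow> real ^ 'd \<Rightarrow> bool"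
  where
  "avail a 0 = (\<lambda>u R B x. own_level a u 0 x)"
| "avail a (Suc n) = (\<lambda>u R B x. own_level a u (Suc n) x \<or>
     avail a n u R B x \<and> emeasure B {y. avail a n u B R y \<and> same_box a u n x y} \<le>
       emeasure R {y. avail a n u R B y \<and> same_box a u n x y \<and> precedes a u n y x})"

definition matched :: "'d::finite \<Rightarrow> ('d \<Rightarrow> nat \<Rightarrow> real) \<Rightarrow> (real ^ 'd) measure \<Rightarrow> (real ^ 'd) measure \<Rightarrow> real ^ 'd \<Rightarrow> real ^ 'd \<Rightarrow> bool"
  where
  "matched a u R B r b \<longleftrightarrow> (\<exists>n. avail a n u R B r \<and> avail a n u B R b \<and> same_box a u n r b \<and>
     emeasure R {y. avail a n u R B y \<and> same_box a u n r y \<and> precedes a u n y r} =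
     emeasure B {y. avail a n u B R y \<and> same_box a u n b y \<and> precedes a u n y b})"


lemma avail_measurable_compose:
  fixes x :: "'x \<Rightarrow> real ^ 'd::finite"
  assumes "Measurable.pred (grid_law \<Otimes>\<^sub>M config_algebra UNIV \<Otimes>\<^sub>M config_algebra UNIV \<Otimes>\<^sub>M borel)
      (\<lambda>(u, R, B, x). avail a n u R B x)"
    and "u \<in> K \<rightarrow>\<^sub>M grid_law" "R \<in> K \<rightarrow>\<^sub>M config_algebra UNIV" "B \<in> K \<rightarrow>\<^sub>M config_algebra UNIV" "x \<in> borel_measurable K"
  shows "Measurable.pred K (\<lambda>w. avail a n (u w) (R w) (B w) (x w))"
  using measurable_compose[OF measurable_Pair[OF assms(2) measurable_Pair[OF assms(3) measurable_Pair[OF assms(4,5)]]] assms(1)]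
  by simp

text \<open>
  The induction has to be over all arguments jointly, since the two colours swap roles and the
  point becomes a variable of integration.
\<close>

lemma avail_measurable_quadruple:
  fixes a :: "'d::finite"
  shows "Measurable.pred (grid_law \<Otimes>\<^sub>M config_algebra UNIV \<Otimes>\<^sub>M config_algebra UNIV \<Otimes>\<^sub>M borel)
     (\<lambda>(u, R, B, x). avail a n u R B x)"
proof (induction n)
  case 0
  show ?case unfolding avail.simps split_beta by (rule own_level_measurable) measurable
next
  case (Suc n)
  let ?K = "grid_law \<Otimes>\<^sub>M config_algebra UNIV \<Otimes>\<^sub>M config_algebra UNIV \<Otimes>\<^sub>M (borel :: (real ^ 'd) measure)"
  note av = avail_measurable_compose[OF Suc.IH]
  have [measurable]: "Measurable.pred ?K (\<lambda>w. own_level a (fst w) (Suc n) (snd (snd (snd w))))"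
    by (rule own_level_measurable) measurable
  have [measurable]: "Measurable.pred ?K (\<lambda>w. avail a n (fst w) (fst (snd w)) (fst (snd (snd w))) (snd (snd (snd w))))"
    by (rule av) measurable
  have av2: "Measurable.pred (?K \<Otimes>\<^sub>M borel) (\<lambda>p. avail a n (fst (fst p)) (fst (snd (snd (fst p)))) (fst (snd (fst p))) (snd p))"
    "Measurable.pred (?K \<Otimes>\<^sub>M borel) (\<lambda>p. avail a n (fst (fst p)) (fst (snd (fst p))) (fst (snd (snd (fst p)))) (snd p))"
    by (rule av; measurable)+
  have sb: "Measurable.pred (?K \<Otimes>\<^sub>M borel) (\<lambda>p. same_box a (fst (fst p)) n (snd (snd (snd (fst p)))) (snd p))"
    by (rule same_box_measurable) measurable
  have pr: "Measurable.pred (?K \<Otimes>\<^sub>M borel) (\<lambda>p. precedes a (fst (fst p)) n (snd p) (snd (snd (snd (fst p)))))"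
    by (rule precedes_measurable) measurable
  have [measurable]: "(\<lambda>w. emeasure (fst (snd (snd w))) {y. avail a n (fst w) (fst (snd (snd w))) (fst (snd w)) y \<and> same_box a (fst w) n (snd (snd (snd w))) y}) \<in> borel_measurable ?K"
  proof (rule emeasure_config_measurable(1), goal_cases)
    case 2
    show ?case unfolding split_beta by (rule pred_intros_logic(3)[OF av2(1) sb])
  qed measurable
  have [measurable]: "(\<lambda>w. emeasure (fst (snd w)) {y. avail a n (fst w) (fst (snd w)) (fst (snd (snd w))) y \<and> same_box a (fst w) n (snd (snd (snd w))) y \<and> precedes a (fst w) n y (snd (snd (snd w)))}) \<in> borel_measurable ?K"
  proof (rule emeasure_config_measurable(1), goal_cases)
    case 2
    show ?case unfolding split_beta by (rule pred_intros_logic(3)[OF av2(2) pred_intros_logic(3)[OF sb pr]])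
  qed measurable
  show ?case unfolding avail.simps split_beta by measurable
qed

lemmas avail_measurable = avail_measurable_compose[OF avail_measurable_quadruple]

lemma rank_measurable:
  fixes x :: "'x \<Rightarrow> real ^ 'd::finite"
  assumes "u \<in> K \<rightarrow>\<^sub>M grid_law" "R \<in> K \<rightarrow>\<^sub>M config_algebra UNIV" "B \<in> K \<rightarrow>\<^sub>M config_algebra UNIV" "x \<in> borel_measurable K"
  shows "(\<lambda>w. emeasure (R w) {y. avail a n (u w) (R w) (B w) y \<and> same_box a (u w) n (x w) y \<and> precedes a (u w) n y (x w)}) \<in> borel_measurable K"
proof -
  note m' = measurable_compose[OF measurable_fst assms(1)] measurable_compose[OF measurable_fst assms(2)]
    measurable_compose[OF measurable_fst assms(3)] measurable_compose[OF measurable_fst assms(4)]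
  show ?thesis
  proof (rule emeasure_config_measurable(1)[OF assms(2)])
    show "Measurable.pred (K \<Otimes>\<^sub>M borel) (\<lambda>(w, y). avail a n (u w) (R w) (B w) y \<and> same_box a (u w) n (x w) y \<and> precedes a (u w) n y (x w))"
      unfolding split_beta
      by (rule pred_intros_logic(3)[OF avail_measurable[OF m'(1-3) measurable_snd]
          pred_intros_logic(3)[OF same_box_measurable[OF m'(1,4) measurable_snd] precedes_measurable[OF m'(1) measurable_snd m'(4)]]])
  qed
qed

lemma matched_measurable:
  fixes r b :: "'x \<Rightarrow> real ^ 'd::finite"
  assumes "u \<in> K \<rightarrow>\<^sub>M grid_law" "R \<in> K \<rightarrow>\<^sub>M config_algebra UNIV" "B \<in> K \<rightarrow>\<^sub>M config_algebra UNIV"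
    "r \<in> borel_measurable K" "b \<in> borel_measurable K"
  shows "Measurable.pred K (\<lambda>w. matched a (u w) (R w) (B w) (r w) (b w))"
proof -
  note [measurable] = avail_measurable[OF assms(1-4)] avail_measurable[OF assms(1,3,2,5)]
    same_box_measurable[OF assms(1,4,5)] rank_measurable[OF assms(1-4)] rank_measurable[OF assms(1,3,2,5)]
  show ?thesis unfolding matched_def by measurable
qed

text \<open>
  The product measure counts all pairs of a red and a blue point; keep the matched ones.
\<close>

definition edge_config :: "'d::finite \<Rightarrow> ('d \<Rightarrow> nat \<Rightarrow> real) \<Rightarrow> (real ^ 'd) measure \<Rightarrow> (real ^ 'd) measure \<Rightarrow> ((real ^ 'd) \<times> (real ^ 'd)) measure"
  where
  "edge_config a u R B = density (R \<Otimes>\<^sub>M B) (indicator {(r, b). matched a u R B r b})"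

lemma avail_sets:
  assumes "R \<in> point_configs UNIV" "B \<in> point_configs UNIV"
  shows "{y :: real ^ 'd::finite. avail a n u R B y} \<in> sets borel"
proof -
  have "Measurable.pred borel (\<lambda>y. avail a n u R B y)"
    by (rule avail_measurable) (use assms in \<open>simp_all add: space_config_algebra\<close>)
  then show ?thesis by (simp add: pred_def)
qed

lemma same_box_sets: "{y. same_box a u n x y} \<in> sets borel"
proof -
  have "Measurable.pred borel (\<lambda>y. same_box a u n x y)" by (rule same_box_measurable) simp_all
  then show ?thesis by (simp add: pred_def)
qed

lemma precedes_sets: "{y. precedes a u n y x} \<in> sets borel"
proof -
  have "Measurable.pred borel (\<lambda>y. precedes a u n y x)" by (rule precedes_measurable) simp_all
  then show ?thesis by (simp add: pred_def)
qed

lemma emeasure_within_box: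
  assumes \<mu>: "\<mu> \<in> point_configs UNIV" "simple_config \<mu>" and A: "A \<in> sets borel" "A \<subseteq> {y. same_box a u n x y}"
  shows "emeasure \<mu> A = of_nat (card (A \<inter> point_support \<mu>))"
proof -
  have "A \<in> sets \<mu>" using A(1) sets_config[OF \<mu>(1)] by simp
  moreover have "bounded A" by (rule bounded_subset[OF bounded_box_of A(2)])
  ultimately show ?thesis using simple_config_card[OF \<mu>] simple_config_finite[OF \<mu>] by blast
qed

lemma matched_pairs_sets:
  assumes "R \<in> point_configs UNIV" "B \<in> point_configs UNIV"
  shows "{(r, b :: real ^ 'd::finite). matched a u R B r b} \<in> sets borel"
proof -
  have "Measurable.pred (borel \<Otimes>\<^sub>M borel) (\<lambda>p. matched a u R B (fst p) (snd p))"
    by (rule matched_measurable) (use assms in \<open>simp_all add: space_config_algebra\<close>)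
  then show ?thesis by (simp add: pred_def borel_prod case_prod_beta' space_pair_measure)
qed

lemma config_pair_sets:
  assumes "R \<in> point_configs UNIV" "B \<in> point_configs UNIV"
  shows "sets (R \<Otimes>\<^sub>M B) = sets (borel :: ('a::euclidean_space \<times> 'b::euclidean_space) measure)"
proof -
  have "sets R = sets borel" "sets B = sets borel" using assms[THEN sets_config] by simp_all
  then have "sets (R \<Otimes>\<^sub>M B) = sets (borel \<Otimes>\<^sub>M borel)" by (intro sets_pair_measure_cong)
  then show ?thesis by (simp only: borel_prod)
qed

lemma emeasure_edge_config:
  fixes R B :: "(real ^ 'd::finite) measure"
  assumes R: "R \<in> point_configs UNIV" and B: "B \<in> point_configs UNIV" and A: "A \<in> sets borel"
  shows "emeasure (edge_config a u R B) A = (\<integral>\<^sup>+r. emeasure B {b. (r, b) \<in> A \<and> matched a u R B r b} \<partial>R)"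
    and "{b. (r, b) \<in> A \<and> matched a u R B r b} \<in> sets borel"
proof -
  let ?X = "{(r, b). matched a u R B r b}"
  interpret B: sigma_finite_measure B by (rule config_sigma_finite[OF B])
  have X: "?X \<in> sets (R \<Otimes>\<^sub>M B)" "A \<in> sets (R \<Otimes>\<^sub>M B)"
    using matched_pairs_sets[OF R B] A config_pair_sets[OF R B] by auto
  have "emeasure (edge_config a u R B) A = (\<integral>\<^sup>+p. indicator ?X p * indicator A p \<partial>(R \<Otimes>\<^sub>M B))"
    unfolding edge_config_def using X by (intro emeasure_density) auto
  also have "\<dots> = (\<integral>\<^sup>+p. indicator (?X \<inter> A) p \<partial>(R \<Otimes>\<^sub>M B))"
    by (simp only: indicator_inter_arith)
  also have "\<dots> = emeasure (R \<Otimes>\<^sub>M B) (?X \<inter> A)"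
    by (rule nn_integral_indicator[OF sets.Int[OF X]])
  also have "\<dots> = (\<integral>\<^sup>+r. emeasure B (Pair r -` (?X \<inter> A)) \<partial>R)"
    by (rule B.emeasure_pair_measure_alt[OF sets.Int[OF X]])
  also have "(\<lambda>r. Pair r -` (?X \<inter> A)) = (\<lambda>r. {b. (r, b) \<in> A \<and> matched a u R B r b})"
    by (rule ext) blast
  finally show "emeasure (edge_config a u R B) A = (\<integral>\<^sup>+r. emeasure B {b. (r, b) \<in> A \<and> matched a u R B r b} \<partial>R)" .
  have "Pair r -` (?X \<inter> A) \<in> sets B" by (rule sets_Pair1[OF sets.Int[OF X]])
  moreover have "Pair r -` (?X \<inter> A) = {b. (r, b) \<in> A \<and> matched a u R B r b}" by blast
  ultimately show "{b. (r, b) \<in> A \<and> matched a u R B r b} \<in> sets borel" using sets_config[OF B] by simp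
qed

lemma edge_config_point_config:
  fixes R B :: "(real ^ 'd::finite) measure"
  assumes R: "R \<in> point_configs UNIV" and B: "B \<in> point_configs UNIV"
  shows "edge_config a u R B \<in> point_configs UNIV"
  unfolding point_configs_def mem_Collect_eq
proof (intro conjI ballI impI)
  show s: "sets (edge_config a u R B) = sets (restrict_space borel UNIV)"
    by (simp add: edge_config_def config_pair_sets[OF R B])
  fix A assume "A \<in> sets (edge_config a u R B)" and bA: "bounded A"
  then have A: "A \<in> sets borel" using s by simp
  note em = emeasure_edge_config[OF R B A, where a = a and u = u]
  obtain k where k: "\<And>p. p \<in> A \<Longrightarrow> norm p \<le> k" using bA bounded_iff by blast
  define D where "D = cball (0 :: real ^ 'd) k"
  have D: "D \<in> sets borel" "bounded D" by (simp_all add: D_def)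
  have AD: "r \<in> D \<and> b \<in> D" if "(r, b) \<in> A" for r b
    using k[OF that] norm_fst_le[of r b] norm_snd_le[of b r] by (auto simp: D_def)
  let ?f = "\<lambda>r. emeasure B {b. (r, b) \<in> A \<and> matched a u R B r b}"
  have f: "?f r * indicator D r = ?f r" for r
  proof (cases "r \<in> D")
    case False
    then have "{b. (r, b) \<in> A \<and> matched a u R B r b} = {}" using AD by blast
    then show ?thesis by (simp only: emeasure_empty mult_zero_left)
  qed simp
  have nat: "\<exists>n::nat. ?f r = of_nat n" for r
  proof (rule config_bounded_nat[OF B])
    show "{b. (r, b) \<in> A \<and> matched a u R B r b} \<in> sets B" using em(2) sets_config[OF B] by simp
    show "bounded {b. (r, b) \<in> A \<and> matched a u R B r b}" by (rule bounded_subset[OF D(2)]) (use AD in blast)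
  qed
  have "Measurable.pred (borel \<Otimes>\<^sub>M borel) (\<lambda>(r, b). (r, b) \<in> A \<and> matched a u R B r b)"
  proof -
    have "A \<inter> {(r, b). matched a u R B r b} \<in> sets (borel \<Otimes>\<^sub>M borel)"
      unfolding borel_prod by (intro sets.Int A matched_pairs_sets R B)
    moreover have "A \<inter> {(r, b). matched a u R B r b} = {p\<in>space (borel \<Otimes>\<^sub>M borel). case p of (r, b) \<Rightarrow> (r, b) \<in> A \<and> matched a u R B r b}"
      by (auto simp: space_pair_measure)
    ultimately show ?thesis by (simp only: pred_def)
  qed
  then have "?f \<in> borel_measurable borel"
    by (rule emeasure_config_measurable(1)[rotated]) (use B in \<open>simp add: space_config_algebra\<close>)
  then show "\<exists>n::nat. emeasure (edge_config a u R B) A = of_nat n"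
    using config_integral_nat[OF R D, of ?f] nat unfolding em(1) f by blast
qed

lemma edge_config_measurable:
  fixes R B :: "'x \<Rightarrow> (real ^ 'd::finite) measure"
  assumes u: "u \<in> K \<rightarrow>\<^sub>M grid_law" and R: "R \<in> K \<rightarrow>\<^sub>M config_algebra UNIV" and B: "B \<in> K \<rightarrow>\<^sub>M config_algebra UNIV"
  shows "(\<lambda>w. edge_config a (u w) (R w) (B w)) \<in> K \<rightarrow>\<^sub>M config_algebra UNIV"
proof (rule measurable_config_algebraI)
  note Rc = config_kernel(1)[OF R] and Bc = config_kernel(1)[OF B]
  show "edge_config a (u w) (R w) (B w) \<in> point_configs UNIV" if "w \<in> space K" for w
    by (rule edge_config_point_config[OF Rc[OF that] Bc[OF that]])
  fix A :: "((real ^ 'd) \<times> (real ^ 'd)) set" assume "A \<in> sets (restrict_space borel UNIV)"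
  then have A: "A \<in> sets borel" by simp
  let ?KK = "(K \<Otimes>\<^sub>M borel) \<Otimes>\<^sub>M (borel :: (real ^ 'd) measure)"
  have fst2: "(\<lambda>p. fst (fst p)) \<in> ?KK \<rightarrow>\<^sub>M K" by measurable
  have P1: "Measurable.pred ?KK (\<lambda>p. matched a (u (fst (fst p))) (R (fst (fst p))) (B (fst (fst p))) (snd (fst p)) (snd p))"
    by (rule matched_measurable[OF measurable_compose[OF fst2 u] measurable_compose[OF fst2 R] measurable_compose[OF fst2 B]]) measurable
  have "A \<in> sets (borel \<Otimes>\<^sub>M borel)" unfolding borel_prod by (rule A)
  then have P2: "Measurable.pred ?KK (\<lambda>p. (snd (fst p), snd p) \<in> A)"
    by (rule pred_sets2) measurable
  have pr: "Measurable.pred ?KK (\<lambda>(q, b). (snd q, b) \<in> A \<and> matched a (u (fst q)) (R (fst q)) (B (fst q)) (snd q) b)"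
    unfolding split_beta by (rule pred_intros_logic(3)[OF P2 P1])
  have Bf: "(\<lambda>q. B (fst q)) \<in> K \<Otimes>\<^sub>M (borel :: (real ^ 'd) measure) \<rightarrow>\<^sub>M config_algebra UNIV"
    by (rule measurable_compose[OF measurable_fst B])
  have "(\<lambda>w. \<integral>\<^sup>+r. emeasure (B w) {b. (r, b) \<in> A \<and> matched a (u w) (R w) (B w) r b} \<partial>R w) \<in> borel_measurable K"
    by (rule nn_integral_config_measurable[OF R]) (use emeasure_config_measurable(1)[OF Bf pr] in \<open>simp add: split_beta\<close>)
  then show "(\<lambda>w. emeasure (edge_config a (u w) (R w) (B w)) A) \<in> borel_measurable K"
    by (rule measurable_cong[THEN iffD1, rotated]) (simp add: emeasure_edge_config(1)[OF Rc Bc A])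
qed

lemma avail_eq_pool:
  fixes R B :: "(real ^ 'd::finite) measure"
  assumes u: "\<forall>i. nested_offsets (u i)"
    and R: "R \<in> point_configs UNIV" "simple_config R" and B: "B \<in> point_configs UNIV" "simple_config B"
  shows "levels.pool (same_box a u) (own_level a u) (precedes a u) n (point_support R) (point_support B) =
    {x\<in>point_support R. avail a n u R B x}"
proof -
  interpret levels "same_box a u" "own_level a u" "precedes a u" by (rule levels_boxes[OF u])
  show ?thesis using R B
  proof (induction n arbitrary: R B)
    case (Suc n)
    have "x \<in> pool (Suc n) (point_support R) (point_support B) \<longleftrightarrow> x \<in> point_support R \<and> avail a (Suc n) u R B x" for x
    proof -
      have "emeasure B {y. avail a n u B R y \<and> same_box a u n x y} = of_nat (card ({y. avail a n u B R y \<and> same_box a u n x y} \<inter> point_support B))"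
        by (rule emeasure_within_box[OF Suc.prems(3,4)]) (use sets.Int[OF avail_sets[OF Suc.prems(3,1)] same_box_sets] in \<open>auto simp: Collect_conj_eq\<close>)
      moreover have "emeasure R {y. avail a n u R B y \<and> same_box a u n x y \<and> precedes a u n y x} =
          of_nat (card ({y. avail a n u R B y \<and> same_box a u n x y \<and> precedes a u n y x} \<inter> point_support R))"
        by (rule emeasure_within_box[OF Suc.prems(1,2)]) (use sets.Int[OF avail_sets[OF Suc.prems(1,3)] sets.Int[OF same_box_sets precedes_sets]] in \<open>auto simp: Collect_conj_eq\<close>)
      moreover have "{y. avail a n u B R y \<and> same_box a u n x y} \<inter> point_support B = {y \<in> pool n (point_support B) (point_support R). same_box a u n x y}"
        unfolding Suc.IH[OF Suc.prems(3,4,1,2)] by blast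
      moreover have "{y. avail a n u R B y \<and> same_box a u n x y \<and> precedes a u n y x} \<inter> point_support R =
          {y \<in> pool n (point_support R) (point_support B). same_box a u n x y \<and> precedes a u n y x}"
        unfolding Suc.IH[OF Suc.prems] by blast
      ultimately show ?thesis
        unfolding pool_Suc rank_def avail.simps unfolding Suc.IH[OF Suc.prems] by auto
    qed
    then show ?case by blast
  qed simp
qed

text \<open>
  The mass of a pair in the product measure is the product of the masses of its ends.
\<close>

lemma edge_config_support:
  fixes R B :: "(real ^ 'd::finite) measure"
  assumes u: "\<forall>i. nested_offsets (u i)"
    and R: "R \<in> point_configs UNIV" "simple_config R" and B: "B \<in> point_configs UNIV" "simple_config B"
  shows "simple_config (edge_config a u R B)"
    and "point_support (edge_config a u R B) = levels.edges (same_box a u) (own_level a u) (precedes a u) (point_support R) (point_support B)"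
proof -
  interpret levels "same_box a u" "own_level a u" "precedes a u" by (rule levels_boxes[OF u])
  have em: "emeasure (edge_config a u R B) {(r, b)} = (if matched a u R B r b then emeasure R {r} * emeasure B {b} else 0)" for r b :: "real ^ 'd"
  proof -
    have "emeasure (edge_config a u R B) {(r, b)} = (\<integral>\<^sup>+x. emeasure B {y. (x, y) \<in> {(r, b)} \<and> matched a u R B x y} \<partial>R)"
      by (rule emeasure_edge_config(1)[OF R(1) B(1)]) simp
    also have "\<dots> = (\<integral>\<^sup>+x. (if matched a u R B r b then emeasure B {b} else 0) * indicator {r} x \<partial>R)"
    proof (rule nn_integral_cong)
      fix x
      have "{y. (x, y) \<in> {(r, b)} \<and> matched a u R B x y} = (if x = r \<and> matched a u R B r b then {b} else {})" by auto
      then show "emeasure B {y. (x, y) \<in> {(r, b)} \<and> matched a u R B x y} = (if matched a u R B r b then emeasure B {b} else 0) * indicator {r} x"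
        by (simp add: indicator_def)
    qed
    also have "\<dots> = (if matched a u R B r b then emeasure B {b} else 0) * emeasure R {r}"
      using sets_config[OF R(1)] by (intro nn_integral_cmult_indicator) simp
    finally show ?thesis by (simp add: mult.commute)
  qed
  show "simple_config (edge_config a u R B)"
    unfolding simple_config_def
  proof
    fix e :: "(real ^ 'd) \<times> (real ^ 'd)"
    obtain r b where e: "e = (r, b)" by (cases e)
    have "emeasure R {r} * emeasure B {b} \<le> 1 * 1" using R(2) B(2) unfolding simple_config_def by (intro mult_mono) auto
    then show "emeasure (edge_config a u R B) {e} \<le> 1" unfolding e em by simp
  qed
  have one: "emeasure R {r} * emeasure B {b} = 1 \<longleftrightarrow> r \<in> point_support R \<and> b \<in> point_support B" for r b :: "real ^ 'd"
  proof
    assume "emeasure R {r} * emeasure B {b} = 1"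
    then have "emeasure R {r} \<noteq> 0" "emeasure B {b} \<noteq> 0" by auto
    then show "r \<in> point_support R \<and> b \<in> point_support B" using simple_config_support R B by blast
  qed (simp add: point_support_def)
  have rank: "emeasure R {y. avail a n u R B y \<and> same_box a u n x y \<and> precedes a u n y x} = of_nat (rank n (point_support R) (point_support B) x)"
    if R: "R \<in> point_configs UNIV" "simple_config R" and B: "B \<in> point_configs UNIV" "simple_config B" for R B :: "(real ^ 'd) measure" and n x
  proof -
    let ?A = "{y. avail a n u R B y \<and> same_box a u n x y \<and> precedes a u n y x}"
    have A: "?A \<in> sets borel" using sets.Int[OF avail_sets[OF R(1) B(1)] sets.Int[OF same_box_sets precedes_sets], of a n u a u n x a u n x]
      by (simp add: Collect_conj_eq)
    have "?A \<inter> point_support R = {y \<in> pool n (point_support R) (point_support B). same_box a u n x y \<and> precedes a u n y x}"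
      unfolding avail_eq_pool[OF u R B] by blast
    then show ?thesis using emeasure_within_box[OF R A, of a u n x] by (auto simp: rank_def)
  qed
  have "r \<in> point_support R \<and> b \<in> point_support B \<and> matched a u R B r b \<longleftrightarrow> (r, b) \<in> edges (point_support R) (point_support B)" for r b
    unfolding edges_def matched_at_def matched_def rank[OF R B] rank[OF B R] avail_eq_pool[OF u R B] avail_eq_pool[OF u B R] by auto
  moreover have "(r, b) \<in> point_support (edge_config a u R B) \<longleftrightarrow> r \<in> point_support R \<and> b \<in> point_support B \<and> matched a u R B r b" for r b
    using one[of r b] unfolding point_support_def[of "edge_config a u R B"] mem_Collect_eq em by auto
  ultimately show "point_support (edge_config a u R B) = edges (point_support R) (point_support B)" by auto
qed

section \<open>Equivariance under translations\<close>

text \<open>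
  Translating both the point and the grids does not change the position in the box.  The matching
  depends on nothing but these positions and the differences of points.
\<close>

lemma pos_shift: "pos a (shift_grid t u) n (x + t) i = pos a u n x i"
proof -
  have "pos a (shift_grid t u) n (x + t) i = wrap (side a n i) (x $ i + t $ i - wrap (side a n i) (u i (lev a n i) + t $ i))"
    by (simp add: pos_def shift_grid_def shift_offsets_def side_def)
  also obtain k :: int where k: "wrap (side a n i) (u i (lev a n i) + t $ i) = u i (lev a n i) + t $ i - side a n i * of_int k"
    using wrap_eq_diff[of "side a n i"] by blast
  also have "x $ i + t $ i - (u i (lev a n i) + t $ i - side a n i * of_int k) = x $ i - u i (lev a n i) + side a n i * of_int k" by simp
  also have "wrap (side a n i) \<dots> = pos a u n x i" by (simp add: pos_def wrap_add_period[OF side_pos])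
  finally show ?thesis .
qed

lemma own_level_shift: "own_level a (shift_grid t u) n (x + t) \<longleftrightarrow> own_level a u n x"
  by (simp add: own_level_def reserved_def portal_def pos_shift)

lemma same_box_shift: "same_box a (shift_grid t u) n (x + t) (y + t) \<longleftrightarrow> same_box a u n x y"
  by (simp add: same_box_iff pos_shift)

lemma precedes_shift: "precedes a (shift_grid t u) n (x + t) (y + t) \<longleftrightarrow> precedes a u n x y"
  by (simp add: precedes_def own_level_shift lex_less_def)

lemma translate_UNIV:
  fixes \<mu> :: "'a::euclidean_space measure"
  assumes "\<mu> \<in> point_configs UNIV"
  shows "translate UNIV t \<mu> \<in> point_configs UNIV"
    and "A \<in> sets borel \<Longrightarrow> emeasure (translate UNIV t \<mu>) A = emeasure \<mu> {x. x + t \<in> A}"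
  using translate_config[of t UNIV \<mu>] assms by simp_all

lemma avail_shift:
  fixes R B :: "(real ^ 'd::finite) measure"
  assumes "R \<in> point_configs UNIV" "B \<in> point_configs UNIV"
  shows "avail a n (shift_grid t u) (translate UNIV t R) (translate UNIV t B) (x + t) \<longleftrightarrow> avail a n u R B x"
  using assms
proof (induction n arbitrary: R B x)
  case 0
  then show ?case by (simp add: own_level_shift)
next
  case (Suc n)
  note T = translate_UNIV[OF Suc.prems(1), where t = t] translate_UNIV[OF Suc.prems(2), where t = t]
  have 1: "{y. avail a n (shift_grid t u) (translate UNIV t B) (translate UNIV t R) y \<and> same_box a (shift_grid t u) n (x + t) y} \<in> sets borel"
    using sets.Int[OF avail_sets[OF T(3,1)] same_box_sets] by (simp add: Collect_conj_eq)
  have 2: "{y. avail a n (shift_grid t u) (translate UNIV t R) (translate UNIV t B) y \<and> same_box a (shift_grid t u) n (x + t) y \<and> precedes a (shift_grid t u) n y (x + t)} \<in> sets borel"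
    using sets.Int[OF avail_sets[OF T(1,3)] sets.Int[OF same_box_sets precedes_sets]] by (simp add: Collect_conj_eq)
  show ?case
    unfolding avail.simps T(4)[OF 1] T(2)[OF 2] mem_Collect_eq
    by (simp only: own_level_shift same_box_shift precedes_shift Suc.IH[OF Suc.prems] Suc.IH[OF Suc.prems(2,1)])
qed

lemma matched_shift:
  fixes R B :: "(real ^ 'd::finite) measure"
  assumes R: "R \<in> point_configs UNIV" and B: "B \<in> point_configs UNIV"
  shows "matched a (shift_grid t u) (translate UNIV t R) (translate UNIV t B) (r + t) (b + t) \<longleftrightarrow> matched a u R B r b"
proof -
  have rank: "emeasure (translate UNIV t R) {y. avail a n (shift_grid t u) (translate UNIV t R) (translate UNIV t B) y \<and> same_box a (shift_grid t u) n (x + t) y \<and> precedes a (shift_grid t u) n y (x + t)}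
      = emeasure R {y. avail a n u R B y \<and> same_box a u n x y \<and> precedes a u n y x}"
    if R: "R \<in> point_configs UNIV" and B: "B \<in> point_configs UNIV" for R B :: "(real ^ 'd) measure" and n x
  proof -
    note T = translate_UNIV[OF R, where t = t] translate_UNIV[OF B, where t = t]
    have 2: "{y. avail a n (shift_grid t u) (translate UNIV t R) (translate UNIV t B) y \<and> same_box a (shift_grid t u) n (x + t) y \<and> precedes a (shift_grid t u) n y (x + t)} \<in> sets borel"
      using sets.Int[OF avail_sets[OF T(1,3)] sets.Int[OF same_box_sets precedes_sets]] by (simp add: Collect_conj_eq)
    show ?thesis unfolding T(2)[OF 2] mem_Collect_eq by (simp only: same_box_shift precedes_shift avail_shift[OF R B])
  qed
  show ?thesis unfolding matched_def rank[OF R B] rank[OF B R] avail_shift[OF R B] avail_shift[OF B R] same_box_shift by (rule refl)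
qed

lemma edge_config_shift:
  fixes R B :: "(real ^ 'd::finite) measure"
  assumes R: "R \<in> point_configs UNIV" and B: "B \<in> point_configs UNIV"
  shows "edge_config a (shift_grid t u) (translate UNIV t R) (translate UNIV t B) = translate UNIV (t, t) (edge_config a u R B)"
proof (rule measure_eqI)
  note T = translate_UNIV[OF R, where t = t] translate_UNIV[OF B, where t = t]
  note E = edge_config_point_config[OF R B, where a = a and u = u] and E' = edge_config_point_config[OF T(1,3), where a = a and u = "shift_grid t u"]
  show "sets (edge_config a (shift_grid t u) (translate UNIV t R) (translate UNIV t B)) = sets (translate UNIV (t, t) (edge_config a u R B))"
    using sets_config[OF E'] sets_config[OF translate_UNIV(1)[OF E]] by simp
  fix A assume "A \<in> sets (edge_config a (shift_grid t u) (translate UNIV t R) (translate UNIV t B))"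
  then have A: "A \<in> sets borel" using sets_config[OF E'] by simp
  have shift: "(\<lambda>x::real ^ 'd. x + t) \<in> R \<rightarrow>\<^sub>M restrict_space borel UNIV"
    using borel_measurable_shift[of t] sets_config[OF R] by (simp cong: measurable_cong_sets)
  let ?A = "{p. p + (t, t) \<in> A}"
  have A': "?A \<in> sets borel" using sets_shift[of "(t, t)" UNIV A] A by simp
  let ?f = "\<lambda>r. emeasure (translate UNIV t B) {b. (r, b) \<in> A \<and> matched a (shift_grid t u) (translate UNIV t R) (translate UNIV t B) r b}"
  have fm: "?f \<in> borel_measurable (restrict_space borel UNIV)"
  proof -
    let ?M = "{(r, b). matched a (shift_grid t u) (translate UNIV t R) (translate UNIV t B) r b}"
    have "A \<inter> ?M \<in> sets (borel \<Otimes>\<^sub>M borel)"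
      unfolding borel_prod by (intro sets.Int A matched_pairs_sets T)
    moreover have "A \<inter> ?M = {p\<in>space (borel \<Otimes>\<^sub>M borel). case p of (r, b) \<Rightarrow> (r, b) \<in> A \<and> matched a (shift_grid t u) (translate UNIV t R) (translate UNIV t B) r b}"
      by (auto simp: space_pair_measure)
    ultimately have "Measurable.pred (borel \<Otimes>\<^sub>M borel) (\<lambda>(r, b). (r, b) \<in> A \<and> matched a (shift_grid t u) (translate UNIV t R) (translate UNIV t B) r b)"
      by (simp only: pred_def)
    then have "?f \<in> borel_measurable borel"
      by (rule emeasure_config_measurable(1)[rotated]) (use T(3) in \<open>simp add: space_config_algebra\<close>)
    then show ?thesis by simp
  qed
  have "emeasure (edge_config a (shift_grid t u) (translate UNIV t R) (translate UNIV t B)) A = (\<integral>\<^sup>+r. ?f r \<partial>translate UNIV t R)"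
    by (rule emeasure_edge_config(1)[OF T(1,3) A])
  also have "\<dots> = (\<integral>\<^sup>+r. ?f (r + t) \<partial>R)"
    unfolding translate_def[of UNIV t R] by (rule nn_integral_distr[OF shift]) (use fm in \<open>simp add: translate_def\<close>)
  also have "\<dots> = (\<integral>\<^sup>+r. emeasure B {b. (r, b) \<in> ?A \<and> matched a u R B r b} \<partial>R)"
  proof (rule nn_integral_cong)
    fix r
    show "?f (r + t) = emeasure B {b. (r, b) \<in> ?A \<and> matched a u R B r b}"
      unfolding T(4)[OF emeasure_edge_config(2)[OF T(1,3) A]] mem_Collect_eq matched_shift[OF R B] by (simp only: add_Pair)
  qed
  also have "\<dots> = emeasure (edge_config a u R B) ?A" by (rule emeasure_edge_config(1)[OF R B A', symmetric])
  also have "\<dots> = emeasure (translate UNIV (t, t) (edge_config a u R B)) A"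
    by (rule translate_UNIV(2)[OF E A, symmetric])
  finally show "emeasure (edge_config a (shift_grid t u) (translate UNIV t R) (translate UNIV t B)) A = emeasure (translate UNIV (t, t) (edge_config a u R B)) A" .
qed

section \<open>Deviations of Poisson counts\<close>

lemma poisson_weight_mean: "(\<lambda>k. real k * poisson_weight m k) sums m"
proof -
  have "(\<lambda>k. m * poisson_weight m k) sums (m * 1)" by (rule sums_mult[OF poisson_weight_sums])
  also have "(\<lambda>k. m * poisson_weight m k) = (\<lambda>k. real (Suc k) * poisson_weight m (Suc k))"
    using poisson_weight_Suc[of m] by (simp add: mult.commute)
  finally show ?thesis by (subst (asm) sums_Suc_iff) simp
qed

lemma poisson_weight_variance: "(\<lambda>k. (real k - m)\<^sup>2 * poisson_weight m k) sums m"
proof -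
  have "(\<lambda>k. m * (real k * poisson_weight m k)) sums (m * m)" by (rule sums_mult[OF poisson_weight_mean])
  also have "(\<lambda>k. m * (real k * poisson_weight m k)) = (\<lambda>k. real (Suc k) * (real (Suc k) - 1) * poisson_weight m (Suc k))"
  proof
    fix k
    have "real (Suc k) * (real (Suc k) - 1) * poisson_weight m (Suc k) = real k * (poisson_weight m (Suc k) * real (Suc k))" by simp
    also have "\<dots> = m * (real k * poisson_weight m k)" unfolding poisson_weight_Suc by simp
    finally show "m * (real k * poisson_weight m k) = real (Suc k) * (real (Suc k) - 1) * poisson_weight m (Suc k)" ..
  qed
  finally have "(\<lambda>k. real k * (real k - 1) * poisson_weight m k) sums (m * m)" by (subst (asm) sums_Suc_iff) simp
  then have "(\<lambda>k. real k * (real k - 1) * poisson_weight m k + (1 - 2 * m) * (real k * poisson_weight m k) + m * m * poisson_weight m k)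
      sums (m * m + (1 - 2 * m) * m + m * m * 1)"
    by (intro sums_add sums_mult poisson_weight_mean poisson_weight_sums)
  moreover have "real k * (real k - 1) * poisson_weight m k + (1 - 2 * m) * (real k * poisson_weight m k) + m * m * poisson_weight m k
      = (real k - m)\<^sup>2 * poisson_weight m k" for k
    by (simp add: power2_eq_square algebra_simps)
  moreover have "m * m + (1 - 2 * m) * m + m * m * 1 = m" by (simp add: algebra_simps)
  ultimately show ?thesis by simp
qed

definition count_within :: "'a measure \<Rightarrow> 'a set \<Rightarrow> real \<Rightarrow> real \<Rightarrow> bool" where
  "count_within \<mu> A m t \<longleftrightarrow> (\<exists>k::nat. emeasure \<mu> A = of_nat k \<and> \<bar>real k - m\<bar> < t)"

lemma poisson_process_deviation:
  assumes P: "poisson_process P S 1 X" and A: "A \<in> sets (restrict_space borel S)" "emeasure lborel A < \<infinity>" and t: "0 < t"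
  shows "measure P {\<omega>\<in>space P. \<not> count_within (X \<omega>) A (measure lborel A) t} \<le> measure lborel A / t\<^sup>2"
    and "{\<omega>\<in>space P. \<not> count_within (X \<omega>) A (measure lborel A) t} \<in> sets P"
proof -
  interpret prob_space P by (rule poisson_process_prob_space[OF P])
  define m where "m = measure lborel A"
  have [measurable]: "(\<lambda>\<omega>. emeasure (X \<omega>) A) \<in> borel_measurable P" by (rule poisson_process_emeasure_measurable[OF P A(1)])
  show "{\<omega>\<in>space P. \<not> count_within (X \<omega>) A (measure lborel A) t} \<in> sets P" unfolding count_within_def by measurable
  let ?E = "{\<omega>\<in>space P. \<exists>k. emeasure (X \<omega>) A = of_nat k \<and> t \<le> \<bar>real k - m\<bar>}"
  have E: "?E \<in> sets P" by measurable
  have "measure P {\<omega>\<in>space P. \<not> count_within (X \<omega>) A m t} \<le> measure P ?E"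
  proof (rule finite_measure_mono_AE[OF _ E])
    show "AE \<omega> in P. \<omega> \<in> {\<omega>\<in>space P. \<not> count_within (X \<omega>) A m t} \<longrightarrow> \<omega> \<in> ?E"
      using poisson_process_AE_nat[OF P A]
    proof eventually_elim
      fix \<omega> assume "\<exists>k::nat. emeasure (X \<omega>) A = of_nat k"
      then obtain k :: nat where k: "emeasure (X \<omega>) A = of_nat k" ..
      show "\<omega> \<in> {\<omega>\<in>space P. \<not> count_within (X \<omega>) A m t} \<longrightarrow> \<omega> \<in> ?E"
      proof
        assume w: "\<omega> \<in> {\<omega>\<in>space P. \<not> count_within (X \<omega>) A m t}"
        then have "\<not> \<bar>real k - m\<bar> < t" using k unfolding count_within_def by blast
        then show "\<omega> \<in> ?E" using k w by (auto intro!: exI[of _ k])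
      qed
    qed
  qed
  also have "measure P ?E \<le> m / t\<^sup>2"
  proof (rule sums_le)
    show "(\<lambda>k. if t \<le> \<bar>real k - m\<bar> then poisson_weight (1 * measure lborel A) k else 0) sums measure P ?E"
      by (rule poisson_process_prob_sums[OF P A])
    show "(\<lambda>k. (real k - m)\<^sup>2 * poisson_weight m k / t\<^sup>2) sums (m / t\<^sup>2)"
      by (rule sums_divide[OF poisson_weight_variance])
    show "(if t \<le> \<bar>real k - m\<bar> then poisson_weight (1 * measure lborel A) k else 0) \<le> (real k - m)\<^sup>2 * poisson_weight m k / t\<^sup>2" for k
    proof -
      have w: "0 \<le> poisson_weight m k" by (rule poisson_weight_nonneg) (simp add: m_def)
      have "1 * poisson_weight m k \<le> (real k - m)\<^sup>2 / t\<^sup>2 * poisson_weight m k" if "t \<le> \<bar>real k - m\<bar>"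
      proof (rule mult_right_mono[OF _ w])
        have "t\<^sup>2 \<le> (real k - m)\<^sup>2" using power_mono[OF that, of 2] t by simp
        then show "1 \<le> (real k - m)\<^sup>2 / t\<^sup>2" using t by simp
      qed
      then show ?thesis using w by (auto simp: m_def[symmetric])
    qed
  qed
  finally show "measure P {\<omega>\<in>space P. \<not> count_within (X \<omega>) A (measure lborel A) t} \<le> measure lborel A / t\<^sup>2"
    by (simp add: m_def)
qed

text \<open>
  If both counts of \<open>A\<close> deviate by less than a quarter of the volume of \<open>D\<close>, and the count of \<open>D\<close> by
  less than half of it, then the surplus in \<open>A\<close> is at most the count of \<open>D\<close>.
\<close>

lemma surplus_exceeds_prob:
  fixes R B :: "'w \<Rightarrow> 'a::euclidean_space measure"
  assumes R: "poisson_process P UNIV 1 R" and B: "poisson_process P UNIV 1 B"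
    and A: "A \<in> sets borel" "emeasure lborel A < \<infinity>" "measure lborel A \<le> v"
    and D: "D \<in> sets borel" "emeasure lborel D < \<infinity>" "w \<le> measure lborel D" "0 < w"
  shows "measure P {\<omega>\<in>space P. \<not> emeasure (R \<omega>) A \<le> emeasure (B \<omega>) A + emeasure (R \<omega>) D} \<le> 32 * v / w\<^sup>2 + 4 / w"
proof -
  interpret prob_space P by (rule poisson_process_prob_space[OF R])
  define m l where "m = measure lborel A" and "l = measure lborel D"
  have l: "0 < l" "w \<le> l" using D by (auto simp: l_def)
  have A': "A \<in> sets (restrict_space borel UNIV)" "D \<in> sets (restrict_space borel UNIV)" using A D by simp_all
  let ?E1 = "{\<omega>\<in>space P. \<not> count_within (R \<omega>) A (measure lborel A) (l / 4)}"
  let ?E2 = "{\<omega>\<in>space P. \<not> count_within (B \<omega>) A (measure lborel A) (l / 4)}"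
  let ?E3 = "{\<omega>\<in>space P. \<not> count_within (R \<omega>) D (measure lborel D) (l / 2)}"
  have E: "measure P ?E1 \<le> m / (l / 4)\<^sup>2" "?E1 \<in> sets P" "measure P ?E2 \<le> m / (l / 4)\<^sup>2" "?E2 \<in> sets P"
    "measure P ?E3 \<le> l / (l / 2)\<^sup>2" "?E3 \<in> sets P"
    using poisson_process_deviation[OF R A'(1) A(2), of "l / 4"] poisson_process_deviation[OF B A'(1) A(2), of "l / 4"]
      poisson_process_deviation[OF R A'(2) D(2), of "l / 2"] l by (simp_all add: m_def l_def)
  have "{\<omega>\<in>space P. \<not> emeasure (R \<omega>) A \<le> emeasure (B \<omega>) A + emeasure (R \<omega>) D} \<subseteq> ?E1 \<union> (?E2 \<union> ?E3)"
  proof (rule subsetI, rule ccontr)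
    fix \<omega> assume w: "\<omega> \<in> {\<omega>\<in>space P. \<not> emeasure (R \<omega>) A \<le> emeasure (B \<omega>) A + emeasure (R \<omega>) D}" "\<omega> \<notin> ?E1 \<union> (?E2 \<union> ?E3)"
    then have "count_within (R \<omega>) A m (l / 4)" "count_within (B \<omega>) A m (l / 4)" "count_within (R \<omega>) D l (l / 2)"
      by (auto simp: m_def l_def)
    then obtain i j k :: nat where ijk: "emeasure (R \<omega>) A = of_nat i" "\<bar>real i - m\<bar> < l / 4"
      "emeasure (B \<omega>) A = of_nat j" "\<bar>real j - m\<bar> < l / 4" "emeasure (R \<omega>) D = of_nat k" "\<bar>real k - l\<bar> < l / 2"
      unfolding count_within_def by blast
    then have "real i \<le> real j + real k" by linarith
    then have "i \<le> j + k" by linarith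
    then have "(of_nat i :: ennreal) \<le> of_nat (j + k)" by (simp only: of_nat_le_iff)
    then show False using w(1) ijk by simp
  qed
  then have "measure P {\<omega>\<in>space P. \<not> emeasure (R \<omega>) A \<le> emeasure (B \<omega>) A + emeasure (R \<omega>) D} \<le> measure P (?E1 \<union> (?E2 \<union> ?E3))"
    using E by (intro finite_measure_mono sets.Un)
  also have "\<dots> \<le> measure P ?E1 + measure P (?E2 \<union> ?E3)" using E by (intro measure_Un_le sets.Un)
  also have "\<dots> \<le> measure P ?E1 + (measure P ?E2 + measure P ?E3)" using E by (intro add_left_mono measure_Un_le)
  also have "\<dots> \<le> m / (l / 4)\<^sup>2 + (m / (l / 4)\<^sup>2 + l / (l / 2)\<^sup>2)" using E by (intro add_mono)
  also have "\<dots> = 32 * m / l\<^sup>2 + 4 / l" using l by (simp add: field_simps power2_eq_square)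
  also have "\<dots> \<le> 32 * v / w\<^sup>2 + 4 / w"
  proof (rule add_mono)
    have "0 \<le> m" by (simp add: m_def)
    moreover have "m \<le> v" using A(3) by (simp add: m_def)
    ultimately show "32 * m / l\<^sup>2 \<le> 32 * v / w\<^sup>2" using D(4) l by (intro frac_le power_mono) auto
    show "4 / l \<le> 4 / w" using l D(4) by (intro divide_left_mono) auto
  qed
  finally show ?thesis .
qed

section \<open>Good boxes\<close>

definition entering :: "'d \<Rightarrow> ('d \<Rightarrow> nat \<Rightarrow> real) \<Rightarrow> nat \<Rightarrow> real ^ 'd \<Rightarrow> (real ^ 'd) set" where
  "entering a u n q = {y. same_box a u n q y \<and> \<not> reserved a u n y}"

definition owned :: "'d \<Rightarrow> ('d \<Rightarrow> nat \<Rightarrow> real) \<Rightarrow> nat \<Rightarrow> real ^ 'd \<Rightarrow> (real ^ 'd) set" where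
  "owned a u n q = {y. same_box a u n q y \<and> own_level a u n y}"

definition good_at :: "'d \<Rightarrow> ('d \<Rightarrow> nat \<Rightarrow> real) \<Rightarrow> nat \<Rightarrow> (real ^ 'd) measure \<Rightarrow> (real ^ 'd) measure \<Rightarrow> real ^ 'd \<Rightarrow> bool" where
  "good_at a u n R B q \<longleftrightarrow> emeasure R (entering a u n q) \<le> emeasure B (entering a u n q) + emeasure R (owned a u n q)"

lemma entering_owned_sets:
  fixes a :: "'d::finite"
  shows "entering a u n q \<in> sets borel" "owned a u n q \<in> sets borel"
proof -
  have [measurable]: "Measurable.pred borel (\<lambda>y. same_box a u n q y)" "Measurable.pred borel (\<lambda>y. reserved a u n y)"
    "Measurable.pred borel (\<lambda>y. own_level a u n y)"
    by (rule same_box_measurable reserved_measurable own_level_measurable; simp)+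
  have "Measurable.pred borel (\<lambda>y. same_box a u n q y \<and> \<not> reserved a u n y)" "Measurable.pred borel (\<lambda>y. same_box a u n q y \<and> own_level a u n y)"
    by measurable
  then show "entering a u n q \<in> sets borel" "owned a u n q \<in> sets borel" by (simp_all add: entering_def owned_def pred_def)
qed

text \<open>
  The last level up to \<open>n\<close> in whose portals the point lies (or else level \<open>0\<close>) owns it.
\<close>

lemma not_reserved_iff: "\<not> reserved a u n y \<longleftrightarrow> (\<exists>k\<le>n. own_level a u k y)"
proof
  assume nr: "\<not> reserved a u n y"
  define k where "k = Max {k. k \<le> n \<and> (k = 0 \<or> portal a u k y)}"
  have fin: "finite {k. k \<le> n \<and> (k = 0 \<or> portal a u k y)}" by (rule finite_subset[of _ "{..n}"]) auto
  have k: "k \<le> n \<and> (k = 0 \<or> portal a u k y)"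
    using Max_in[OF fin] unfolding k_def by blast
  have "\<not> portal a u m y" if "k < m" for m
  proof (cases "m \<le> n")
    case True
    then show ?thesis using Max_ge[OF fin, of m] that unfolding k_def[symmetric] by auto
  next
    case False
    then show ?thesis using nr unfolding reserved_def by auto
  qed
  then show "\<exists>k\<le>n. own_level a u k y" using k unfolding own_level_def reserved_def by blast
next
  assume "\<exists>k\<le>n. own_level a u k y"
  then obtain k where "k \<le> n" "own_level a u k y" by blast
  then show "\<not> reserved a u n y" unfolding own_level_def reserved_def by (meson le_less_trans)
qed

lemma good_of_good_at:
  fixes R B :: "(real ^ 'd::finite) measure"
  assumes u: "\<forall>i. nested_offsets (u i)"
    and R: "R \<in> point_configs UNIV" "simple_config R" and B: "B \<in> point_configs UNIV" "simple_config B"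
    and g: "good_at a u n R B q" and y: "same_box a u n q y"
  shows "levels.good (same_box a u) (own_level a u) n (point_support R) (point_support B) y"
proof -
  interpret levels "same_box a u" "own_level a u" "precedes a u" by (rule levels_boxes[OF u])
  have box: "same_box a u n q z \<longleftrightarrow> same_box a u n y z" for z using y same_box_equiv by metis
  have ent: "entering a u n q \<inter> V = entered n V y" for V
    unfolding entering_def entered_def not_reserved_iff box by blast
  have own: "owned a u n q \<inter> V = {z\<in>V. same_box a u n y z \<and> own_level a u n z}" for V
    unfolding owned_def box by blast
  have sub: "entering a u n q \<subseteq> {z. same_box a u n q z}" "owned a u n q \<subseteq> {z. same_box a u n q z}"
    by (auto simp: entering_def owned_def)
  have "(of_nat (card (entered n (point_support R) y)) :: ennreal) \<le>
      of_nat (card (entered n (point_support B) y)) + of_nat (card {z\<in>point_support R. same_box a u n y z \<and> own_level a u n z})"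
    using g unfolding good_at_def emeasure_within_box[OF R entering_owned_sets(1) sub(1)] emeasure_within_box[OF B entering_owned_sets(1) sub(1)]
      emeasure_within_box[OF R entering_owned_sets(2) sub(2)] ent own .
  then have "(of_nat (card (entered n (point_support R) y)) :: ennreal) \<le>
      of_nat (card (entered n (point_support B) y) + card {z\<in>point_support R. same_box a u n y z \<and> own_level a u n z})"
    by simp
  then show ?thesis unfolding good_def by (simp only: of_nat_le_iff)
qed

lemma box_volumes:
  fixes q :: "real ^ 'd::finite"
  shows "emeasure lborel (entering a u n q) < \<infinity>" "measure lborel (entering a u n q) \<le> (128 * 8 ^ n) ^ CARD('d)"
    "emeasure lborel (owned a u n q) < \<infinity>"
proof -
  define lo where "lo = (\<chi> i. u i (lev a n i) + side a n i * of_int (cell a u n q i))"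
  define hi where "hi = (\<chi> i. lo $ i + side a n i)"
  have "y \<in> cbox lo hi" if "same_box a u n q y" for y
    unfolding mem_box_cart
  proof
    fix i
    have "y $ i = lo $ i + pos a u n y i" using that cell_pos[of y i u a n] by (simp add: lo_def same_box_def)
    then show "lo $ i \<le> y $ i \<and> y $ i \<le> hi $ i" using pos_bounds[of a u n y i] by (simp add: hi_def)
  qed
  then have sub: "entering a u n q \<subseteq> cbox lo hi" "owned a u n q \<subseteq> cbox lo hi"
    by (auto simp: entering_def owned_def)
  have fin: "emeasure lborel (cbox lo hi) < \<infinity>" by (rule emeasure_bounded_finite[OF bounded_cbox])
  show "emeasure lborel (entering a u n q) < \<infinity>" "emeasure lborel (owned a u n q) < \<infinity>"
    using emeasure_mono[OF sub(1), of lborel] emeasure_mono[OF sub(2), of lborel] fin by (simp_all add: le_less_trans)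
  have "measure lborel (entering a u n q) \<le> measure lborel (cbox lo hi)"
    by (rule measure_mono_fmeasurable[OF sub(1)]) (simp_all add: entering_owned_sets)
  also have "\<dots> = (\<Prod>i\<in>UNIV. hi $ i - lo $ i)"
    by (rule content_cbox_cart) (simp add: interval_ne_empty_cart hi_def less_imp_le)
  also have "\<dots> = (\<Prod>i\<in>UNIV. side a n i)" by (simp add: hi_def)
  also have "\<dots> \<le> (\<Prod>i\<in>(UNIV :: 'd set). 128 * 8 ^ n)" by (intro prod_mono) (simp add: side_bounds less_imp_le)
  finally show "measure lborel (entering a u n q) \<le> (128 * 8 ^ n) ^ CARD('d)" by simp
qed

text \<open>
  If some part of the box is not reserved, then the portal is free of later portals, so the box owns
  all of its portal.
\<close>

lemma portal_volume:
  fixes q :: "real ^ 'd::finite"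
  assumes u: "\<forall>i. nested_offsets (u i)" and n: "1 \<le> n" and nr: "entering a u n q \<noteq> {}"
  shows "(4 ^ n) ^ CARD('d) \<le> measure lborel (owned a u n q)"
proof -
  obtain z where z: "same_box a u n q z" "\<not> reserved a u n z" using nr by (auto simp: entering_def)
  then have free: "\<And>y. same_box a u n q y \<Longrightarrow> portal a u n y \<Longrightarrow> \<not> reserved a u n y"
    using reserved_dichotomy[OF u, of a n q] by blast
  define lo where "lo = (\<chi> i. u i (lev a n i) + side a n i * of_int (cell a u n q i) + 4 ^ n)"
  define hi where "hi = (\<chi> i. lo $ i + 4 ^ n)"
  have "y \<in> owned a u n q" if "y \<in> box lo hi" for y
  proof -
    have c: "cell a u n y i = cell a u n q i \<and> 4 ^ n \<le> pos a u n y i \<and> pos a u n y i < 2 * 4 ^ n" for i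
    proof -
      define p where "p = y $ i - lo $ i + 4 ^ n"
      have "lo $ i < y $ i" "y $ i < hi $ i" using that by (auto simp: mem_box_cart)
      then have p: "4 ^ n \<le> p" "p < 2 * 4 ^ n" by (simp_all add: hi_def p_def)
      have "(4::real) ^ n \<le> 8 ^ n" by (rule power_mono) simp_all
      then have "p < side a n i" using p side_bounds(1)[of n a i] by linarith
      moreover have "0 \<le> p" using p(1) order.trans[OF zero_le_power[of "4::real" n]] by simp
      moreover have "y $ i = u i (lev a n i) + side a n i * of_int (cell a u n q i) + p" by (simp add: p_def lo_def)
      ultimately show ?thesis using cell_eqI[of y i u a n "cell a u n q i" p] p by simp
    qed
    then have "same_box a u n q y" "portal a u n y" by (simp_all add: same_box_def portal_def)
    then show ?thesis using free n by (simp add: owned_def own_level_def)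
  qed
  then have sub: "box lo hi \<subseteq> owned a u n q" by blast
  have v1: "measure lborel (box lo hi) = measure lborel (cbox lo hi)"
    by (simp add: measure_lborel_box_eq measure_lborel_cbox_eq)
  have "measure lborel (cbox lo hi) = (\<Prod>i\<in>UNIV. hi $ i - lo $ i)"
    by (rule content_cbox_cart) (simp add: interval_ne_empty_cart hi_def)
  then have v2: "measure lborel (cbox lo hi) = (4 ^ n) ^ CARD('d)" by (simp add: hi_def)
  have "measure lborel (box lo hi) \<le> measure lborel (owned a u n q)"
    by (rule measure_mono_fmeasurable[OF sub]) (use box_volumes(3)[of a u n q] in \<open>simp_all add: fmeasurable_def entering_owned_sets\<close>)
  then show ?thesis unfolding v1 v2 .
qed

text \<open>
  The deviations are of order \<open>8 ^ (n * d / 2)\<close>, against a portal of volume \<open>4 ^ (n * d)\<close>; so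
  the probability is of order \<open>2 ^ (- n * d)\<close>, which is summable.
\<close>

lemma good_at_prob:
  fixes R B :: "'w \<Rightarrow> (real ^ 'd::finite) measure"
  assumes R: "poisson_process P UNIV 1 R" and B: "poisson_process P UNIV 1 B"
    and u: "\<forall>i. nested_offsets (u i)" and n: "1 \<le> n"
  shows "measure P {\<omega>\<in>space P. \<not> good_at a u n (R \<omega>) (B \<omega>) q} \<le> (32 * 128 ^ CARD('d) + 4) * (1 / 2) ^ n"
proof (cases "entering a u n q = {}")
  case True
  then have "{\<omega>\<in>space P. \<not> good_at a u n (R \<omega>) (B \<omega>) q} = {}" by (simp add: good_at_def)
  then show ?thesis by (simp only: measure_empty) simp
next
  case False
  define d where "d = CARD('d)"
  have d: "1 \<le> d" unfolding d_def using zero_less_card_finite[where 'a='d] by linarith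
  have "measure P {\<omega>\<in>space P. \<not> good_at a u n (R \<omega>) (B \<omega>) q} \<le> 32 * (128 * 8 ^ n) ^ d / ((4 ^ n) ^ d)\<^sup>2 + 4 / (4 ^ n) ^ d"
    unfolding good_at_def d_def
    by (rule surplus_exceeds_prob[OF R B entering_owned_sets(1) box_volumes(1,2) entering_owned_sets(2) box_volumes(3) portal_volume[OF u n False]]) simp
  also have "\<dots> = 32 * 128 ^ d * ((1 / 2) ^ n) ^ d + 4 * ((1 / 4) ^ n) ^ d"
  proof -
    have "(8::real) ^ n = 4 ^ n * 2 ^ n" "(4::real) ^ n = 2 ^ n * 2 ^ n" by (simp_all add: power_mult_distrib[symmetric])
    then have "(128 * 8 ^ n) / (4 ^ n)\<^sup>2 = (128::real) * (1 / 2) ^ n" by (simp add: power2_eq_square power_one_over field_simps)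
    then have e: "((128 * 8 ^ n) / (4 ^ n)\<^sup>2) ^ d = ((128::real) * (1 / 2) ^ n) ^ d" by (rule arg_cong)
    have c: "(((4::real) ^ n)\<^sup>2) ^ d = ((4 ^ n) ^ d)\<^sup>2" by (simp only: power_mult[symmetric] mult_ac)
    have "(128 * (8::real) ^ n) ^ d / ((4 ^ n) ^ d)\<^sup>2 = 128 ^ d * ((1 / 2) ^ n) ^ d"
      using e unfolding power_divide[of "128 * 8 ^ n"] c power_mult_distrib[of 128 "(1 / 2) ^ n"] .
    then show ?thesis by (simp add: power_one_over)
  qed
  also have "\<dots> \<le> 32 * 128 ^ d * (1 / 2) ^ n + 4 * (1 / 2) ^ n"
  proof (intro add_mono mult_left_mono)
    have le: "x ^ d \<le> x" if "0 \<le> x" "x \<le> 1" for x :: real using power_decreasing[OF d that] by simp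
    show "((1 / 2 :: real) ^ n) ^ d \<le> (1 / 2) ^ n" by (intro le power_le_one) simp_all
    have "((1 / 4 :: real) ^ n) ^ d \<le> (1 / 4) ^ n" by (intro le power_le_one) simp_all
    also have "\<dots> \<le> (1 / 2) ^ n" by (rule power_mono) simp_all
    finally show "((1 / 4 :: real) ^ n) ^ d \<le> (1 / 2) ^ n" .
  qed simp_all
  finally show ?thesis by (simp add: d_def distrib_right)
qed

text \<open>
  The boxes of level \<open>n\<close> in the box of the origin of level \<open>n + 1\<close> depend on the grids.  But every such
  box contains a point of a lattice of mesh \<open>2 * 8 ^ n\<close>, the smallest possible side; and since the
  sides are at most \<open>128 * 8 ^ n\<close> and \<open>128 * 8 ^ (n + 1)\<close>, lattice coordinates up to \<open>576\<close> suffice.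
\<close>

definition corner :: "nat \<Rightarrow> ('d \<Rightarrow> int) \<Rightarrow> real ^ 'd" where
  "corner n z = (\<chi> i. 2 * 8 ^ n * of_int (z i))"

definition corners :: "('d::finite \<Rightarrow> int) set" where
  "corners = {z. \<forall>i. \<bar>z i\<bar> \<le> 576}"

lemma finite_corners: "finite (corners :: ('d::finite \<Rightarrow> int) set)"
proof -
  have "corners \<subseteq> Pi\<^sub>E (UNIV :: 'd set) (\<lambda>_. {- 576 .. 576 :: int})"
  proof
    fix z :: "'d \<Rightarrow> int" assume "z \<in> corners"
    then have "\<bar>z i\<bar> \<le> 576" for i by (simp add: corners_def)
    then have "z i \<in> {- 576 .. 576}" for i unfolding atLeastAtMost_iff by (metis abs_le_iff minus_le_iff)
    then show "z \<in> Pi\<^sub>E UNIV (\<lambda>_. {- 576 .. 576})" by auto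
  qed
  then show ?thesis by (rule finite_subset) (simp add: finite_PiE)
qed

lemma corner_in_box:
  assumes y: "same_box a u (Suc n) 0 y"
  shows "\<exists>z\<in>corners. same_box a u n (corner n z) y"
proof -
  define s where "s = 2 * (8::real) ^ n"
  have s: "0 < s" by (simp add: s_def)
  define c where "c i = u i (lev a n i) + side a n i * of_int (cell a u n y i)" for i
  \<comment> \<open>the first lattice coordinate in the interval that starts at \<open>c i\<close>\<close>
  define z where "z i = \<lceil>c i / s\<rceil>" for i
  have z: "c i \<le> s * of_int (z i)" "s * of_int (z i) < c i + s" for i
  proof -
    have "c i / s \<le> of_int (z i)" "of_int (z i) < c i / s + 1" unfolding z_def by linarith+
    then show "c i \<le> s * of_int (z i)" "s * of_int (z i) < c i + s" using s by (simp_all add: field_simps)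
  qed
  have sides: "s \<le> side a n i" "side a n i \<le> 64 * s" "side a (Suc n) i \<le> 512 * s" for i
    using side_bounds(1)[of n a i] side_bounds(2)[of a n i] side_bounds(2)[of a "Suc n" i] by (simp_all add: s_def)
  have "same_box a u n (corner n z) y"
    unfolding same_box_def
  proof
    fix i
    have "corner n z $ i = s * of_int (z i)" by (simp add: corner_def s_def)
    then have "corner n z $ i = u i (lev a n i) + side a n i * of_int (cell a u n y i) + (s * of_int (z i) - c i)"
      by (simp add: c_def)
    then show "cell a u n (corner n z) i = cell a u n y i"
      by (rule cell_eqI) (use z[of i] sides(1)[of i] in linarith)+
  qed
  moreover have "\<bar>z i\<bar> \<le> 576" for i
  proof -
    have yi: "\<bar>y $ i\<bar> < 512 * s" using same_box_dist[OF y, of i] sides(3)[of i] by simp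
    have yc: "c i \<le> y $ i" "y $ i < c i + 64 * s"
      using cell_pos[of y i u a n] pos_bounds[of a u n y i] sides(2)[of i] by (simp_all add: c_def)
    have "s * of_int (z i) < s * 577" using z(2)[of i] yi yc by linarith
    then have "of_int (z i) < (577::real)" using s by simp
    moreover have "s * (- 577) < s * of_int (z i)" using z(1)[of i] yi yc s by linarith
    then have "- 577 < (of_int (z i) :: real)" by (rule mult_less_cancel_left_pos[OF s, THEN iffD1])
    ultimately show ?thesis by linarith
  qed
  ultimately show ?thesis by (intro bexI[of _ z]) (simp_all add: corners_def)
qed

lemma good_at_measurable:
  fixes R B :: "'x \<Rightarrow> (real ^ 'd::finite) measure"
  assumes u: "u \<in> K \<rightarrow>\<^sub>M grid_law" and R: "R \<in> K \<rightarrow>\<^sub>M config_algebra UNIV" and B: "B \<in> K \<rightarrow>\<^sub>M config_algebra UNIV"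
  shows "Measurable.pred K (\<lambda>w. good_at a (u w) n (R w) (B w) q)"
proof -
  note u' = measurable_compose[OF measurable_fst u]
  have [measurable]: "Measurable.pred (K \<Otimes>\<^sub>M borel) (\<lambda>p. same_box a (u (fst p)) n q (snd p))"
    by (rule same_box_measurable[OF u']) measurable
  have [measurable]: "Measurable.pred (K \<Otimes>\<^sub>M borel) (\<lambda>p. reserved a (u (fst p)) n (snd p))"
    by (rule reserved_measurable[OF u']) measurable
  have [measurable]: "Measurable.pred (K \<Otimes>\<^sub>M borel) (\<lambda>p. own_level a (u (fst p)) n (snd p))"
    by (rule own_level_measurable[OF u']) measurable
  have 1: "Measurable.pred (K \<Otimes>\<^sub>M borel) (\<lambda>(w, y). same_box a (u w) n q y \<and> \<not> reserved a (u w) n y)"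
    unfolding split_beta by measurable
  have 2: "Measurable.pred (K \<Otimes>\<^sub>M borel) (\<lambda>(w, y). same_box a (u w) n q y \<and> own_level a (u w) n y)"
    unfolding split_beta by measurable
  have [measurable]: "(\<lambda>w. emeasure (R w) (entering a (u w) n q)) \<in> borel_measurable K"
    "(\<lambda>w. emeasure (B w) (entering a (u w) n q)) \<in> borel_measurable K"
    "(\<lambda>w. emeasure (R w) (owned a (u w) n q)) \<in> borel_measurable K"
    unfolding entering_def owned_def
    by (rule emeasure_config_measurable(1)[OF R 1] emeasure_config_measurable(1)[OF B 1] emeasure_config_measurable(1)[OF R 2])+
  show ?thesis unfolding good_at_def by measurable
qed

text \<open>
  Borel-Cantelli over the levels; the number of lattice points is the same at all levels.
\<close>

lemma good_at_eventually:
  fixes R B :: "'w \<Rightarrow> (real ^ 'd::finite) measure"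
  assumes R: "poisson_process P UNIV 1 R" and B: "poisson_process P UNIV 1 B" and u: "\<forall>i. nested_offsets (u i)"
  shows "AE \<omega> in P. \<forall>\<^sub>F n in sequentially. \<forall>z\<in>corners. good_at a u n (R \<omega>) (B \<omega>) (corner n z)"
proof -
  interpret prob_space P by (rule poisson_process_prob_space[OF R])
  define E where "E n = (\<Union>z\<in>corners. {\<omega>\<in>space P. \<not> good_at a u n (R \<omega>) (B \<omega>) (corner n z)})" for n
  define C where "C = real (card (corners :: ('d \<Rightarrow> int) set)) * (32 * 128 ^ CARD('d) + 4)"
  have s: "{\<omega>\<in>space P. \<not> good_at a u n (R \<omega>) (B \<omega>) (corner n z)} \<in> sets P" for n z
    using good_at_measurable[OF measurable_const poisson_process_measurable[OF R] poisson_process_measurable[OF B], of u a n "corner n z"]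
    by simp
  have E: "E n \<in> sets P" for n unfolding E_def using finite_corners s by (intro sets.finite_UN)
  have bound: "measure P (E n) \<le> C * (1 / 2) ^ n" if "1 \<le> n" for n
  proof -
    have "measure P (E n) \<le> (\<Sum>z\<in>corners. measure P {\<omega>\<in>space P. \<not> good_at a u n (R \<omega>) (B \<omega>) (corner n z)})"
      unfolding E_def using s by (intro measure_UNION_le finite_corners)
    also have "\<dots> \<le> (\<Sum>z\<in>(corners :: ('d \<Rightarrow> int) set). (32 * 128 ^ CARD('d) + 4) * (1 / 2) ^ n)"
      by (intro sum_mono good_at_prob[OF R B u that])
    finally show ?thesis by (simp add: C_def)
  qed
  have "summable (\<lambda>n. measure P (E n))"
  proof (rule summable_comparison_test')
    show "summable (\<lambda>n. C * (1 / 2) ^ n)" by (intro summable_mult summable_geometric) simp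
    show "norm (measure P (E n)) \<le> C * (1 / 2) ^ n" if "1 \<le> n" for n using bound[OF that] by simp
  qed
  then have "AE \<omega> in P. \<forall>\<^sub>F n in sequentially. \<omega> \<in> space P - E n"
    by (intro borel_cantelli_AE1 E) (simp_all add: emeasure_eq_measure)
  then show ?thesis by (rule AE_mp) (auto simp: E_def elim!: eventually_mono)
qed

section \<open>The origin is eventually well placed\<close>

text \<open>
  The offset is uniform, so each coordinate of the origin in its box is; it has to avoid margins of
  total length of order \<open>4 ^ n\<close> in an interval of length of order \<open>8 ^ n\<close>.
\<close>

lemma well_placed_prob:
  fixes a :: "'d::finite"
  shows "measure grid_law {u. \<not> well_placed a u n} \<le> 2 * CARD('d) * (1 / 2) ^ n" and "{u. \<not> well_placed a u n} \<in> sets grid_law"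
proof -
  interpret prob_space "grid_law :: ('d \<Rightarrow> nat \<Rightarrow> real) measure" by (rule prob_space_grid_law)
  have [measurable]: "(\<lambda>u. pos a u n 0 i) \<in> borel_measurable grid_law" for i
    by (rule pos_measurable) simp_all
  show "{u. \<not> well_placed a u n} \<in> sets grid_law"
  proof -
    have "Measurable.pred grid_law (\<lambda>u. \<not> well_placed a u n)" unfolding well_placed_def by measurable
    then show ?thesis by (simp add: pred_def)
  qed
  define r where "r = 2 * (4::real) ^ n + real n"
  have r: "real n \<le> r" by (simp add: r_def)
  \<comment> \<open>the offsets that place the origin in one of the margins: its position is \<open>side - v\<close> for \<open>v > 0\<close>\<close>
  define T where "T i = {v::real. v \<le> real n \<or> side a n i - r < v}" for i
  have T: "T i \<in> sets borel" for i
  proof -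
    have "T i = {..real n} \<union> {side a n i - r<..}" by (auto simp: T_def)
    then show ?thesis by simp
  qed
  let ?Y = "\<lambda>i. {u. u i (lev a n i) \<in> T i}"
  have Y: "?Y i \<in> sets grid_law" for i
    using measurable_sets[OF grid_offset_measurable[of i "lev a n i"] T[of i]] by (simp add: vimage_def)
  have law: "measure grid_law (?Y i) \<le> (real n + r) / side a n i" for i
  proof -
    define L where "L = side a n i"
    have L: "0 < L" by (simp add: L_def)
    have "emeasure grid_law (?Y i) = emeasure (distr grid_law borel (\<lambda>u. u i (lev a n i))) (T i)"
      using T by (subst emeasure_distr) (simp_all add: vimage_def)
    also have "\<dots> = emeasure lborel ({0..<L} \<inter> T i) / emeasure lborel {0..<L}"
      unfolding grid_law_component using T by (simp add: emeasure_uniform_measure L_def side_def)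
    also have "\<dots> \<le> ennreal (real n + r) / ennreal L"
    proof -
      have "emeasure lborel ({0..<L} \<inter> T i) \<le> emeasure lborel ({0..real n} \<union> {L - r<..<L})"
        by (rule emeasure_mono) (auto simp: T_def L_def)
      also have "\<dots> \<le> emeasure lborel {0..real n} + emeasure lborel {L - r<..<L}"
        by (rule emeasure_subadditive) simp_all
      also have "\<dots> = ennreal (real n + r)" using r by (simp add: ennreal_plus[symmetric] del: ennreal_plus)
      finally have "emeasure lborel ({0..<L} \<inter> T i) \<le> ennreal (real n + r)" .
      then show ?thesis using L by (simp add: divide_right_mono_ennreal)
    qed
    also have "\<dots> = ennreal ((real n + r) / L)" using L r by (simp add: divide_ennreal del: ennreal_plus)
    finally have "emeasure grid_law (?Y i) \<le> ennreal ((real n + r) / L)" .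
    moreover have "0 \<le> (real n + r) / L" using L r by simp
    ultimately show ?thesis by (simp add: emeasure_eq_measure L_def)
  qed
  have ev: "pos a u n 0 i < r \<or> side a n i \<le> pos a u n 0 i + real n \<Longrightarrow> u \<in> ?Y i \<or> \<not> (0 \<le> u i (lev a n i) \<and> u i (lev a n i) < side a n i)" for u i
  proof -
    assume p: "pos a u n 0 i < r \<or> side a n i \<le> pos a u n 0 i + real n"
    define L v where "L = side a n i" and "v = u i (lev a n i)"
    have "v \<le> real n \<or> L - r < v \<or> \<not> (0 \<le> v \<and> v < L)"
    proof (cases "0 < v \<and> v < L")
      case True
      then have "pos a u n 0 i = L - v"
        using cell_eqI(2)[of 0 i u a n "-1" "L - v"] by (simp add: L_def v_def)
      then have "L - v < r \<or> L \<le> L - v + real n" using p by (simp add: L_def)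
      then show ?thesis by (metis add_diff_cancel_left' diff_add_cancel diff_le_eq diff_less_eq add.commute le_diff_eq less_diff_eq)
    next
      case False
      then have "v \<le> 0 \<or> L \<le> v" by linarith
      then show ?thesis by (metis not_le of_nat_0_le_iff order.trans)
    qed
    then show ?thesis by (auto simp: T_def L_def v_def)
  qed
  have AEr: "AE u in grid_law. \<forall>i. 0 \<le> u i (lev a n i) \<and> u i (lev a n i) < side a n i"
  proof -
    have "AE u in grid_law. 0 \<le> u i (lev a n i) \<and> u i (lev a n i) < side a n i" for i
    proof -
      have "AE v in uniform_upto (side a n i). v \<in> {0..<side a n i}" by (rule AE_uniform_measureI) simp_all
      then have "AE v in distr grid_law borel (\<lambda>u. u i (lev a n i)). v \<in> {0..<side a n i}"
        unfolding grid_law_component side_def .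
      then have "AE u in grid_law. u i (lev a n i) \<in> {0..<side a n i}" by (subst (asm) AE_distr_iff) simp_all
      then show ?thesis by simp
    qed
    then show ?thesis by (simp add: AE_all_countable)
  qed
  have "measure grid_law {u. \<not> well_placed a u n} \<le> measure grid_law (\<Union>i. ?Y i)"
  proof (rule finite_measure_mono_AE)
    show "AE u in grid_law. u \<in> {u. \<not> well_placed a u n} \<longrightarrow> u \<in> (\<Union>i. ?Y i)"
      using AEr
    proof eventually_elim
      fix u assume "\<forall>i. 0 \<le> u i (lev a n i) \<and> u i (lev a n i) < side a n i"
      then show "u \<in> {u. \<not> well_placed a u n} \<longrightarrow> u \<in> (\<Union>i. ?Y i)"
        using ev[of u] unfolding well_placed_def r_def[symmetric] by (auto simp: not_le not_less)
    qed
    show "(\<Union>i. ?Y i) \<in> sets grid_law" using Y by (intro sets.finite_UN) simp_all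
  qed
  also have "\<dots> \<le> (\<Sum>i\<in>UNIV. measure grid_law (?Y i))" using Y by (intro measure_UNION_le) simp_all
  also have "\<dots> \<le> (\<Sum>i\<in>(UNIV :: 'd set). 2 * (1 / 2) ^ n)"
  proof (rule sum_mono)
    fix i
    have "(2::real) ^ n \<le> 4 ^ n" by (rule power_mono) simp_all
    then have "real n \<le> 4 ^ n" using of_nat_less_two_power[of n, where 'a=real] by linarith
    then have "real n + r \<le> 4 * 4 ^ n" by (simp add: r_def)
    then have "(real n + r) / side a n i \<le> 4 * 4 ^ n / (2 * 8 ^ n)"
      using r side_bounds(1)[of n a i] by (intro frac_le) simp_all
    also have "\<dots> = 2 * (1 / 2) ^ n"
    proof -
      have "(8::real) ^ n = 4 ^ n * 2 ^ n" by (simp add: power_mult_distrib[symmetric])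
      then show ?thesis by (simp add: power_one_over field_simps)
    qed
    finally show "measure grid_law (?Y i) \<le> 2 * (1 / 2) ^ n" using law[of i] by linarith
  qed
  finally show "measure grid_law {u. \<not> well_placed a u n} \<le> 2 * CARD('d) * (1 / 2) ^ n" by (simp add: mult_ac)
qed

lemma well_placed_eventually: "AE u in grid_law. \<forall>\<^sub>F n in sequentially. well_placed a u n"
proof -
  interpret prob_space "grid_law :: ('a::finite \<Rightarrow> nat \<Rightarrow> real) measure" by (rule prob_space_grid_law)
  have "summable (\<lambda>n. measure grid_law {u. \<not> well_placed a u n})"
  proof (rule summable_comparison_test')
    show "summable (\<lambda>n. 2 * CARD('a) * (1 / 2 :: real) ^ n)" by (intro summable_mult summable_geometric) simp
    show "norm (measure grid_law {u. \<not> well_placed a u n}) \<le> 2 * CARD('a) * (1 / 2) ^ n" if "0 \<le> n" for n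
      using well_placed_prob(1)[of a n] by simp
  qed
  then have "AE u in grid_law. \<forall>\<^sub>F n in sequentially. u \<in> space grid_law - {u. \<not> well_placed a u n}"
    by (intro borel_cantelli_AE1 well_placed_prob(2)) (simp_all add: emeasure_eq_measure)
  then show ?thesis by simp
qed

section \<open>Transport to the canonical sample space\<close>

text \<open>
  The image of a probability space under an arbitrary map, with the largest \<open>\<sigma>\<close>-algebra.  The
  completion makes statements that hold almost surely measurable on the image, whether or not they
  are measurable themselves.
\<close>

definition image_events :: "'w measure \<Rightarrow> ('w \<Rightarrow> 'v) \<Rightarrow> 'v set set" where
  "image_events P X = {Y. Y \<subseteq> X ` space P \<and> X -` Y \<inter> space P \<in> sets (completion P)}"

definition image_law :: "'w measure \<Rightarrow> ('w \<Rightarrow> 'v) \<Rightarrow> 'v measure" where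
  "image_law P X = distr (completion P) (sigma (X ` space P) (image_events P X)) X"

lemma sets_image_law: "sets (image_law P X) = image_events P X"
  and space_image_law: "space (image_law P X) = X ` space P"
proof -
  have "sigma_algebra (X ` space P) (image_events P X)"
    unfolding sigma_algebra_iff2
  proof (intro conjI allI impI ballI)
    show "X ` space P - Y \<in> image_events P X" if "Y \<in> image_events P X" for Y
    proof -
      have "X -` (X ` space P - Y) \<inter> space P = space (completion P) - (X -` Y \<inter> space P)" by auto
      also have "\<dots> \<in> sets (completion P)" using that by (intro sets.compl_sets) (simp add: image_events_def)
      finally show ?thesis by (simp add: image_events_def)
    qed
    show "(\<Union>i. Y i) \<in> image_events P X" if "range Y \<subseteq> image_events P X" for Y :: "nat \<Rightarrow> _"
    proof -
      have Y: "Y i \<subseteq> X ` space P" "X -` Y i \<inter> space P \<in> sets (completion P)" for i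
        using that by (auto simp: image_events_def)
      have "X -` (\<Union>i. Y i) \<inter> space P = (\<Union>i. X -` Y i \<inter> space P)" by auto
      also have "\<dots> \<in> sets (completion P)" using Y(2) by (intro sets.countable_UN) auto
      finally show ?thesis using Y(1) by (auto simp: image_events_def)
    qed
  qed (auto simp: image_events_def)
  then show "sets (image_law P X) = image_events P X" unfolding image_law_def sets_distr
    by (intro sigma_algebra.sets_measure_of_eq)
  show "space (image_law P X) = X ` space P"
    unfolding image_law_def space_distr by (rule space_measure_of) (auto simp: image_events_def)
qed

lemma measurable_image_law: "X \<in> completion P \<rightarrow>\<^sub>M image_law P X"
  by (rule measurableI) (simp_all add: sets_image_law space_image_law image_events_def)

lemma image_law_eq: "image_law P X = distr (completion P) (image_law P X) X"
proof -
  have "distr (completion P) (image_law P X) X = distr (completion P) (sigma (X ` space P) (image_events P X)) X"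
    by (rule distr_cong) (simp_all add: image_law_def)
  then show ?thesis by (simp add: image_law_def)
qed

lemma prob_space_image_law:
  assumes "prob_space P" shows "prob_space (image_law P X)"
proof -
  interpret prob_space P by fact
  have "prob_space (completion P)" by (rule prob_spaceI) (simp add: emeasure_space_1)
  then have "prob_space (distr (completion P) (image_law P X) X)" by (rule prob_space.prob_space_distr[OF _ measurable_image_law])
  then show ?thesis by (simp only: image_law_eq[symmetric])
qed

lemma image_law_measurable:
  assumes f: "(\<lambda>\<omega>. f (X \<omega>)) \<in> P \<rightarrow>\<^sub>M N"
  shows "f \<in> image_law P X \<rightarrow>\<^sub>M N" and "distr (image_law P X) N f = distr P N (\<lambda>\<omega>. f (X \<omega>))"
proof -
  show m: "f \<in> image_law P X \<rightarrow>\<^sub>M N"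
  proof (rule measurableI)
    show "f x \<in> space N" if "x \<in> space (image_law P X)" for x
      using that measurable_space[OF f] by (auto simp: space_image_law)
    fix A assume A: "A \<in> sets N"
    have "X -` (f -` A \<inter> X ` space P) \<inter> space P = (\<lambda>\<omega>. f (X \<omega>)) -` A \<inter> space P" by auto
    also have "\<dots> \<in> sets (completion P)" using measurable_sets[OF f A] by (rule sets_completionI_sets)
    finally show "f -` A \<inter> space (image_law P X) \<in> sets (image_law P X)"
      by (simp add: sets_image_law space_image_law image_events_def)
  qed
  have "distr (image_law P X) N f = distr (distr (completion P) (image_law P X) X) N f" by (simp only: image_law_eq[symmetric])
  also have "\<dots> = distr (completion P) N (f \<circ> X)" by (rule distr_distr[OF m measurable_image_law])
  also have "\<dots> = distr P N (\<lambda>\<omega>. f (X \<omega>))" unfolding comp_def by (rule distr_completion[OF f])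
  finally show "distr (image_law P X) N f = distr P N (\<lambda>\<omega>. f (X \<omega>))" .
qed

lemma AE_image_law:
  assumes "AE \<omega> in P. Q (X \<omega>)" shows "AE x in image_law P X. Q x"
proof -
  have ae: "AE \<omega> in completion P. Q (X \<omega>)" using assms by (rule AE_completion)
  have "{\<omega>\<in>space (completion P). \<not> Q (X \<omega>)} \<in> sets (completion P)"
    using ae unfolding completion.AE_iff_null_sets by (rule null_setsD2)
  then have "space (completion P) - {\<omega>\<in>space (completion P). \<not> Q (X \<omega>)} \<in> sets (completion P)" by (rule sets.compl_sets)
  also have "space (completion P) - {\<omega>\<in>space (completion P). \<not> Q (X \<omega>)} = X -` {x\<in>X ` space P. Q x} \<inter> space P" by auto
  finally have "{x\<in>space (image_law P X). Q x} \<in> sets (image_law P X)"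
    by (auto simp: sets_image_law space_image_law image_events_def)
  then have "AE x in distr (completion P) (image_law P X) X. Q x" using ae by (subst AE_distr_iff[OF measurable_image_law])
  then show ?thesis by (simp only: image_law_eq[symmetric])
qed

section \<open>A locally finite matching scheme\<close>

lemma distr_pair_prob:
  assumes "prob_space M" "prob_space N"
  shows "distr (M \<Otimes>\<^sub>M N) M fst = M" "distr (M \<Otimes>\<^sub>M N) N snd = N"
proof -
  interpret pair_prob_space M N using assms by (simp add: pair_prob_space_def pair_sigma_finite_def prob_space_imp_sigma_finite)
  show "distr (M \<Otimes>\<^sub>M N) M fst = M"
  proof (rule measure_eqI)
    fix A assume "A \<in> sets (distr (M \<Otimes>\<^sub>M N) M fst)"
    then have A: "A \<in> sets M" by simp
    have "fst -` A \<inter> space (M \<Otimes>\<^sub>M N) = A \<times> space N" using sets.sets_into_space[OF A] by (auto simp: space_pair_measure)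
    then show "emeasure (distr (M \<Otimes>\<^sub>M N) M fst) A = emeasure M A"
      using A by (simp add: emeasure_distr M2.emeasure_pair_measure_Times M2.emeasure_space_1)
  qed simp
  show "distr (M \<Otimes>\<^sub>M N) N snd = N"
  proof (rule measure_eqI)
    fix A assume "A \<in> sets (distr (M \<Otimes>\<^sub>M N) N snd)"
    then have A: "A \<in> sets N" by simp
    have "snd -` A \<inter> space (M \<Otimes>\<^sub>M N) = space M \<times> A" using sets.sets_into_space[OF A] by (auto simp: space_pair_measure)
    then show "emeasure (distr (M \<Otimes>\<^sub>M N) N snd) A = emeasure N A"
      using A by (simp add: emeasure_distr M2.emeasure_pair_measure_Times M1.emeasure_space_1)
  qed simp
qed

text \<open>
  For a fixed red configuration, each of its countably many points is almost surely not blue.  The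
  integral of the blue point masses against the red configuration turns this into a measurable event
  to which Fubini applies.
\<close>

lemma AE_disjoint_supports:
  fixes P :: "'a::euclidean_space measure measure"
  assumes P: "poisson_process P UNIV 1 (\<lambda>\<mu>. \<mu>)" and sets: "sets P = sets (config_algebra UNIV)"
  shows "AE p in P \<Otimes>\<^sub>M P. point_support (fst p) \<inter> point_support (snd p) = {}"
proof -
  interpret prob_space P by (rule poisson_process_prob_space[OF P])
  interpret PP: pair_sigma_finite P P ..
  define common where "common p = (\<integral>\<^sup>+x. emeasure (snd p) {x} \<partial>fst p)" for p :: "'a measure \<times> 'a measure"
  have id: "(\<lambda>\<mu>. \<mu>) \<in> P \<rightarrow>\<^sub>M config_algebra UNIV" by (rule poisson_process_measurable[OF P])
  have R: "fst \<in> P \<Otimes>\<^sub>M P \<rightarrow>\<^sub>M config_algebra UNIV" by (rule measurable_compose[OF measurable_fst id])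
  have B: "snd \<in> P \<Otimes>\<^sub>M P \<rightarrow>\<^sub>M config_algebra UNIV" by (rule measurable_compose[OF measurable_snd id])
  have sing: "(\<lambda>q. emeasure (snd (fst q)) {y. y = snd q}) \<in> borel_measurable ((P \<Otimes>\<^sub>M P) \<Otimes>\<^sub>M borel)"
    by (rule emeasure_config_measurable(1)[OF measurable_compose[OF measurable_fst B]]) measurable
  have [measurable]: "common \<in> borel_measurable (P \<Otimes>\<^sub>M P)"
    unfolding common_def by (rule nn_integral_config_measurable[OF R]) (use sing in \<open>simp add: split_beta\<close>)
  have "AE \<nu> in P. common (\<mu>, \<nu>) = 0" if "\<mu> \<in> space P" for \<mu>
  proof -
    have \<mu>: "\<mu> \<in> point_configs UNIV" using poisson_process_config[OF P that] .
    define At where "At = {x. emeasure \<mu> {x} \<noteq> 0}"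
    have "countable At"
    proof -
      have "finite {x\<in>ball 0 (real n). emeasure \<mu> {x} \<noteq> 0}" for n
      proof (rule config_finite_atoms[OF \<mu>])
        show "ball 0 (real n) \<in> sets \<mu>" using sets_config[OF \<mu>] by simp
        then obtain m :: nat where "emeasure \<mu> (ball 0 (real n)) = of_nat m" using config_bounded_nat[OF \<mu>] bounded_ball by blast
        then show "emeasure \<mu> (ball 0 (real n)) \<noteq> \<infinity>" by simp
      qed
      then have "countable (\<Union>n. {x\<in>ball 0 (real n). emeasure \<mu> {x} \<noteq> 0})" by (intro countable_UN countableI_type countable_finite)
      moreover have "At \<subseteq> (\<Union>n. {x\<in>ball 0 (real n). emeasure \<mu> {x} \<noteq> 0})"
        using reals_Archimedean2 by (auto simp: At_def)
      ultimately show ?thesis by (rule countable_subset[rotated])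
    qed
    moreover have "AE \<nu> in P. emeasure \<nu> {x} = 0" for x
    proof -
      have "measure P {\<nu>\<in>space P. emeasure \<nu> {x} = of_nat 0} = poisson_weight (1 * measure lborel {x}) 0"
        by (rule poisson_process_weight[OF P]) simp_all
      then have "prob {\<nu>\<in>space P. emeasure \<nu> {x} = 0} = 1" by (simp add: poisson_weight_def)
      moreover have "{\<nu>\<in>space P. emeasure \<nu> {x} = 0} \<in> events"
        using poisson_process_emeasure_measurable[OF P, of "{x}"] by simp
      ultimately show ?thesis by (rule prob_Collect_eq_1[THEN iffD1, rotated])
    qed
    ultimately have "AE \<nu> in P. \<forall>x\<in>At. emeasure \<nu> {x} = 0" by (subst AE_ball_countable) simp_all
    moreover have "AE \<nu> in P. \<nu> \<in> point_configs UNIV" using poisson_process_config[OF P] by (intro AE_I2)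
    ultimately show ?thesis
    proof eventually_elim
      fix \<nu> :: "'a measure" assume \<nu>: "\<forall>x\<in>At. emeasure \<nu> {x} = 0" "\<nu> \<in> point_configs UNIV"
      have "Measurable.pred (borel \<Otimes>\<^sub>M borel) (\<lambda>(x, y). y = (x :: 'a))" by measurable
      then have m: "(\<lambda>x. emeasure \<nu> {y. y = x}) \<in> borel_measurable borel"
        by (rule emeasure_config_measurable(1)[rotated]) (use \<nu>(2) in \<open>simp add: space_config_algebra\<close>)
      then have "{x\<in>space borel. emeasure \<nu> {y. y = x} \<noteq> 0} \<in> sets borel" by measurable
      then have s: "{x. emeasure \<nu> {x} \<noteq> 0} \<in> sets \<mu>" using sets_config[OF \<mu>] by simp
      have "emeasure \<mu> {x. emeasure \<nu> {x} \<noteq> 0} = 0"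
        by (rule config_no_atoms_null[OF \<mu> s]) (use \<nu>(1) in \<open>auto simp: At_def\<close>)
      then have "AE x in \<mu>. x \<notin> {x. emeasure \<nu> {x} \<noteq> 0}" using s by (intro AE_not_in) auto
      then have "AE x in \<mu>. emeasure \<nu> {x} = 0" by simp
      then have "(\<integral>\<^sup>+x. emeasure \<nu> {x} \<partial>\<mu>) = (\<integral>\<^sup>+x. 0 \<partial>\<mu>)" by (rule nn_integral_cong_AE)
      then show "common (\<mu>, \<nu>) = 0" by (simp add: common_def)
    qed
  qed
  then have ae: "AE \<mu> in P. AE \<nu> in P. common (\<mu>, \<nu>) = 0" by (rule AE_I2)
  have "AE p in P \<Otimes>\<^sub>M P. common p = 0"
  proof (rule PP.AE_pair_measure[OF _ ae])
    show "{p\<in>space (P \<Otimes>\<^sub>M P). common p = 0} \<in> sets (P \<Otimes>\<^sub>M P)" by measurable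
  qed
  moreover have "AE p in P \<Otimes>\<^sub>M P. p \<in> space (P \<Otimes>\<^sub>M P)" by (rule AE_space)
  ultimately show ?thesis
  proof eventually_elim
    fix p assume p: "common p = 0" "p \<in> space (P \<Otimes>\<^sub>M P)"
    show "point_support (fst p) \<inter> point_support (snd p) = {}"
    proof (rule ccontr)
      assume "point_support (fst p) \<inter> point_support (snd p) \<noteq> {}"
      then obtain x where x: "emeasure (fst p) {x} = 1" "emeasure (snd p) {x} = 1" by (auto simp: point_support_def)
      have c: "{x} \<in> sets (fst p)" using config_kernel(2)[OF R p(2)] by simp
      have "1 = (\<integral>\<^sup>+y. indicator {x} y \<partial>fst p)" using x c by simp
      also have "\<dots> \<le> common p"
        unfolding common_def by (rule nn_integral_mono) (auto simp: indicator_def x)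
      finally show False using p(1) by simp
    qed
  qed
qed

text \<open>
  All hypotheses of \<open>matching_of_good_boxes\<close> hold almost surely: for fixed grids the goodness of the
  boxes is a property of two Poisson processes, and Fubini combines this with the random grids.
\<close>

lemma AE_matching_of_good_boxes:
  fixes a :: "'d::finite"
  assumes d: "2 \<le> CARD('d)" and P: "poisson_process P UNIV 1 (\<lambda>\<mu> :: (real ^ 'd) measure. \<mu>)" and sets: "sets P = sets (config_algebra UNIV)"
  shows "AE (u, R, B) in grid_law \<Otimes>\<^sub>M (P \<Otimes>\<^sub>M P). simple_config (edge_config a u R B) \<and>
    perfect_matching (point_support R) (point_support B) (point_support (edge_config a u R B)) \<and>
    (\<forall>C. bounded C \<longrightarrow> finite {e\<in>point_support (edge_config a u R B). crosses e C})"
proof -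
  interpret P: prob_space P by (rule poisson_process_prob_space[OF P])
  interpret G: prob_space "grid_law :: ('d \<Rightarrow> nat \<Rightarrow> real) measure" by (rule prob_space_grid_law)
  interpret PP: pair_prob_space P P ..
  interpret GPP: pair_prob_space "grid_law :: ('d \<Rightarrow> nat \<Rightarrow> real) measure" "P \<Otimes>\<^sub>M P" ..
  let ?\<Omega> = "(grid_law :: ('d \<Rightarrow> nat \<Rightarrow> real) measure) \<Otimes>\<^sub>M (P \<Otimes>\<^sub>M P)"
  have id: "(\<lambda>\<mu>. \<mu>) \<in> P \<rightarrow>\<^sub>M config_algebra UNIV" by (rule poisson_process_measurable[OF P])
  have R: "fst \<in> P \<Otimes>\<^sub>M P \<rightarrow>\<^sub>M config_algebra UNIV" by (rule measurable_compose[OF measurable_fst id])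
  have B: "snd \<in> P \<Otimes>\<^sub>M P \<rightarrow>\<^sub>M config_algebra UNIV" by (rule measurable_compose[OF measurable_snd id])
  have law: "distr P (config_algebra UNIV) (\<lambda>\<mu>. \<mu>) = P" by (rule distr_id2) (simp add: sets)
  have Pc: "distr (P \<Otimes>\<^sub>M P) (config_algebra UNIV) fst = P" "distr (P \<Otimes>\<^sub>M P) (config_algebra UNIV) snd = P"
    using distr_pair_prob[OF P.prob_space_axioms P.prob_space_axioms] sets by (simp_all cong: distr_cong)
  have R1: "poisson_process (P \<Otimes>\<^sub>M P) UNIV 1 fst" by (rule poisson_process_transfer[OF P PP.prob_space_axioms R]) (simp only: law Pc)
  have B1: "poisson_process (P \<Otimes>\<^sub>M P) UNIV 1 snd" by (rule poisson_process_transfer[OF P PP.prob_space_axioms B]) (simp only: law Pc)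
  have AE1: "AE \<omega> in ?\<Omega>. Q (fst \<omega>)" if "AE u in grid_law. Q u" for Q
  proof (rule AE_distrD[OF measurable_fst])
    show "AE u in distr ?\<Omega> grid_law fst. Q u"
      unfolding distr_pair_prob(1)[OF G.prob_space_axioms PP.prob_space_axioms] by (rule that)
  qed
  have AE2: "AE \<omega> in ?\<Omega>. Q (snd \<omega>)" if "AE p in P \<Otimes>\<^sub>M P. Q p" for Q
  proof (rule AE_distrD[OF measurable_snd])
    show "AE p in distr ?\<Omega> (P \<Otimes>\<^sub>M P) snd. Q p"
      unfolding distr_pair_prob(2)[OF G.prob_space_axioms PP.prob_space_axioms] by (rule that)
  qed
  have good: "AE \<omega> in ?\<Omega>. \<forall>\<^sub>F n in sequentially. \<forall>z\<in>corners. good_at a (fst \<omega>) n (X (snd \<omega>)) (Y (snd \<omega>)) (corner n z)"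
    if X: "poisson_process (P \<Otimes>\<^sub>M P) UNIV 1 X" and Y: "poisson_process (P \<Otimes>\<^sub>M P) UNIV 1 Y" for X Y
  proof (rule GPP.AE_pair_measure)
    have g: "Measurable.pred ?\<Omega> (\<lambda>\<omega>. good_at a (fst \<omega>) n (X (snd \<omega>)) (Y (snd \<omega>)) (corner n z))" for n z
      by (rule good_at_measurable[OF measurable_fst measurable_compose[OF measurable_snd poisson_process_measurable[OF X]]
          measurable_compose[OF measurable_snd poisson_process_measurable[OF Y]]])
    have "Measurable.pred ?\<Omega> (\<lambda>\<omega>. \<forall>z\<in>corners. good_at a (fst \<omega>) n (X (snd \<omega>)) (Y (snd \<omega>)) (corner n z))" for n
      by (rule pred_intros_finite(3)[OF finite_corners g])
    then have "Measurable.pred ?\<Omega> (\<lambda>\<omega>. \<exists>N. \<forall>n. N \<le> n \<longrightarrow> (\<forall>z\<in>corners. good_at a (fst \<omega>) n (X (snd \<omega>)) (Y (snd \<omega>)) (corner n z)))"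
      by measurable
    then show "{\<omega>\<in>space ?\<Omega>. \<forall>\<^sub>F n in sequentially. \<forall>z\<in>corners. good_at a (fst \<omega>) n (X (snd \<omega>)) (Y (snd \<omega>)) (corner n z)} \<in> sets ?\<Omega>"
      unfolding eventually_sequentially by (rule pred_def[THEN iffD1])
    show "AE u in grid_law. AE p in P \<Otimes>\<^sub>M P. \<forall>\<^sub>F n in sequentially. \<forall>z\<in>corners. good_at a (fst (u, p)) n (X (snd (u, p))) (Y (snd (u, p))) (corner n z)"
      using AE_nested_grid
    proof eventually_elim
      fix u :: "'d \<Rightarrow> nat \<Rightarrow> real" assume "\<forall>i. nested_offsets (u i)"
      then show "AE p in P \<Otimes>\<^sub>M P. \<forall>\<^sub>F n in sequentially. \<forall>z\<in>corners. good_at a (fst (u, p)) n (X (snd (u, p))) (Y (snd (u, p))) (corner n z)"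
        using good_at_eventually[OF X Y] by simp
    qed
  qed
  have simple: "AE p in P \<Otimes>\<^sub>M P. simple_config (fst p) \<and> simple_config (snd p)"
    using poisson_process_simple[OF R1] poisson_process_simple[OF B1] by simp
  have "AE \<omega> in ?\<Omega>. \<omega> \<in> space ?\<Omega>" by (rule AE_space)
  with AE1[OF AE_nested_grid] AE1[OF well_placed_eventually[of a]] AE2[OF simple] AE2[OF AE_disjoint_supports[OF P sets]] good[OF R1 B1] good[OF B1 R1]
  have "AE \<omega> in ?\<Omega>. simple_config (edge_config a (fst \<omega>) (fst (snd \<omega>)) (snd (snd \<omega>))) \<and>
    perfect_matching (point_support (fst (snd \<omega>))) (point_support (snd (snd \<omega>))) (point_support (edge_config a (fst \<omega>) (fst (snd \<omega>)) (snd (snd \<omega>)))) \<and>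
    (\<forall>C. bounded C \<longrightarrow> finite {e\<in>point_support (edge_config a (fst \<omega>) (fst (snd \<omega>)) (snd (snd \<omega>))). crosses e C})"
  proof eventually_elim
    case (elim \<omega>)
    define u R' B' where "u = fst \<omega>" and "R' = fst (snd \<omega>)" and "B' = snd (snd \<omega>)"
    have w2: "snd \<omega> \<in> space (P \<Otimes>\<^sub>M P)" using elim(7) by (auto simp: space_pair_measure)
    have u: "\<forall>i. nested_offsets (u i)" using elim(1) by (simp add: u_def)
    have R': "R' \<in> point_configs UNIV" "simple_config R'" using config_kernel(1)[OF R w2] elim(3) by (simp_all add: R'_def)
    have B': "B' \<in> point_configs UNIV" "simple_config B'" using config_kernel(1)[OF B w2] elim(3) by (simp_all add: B'_def)
    have fin: "finite (point_support \<mu> \<inter> C)" if \<mu>: "\<mu> \<in> point_configs UNIV" "simple_config \<mu>" and C: "bounded C" for \<mu> :: "(real ^ 'd) measure" and C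
    proof -
      obtain r where "\<forall>x\<in>C. norm x \<le> r" using C unfolding bounded_iff by blast
      then have r: "C \<subseteq> cball 0 r" by auto
      have "finite (cball 0 r \<inter> point_support \<mu>)" by (rule simple_config_finite[OF \<mu>]) (use sets_config[OF \<mu>(1)] in simp_all)
      then show ?thesis by (rule finite_subset[rotated]) (use r in blast)
    qed
    have ev: "\<forall>\<^sub>F n in sequentially. \<forall>y. same_box a u (Suc n) 0 y \<longrightarrow>
        levels.good (same_box a u) (own_level a u) n (point_support R') (point_support B') y \<and>
        levels.good (same_box a u) (own_level a u) n (point_support B') (point_support R') y"
      using elim(5,6)
    proof eventually_elim
      fix n assume g: "\<forall>z\<in>corners. good_at a (fst \<omega>) n (fst (snd \<omega>)) (snd (snd \<omega>)) (corner n z)"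
        "\<forall>z\<in>corners. good_at a (fst \<omega>) n (snd (snd \<omega>)) (fst (snd \<omega>)) (corner n z)"
      show "\<forall>y. same_box a u (Suc n) 0 y \<longrightarrow>
        levels.good (same_box a u) (own_level a u) n (point_support R') (point_support B') y \<and>
        levels.good (same_box a u) (own_level a u) n (point_support B') (point_support R') y"
      proof (intro allI impI)
        fix y assume "same_box a u (Suc n) 0 y"
        then obtain z where z: "z \<in> corners" "same_box a u n (corner n z) y" using corner_in_box by blast
        have "good_at a u n R' B' (corner n z)" "good_at a u n B' R' (corner n z)" using g z(1) by (simp_all add: u_def R'_def B'_def)
        then show "levels.good (same_box a u) (own_level a u) n (point_support R') (point_support B') y \<and>
            levels.good (same_box a u) (own_level a u) n (point_support B') (point_support R') y"
          using good_of_good_at[OF u R' B' _ z(2)] good_of_good_at[OF u B' R' _ z(2)] by blast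
      qed
    qed
    have wp: "\<forall>\<^sub>F n in sequentially. well_placed a u n" using elim(2) by (simp add: u_def)
    have disj: "point_support R' \<inter> point_support B' = {}" using elim(4) by (simp add: R'_def B'_def)
    note match = matching_of_good_boxes[OF u d fin[OF R'] fin[OF B'] disj wp ev]
    show ?case
      unfolding u_def[symmetric] R'_def[symmetric] B'_def[symmetric] edge_config_support(2)[OF u R' B']
      using match edge_config_support(1)[OF u R' B'] by blast
  qed
  then show ?thesis by (simp add: split_beta)
qed

text \<open>
  Translating red points, blue points and grids together preserves their joint law, and the edges
  follow the translation.  It remains to carry the triple of configurations to the canonical space.
\<close>

theorem locally_finite_scheme_exists:
  assumes d: "2 \<le> CARD('d::finite)"
  shows "\<exists>(P :: (real ^ 'd) canonical_sample measure) R (B :: _ \<Rightarrow> (real ^ 'd) measure) M.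
    independent_poisson_processes P UNIV R B \<and> matching_scheme P UNIV R B M \<and>
    translation_invariant P UNIV UNIV R B M \<and> locally_finite_scheme P UNIV M"
proof -
  fix a :: 'd
  let ?C = "config_algebra (UNIV :: (real ^ 'd) set)"
  let ?CC = "config_algebra (UNIV :: ((real ^ 'd) \<times> (real ^ 'd)) set)"
  define P :: "(real ^ 'd) measure measure" where "P = distr (PiM UNIV annulus_law) ?C annuli_points"
  note pp = poisson_process_annuli_points[where 'a = "real ^ 'd"]
  have sets_P: "sets P = sets ?C" by (simp add: P_def)
  interpret P: prob_space P
    unfolding P_def by (rule prob_space.prob_space_distr[OF poisson_process_prob_space[OF pp] poisson_process_measurable[OF pp]])
  have id: "(\<lambda>\<mu>. \<mu>) \<in> P \<rightarrow>\<^sub>M ?C" using sets_P by (intro measurable_ident_sets)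
  have PP: "poisson_process P UNIV 1 (\<lambda>\<mu>. \<mu>)"
    by (rule poisson_process_transfer[OF pp P.prob_space_axioms id]) (simp add: P_def distr_id2)
  interpret G: prob_space "grid_law :: ('d \<Rightarrow> nat \<Rightarrow> real) measure" by (rule prob_space_grid_law)
  interpret PPs: pair_prob_space P P ..
  interpret GPP: pair_prob_space "grid_law :: ('d \<Rightarrow> nat \<Rightarrow> real) measure" "P \<Otimes>\<^sub>M P" ..
  let ?\<Omega> = "(grid_law :: ('d \<Rightarrow> nat \<Rightarrow> real) measure) \<Otimes>\<^sub>M (P \<Otimes>\<^sub>M P)"
  define red where "red = (\<lambda>\<omega> :: ('d \<Rightarrow> nat \<Rightarrow> real) \<times> (real ^ 'd) measure \<times> (real ^ 'd) measure. fst (snd \<omega>))"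
  define blue where "blue = (\<lambda>\<omega> :: ('d \<Rightarrow> nat \<Rightarrow> real) \<times> (real ^ 'd) measure \<times> (real ^ 'd) measure. snd (snd \<omega>))"
  define edge where "edge = (\<lambda>\<omega>. edge_config a (fst \<omega>) (red \<omega>) (blue \<omega>))"
  define X where "X = (\<lambda>\<omega>. (red \<omega>, blue \<omega>, edge \<omega>))"
  define P' where "P' = image_law ?\<Omega> X"
  have red: "red \<in> ?\<Omega> \<rightarrow>\<^sub>M ?C" unfolding red_def
    by (rule measurable_compose[OF measurable_snd measurable_compose[OF measurable_fst id]])
  have blue: "blue \<in> ?\<Omega> \<rightarrow>\<^sub>M ?C" unfolding blue_def
    by (rule measurable_compose[OF measurable_snd measurable_compose[OF measurable_snd id]])
  have edge: "edge \<in> ?\<Omega> \<rightarrow>\<^sub>M ?CC" unfolding edge_def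
    by (rule edge_config_measurable[OF measurable_fst red blue])
  have X: "X \<in> ?\<Omega> \<rightarrow>\<^sub>M ?C \<Otimes>\<^sub>M ?C \<Otimes>\<^sub>M ?CC" unfolding X_def using red blue edge by measurable
  have law_snd: "distr ?\<Omega> (P \<Otimes>\<^sub>M P) snd = P \<Otimes>\<^sub>M P" by (rule distr_pair_prob(2)[OF G.prob_space_axioms PPs.prob_space_axioms])
  have law_red: "distr ?\<Omega> ?C red = P"
  proof -
    have "distr ?\<Omega> ?C red = distr ?\<Omega> P (fst \<circ> snd)" by (rule distr_cong) (simp_all add: sets_P red_def)
    also have "\<dots> = distr (distr ?\<Omega> (P \<Otimes>\<^sub>M P) snd) P fst" by (rule distr_distr[symmetric]) simp_all
    also have "\<dots> = P" unfolding law_snd by (rule distr_pair_prob(1)[OF P.prob_space_axioms P.prob_space_axioms])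
    finally show ?thesis .
  qed
  have law_blue: "distr ?\<Omega> ?C blue = P"
  proof -
    have "distr ?\<Omega> ?C blue = distr ?\<Omega> P (snd \<circ> snd)" by (rule distr_cong) (simp_all add: sets_P blue_def)
    also have "\<dots> = distr (distr ?\<Omega> (P \<Otimes>\<^sub>M P) snd) P snd" by (rule distr_distr[symmetric]) simp_all
    also have "\<dots> = P" unfolding law_snd by (rule distr_pair_prob(2)[OF P.prob_space_axioms P.prob_space_axioms])
    finally show ?thesis .
  qed
  interpret P': prob_space P' unfolding P'_def by (rule prob_space_image_law[OF GPP.prob_space_axioms])
  note im = image_law_measurable[of _ X ?\<Omega>, folded P'_def]
  have R': "fst \<in> P' \<rightarrow>\<^sub>M ?C" "distr P' ?C fst = P" using im[of fst ?C] red law_red by (simp_all add: X_def)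
  have B': "(\<lambda>s. fst (snd s)) \<in> P' \<rightarrow>\<^sub>M ?C" "distr P' ?C (\<lambda>s. fst (snd s)) = P"
    using im[of "\<lambda>s. fst (snd s)" ?C] blue law_blue by (simp_all add: X_def)
  have M': "(\<lambda>s. snd (snd s)) \<in> P' \<rightarrow>\<^sub>M ?CC" using im[of "\<lambda>s. snd (snd s)" ?CC] edge by (simp add: X_def)
  have P_id: "distr P ?C (\<lambda>\<mu>. \<mu>) = P" by (rule distr_id2) (simp add: sets_P)
  have indep: "independent_poisson_processes P' UNIV fst (\<lambda>s. fst (snd s))"
    unfolding independent_poisson_processes_def
  proof (intro conjI)
    show "poisson_process P' UNIV 1 fst"
      by (rule poisson_process_transfer[OF PP P'.prob_space_axioms R'(1)]) (simp only: P_id R'(2))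
    show "poisson_process P' UNIV 1 (\<lambda>s. fst (snd s))"
      by (rule poisson_process_transfer[OF PP P'.prob_space_axioms B'(1)]) (simp only: P_id B'(2))
    show "P'.indep_var ?C fst ?C (\<lambda>s. fst (snd s))"
      unfolding P'.indep_var_distribution_eq
    proof (intro conjI R'(1) B'(1))
      have m: "(\<lambda>\<omega>. (fst (X \<omega>), fst (snd (X \<omega>)))) \<in> ?\<Omega> \<rightarrow>\<^sub>M ?C \<Otimes>\<^sub>M ?C" using red blue by (simp add: X_def)
      have "distr P' (?C \<Otimes>\<^sub>M ?C) (\<lambda>s. (fst s, fst (snd s))) = distr ?\<Omega> (?C \<Otimes>\<^sub>M ?C) (\<lambda>\<omega>. (fst (X \<omega>), fst (snd (X \<omega>))))"
        by (rule im(2)[OF m])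
      also have "\<dots> = distr ?\<Omega> (P \<Otimes>\<^sub>M P) snd"
        by (rule distr_cong) (simp_all add: X_def red_def blue_def sets_pair_measure_cong[OF sets_P sets_P])
      finally show "distr P' ?C fst \<Otimes>\<^sub>M distr P' ?C (\<lambda>s. fst (snd s)) = distr P' (?C \<Otimes>\<^sub>M ?C) (\<lambda>s. (fst s, fst (snd s)))"
        by (simp only: R'(2) B'(2) law_snd)
    qed
  qed
  have "AE \<omega> in ?\<Omega>. simple_config (edge \<omega>) \<and> perfect_matching (point_support (red \<omega>)) (point_support (blue \<omega>)) (point_support (edge \<omega>)) \<and>
      (\<forall>C. bounded C \<longrightarrow> finite {e\<in>point_support (edge \<omega>). crosses e C})"
    using AE_matching_of_good_boxes[OF d PP sets_P, of a] by (simp add: split_beta edge_def red_def blue_def)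
  then have "AE s in P'. simple_config (snd (snd s)) \<and> perfect_matching (point_support (fst s)) (point_support (fst (snd s))) (point_support (snd (snd s))) \<and>
      (\<forall>C. bounded C \<longrightarrow> finite {e\<in>point_support (snd (snd s)). crosses e C})"
    unfolding P'_def by (intro AE_image_law) (simp add: X_def)
  then have AE: "AE s in P'. simple_config (snd (snd s))"
      "AE s in P'. perfect_matching (point_support (fst s)) (point_support (fst (snd s))) (point_support (snd (snd s)))"
      "AE s in P'. \<forall>C. bounded C \<longrightarrow> finite {e\<in>point_support (snd (snd s)). crosses e C}"
    by (auto elim: eventually_mono)
  have match: "matching_scheme P' UNIV fst (\<lambda>s. fst (snd s)) (\<lambda>s. snd (snd s))"
    unfolding matching_scheme_def simple_point_process_def point_process_def UNIV_Times_UNIV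
  proof (intro conjI P'.prob_space_axioms M' AE(2))
    show "AE s in P'. \<forall>x\<in>UNIV. emeasure (snd (snd s)) {x} \<le> 1" using AE(1) by (simp add: simple_config_def)
  qed
  have fin: "locally_finite_scheme P' UNIV (\<lambda>s. snd (snd s))"
    unfolding locally_finite_scheme_def using AE(3) by simp
  have inv: "translation_invariant P' UNIV UNIV fst (\<lambda>s. fst (snd s)) (\<lambda>s. snd (snd s))"
    unfolding translation_invariant_def Let_def UNIV_Times_UNIV
  proof
    fix t :: "real ^ 'd"
    let ?K = "?C \<Otimes>\<^sub>M ?C \<Otimes>\<^sub>M ?CC"
    define T where "T = (\<lambda>\<omega> :: ('d \<Rightarrow> nat \<Rightarrow> real) \<times> (real ^ 'd) measure \<times> (real ^ 'd) measure.
        (shift_grid t (fst \<omega>), translate UNIV t (fst (snd \<omega>)), translate UNIV t (snd (snd \<omega>))))"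
    have tr: "translate UNIV t \<in> P \<rightarrow>\<^sub>M P"
    proof -
      have "translate UNIV t \<in> ?C \<rightarrow>\<^sub>M ?C" by (rule translate_measurable) simp
      then show ?thesis by (simp add: measurable_cong_sets[OF sets_P sets_P])
    qed
    have trP: "distr P P (translate UNIV t) = P"
    proof -
      have "distr P P (translate UNIV t) = distr P ?C (translate UNIV t)" by (rule distr_cong) (simp_all add: sets_P)
      also have "\<dots> = distr P ?C (\<lambda>\<mu>. \<mu>)" by (rule poisson_process_law_unique[OF poisson_process_translate[OF PP] PP])
      finally show ?thesis by (simp only: P_id)
    qed
    have T: "T \<in> ?\<Omega> \<rightarrow>\<^sub>M ?\<Omega>" unfolding T_def using tr shift_grid_measurable[of t] by measurable
    have "?\<Omega> = distr grid_law grid_law (shift_grid t) \<Otimes>\<^sub>M (distr P P (translate UNIV t) \<Otimes>\<^sub>M distr P P (translate UNIV t))"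
      by (simp only: shift_grid_law trP)
    also have "distr P P (translate UNIV t) \<Otimes>\<^sub>M distr P P (translate UNIV t) =
        distr (P \<Otimes>\<^sub>M P) (P \<Otimes>\<^sub>M P) (\<lambda>(x, y). (translate UNIV t x, translate UNIV t y))"
      by (rule pair_measure_distr[OF tr tr]) (simp only: trP P.sigma_finite_measure_axioms)
    also have "distr grid_law grid_law (shift_grid t) \<Otimes>\<^sub>M \<dots> =
        distr ?\<Omega> ?\<Omega> (\<lambda>(x, y). (shift_grid t x, (\<lambda>(x, y). (translate UNIV t x, translate UNIV t y)) y))"
    proof (rule pair_measure_distr[OF shift_grid_measurable])
      show m: "(\<lambda>(x, y). (translate UNIV t x, translate UNIV t y)) \<in> P \<Otimes>\<^sub>M P \<rightarrow>\<^sub>M P \<Otimes>\<^sub>M P" using tr by measurable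
      show "sigma_finite_measure (distr (P \<Otimes>\<^sub>M P) (P \<Otimes>\<^sub>M P) (\<lambda>(x, y). (translate UNIV t x, translate UNIV t y)))"
        by (intro prob_space_imp_sigma_finite PPs.prob_space_distr m)
    qed
    also have "(\<lambda>(x, y). (shift_grid t x, (\<lambda>(x, y). (translate UNIV t x, translate UNIV t y)) y)) = T"
      by (simp add: T_def fun_eq_iff split_beta)
    finally have law_T: "distr ?\<Omega> ?\<Omega> T = ?\<Omega>" ..
    define \<tau> where "\<tau> s = (translate UNIV t (fst s), translate UNIV t (fst (snd s)), translate UNIV (t, t) (snd (snd s)))" for s :: "(real ^ 'd) canonical_sample"
    have XT: "\<tau> (X \<omega>) = X (T \<omega>)" if "\<omega> \<in> space ?\<Omega>" for \<omega>
    proof -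
      have "red \<omega> \<in> point_configs UNIV" "blue \<omega> \<in> point_configs UNIV"
        using measurable_space[OF red that] measurable_space[OF blue that] by (simp_all add: space_config_algebra)
      then show ?thesis using edge_config_shift[of "red \<omega>" "blue \<omega>" a t "fst \<omega>"]
        by (simp add: \<tau>_def X_def T_def edge_def red_def blue_def)
    qed
    have m1: "(\<lambda>\<omega>. \<tau> (X \<omega>)) \<in> ?\<Omega> \<rightarrow>\<^sub>M ?K"
      using measurable_compose[OF T X] by (subst measurable_cong[OF XT]) assumption+
    have "distr P' ?K \<tau> = distr ?\<Omega> ?K (\<lambda>\<omega>. \<tau> (X \<omega>))" by (rule im(2)[OF m1])
    also have "\<dots> = distr ?\<Omega> ?K (X \<circ> T)" by (rule distr_cong) (simp_all add: XT)
    also have "\<dots> = distr (distr ?\<Omega> ?\<Omega> T) ?K X" by (rule distr_distr[OF X T, symmetric])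
    also have "\<dots> = distr ?\<Omega> ?K X" by (simp only: law_T)
    also have "\<dots> = distr P' ?K (\<lambda>s. s)" by (rule im(2)[OF X, symmetric])
    finally show "distr P' ?K (\<lambda>s. (translate UNIV t (fst s), translate UNIV t (fst (snd s)), translate UNIV (t, t) (snd (snd s))))
        = distr P' ?K (\<lambda>s. (fst s, fst (snd s), snd (snd s)))"
      unfolding \<tau>_def prod.collapse .
  qed
  show ?thesis by (intro exI conjI) (rule indep match inv fin)+
qed

theorem theorem3:
  shows
    "(\<nexists>(P :: 'w measure) (R :: 'w \<Rightarrow> real measure) B M.
        independent_poisson_processes P UNIV R B \<and> matching_scheme P UNIV R B M \<and>
        translation_invariant P UNIV UNIV R B M \<and> locally_finite_scheme P UNIV M) \<and>
     (\<nexists>(P :: 'w measure) R B M.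
        independent_poisson_processes P strip R B \<and> matching_scheme P strip R B M \<and>
        translation_invariant P strip (UNIV \<times> {0}) R B M \<and> locally_finite_scheme P strip M) \<and>
     (CARD('d::finite) \<ge> 2 \<longrightarrow>
       (\<exists>(P :: (real ^ 'd) canonical_sample measure) R (B :: _ \<Rightarrow> (real ^ 'd) measure) M.
        independent_poisson_processes P UNIV R B \<and> matching_scheme P UNIV R B M \<and>
        translation_invariant P UNIV UNIV R B M \<and> locally_finite_scheme P UNIV M))"
proof (intro conjI impI)
  show "\<nexists>(P :: 'w measure) (R :: 'w \<Rightarrow> real measure) B M.
      independent_poisson_processes P UNIV R B \<and> matching_scheme P UNIV R B M \<and>
      translation_invariant P UNIV UNIV R B M \<and> locally_finite_scheme P UNIV M"
    by (rule no_locally_finite_scheme_line)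
  show "\<nexists>(P :: 'w measure) R B M.
      independent_poisson_processes P strip R B \<and> matching_scheme P strip R B M \<and>
      translation_invariant P strip (UNIV \<times> {0}) R B M \<and> locally_finite_scheme P strip M"
    by (rule no_locally_finite_scheme_strip)
  assume "2 \<le> CARD('d)"
  then show "\<exists>(P :: (real ^ 'd) canonical_sample measure) R (B :: _ \<Rightarrow> (real ^ 'd) measure) M.
      independent_poisson_processes P UNIV R B \<and> matching_scheme P UNIV R B M \<and>
      translation_invariant P UNIV UNIV R B M \<and> locally_finite_scheme P UNIV M"
    by (rule locally_finite_scheme_exists)
qed

end
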